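(* Let $L=L_1\cup L_2\cup\cdots\cup L_n$ be any $n$-component link in $\mathbb{R}^3$ and let $I\subset\{1,2,\ldots,n\}$ be any subset (possibly empty or all of $\{1,\dots,n\}$). Then there is a time-dependent electromagnetic field $\mathbf{F}=\mathbf{E}+\mathrm{i}\mathbf{B}$ on $\mathbb{R}\times\mathbb{R}^3$ satisfying Maxwell's equations in free space such that for every time $t\in\mathbb{R}$: the field $\mathbf{E}(t,\cdot)$ has a set of closed field lines whose union is ambient isotopic to $\bigcup_{i\in I}L_i$, the field $\mathbf{B}(t,\cdot)$ has a set of closed field lines whose union is ambient isotopic to $\bigcup_{i\notin I}L_i$, and the union of these closed electric and magnetic field lines is a link ambient isotopic to $L$ (with the electric lines corresponding to the components $L_i$, $i\in I$, and the magnetic lines to the components $L_i$, $i\notin I$).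
   Context: An electromagnetic field is represented by its Riemann–Silberstein vector $\mathbf{F}=\mathbf{E}+\mathrm{i}\mathbf{B}$, where $\mathbf{E},\mathbf{B}:\mathbb{R}\times\mathbb{R}^3\to\mathbb{R}^3$ (time $t$, space $(x,y,z)$) are the electric and magnetic fields. Maxwell's equations in free space (units with speed of light $1$) read $\nabla\cdot\mathbf{F}=0$ and $\mathrm{i}\,\partial_t\mathbf{F}=\nabla\times\mathbf{F}$, where $\nabla$ acts on the spatial variables. A closed field line of a vector field $\mathbf{V}$ on $\mathbb{R}^3$ is a closed embedded curve along which $\mathbf{V}$ is nonvanishing and tangent. A link is a smooth embedding of finitely many disjoint circles; links are considered up to ambient isotopy. *)

theory Defs
  imports "HOL-Analysis.Analysis"
begin

definition smooth_real_fun :: "(real \<Rightarrow> real) \<Rightarrow> bool" where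
  "smooth_real_fun f \<longleftrightarrow> (\<forall>k. \<forall>x. ((deriv ^^ k) f) differentiable (at x))"

definition closed_curve_param :: "(real \<Rightarrow> real^3) \<Rightarrow> bool" where
  "closed_curve_param \<gamma> \<longleftrightarrow>
     (\<forall>s. \<gamma> (s + 1) = \<gamma> s) \<and>
     (\<forall>i. smooth_real_fun (\<lambda>s. \<gamma> s $ i)) \<and>
     inj_on \<gamma> {0..<1} \<and>
     (\<forall>s. vector_derivative \<gamma> (at s) \<noteq> 0)"

definition curve_set :: "(real \<Rightarrow> real^3) \<Rightarrow> (real^3) set" where
  "curve_set \<gamma> = \<gamma> ` {0..1}"

definition is_link :: "nat \<Rightarrow> (nat \<Rightarrow> real \<Rightarrow> real^3) \<Rightarrow> bool" where
  "is_link n L \<longleftrightarrow>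
     (\<forall>i<n. closed_curve_param (L i)) \<and>
     (\<forall>i<n. \<forall>j<n. i \<noteq> j \<longrightarrow> curve_set (L i) \<inter> curve_set (L j) = {})"

definition ambient_isotopic :: "nat \<Rightarrow> (nat \<Rightarrow> real \<Rightarrow> real^3) \<Rightarrow> (nat \<Rightarrow> real \<Rightarrow> real^3) \<Rightarrow> bool" where
  "ambient_isotopic n L L' \<longleftrightarrow>
     (\<exists>H :: real \<Rightarrow> real^3 \<Rightarrow> real^3.
        continuous_on ({0..1} \<times> UNIV) (\<lambda>p. H (fst p) (snd p)) \<and>
        (\<forall>t\<in>{0..1}. \<exists>g. homeomorphism UNIV UNIV (H t) g) \<and>
        H 0 = id \<and>
        (\<forall>i<n. H 1 ` curve_set (L i) = curve_set (L' i)))"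

definition closed_field_line :: "(real^3 \<Rightarrow> real^3) \<Rightarrow> (real \<Rightarrow> real^3) \<Rightarrow> bool" where
  "closed_field_line V \<gamma> \<longleftrightarrow>
     closed_curve_param \<gamma> \<and>
     (\<forall>s. V (\<gamma> s) \<noteq> 0 \<and> (\<exists>c::real. V (\<gamma> s) = c *\<^sub>R vector_derivative \<gamma> (at s)))"

definition C1_tfield :: "(real \<Rightarrow> real^3 \<Rightarrow> real^3) \<Rightarrow> bool" where
  "C1_tfield V \<longleftrightarrow>
     (\<exists>D :: (real \<times> (real^3)) \<Rightarrow> ((real \<times> (real^3)) \<Rightarrow>\<^sub>L (real^3)).
        (\<forall>p. ((\<lambda>q. V (fst q) (snd q)) has_derivative blinfun_apply (D p)) (at p)) \<and>
        continuous_on UNIV D)"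

definition time_deriv :: "(real \<Rightarrow> real^3 \<Rightarrow> real^3) \<Rightarrow> real \<Rightarrow> real^3 \<Rightarrow> real^3" where
  "time_deriv V t x = vector_derivative (\<lambda>s. V s x) (at t)"

definition pderiv3 :: "(real^3 \<Rightarrow> real^3) \<Rightarrow> 3 \<Rightarrow> real^3 \<Rightarrow> real^3" where
  "pderiv3 V j x = vector_derivative (\<lambda>s. V (x + s *\<^sub>R axis j 1)) (at 0)"

definition div3 :: "(real^3 \<Rightarrow> real^3) \<Rightarrow> real^3 \<Rightarrow> real" where
  "div3 V x = pderiv3 V 1 x $ 1 + pderiv3 V 2 x $ 2 + pderiv3 V 3 x $ 3"

definition curl3 :: "(real^3 \<Rightarrow> real^3) \<Rightarrow> real^3 \<Rightarrow> real^3" where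
  "curl3 V x = vector [pderiv3 V 2 x $ 3 - pderiv3 V 3 x $ 2,
                       pderiv3 V 3 x $ 1 - pderiv3 V 1 x $ 3,
                       pderiv3 V 1 x $ 2 - pderiv3 V 2 x $ 1]"

text \<open>Maxwell's equations in free space for F = E + iB:
  div F = 0 and i dF/dt = curl F, i.e. (real and imaginary parts)
  div E = 0, div B = 0, dE/dt = curl B, dB/dt = - curl E.\<close>
definition maxwell :: "(real \<Rightarrow> real^3 \<Rightarrow> real^3) \<Rightarrow> (real \<Rightarrow> real^3 \<Rightarrow> real^3) \<Rightarrow> bool" where
  "maxwell E B \<longleftrightarrow> C1_tfield E \<and> C1_tfield B \<and>
     (\<forall>t x. div3 (E t) x = 0 \<and> div3 (B t) x = 0 \<and>
            time_deriv E t x = curl3 (B t) x \<and>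
            time_deriv B t x = - curl3 (E t) x)"

end

(* Separating variables by the factor exp t, a field E = exp t * u, B = exp t * b solves Maxwell's
   equations when u = curl P + curl curl Q and b = curl Q - curl curl P with all components of P and Q
   solutions of the Helmholtz equation "laplacian f = f"; its field lines do not depend on t.
   Parallel to each component g of the link, at distance r, run three wires carrying Yukawa sources,
   chosen so that to leading order the curl of their potential is a positive multiple of g' on g and
   is a linear saddle in the normal directions.  Electric components put their wires into P and
   magnetic ones into Q, so every other contribution stays bounded as r tends to 0.  The saddle gives
   a closed hyperbolic field line close to g that survives small perturbations.  Since every
   wire point can be joined to infinity by a ray avoiding thinner tubes around the link, a Runge
   argument (moving each pole to infinity along its ray) replaces the wire potentials
   by global solutions of the Helmholtz equation. *)
theory Submission
  imports Defs "HOL-Complex_Analysis.Cauchy_Integral_Formula"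
begin

section \<open>Formal derivatives of the Yukawa potential\<close>

text \<open>The factor exp t turns the wave equation into the Helmholtz equation, whose decaying
  fundamental solution is the Yukawa potential. The three wires share the work. One, displaced along
  a normal n1 and carrying moments along n2, has a curl along n1 x n2, the tangent, but no
  hyperbolicity in the normal plane. Two more at plus and minus n1 + n2, carrying tangential
  moments, cancel each other on the curve to leading order and supply the saddle. The scales decide
  the proof. The wanted field has size 1 / r and its gradient 1 / r^2, while the interaction of
  different components is bounded independently of r; so the closed orbit can be sought in a tube of
  radius proportional to r. The obstacle is that the wires run at that same scale: the approximation
  has to hold on a tube whose radius is a small fixed multiple of r, and the rays from the wires
  have to miss it. Near its own curve a ray does so by leaving with a positive component along the
  displacement, elsewhere because almost every direction misses the link.\<close>

datatype ex = Cn real | Tau | Ax 3 | Ui | Xi | Ad ex ex | Mu ex ex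

text \<open>The rules differentiate in the space variable. The derivatives of \<open>Ui\<close> and
  \<open>Xi\<close> are polynomials in the same symbols, so every derivative of the potential is
  again an expression, and one induction over \<open>ex\<close> proves differentiability,
  analyticity in \<open>Tau\<close> and continuity for all of them.\<close>

fun dv :: "3 \<Rightarrow> ex \<Rightarrow> ex" where
  "dv i (Cn c) = Cn 0"
| "dv i Tau = Cn 0"
| "dv i (Ax j) = (if i = j then Tau else Cn 0)"
| "dv i Ui = Mu (Cn (-1)) (Mu Tau (Mu (Ax i) (Mu Ui (Mu Ui Ui))))"
| "dv i Xi = Mu (Cn (-1)) (Mu (Ax i) (Mu Ui Xi))"
| "dv i (Ad a b) = Ad (dv i a) (dv i b)"
| "dv i (Mu a b) = Ad (Mu (dv i a) b) (Mu a (dv i b))"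

definition jet :: "3 list \<Rightarrow> ex" where "jet l = foldr dv l (Mu Xi Ui)"

lemma jet_simps [simp]: "jet [] = Mu Xi Ui" "jet (i # l) = dv i (jet l)"
  by (auto simp: jet_def)

text \<open>For real \<tau> in (0, 1] this is \<tau> times the i-th coordinate of x - p, where the
  pole p = y + ((1 - \<tau>) / \<tau>) v slides from y at \<tau> = 1 along the ray in direction v to
  infinity as \<tau> tends to 0. The scaled form survives at \<tau> = 0, where it equals -
  v.\<close>

definition ax :: "real^3 \<Rightarrow> real^3 \<Rightarrow> 3 \<Rightarrow> complex \<Rightarrow> real^3 \<Rightarrow> complex" where
  "ax y v i \<tau> x = \<tau> * of_real ((x - y + v) $ i) - of_real (v $ i)"

definition qd :: "real^3 \<Rightarrow> real^3 \<Rightarrow> complex \<Rightarrow> real^3 \<Rightarrow> complex" where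
  "qd y v \<tau> x = (\<Sum>i\<in>UNIV. (ax y v i \<tau> x)\<^sup>2)"

text \<open>For a unit vector v this is (1 - \<open>qd\<close>) / \<tau> with the division carried
  out, hence regular at \<tau> = 0.\<close>

definition nm :: "real^3 \<Rightarrow> real^3 \<Rightarrow> complex \<Rightarrow> real^3 \<Rightarrow> complex" where
  "nm y v \<tau> x = (\<Sum>i\<in>UNIV. of_real ((x - y + v) $ i) * (of_real (v $ i) - ax y v i \<tau> x))"

text \<open>With the pole p of \<open>ax\<close> and real \<tau> in (0, 1], \<open>Ui\<close> is 1 /
  (\<tau> norm (x - p)) and \<open>Xi\<close> is exp (1 / \<tau> - 1 - norm (x - p)). So
  \<open>Mu Xi Ui\<close> is a multiple of the Yukawa potential with pole p, normalised to have a
  limit at \<tau> = 0: there it is the global solution exp ((x - y) . v), while at \<tau> = 1 it is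
  the point source at y.\<close>

fun ev :: "real^3 \<Rightarrow> real^3 \<Rightarrow> ex \<Rightarrow> complex \<Rightarrow> real^3 \<Rightarrow> complex" where
  "ev y v (Cn c) \<tau> x = of_real c"
| "ev y v Tau \<tau> x = \<tau>"
| "ev y v (Ax i) \<tau> x = ax y v i \<tau> x"
| "ev y v Ui \<tau> x = 1 / csqrt (qd y v \<tau> x)"
| "ev y v Xi \<tau> x = exp (nm y v \<tau> x / (1 + csqrt (qd y v \<tau> x)) - 1)"
| "ev y v (Ad a b) \<tau> x = ev y v a \<tau> x + ev y v b \<tau> x"
| "ev y v (Mu a b) \<tau> x = ev y v a \<tau> x * ev y v b \<tau> x"

text \<open>Formal derivatives commute only after evaluation, since expressions are not brought to a
  normal form.\<close>

lemma ev_commute: "ev y v (dv i (dv j e)) \<tau> x = ev y v (dv j (dv i e)) \<tau> x"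
  by (induction e) (auto simp: algebra_simps)

lemma Re_csqrt_pos:
  assumes "Re z > 0"
  shows "Re (csqrt z) > 0"
proof -
  have "Re z = Re ((csqrt z)\<^sup>2)" by simp
  also have "\<dots> = (Re (csqrt z))\<^sup>2 - (Im (csqrt z))\<^sup>2" by (simp only: Re_power2)
  finally have "Re (csqrt z) \<noteq> 0" using assms by (intro notI) (simp del: csqrt.simps)
  then show ?thesis using csqrt_principal[of z] by blast
qed

lemma qd_deriv: "((\<lambda>x. qd y v \<tau> x) has_derivative (\<lambda>h. \<Sum>i\<in>UNIV. of_real (h$i) * (2 * \<tau> * ax y v i \<tau> x))) (at x)"
  unfolding qd_def ax_def
  by (auto intro!: derivative_eq_intros ext sum.cong bounded_linear.has_derivative[OF bounded_linear_vec_nth] simp: algebra_simps)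

lemma nm_deriv: "((\<lambda>x. nm y v \<tau> x) has_derivative (\<lambda>h. \<Sum>i\<in>UNIV. of_real (h$i) * (- 2 * ax y v i \<tau> x))) (at x)"
  unfolding nm_def ax_def
  by (auto intro!: derivative_eq_intros ext sum.cong bounded_linear.has_derivative[OF bounded_linear_vec_nth] simp: algebra_simps)

lemma qd_expand:
  assumes "norm v = 1"
  shows "\<tau> * nm y v \<tau> x = 1 - qd y v \<tau> x"
proof -
  have v: "(v$1)^2 + (v$2)^2 + (v$3)^2 = 1"
    using assms by (simp add: norm_vec_def L2_set_def sum_3)
  have v': "(of_real (v$1))^2 + (of_real (v$2))^2 + (of_real (v$3))^2 = (1::complex)"
    using arg_cong[OF v, of complex_of_real] by simp
  show ?thesis
    unfolding qd_def nm_def ax_def sum_3 v'[symmetric]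
    by (simp add: algebra_simps power2_eq_square)
qed

lemma ev_deriv:
  assumes v: "norm v = 1" and q: "Re (qd y v \<tau> x) > 0"
  shows "((\<lambda>x. ev y v e \<tau> x) has_derivative (\<lambda>h. \<Sum>i\<in>UNIV. of_real (h$i) * ev y v (dv i e) \<tau> x)) (at x)"
proof (induction e)
  case (Ax j)
  have "(\<Sum>i\<in>UNIV. complex_of_real (h$i) * ev y v (dv i (Ax j)) \<tau> x) = of_real (h$j) * \<tau>" for h
    by (subst sum.remove[of _ j]) (auto)
  then show ?case unfolding ev.simps ax_def
    by (auto intro!: derivative_eq_intros bounded_linear.has_derivative[OF bounded_linear_vec_nth] simp: ax_def)
next
  case Ui
  define S where "S = csqrt (qd y v \<tau> x)"
  have S: "S \<noteq> 0" "Re S > 0" using Re_csqrt_pos[OF q] by (auto simp: S_def)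
  have nr: "qd y v \<tau> x \<notin> \<real>\<^sub>\<le>\<^sub>0" using q by (auto simp: complex_nonpos_Reals_iff)
  have "((\<lambda>z. 1 / csqrt z) has_field_derivative - (1/(2*S^3))) (at (qd y v \<tau> x))"
    using nr S by (auto intro!: derivative_eq_intros simp: S_def[symmetric] power2_eq_square power3_eq_cube field_simps)
  then have "((\<lambda>z. 1 / csqrt z) has_derivative (*) (- (1/(2*S^3)))) (at (qd y v \<tau> x))"
    by (simp add: has_field_derivative_def)
  from has_derivative_compose[OF qd_deriv this]
  show ?case
    by (simp add: S_def[symmetric] sum_distrib_left sum_negf[symmetric] field_simps power3_eq_cube S)
next
  case Xi
  define S where "S = csqrt (qd y v \<tau> x)"
  have S: "S \<noteq> 0" "Re S > 0" using Re_csqrt_pos[OF q] by (auto simp: S_def)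
  have S1: "1 + S \<noteq> 0" using S(2) by (metis add_pos_pos less_irrefl one_complex.simps(1) plus_complex.simps(1) zero_complex.simps(1) zero_less_one)
  have nr: "qd y v \<tau> x \<notin> \<real>\<^sub>\<le>\<^sub>0" using q by (auto simp: complex_nonpos_Reals_iff)
  have Sd: "(csqrt has_derivative (*) (1/(2*S))) (at (qd y v \<tau> x))"
    using nr S has_field_derivative_csqrt[OF nr] by (simp add: has_field_derivative_def S_def inverse_eq_divide)
  note Sx = has_derivative_compose[OF qd_deriv Sd]
  have q2: "\<tau> * nm y v \<tau> x = (1 - S) * (1 + S)"
    unfolding qd_expand[OF v] by (simp add: S_def algebra_simps power2_eq_square[symmetric])
  define N where "N = nm y v \<tau> x"
  \<comment> \<open>The quotient rule for nm / (1 + S), with the denominator cleared. Both gradients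
    are multiples of \<open>ax\<close>, and \<tau> N = (1 - S) (1 + S) removes N, so no division by
    \<tau> is ever needed.\<close>
  have key: "(\<Sum>i\<in>UNIV. of_real (h$i) * (- 2 * ax y v i \<tau> x)) * (1+S)
     - N * (1/(2*S) * (\<Sum>i\<in>UNIV. of_real (h$i) * (2 * \<tau> * ax y v i \<tau> x)))
     = (1+S)*(1+S) * (\<Sum>i\<in>UNIV. of_real (h$i) * (- ax y v i \<tau> x / S))" for h :: "real^3"
  proof -
    define W where "W = (\<Sum>i\<in>UNIV. of_real (h$i) * ax y v i \<tau> x)"
    have 1: "(\<Sum>i\<in>UNIV. of_real (h$i) * (- 2 * ax y v i \<tau> x)) = - 2 * W"
      "(\<Sum>i\<in>UNIV. of_real (h$i) * (2 * \<tau> * ax y v i \<tau> x)) = 2 * \<tau> * W"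
      "(\<Sum>i\<in>UNIV. of_real (h$i) * (- ax y v i \<tau> x / S)) = - W / S"
      unfolding W_def sum_3 using S by (auto simp: field_simps)
    have "- 2 * W * (1+S) - N * (1/(2*S) * (2*\<tau>*W)) = -2*W*(1+S) - (\<tau>*N) * W / S"
      by (simp add: field_simps)
    also have "\<tau>*N = (1-S)*(1+S)" using q2 by (simp add: N_def)
    also have "-2*W*(1+S) - (1-S)*(1+S) * W / S = (1+S)*(1+S)*(-W/S)"
      using S by (simp add: field_simps)
    finally show ?thesis unfolding 1 .
  qed
  have aux: "- N * (inverse (1+S) * Q * inverse (1+S)) + P / (1+S) = R"
    if "P * (1+S) - N * Q = (1+S) * (1+S) * R" for P Q R
  proof -
    have "R = (P * (1+S) - N * Q) / ((1+S) * (1+S))" using that S1 by simp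
    then show ?thesis using S1 by (simp add: diff_divide_distrib inverse_eq_divide)
  qed
  have d: "((\<lambda>x. nm y v \<tau> x / (1 + csqrt (qd y v \<tau> x)) - 1) has_derivative
     (\<lambda>h. \<Sum>i\<in>UNIV. of_real (h$i) * (- ax y v i \<tau> x / S))) (at x)"
    apply (rule has_derivative_eq_rhs)
     apply (rule has_derivative_diff[OF has_derivative_divide[OF nm_deriv has_derivative_add[OF has_derivative_const Sx]] has_derivative_const])
    using S1 apply (simp add: S_def del: csqrt.simps)
    apply (rule ext)
    apply (simp only: S_def[symmetric] N_def[symmetric] add_0 diff_0_right)
    apply (rule aux[OF key])
    done
  have e: "(exp has_derivative (*) (exp (N/(1+S) - 1))) (at (nm y v \<tau> x / (1 + csqrt (qd y v \<tau> x)) - 1))"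
    using DERIV_exp[of "N/(1+S) - 1"] by (simp add: has_field_derivative_def N_def S_def)
  from has_derivative_compose[OF d e] show ?case
    by (simp add: S_def[symmetric] N_def[symmetric] sum_distrib_left sum_negf[symmetric] field_simps)
next
  case (Ad a b)
  from has_derivative_add[OF Ad] show ?case by (simp add: algebra_simps sum.distrib)
next
  case (Mu a b)
  from has_derivative_mult[OF Mu] show ?case
    by (simp add: algebra_simps sum.distrib sum_distrib_left)
qed auto

text \<open>The squares of the three coordinates add up to 1 / U^2, after which all powers of U
  except the first cancel. The computation is algebraic and therefore covers complex \<tau> and the
  value 0.\<close>

lemma ev_helmholtz:
  assumes q: "Re (qd y v \<tau> x) > 0"
  shows "(\<Sum>i\<in>UNIV. ev y v (dv i (dv i (Mu Xi Ui))) \<tau> x) = ev y v (Mu Xi Ui) \<tau> x"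
proof -
  define U where "U = ev y v Ui \<tau> x"
  define E where "E = ev y v Xi \<tau> x"
  define a where "a i = ax y v i \<tau> x" for i
  have "csqrt (qd y v \<tau> x) \<noteq> 0" using Re_csqrt_pos[OF q] by auto
  moreover have "(a 1)^2 + (a 2)^2 + (a 3)^2 = qd y v \<tau> x"
    by (simp add: a_def qd_def sum_3)
  ultimately have U: "((a 1)^2 + (a 2)^2 + (a 3)^2) * U^2 = 1"
    using q by (auto simp: U_def power_divide simp del: csqrt.simps)
  have lap: "ev y v (dv i (dv i (Mu Xi Ui))) \<tau> x = E * (-\<tau>*U^2 - \<tau>^2*U^3) + (a i)^2 * E * (U^3 + 3*\<tau>*U^4 + 3*\<tau>^2*U^5)" for i
    unfolding dv.simps ev.simps(1-3,6,7) if_True U_def[symmetric] E_def[symmetric] a_def[symmetric]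
    by (simp add: algebra_simps eval_nat_numeral)
  have "(\<Sum>i\<in>UNIV. ev y v (dv i (dv i (Mu Xi Ui))) \<tau> x) = 3 * E * (-\<tau>*U^2 - \<tau>^2*U^3)
     + (((a 1)^2 + (a 2)^2 + (a 3)^2) * U^2) * E * (U + 3*\<tau>*U^2 + 3*\<tau>^2*U^3)"
    unfolding sum_3 lap by (simp add: algebra_simps eval_nat_numeral del: dv.simps ev.simps)
  also have "\<dots> = E * U" unfolding U by (simp add: algebra_simps)
  finally show ?thesis unfolding ev.simps(7) E_def U_def .
qed

text \<open>A solution is carried together with all its partial derivatives: \<open>u []\<close> is
  the function, and the head of a list is the direction differentiated last. Smoothness is thus
  built in, and dropping directions at the end of the list yields new solutions.\<close>

definition helmholtz_jet :: "(3 list \<Rightarrow> real^3 \<Rightarrow> real) \<Rightarrow> bool" where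
  "helmholtz_jet u \<longleftrightarrow>
     (\<forall>l x. (u l has_derivative (\<lambda>h. \<Sum>i\<in>UNIV. h$i * u (i # l) x)) (at x)) \<and>
     (\<forall>l i j x. u (i # j # l) x = u (j # i # l) x) \<and>
     (\<forall>l x. (\<Sum>i\<in>UNIV. u (i # i # l) x) = u l x)"

text \<open>The real evaluation at the end \<tau> = 1 of the path, with the pole at the origin:
  \<open>gev (jet l)\<close> is the derivative along l of exp (- norm z) / norm z.\<close>

fun gev :: "ex \<Rightarrow> real^3 \<Rightarrow> real" where
  "gev (Cn c) z = c"
| "gev Tau z = 1"
| "gev (Ax i) z = z $ i"
| "gev Ui z = 1 / norm z"
| "gev Xi z = exp (- norm z)"
| "gev (Ad a b) z = gev a z + gev b z"
| "gev (Mu a b) z = gev a z * gev b z"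

lemma qd_1: "qd y v 1 x = of_real ((norm (x - y))\<^sup>2)"
  by (simp add: qd_def ax_def norm_vec_def L2_set_def sum_3)

lemma ev_1:
  assumes v: "norm v = 1"
  shows "ev y v e 1 x = of_real (gev e (x - y))"
proof (induction e)
  case Ui
  show ?case by (simp add: qd_1 del: csqrt.simps of_real_power)
next
  case Xi
  have "nm y v 1 x = 1 - of_real ((norm (x - y))\<^sup>2)"
    using qd_expand[OF v, of 1] by (simp add: qd_1)
  then have 1: "nm y v 1 x / (1 + csqrt (qd y v 1 x)) - 1 =
    of_real ((1 - (norm (x - y))\<^sup>2) / (1 + norm (x-y)) - 1)"
    by (simp add: qd_1 del: csqrt.simps)
  have 2: "(1 - (norm (x - y))\<^sup>2) / (1 + norm (x-y)) - 1 = - norm (x - y)"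
  proof -
    have "1 + norm (x - y) > 0" by (simp add: add_pos_nonneg)
    then show ?thesis by (simp add: divide_simps power2_eq_square algebra_simps)
  qed
  show ?case unfolding ev.simps gev.simps 1 2 by (rule exp_of_real)
qed (auto simp: ax_def)

section \<open>Analyticity in the pole parameter\<close>

lemma holo_on_ev:
  "(\<lambda>\<tau>. ev y v e \<tau> x) holomorphic_on {\<tau>. Re (qd y v \<tau> x) > 0}"
proof (induction e)
  case Ui
  have "csqrt (qd y v \<tau> x) \<noteq> 0" if "Re (qd y v \<tau> x) > 0" for \<tau>
    using Re_csqrt_pos[OF that] by auto
  then show ?case unfolding ev.simps qd_def ax_def
    by (intro holomorphic_intros) (auto simp: complex_nonpos_Reals_iff qd_def ax_def)
next
  case Xi
  have "1 + csqrt (qd y v \<tau> x) \<noteq> 0" if "Re (qd y v \<tau> x) > 0" for \<tau>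
    using Re_csqrt_pos[OF that]
    by (metis add_pos_pos less_irrefl one_complex.simps(1) plus_complex.simps(1) zero_complex.simps(1) zero_less_one)
  then show ?case unfolding ev.simps qd_def ax_def nm_def
    by (intro holomorphic_intros) (auto simp: complex_nonpos_Reals_iff qd_def ax_def)
qed (auto intro!: holomorphic_intros simp: ax_def)

lemma continuous_on_qd: "continuous_on A (\<lambda>p. qd y v (fst p) (snd p))"
  unfolding qd_def ax_def by (intro continuous_intros)

lemma continuous_on_csqrt_qd:
  "continuous_on {p. Re (qd y v (fst p) (snd p)) > 0} (\<lambda>p. csqrt (qd y v (fst p) (snd p)))"
proof (rule continuous_on_compose2[OF _ continuous_on_qd])
  have "csqrt holomorphic_on {z. Re z > 0}"
    by (intro holomorphic_intros) (auto simp: complex_nonpos_Reals_iff)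
  then show "continuous_on {z. Re z > 0} csqrt" by (rule holomorphic_on_imp_continuous_on)
qed auto

lemma continuous_on_ev:
  "continuous_on {p. Re (qd y v (fst p) (snd p)) > 0} (\<lambda>p. ev y v e (fst p) (snd p))"
proof (induction e)
  case Ui
  have "csqrt (qd y v (fst p) (snd p)) \<noteq> 0" if "Re (qd y v (fst p) (snd p)) > 0" for p
    using Re_csqrt_pos[OF that] by auto
  then show ?case unfolding ev.simps
    by (intro continuous_intros continuous_on_csqrt_qd) auto
next
  case Xi
  have "1 + csqrt (qd y v (fst p) (snd p)) \<noteq> 0" if "Re (qd y v (fst p) (snd p)) > 0" for p
    using Re_csqrt_pos[OF that]
    by (metis add_pos_pos less_irrefl one_complex.simps(1) plus_complex.simps(1) zero_complex.simps(1) zero_less_one)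
  moreover have "continuous_on A (\<lambda>p. nm y v (fst p) (snd p))" for A
    unfolding nm_def ax_def by (intro continuous_intros)
  ultimately show ?case unfolding ev.simps
    by (intro continuous_intros continuous_on_csqrt_qd) auto
qed (auto intro!: continuous_intros simp: ax_def)

lemma open_ev_domain: "open {p. Re (qd y v (fst p) (snd p)) > 0}"
  by (intro open_Collect_less continuous_intros continuous_on_qd)

text \<open>By compactness, the real path of parameters may be thickened in the complex plane,
  uniformly over K, without leaving the domain on which the root of \<open>qd\<close> is
  analytic.\<close>

lemma compact_nbhd:
  fixes S :: "complex set" and K :: "(real^3) set"
  assumes "compact S" "compact K"
    and "\<And>\<tau> x. \<tau> \<in> S \<Longrightarrow> x \<in> K \<Longrightarrow> Re (qd y v \<tau> x) > 0"
  obtains d where "d > 0"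
    "\<And>\<sigma> \<tau> x. \<sigma> \<in> S \<Longrightarrow> dist \<tau> \<sigma> < d \<Longrightarrow> x \<in> K \<Longrightarrow> Re (qd y v \<tau> x) > 0"
proof -
  have "compact (S \<times> K)" using assms by (intro compact_Times)
  moreover have "S \<times> K \<subseteq> {p. Re (qd y v (fst p) (snd p)) > 0}" using assms(3) by auto
  ultimately have "\<exists>e>0. S \<times> K = {} \<or> {p. infdist p (S \<times> K) \<le> e} \<subseteq> {p. Re (qd y v (fst p) (snd p)) > 0}"
  proof (cases "S \<times> K = {}")
    case False
    from compact_in_open_separated[OF this \<open>compact (S \<times> K)\<close> open_ev_domain \<open>S \<times> K \<subseteq> _\<close>]
    show ?thesis by meson
  qed (auto intro: exI[of _ 1])
  then obtain e where e: "e > 0" "S \<times> K = {} \<or> {p. infdist p (S \<times> K) \<le> e} \<subseteq> {p. Re (qd y v (fst p) (snd p)) > 0}"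
    by blast
  show ?thesis
  proof (rule that[OF e(1)])
    fix \<sigma> \<tau> x assume *: "\<sigma> \<in> S" "dist \<tau> \<sigma> < e" "x \<in> K"
    have "infdist (\<tau>, x) (S \<times> K) \<le> dist (\<tau>, x) (\<sigma>, x)"
      using * by (intro infdist_le) auto
    also have "\<dots> = dist \<tau> \<sigma>" by (simp add: dist_Pair_Pair)
    finally have "infdist (\<tau>, x) (S \<times> K) \<le> e" using * by simp
    then show "Re (qd y v \<tau> x) > 0" using e(2) * by auto
  qed
qed

text \<open>The map - Ln (1 - \<eta> w) / L sends the disc into a thin strip, because the argument
  of a point in the right half plane is bounded and is divided by L; a large L squeezes the image
  onto the segment. The radius exceeds 1 so that a Taylor series at 0 converges geometrically at w =
  1.\<close>

lemma disc_map_along_segment: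
  fixes d :: real
  assumes "d > 0"
  obtains R \<psi> where "R > 1" "\<psi> holomorphic_on ball 0 R" "\<psi> 0 = 0" "\<psi> 1 = (1::complex)"
    "\<And>w. w \<in> ball 0 R \<Longrightarrow> \<exists>t\<in>{0..1}. dist (\<psi> w) (of_real t) < d"
proof -
  define L where "L = 4 / d + 1"
  have L: "L > 0" "4 / L < d" using assms by (auto simp: L_def field_simps add_pos_pos)
  define \<eta> where "\<eta> = 1 - exp (- L)"
  have \<eta>: "0 < \<eta>" "\<eta> < 1" using L by (auto simp: \<eta>_def)
  \<comment> \<open>The midpoint between 1 and the singularity 1 / \<eta>. On this disc 1 - \<eta> w
    stays in the right half plane, with modulus at least exp (- L) / 2.\<close>
  define R where "R = (1 + 1/\<eta>) / 2"
  have R: "R > 1" "\<eta> * R = (1 + \<eta>) / 2" using \<eta> by (auto simp: R_def field_simps)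
  define \<psi> where "\<psi> w = - Ln (1 - of_real \<eta> * w) / of_real L" for w
  have a: "cmod (1 - (1 - of_real \<eta> * w)) \<le> \<eta> * R" if "w \<in> ball 0 R" for w
    using that \<eta> by (auto simp: norm_mult intro!: mult_left_mono)
  have lt: "\<eta> * R < 1" using R \<eta> by simp
  have re: "Re (1 - of_real \<eta> * w) > 0" if "w \<in> ball 0 R" for w
  proof -
    have "Re (of_real \<eta> * w) \<le> cmod (of_real \<eta> * w)" by (rule complex_Re_le_cmod)
    then show ?thesis using a[OF that] lt by simp
  qed
  show ?thesis
  proof (rule that[of R \<psi>])
    show "R > 1" by fact
    show "\<psi> holomorphic_on ball 0 R"
    proof -
      have "1 - of_real \<eta> * w \<notin> \<real>\<^sub>\<le>\<^sub>0" if "w \<in> ball 0 R" for w :: complex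
        using re[OF that] by (metis complex_nonpos_Reals_iff not_less)
      then show ?thesis unfolding \<psi>_def using L(1) by (intro holomorphic_intros) simp_all
    qed
    show "\<psi> 0 = 0" by (simp add: \<psi>_def)
    have "Ln (1 - of_real \<eta>) = of_real (- L)"
    proof -
      have "1 - complex_of_real \<eta> = exp (of_real (- L))" by (simp add: \<eta>_def exp_of_real[symmetric])
      then show ?thesis by (metis Ln_of_real exp_gt_zero exp_of_real ln_exp)
    qed
    then show "\<psi> 1 = 1" using L(1) by (simp add: \<psi>_def)
    fix w :: complex assume w: "w \<in> ball 0 R"
    define z where "z = 1 - of_real \<eta> * w"
    have z: "Re z > 0" "cmod (1 - z) \<le> \<eta> * R" using re[OF w] a[OF w] by (auto simp: z_def)
    then have z0: "z \<noteq> 0" by auto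
    have "cmod z \<le> 2" using norm_triangle_ineq4[of 1 "1 - z"] z lt by simp
    then have up: "ln (cmod z) \<le> 1" using z0 ln_le_minus_one[of "cmod z"] by simp
    have "cmod z \<ge> 1 - \<eta> * R" using norm_triangle_ineq2[of 1 "1 - z"] z by simp
    then have "cmod z \<ge> exp (-L) / 2" using R by (simp add: \<eta>_def field_simps)
    then have "ln (cmod z) \<ge> ln (exp (-L) / 2)" by (subst ln_le_cancel_iff) (use z0 in auto)
    also have "ln (exp (-L) / 2) = - L - ln 2" by (simp add: ln_div)
    finally have lo: "ln (cmod z) \<ge> - L - 1" using ln_2_less_1 by simp
    have im: "\<bar>Im (Ln z)\<bar> < 2" using z(1) Re_Ln_pos_lt[OF z0] pi_half_less_two by (auto simp: abs_if)
    \<comment> \<open>The real part of \<psi> w, clamped to the segment. Since ln (cmod z) lies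
      between - L - 1 and 1, clamping moves it by at most 1 / L.\<close>
    define t where "t = max 0 (min 1 (- ln (cmod z) / L))"
    have t: "t \<in> {0..1}" by (auto simp: t_def)
    have pz: "\<psi> w = - Ln z / of_real L" by (simp add: \<psi>_def z_def)
    have "Re (\<psi> w) = - ln (cmod z) / L" "Im (\<psi> w) = - Im (Ln z) / L"
      unfolding pz using z0 L by (auto simp: Re_divide_of_real Im_divide_of_real)
    moreover have "\<bar>- ln (cmod z) / L - t\<bar> \<le> 1 / L"
    proof -
      have "- ln (cmod z) / L \<ge> - 1 / L" "- ln (cmod z) / L \<le> (L + 1) / L"
        using up lo L(1) by (intro divide_right_mono; simp)+
      moreover have "(L + 1) / L = 1 + 1 / L" "1 / L > 0" using L(1) by (auto simp: field_simps)
      ultimately show ?thesis unfolding t_def by (simp add: max_def min_def abs_if)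
    qed
    moreover have "\<bar>- Im (Ln z) / L\<bar> < 2 / L" using im L(1) by (simp add: divide_strict_right_mono)
    ultimately have "\<bar>Re (\<psi> w - of_real t)\<bar> + \<bar>Im (\<psi> w - of_real t)\<bar> < 1 / L + 2 / L" by simp
    also have "\<dots> < d" using L by (simp add: field_simps)
    finally have "cmod (\<psi> w - of_real t) < d"
      using cmod_le[of "\<psi> w - of_real t"] by linarith
    then show "\<exists>t\<in>{0..1}. dist (\<psi> w) (of_real t) < d" using t by (auto simp: dist_norm)
  qed
qed

section \<open>Runge approximation of point sources\<close>

text \<open>The n-th Taylor coefficient at w = 0 of the potential with pole parameter \<psi> w. It
  is meaningful for every x, even where the potential itself has its pole, because \<psi> 0 = 0 puts
  the pole at infinity.\<close>

definition cof :: "real^3 \<Rightarrow> real^3 \<Rightarrow> (complex \<Rightarrow> complex) \<Rightarrow> nat \<Rightarrow> ex \<Rightarrow> real^3 \<Rightarrow> complex" where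
  "cof y v \<psi> n e x = (deriv ^^ n) (\<lambda>w. ev y v e (\<psi> w) x) 0 / fact n"

lemma sum_norm_le_3: "(\<Sum>i\<in>UNIV. \<bar>h $ i\<bar> * c) \<le> 3 * c * norm (h::real^3)" if "c \<ge> 0"
proof -
  have "(\<Sum>i\<in>UNIV. \<bar>h $ i\<bar> * c) \<le> (\<Sum>i\<in>(UNIV::3 set). norm h * c)"
    using that by (intro sum_mono mult_right_mono component_le_norm_cart)
  then show ?thesis by (simp add: algebra_simps)
qed

lemma bounded_linear_comb: "bounded_linear (\<lambda>h::real^3. \<Sum>i\<in>UNIV. of_real (h$i) * (c i :: complex))"
  by (intro bounded_linear_sum bounded_linear_mult_const bounded_linear_compose[OF bounded_linear_of_real] bounded_linear_vec_nth)

locale disc_family =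
  fixes y v :: "real^3" and \<psi> :: "complex \<Rightarrow> complex" and R :: real
  assumes v: "norm v = 1" and R: "R > 0" and hol: "\<psi> holomorphic_on ball 0 R" and \<psi>0: "\<psi> 0 = 0"
begin

text \<open>At \<tau> = 0 \<open>qd\<close> equals 1 for every x, so around each x0 a small circle
  of parameters w is admissible. Its radius depends on x0, which is harmless for Taylor coefficients
  at 0.\<close>

lemma near0: obtains e where "(0::real) < e" "e < R"
  "\<And>(w::complex) x. w \<in> cball 0 e \<Longrightarrow> x \<in> cball x0 1 \<Longrightarrow> Re (qd y v (\<psi> w) x) > 0"
proof -
  have "Re (qd y v 0 x) > 0" for x
  proof -
    have "(v$1)^2 + (v$2)^2 + (v$3)^2 = 1"
      using v by (simp add: norm_vec_def L2_set_def sum_3)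
    then show ?thesis by (simp add: qd_def ax_def sum_3 flip: of_real_power of_real_add)
  qed
  then obtain d where d: "d > 0" "\<And>\<tau> x. dist \<tau> 0 < d \<Longrightarrow> x \<in> cball x0 1 \<Longrightarrow> Re (qd y v \<tau> x) > 0"
    using compact_nbhd[of "{0}" "cball x0 1" y v] by (auto simp: dist_norm) (metis dist_0_norm dist_commute dist_norm)
  have "isCont \<psi> 0"
    using hol R by (metis centre_in_ball continuous_on_eq_continuous_at holomorphic_on_imp_continuous_on open_ball)
  then obtain s where s: "s > 0" "\<And>w. dist w 0 < s \<Longrightarrow> dist (\<psi> w) (\<psi> 0) < d"
    using d(1) unfolding continuous_at_eps_delta by (auto simp: dist_norm)
  show ?thesis
  proof (rule that[of "min s R / 2"])
    fix w :: complex and x assume "w \<in> cball 0 (min s R / 2)" "x \<in> cball x0 1"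
    then show "Re (qd y v (\<psi> w) x) > 0" using s R \<psi>0 by (intro d(2)) (auto simp: dist_norm)
  qed (use s R in auto)
qed

lemma holo_ev_psi:
  assumes "\<And>w. w \<in> S \<Longrightarrow> Re (qd y v (\<psi> w) x) > 0" "S \<subseteq> ball 0 R"
  shows "(\<lambda>w. ev y v e (\<psi> w) x) holomorphic_on S"
proof -
  have "((\<lambda>\<tau>. ev y v e \<tau> x) \<circ> \<psi>) holomorphic_on S"
    using assms by (intro holomorphic_on_compose_gen[OF holomorphic_on_subset[OF hol] holo_on_ev]) auto
  then show ?thesis by (simp add: o_def)
qed

text \<open>Differentiation in x commutes with taking a Taylor coefficient in w: the first-order
  remainder is holomorphic in w and small uniformly on a circle, so the Cauchy inequality makes its
  n-th coefficient small.\<close>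

lemma cof_has_derivative:
  "((\<lambda>x. cof y v \<psi> n e x) has_derivative (\<lambda>h. \<Sum>i\<in>UNIV. of_real (h$i) * cof y v \<psi> n (dv i e) x0)) (at x0)"
  unfolding has_derivative_at_alt
proof (intro conjI allI impI)
  show "bounded_linear (\<lambda>h. \<Sum>i\<in>UNIV. of_real (h$i) * cof y v \<psi> n (dv i e) x0)"
    by (rule bounded_linear_comb)
  fix \<epsilon> :: real assume \<epsilon>: "\<epsilon> > 0"
  obtain r where r: "0 < r" "r < R" "\<And>w x. w \<in> cball 0 r \<Longrightarrow> x \<in> cball x0 1 \<Longrightarrow> Re (qd y v (\<psi> w) x) > 0"
    by (rule near0[of x0], rule that)
  \<comment> \<open>The Cauchy inequality on the circle of radius r costs a factor 1 / r^n, and the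
    three coordinates of the linear part cost a factor 3.\<close>
  define \<eta> where "\<eta> = \<epsilon> * r ^ n / 3"
  have \<eta>: "\<eta> > 0" using \<epsilon> r(1) by (simp add: \<eta>_def)
  have psic: "continuous_on (cball 0 r) \<psi>"
    by (rule holomorphic_on_imp_continuous_on[OF holomorphic_on_subset[OF hol]]) (use r(2) in auto)
  have "\<exists>d>0. \<forall>w\<in>cball 0 r. \<forall>x\<in>cball x0 1. dist x x0 < d \<longrightarrow>
      (\<forall>i. cmod (ev y v (dv i e) (\<psi> w) x - ev y v (dv i e) (\<psi> w) x0) < \<eta>)"
  proof -
    have "\<exists>d>0. \<forall>w\<in>cball 0 r. \<forall>x\<in>cball x0 1. dist x x0 < d \<longrightarrow>
      cmod (ev y v (dv i e) (\<psi> w) x - ev y v (dv i e) (\<psi> w) x0) < \<eta>" for i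
    proof -
      have "continuous_on (cball 0 r \<times> cball x0 1) (\<lambda>p. ev y v (dv i e) (fst (\<psi> (fst p), snd p)) (snd (\<psi> (fst p), snd p)))"
        using r(3)
        by (intro continuous_on_compose2[OF continuous_on_ev] continuous_intros
              continuous_on_compose2[OF psic]) auto
      then have "uniformly_continuous_on (cball 0 r \<times> cball x0 1) (\<lambda>p. ev y v (dv i e) (\<psi> (fst p)) (snd p))"
        by (intro compact_uniformly_continuous compact_Times) simp_all
      then obtain d where "d > 0" and d: "\<And>p q. p \<in> cball 0 r \<times> cball x0 1 \<Longrightarrow> q \<in> cball 0 r \<times> cball x0 1 \<Longrightarrow>
          dist q p < d \<Longrightarrow> dist (ev y v (dv i e) (\<psi> (fst q)) (snd q)) (ev y v (dv i e) (\<psi> (fst p)) (snd p)) < \<eta>"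
        using \<eta> unfolding uniformly_continuous_on_def by metis
      show ?thesis
      proof (intro exI[of _ d] conjI ballI impI)
        fix w :: complex and x assume "w \<in> cball 0 r" "x \<in> cball x0 1" "dist x x0 < d"
        then show "cmod (ev y v (dv i e) (\<psi> w) x - ev y v (dv i e) (\<psi> w) x0) < \<eta>"
          using d[of "(w, x0)" "(w, x)"] by (simp add: dist_Pair_Pair dist_norm)
      qed fact
    qed
    then obtain D where D: "\<And>i. D i > 0" "\<And>i w x. w\<in>cball 0 r \<Longrightarrow> x\<in>cball x0 1 \<Longrightarrow> dist x x0 < D i \<Longrightarrow>
      cmod (ev y v (dv i e) (\<psi> w) x - ev y v (dv i e) (\<psi> w) x0) < \<eta>"
      by metis
    show ?thesis
      using D by (intro exI[of _ "Min (range D)"]) auto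
  qed
  then obtain d where d: "d > 0" "\<And>w x i. w\<in>cball 0 r \<Longrightarrow> x\<in>cball x0 1 \<Longrightarrow> dist x x0 < d \<Longrightarrow>
      cmod (ev y v (dv i e) (\<psi> w) x - ev y v (dv i e) (\<psi> w) x0) < \<eta>" by metis
  show "\<exists>d>0. \<forall>x. norm (x - x0) < d \<longrightarrow>
      norm (cof y v \<psi> n e x - cof y v \<psi> n e x0 - (\<Sum>i\<in>UNIV. of_real ((x - x0)$i) * cof y v \<psi> n (dv i e) x0))
      \<le> \<epsilon> * norm (x - x0)"
  proof (intro exI[of _ "min d 1"] conjI allI impI)
    show "min d 1 > 0" using d by simp
    fix x assume x: "norm (x - x0) < min d 1"
    have x1: "x \<in> cball x0 1" using x by (simp add: dist_norm norm_minus_commute)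
    define f where "f w = ev y v e (\<psi> w) x" for w
    define g where "g w = ev y v e (\<psi> w) x0" for w
    define k where "k i w = ev y v (dv i e) (\<psi> w) x0" for i w
    have sub: "ball 0 r \<subseteq> ball (0::complex) R" "cball 0 r \<subseteq> ball (0::complex) R" using r(2) by auto
    have holB: "(\<lambda>w. ev y v a (\<psi> w) z) holomorphic_on cball 0 r" if "z \<in> cball x0 1" for a z
      using r(3) that by (intro holo_ev_psi[OF _ sub(2)]) auto
    have fgk: "f holomorphic_on cball 0 r" "g holomorphic_on cball 0 r" "k i holomorphic_on cball 0 r" for i
      unfolding f_def g_def k_def using holB x1 by auto
    note fgk' = holomorphic_on_subset[OF fgk(1) ball_subset_cball] holomorphic_on_subset[OF fgk(2) ball_subset_cball]
       holomorphic_on_subset[OF fgk(3) ball_subset_cball]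
    define h where "h w = f w - g w - (of_real ((x-x0)$1) * k 1 w + of_real ((x-x0)$2) * k 2 w + of_real ((x-x0)$3) * k 3 w)" for w
    have hB: "norm (h w) \<le> \<epsilon> * r ^ n * norm (x - x0)" if w: "w \<in> cball 0 r" for w
    proof -
      define f' where "f' z = (\<lambda>h. \<Sum>i\<in>UNIV. complex_of_real (h$i) * ev y v (dv i e) (\<psi> w) z)" for z
      have ball: "x0 + t *\<^sub>R (x - x0) \<in> cball x0 (norm (x - x0))" if "t \<in> {0..1}" for t
        using that by (auto simp: dist_norm mult_left_le_one_le)
      have "norm (ev y v e (\<psi> w) x - ev y v e (\<psi> w) x0 - f' x0 (x - x0)) \<le> norm (x - x0) * (3 * \<eta>)"
      proof (rule differentiable_bound_linearization[of x0 x "cball x0 (norm (x - x0))" _ f' x0 "3 * \<eta>"])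
        fix z assume z: "z \<in> cball x0 (norm (x - x0))"
        then have z1: "z \<in> cball x0 1" "dist z x0 < d" using x by (auto simp: dist_commute)
        show "((\<lambda>x. ev y v e (\<psi> w) x) has_derivative f' z) (at z within cball x0 (norm (x - x0)))"
          unfolding f'_def using r(3)[OF w z1(1)] by (intro has_derivative_at_withinI[OF ev_deriv[OF v]]) auto
        show "onorm (f' z - f' x0) \<le> 3 * \<eta>"
        proof (rule onorm_le)
          fix h :: "real^3"
          have "norm ((f' z - f' x0) h) = norm (\<Sum>i\<in>UNIV. complex_of_real (h$i) * (ev y v (dv i e) (\<psi> w) z - ev y v (dv i e) (\<psi> w) x0))"
            by (simp add: f'_def sum_subtractf algebra_simps)
          also have "\<dots> \<le> (\<Sum>i\<in>UNIV. \<bar>h$i\<bar> * \<eta>)"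
            using less_imp_le[OF d(2)[OF w z1]] by (intro sum_norm_le) (auto simp: norm_mult intro!: mult_left_mono)
          also have "\<dots> \<le> 3 * \<eta> * norm h" using \<eta> by (intro sum_norm_le_3) simp
          finally show "norm ((f' z - f' x0) h) \<le> 3 * \<eta> * norm h" .
        qed
      qed (use ball in auto)
      then show ?thesis by (simp add: h_def f_def g_def k_def f'_def sum_3 \<eta>_def algebra_simps)
    qed
    have hh: "h holomorphic_on cball 0 r" unfolding h_def using fgk by (intro holomorphic_intros)
    have "norm ((deriv ^^ n) h 0) \<le> fact n * (\<epsilon> * r ^ n * norm (x - x0)) / r ^ n"
      using r(1) hB by (intro Cauchy_inequality holomorphic_on_subset[OF hh] holomorphic_on_imp_continuous_on[OF hh]) auto
    moreover have "(deriv ^^ n) h 0 = (deriv ^^ n) f 0 - (deriv ^^ n) g 0 - (of_real ((x-x0)$1) * (deriv ^^ n) (k 1) 0 + of_real ((x-x0)$2) * (deriv ^^ n) (k 2) 0 + of_real ((x-x0)$3) * (deriv ^^ n) (k 3) 0)"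
      unfolding h_def using fgk' r(1)
      by (simp add: higher_deriv_diff[where S="ball 0 r"] higher_deriv_add[where S="ball 0 r"] higher_deriv_cmult[where A="ball 0 r"] holomorphic_intros)
    ultimately have "norm (((deriv ^^ n) f 0 - (deriv ^^ n) g 0 - (of_real ((x-x0)$1) * (deriv ^^ n) (k 1) 0 + of_real ((x-x0)$2) * (deriv ^^ n) (k 2) 0 + of_real ((x-x0)$3) * (deriv ^^ n) (k 3) 0)) / fact n) \<le> \<epsilon> * norm (x - x0)"
      using r(1) by (simp add: norm_divide field_simps)
    then show "norm (cof y v \<psi> n e x - cof y v \<psi> n e x0 - (\<Sum>i\<in>UNIV. of_real ((x - x0)$i) * cof y v \<psi> n (dv i e) x0))
      \<le> \<epsilon> * norm (x - x0)"
      by (simp add: cof_def sum_3 f_def[symmetric] g_def[symmetric] k_def[symmetric] diff_divide_distrib add_divide_distrib)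
  qed
qed

text \<open>A coefficient depends only on values for w near 0, all of which lie in the domain.
  Pointwise identities between expressions thereby become identities between functions on the whole
  space.\<close>

lemma cof_cong:
  assumes "\<And>w x. Re (qd y v (\<psi> w) x) > 0 \<Longrightarrow> ev y v a (\<psi> w) x = ev y v b (\<psi> w) x"
  shows "cof y v \<psi> n a x = cof y v \<psi> n b x"
proof -
  obtain r where r: "0 < r" "r < R" "\<And>w z. w \<in> cball 0 r \<Longrightarrow> z \<in> cball x 1 \<Longrightarrow> Re (qd y v (\<psi> w) z) > 0"
    by (rule near0[of x], rule that)
  have "eventually (\<lambda>w. w \<in> ball 0 r) (nhds (0::complex))"
    using r(1) by (intro eventually_nhds_in_open) auto
  then have "eventually (\<lambda>w. ev y v a (\<psi> w) x = ev y v b (\<psi> w) x) (nhds 0)"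
    by eventually_elim (use r assms in auto)
  then show ?thesis unfolding cof_def by (simp add: higher_deriv_cong_ev)
qed

lemma cof_sum:
  "(\<Sum>i\<in>UNIV. cof y v \<psi> n (e i) x) = cof y v \<psi> n (Ad (Ad (e (1::3)) (e 2)) (e 3)) x"
proof -
  obtain r where r: "0 < r" "r < R" "\<And>w z. w \<in> cball 0 r \<Longrightarrow> z \<in> cball x 1 \<Longrightarrow> Re (qd y v (\<psi> w) z) > 0"
    by (rule near0[of x], rule that)
  have "(\<lambda>w. ev y v a (\<psi> w) x) holomorphic_on ball 0 r" for a
    using r by (intro holo_ev_psi) auto
  then show ?thesis
    unfolding cof_def sum_3 using r(1)
    by (simp add: higher_deriv_add[where S="ball 0 r"] holomorphic_intros add_divide_distrib)
qed

end

text \<open>An identity of values on an open set of x may be differentiated, by uniqueness of the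
  derivative. This carries the Helmholtz identity through further derivatives although the two sides
  differ as expressions.\<close>

lemma ev_dv_cong:
  assumes v: "norm v = 1" and q: "Re (qd y v \<tau> x) > 0"
    and eq: "\<And>z. Re (qd y v \<tau> z) > 0 \<Longrightarrow> ev y v a \<tau> z = ev y v b \<tau> z"
  shows "ev y v (dv k a) \<tau> x = ev y v (dv k b) \<tau> x"
proof -
  have op: "open {x. Re (qd y v \<tau> x) > 0}"
    unfolding qd_def ax_def by (intro open_Collect_less continuous_intros)
  have "eventually (\<lambda>z. z \<in> {x. Re (qd y v \<tau> x) > 0}) (nhds x)"
    using op q by (intro eventually_nhds_in_open) auto
  then have "eventually (\<lambda>z. ev y v a \<tau> z = ev y v b \<tau> z) (at x)"
    unfolding eventually_at_filter by eventually_elim (use eq in simp)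
  from has_derivative_transform_eventually[OF ev_deriv[OF v q] this]
  have "((\<lambda>z. ev y v b \<tau> z) has_derivative (\<lambda>h. \<Sum>i\<in>UNIV. of_real (h$i) * ev y v (dv i a) \<tau> x)) (at x)"
    using eq q by auto
  from has_derivative_unique[OF this ev_deriv[OF v q]]
  have "(\<Sum>i\<in>UNIV. complex_of_real (axis k 1 $ i) * ev y v (dv i a) \<tau> x) = (\<Sum>i\<in>UNIV. of_real (axis k 1 $ i) * ev y v (dv i b) \<tau> x)"
    by meson
  then show ?thesis
    by (simp add: axis_def if_distrib[of complex_of_real] if_distrib[of "\<lambda>a. a * _"] sum.delta cong: if_cong)
qed

lemma ev_laplace_jet:
  assumes v: "norm v = 1" and q: "Re (qd y v \<tau> x) > 0"
  shows "ev y v (Ad (Ad (dv 1 (dv 1 (jet l))) (dv 2 (dv 2 (jet l)))) (dv 3 (dv 3 (jet l)))) \<tau> x = ev y v (jet l) \<tau> x"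
  using q
proof (induction l arbitrary: x)
  case Nil
  from ev_helmholtz[OF Nil] show ?case unfolding sum_3 by simp
next
  case (Cons k l)
  have c: "ev y v (dv i (dv i (dv k e))) \<tau> x = ev y v (dv k (dv i (dv i e))) \<tau> x" for i e
    by (rule trans[OF ev_dv_cong[OF v Cons.prems ev_commute] ev_commute])
  show ?case using ev_dv_cong[OF v Cons.prems Cons.IH, of k] by (simp add: c del: ev.simps(1-5))
qed

lemma geometric_tail:
  fixes c :: "nat \<Rightarrow> complex"
  assumes s: "c sums L" and b: "\<And>n. norm (c n) \<le> B * q ^ n" and q: "0 \<le> q" "q < 1"
  shows "norm (L - (\<Sum>n<N. c n)) \<le> B * q ^ N / (1 - q)"
proof -
  have t: "(\<lambda>n. c (n + N)) sums (L - (\<Sum>n<N. c n))" using s by (subst sums_iff_shift') simp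
  have g: "(\<lambda>n. B * q ^ (n + N)) sums (B * q ^ N / (1 - q))"
  proof -
    have "(\<lambda>n. (B * q ^ N) * q ^ n) sums ((B * q ^ N) * (1 / (1 - q)))"
      using q by (intro sums_mult geometric_sums) simp
    then show ?thesis by (simp add: power_add mult_ac)
  qed
  have "norm (suminf (\<lambda>n. c (n + N))) \<le> suminf (\<lambda>n. B * q ^ (n + N))"
    using g b by (intro norm_suminf_le) (auto simp: sums_iff)
  then show ?thesis using t g by (simp add: sums_iff)
qed

text \<open>Each coefficient inherits the Helmholtz equation from the potential, and taking real
  parts is allowed because the equation is linear with real coefficients.\<close>

lemma (in disc_family) helmholtz_jet_partial_sum:
  "helmholtz_jet (\<lambda>l x. Re (\<Sum>n<N. cof y v \<psi> n (jet l) x))"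
  unfolding helmholtz_jet_def
proof (intro conjI allI)
  fix l x
  have "((\<lambda>x. Re (\<Sum>n<N. cof y v \<psi> n (jet l) x)) has_derivative
    (\<lambda>h. Re (\<Sum>n<N. \<Sum>i\<in>UNIV. of_real (h$i) * cof y v \<psi> n (dv i (jet l)) x))) (at x)"
    by (intro has_derivative_Re has_derivative_sum cof_has_derivative)
  then show "((\<lambda>x. Re (\<Sum>n<N. cof y v \<psi> n (jet l) x)) has_derivative
     (\<lambda>h. \<Sum>i\<in>UNIV. h$i * Re (\<Sum>n<N. cof y v \<psi> n (jet (i # l)) x))) (at x)"
    by (simp add: sum_3 sum.distrib flip: sum_distrib_left)
next
  fix l i j x
  show "Re (\<Sum>n<N. cof y v \<psi> n (jet (i # j # l)) x) = Re (\<Sum>n<N. cof y v \<psi> n (jet (j # i # l)) x)"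
    using cof_cong[OF ev_commute] by simp
next
  fix l x
  have "cof y v \<psi> n (Ad (Ad (dv 1 (dv 1 (jet l))) (dv 2 (dv 2 (jet l)))) (dv 3 (dv 3 (jet l)))) x = cof y v \<psi> n (jet l) x" for n
    by (rule cof_cong[OF ev_laplace_jet[OF v]])
  then have "(\<Sum>i\<in>UNIV. cof y v \<psi> n (dv i (dv i (jet l))) x) = cof y v \<psi> n (jet l) x" for n
    using cof_sum[of n "\<lambda>i. dv i (dv i (jet l))" x] by simp
  then show "(\<Sum>i\<in>UNIV. Re (\<Sum>n<N. cof y v \<psi> n (jet (i # i # l)) x)) = Re (\<Sum>n<N. cof y v \<psi> n (jet l) x)"
    unfolding jet_simps Re_sum[symmetric] by (subst sum.swap) simp
qed

text \<open>The pole travels to infinity in one step. As a function of w the potential is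
  holomorphic on a disc of radius R > 1; at w = 1 it is the given point source, and its Taylor
  polynomials at 0 are global solutions. Convergence at w = 1 is geometric, uniformly over K and
  over the finitely many derivatives of order at most 3.\<close>

theorem runge_point_source:
  fixes y v :: "real^3"
  assumes K: "compact K" and v: "norm v = 1" and ray: "\<And>t. t \<ge> 0 \<Longrightarrow> y + t *\<^sub>R v \<notin> K" and e: "\<epsilon> > 0"
  obtains u where "helmholtz_jet u"
    "\<And>l x. length l \<le> 3 \<Longrightarrow> x \<in> K \<Longrightarrow> \<bar>u l x - gev (jet l) (x - y)\<bar> < \<epsilon>"
proof -
  have pos: "Re (qd y v \<tau> x) > 0" if "\<tau> \<in> complex_of_real ` {0..1}" "x \<in> K" for \<tau> x
  proof -
    from that(1) obtain t where t: "t \<in> {0..1}" "\<tau> = of_real t" by auto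
    \<comment> \<open>This is t times x minus the moved pole. It vanishes only if x lies on the ray
      or, at t = 0, if v vanishes.\<close>
    define a where "a = t *\<^sub>R (x - y) - (1 - t) *\<^sub>R v"
    have "qd y v \<tau> x = of_real ((norm a)\<^sup>2)"
      by (simp add: qd_def ax_def a_def t norm_vec_def L2_set_def sum_3 algebra_simps)
    moreover have "a \<noteq> 0"
    proof
      assume "a = 0"
      show False
      proof (cases "t = 0")
        case True then show False using \<open>a = 0\<close> v by (simp add: a_def)
      next
        case False
        have "t *\<^sub>R (x - y) = t *\<^sub>R (((1-t)/t) *\<^sub>R v)" using \<open>a = 0\<close> False by (simp add: a_def)
        then have "x = y + ((1-t)/t) *\<^sub>R v" using False by (metis add.commute diff_add_cancel real_vector.scale_cancel_left)
        then show False using ray[of "(1-t)/t"] t that by auto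
      qed
    qed
    ultimately show ?thesis by simp
  qed
  have "compact (complex_of_real ` {0..1})" by (intro compact_continuous_image continuous_intros) simp
  from compact_nbhd[OF this K pos]
  obtain d where d: "d > 0" "\<And>\<sigma> \<tau> x. \<sigma> \<in> complex_of_real ` {0..1} \<Longrightarrow> dist \<tau> \<sigma> < d \<Longrightarrow> x \<in> K \<Longrightarrow> Re (qd y v \<tau> x) > 0"
    by metis
  from disc_map_along_segment[OF d(1)] obtain R \<psi> where R1: "R > 1" and psi: "\<psi> holomorphic_on ball 0 R" "\<psi> 0 = 0" "\<psi> 1 = (1::complex)"
    and seg: "\<And>w. w \<in> ball 0 R \<Longrightarrow> \<exists>t\<in>{0..1}. dist (\<psi> w) (of_real t) < d" by metis
  interpret disc_family y v \<psi> R using v R1 psi by unfold_locales auto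
  have dom: "Re (qd y v (\<psi> w) x) > 0" if "w \<in> ball 0 R" "x \<in> K" for w x
    using seg[OF that(1)] d(2) that(2) by blast
  \<comment> \<open>A radius strictly between 1 and R: bounds on this closed disc make the
    coefficients decay like (1 / r)^n with ratio below 1.\<close>
  define r where "r = (1 + R) / 2"
  have r: "1 < r" "r < R" using R1 by (auto simp: r_def)
  have subr: "cball (0::complex) r \<subseteq> ball 0 R" using r by auto
  have holo: "(\<lambda>w. ev y v (jet l) (\<psi> w) x) holomorphic_on ball 0 R" if "x \<in> K" for l x
    using dom that by (intro holo_ev_psi) auto
  have "\<exists>B. \<forall>w\<in>cball 0 r. \<forall>x\<in>K. cmod (ev y v (jet l) (\<psi> w) x) \<le> B" for l
  proof -
    have psic: "continuous_on (cball 0 r) \<psi>"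
      by (rule holomorphic_on_imp_continuous_on[OF holomorphic_on_subset[OF psi(1) subr]])
    have "continuous_on (cball 0 r \<times> K) (\<lambda>p. ev y v (jet l) (fst (\<psi> (fst p), snd p)) (snd (\<psi> (fst p), snd p)))"
      using dom subr
      by (intro continuous_on_compose2[OF continuous_on_ev] continuous_intros
            continuous_on_compose2[OF psic]) auto
    then have "compact ((\<lambda>p. ev y v (jet l) (\<psi> (fst p)) (snd p)) ` (cball 0 r \<times> K))"
      using K by (intro compact_continuous_image compact_Times) simp_all
    from compact_imp_bounded[OF this] show ?thesis unfolding bounded_iff by force
  qed
  then obtain B where B: "\<And>l w x. w \<in> cball 0 r \<Longrightarrow> x \<in> K \<Longrightarrow> cmod (ev y v (jet l) (\<psi> w) x) \<le> B l" by metis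
  have tail: "cmod (ev y v (jet l) 1 x - (\<Sum>n<N. cof y v \<psi> n (jet l) x)) \<le> B l * (1/r) ^ N / (1 - 1/r)"
    if x: "x \<in> K" for l x N
  proof (rule geometric_tail)
    have "(\<lambda>n. (deriv ^^ n) (\<lambda>w. ev y v (jet l) (\<psi> w) x) 0 / fact n * (1 - 0) ^ n) sums ev y v (jet l) (\<psi> 1) x"
      using R1 by (intro holomorphic_power_series[OF holo[OF x]]) simp
    then show "(\<lambda>n. cof y v \<psi> n (jet l) x) sums ev y v (jet l) 1 x" by (simp add: cof_def psi(3))
    fix n
    have "norm ((deriv ^^ n) (\<lambda>w. ev y v (jet l) (\<psi> w) x) 0) \<le> fact n * B l / r ^ n"
      using r(1) subr B[OF _ x]
      by (intro Cauchy_inequality holomorphic_on_imp_continuous_on holomorphic_on_subset[OF holo[OF x]]) auto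
    then show "cmod (cof y v \<psi> n (jet l) x) \<le> B l * (1/r) ^ n"
      using r(1) by (simp add: cof_def norm_divide field_simps)
  qed (use r in auto)
  define F where "F = {l :: 3 list. length l \<le> 3}"
  have "finite F" using finite_lists_length_le[of "UNIV :: 3 set" 3] by (simp add: F_def)
  have "(\<lambda>N. B l * (1/r) ^ N / (1 - 1/r)) \<longlonglongrightarrow> B l * 0 / (1 - 1/r)" for l
    using r by (intro tendsto_intros LIMSEQ_realpow_zero) auto
  then have "eventually (\<lambda>N. B l * (1/r) ^ N / (1 - 1/r) < \<epsilon>) sequentially" for l
    using e by (intro order_tendstoD(2)[of _ 0]) auto
  then have "eventually (\<lambda>N. \<forall>l\<in>F. B l * (1/r) ^ N / (1 - 1/r) < \<epsilon>) sequentially"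
    using \<open>finite F\<close> by (simp add: eventually_ball_finite_distrib)
  then obtain N where N: "\<And>l. l \<in> F \<Longrightarrow> B l * (1/r) ^ N / (1 - 1/r) < \<epsilon>"
    by (auto simp: eventually_sequentially)
  show ?thesis
  proof (rule that[OF helmholtz_jet_partial_sum[of N]])
    fix l :: "3 list" and x assume l: "length l \<le> 3" and x: "x \<in> K"
    have "\<bar>Re (ev y v (jet l) 1 x - (\<Sum>n<N. cof y v \<psi> n (jet l) x))\<bar> \<le> cmod (ev y v (jet l) 1 x - (\<Sum>n<N. cof y v \<psi> n (jet l) x))"
      by (rule abs_Re_le_cmod)
    also have "\<dots> < \<epsilon>" using tail[OF x, of l N] N[of l] l by (simp add: F_def)
    finally show "\<bar>Re (\<Sum>n<N. cof y v \<psi> n (jet l) x) - gev (jet l) (x - y)\<bar> < \<epsilon>"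
      by (simp add: ev_1[OF v] abs_minus_commute)
  qed
qed

section \<open>Maxwell fields from solutions of the Helmholtz equation\<close>

lemma helmholtz_jetD:
  assumes "helmholtz_jet u"
  shows "(u l has_derivative (\<lambda>h. \<Sum>i\<in>UNIV. h$i * u (i # l) x)) (at x)"
    "u (i # j # l) x = u (j # i # l) x" "(\<Sum>i\<in>UNIV. u (i # i # l) x) = u l x"
  using assms unfolding helmholtz_jet_def by blast+

lemma helmholtz_jetI:
  assumes "\<And>l x. (u l has_derivative (\<lambda>h. \<Sum>i\<in>UNIV. h$i * u (i # l) x)) (at x)"
    "\<And>i j l x. u (i # j # l) x = u (j # i # l) x" "\<And>l x. (\<Sum>i\<in>UNIV. u (i # i # l) x) = u l x"
  shows "helmholtz_jet u"
  unfolding helmholtz_jet_def by (intro conjI allI assms)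

lemma helmholtz_jet_shift:
  assumes "helmholtz_jet u" shows "helmholtz_jet (\<lambda>l. u (l @ m))"
  by (rule helmholtz_jetI) (simp_all only: append_Cons helmholtz_jetD(1,3)[OF assms], rule helmholtz_jetD(2)[OF assms])

lemma helmholtz_jet_add:
  assumes "helmholtz_jet u" "helmholtz_jet w" shows "helmholtz_jet (\<lambda>l x. u l x + w l x)"
proof (rule helmholtz_jetI)
  fix l x show "((\<lambda>x. u l x + w l x) has_derivative (\<lambda>h. \<Sum>i\<in>UNIV. h$i * (u (i # l) x + w (i # l) x))) (at x)"
    by (rule has_derivative_eq_rhs[OF has_derivative_add[OF helmholtz_jetD(1)[OF assms(1)] helmholtz_jetD(1)[OF assms(2)]]])
      (simp add: sum.distrib distrib_left)
next
  fix i j l x show "u (i # j # l) x + w (i # j # l) x = u (j # i # l) x + w (j # i # l) x"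
    by (intro arg_cong2[where f="(+)"] helmholtz_jetD(2) assms)
next
  fix l x show "(\<Sum>i\<in>UNIV. u (i # i # l) x + w (i # i # l) x) = u l x + w l x"
    by (simp only: sum.distrib helmholtz_jetD(3)[OF assms(1)] helmholtz_jetD(3)[OF assms(2)])
qed

lemma helmholtz_jet_cmult:
  assumes "helmholtz_jet u" shows "helmholtz_jet (\<lambda>l x. c * u l x)"
proof (rule helmholtz_jetI)
  fix l x show "((\<lambda>x. c * u l x) has_derivative (\<lambda>h. \<Sum>i\<in>UNIV. h$i * (c * u (i # l) x))) (at x)"
    by (rule has_derivative_eq_rhs[OF has_derivative_mult_right[OF helmholtz_jetD(1)[OF assms]]])
      (simp add: sum_distrib_left mult_ac)
next
  fix i j l x show "c * u (i # j # l) x = c * u (j # i # l) x"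
    by (intro arg_cong[where f="(*) c"] helmholtz_jetD(2) assms)
next
  fix l x show "(\<Sum>i\<in>UNIV. c * u (i # i # l) x) = c * u l x"
    by (simp only: sum_distrib_left[symmetric] helmholtz_jetD(3)[OF assms])
qed

lemma helmholtz_jet_diff: "helmholtz_jet u \<Longrightarrow> helmholtz_jet w \<Longrightarrow> helmholtz_jet (\<lambda>l x. u l x - w l x)"
  using helmholtz_jet_add[of u "\<lambda>l x. (-1) * w l x"] helmholtz_jet_cmult[of w "-1"] by simp

lemma helmholtz_jet_0: "helmholtz_jet (\<lambda>l x. 0)"
  by (rule helmholtz_jetI) auto

lemma helmholtz_jet_sum: "(\<And>a. a \<in> A \<Longrightarrow> helmholtz_jet (u a)) \<Longrightarrow> helmholtz_jet (\<lambda>l x. \<Sum>a\<in>A. u a l x)"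
proof (induction A rule: infinite_finite_induct)
  case (insert a A)
  then show ?case using helmholtz_jet_add[of "u a" "\<lambda>l x. \<Sum>a\<in>A. u a l x"] by simp
qed (use helmholtz_jet_0 in auto)

text \<open>The direction of the curl is appended at the end of the list, so that directions put in
  front differentiate the curl as a whole.\<close>

definition curlj :: "(3 \<Rightarrow> 3 list \<Rightarrow> real^3 \<Rightarrow> real) \<Rightarrow> 3 \<Rightarrow> 3 list \<Rightarrow> real^3 \<Rightarrow> real" where
  "curlj P k l x = (if k = 1 then P 3 (l @ [2]) x - P 2 (l @ [3]) x
     else if k = 2 then P 1 (l @ [3]) x - P 3 (l @ [1]) x
     else P 2 (l @ [1]) x - P 1 (l @ [2]) x)"

text \<open>The identity curl curl = grad div - laplacian, with the Laplacian replaced by the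
  function itself through the Helmholtz equation.\<close>

definition curlcurlj :: "(3 \<Rightarrow> 3 list \<Rightarrow> real^3 \<Rightarrow> real) \<Rightarrow> 3 \<Rightarrow> 3 list \<Rightarrow> real^3 \<Rightarrow> real" where
  "curlcurlj P k l x = (\<Sum>j\<in>UNIV. P j (l @ [k, j]) x) - P k l x"

lemma helmholtz_jet_curlj:
  assumes "\<And>k. helmholtz_jet (P k)" shows "helmholtz_jet (curlj P k)"
  using assms exhaust_3[of k]
  by (auto simp: curlj_def[abs_def] intro!: helmholtz_jet_diff helmholtz_jet_shift)

lemma helmholtz_jet_curlcurlj:
  assumes "\<And>k. helmholtz_jet (P k)" shows "helmholtz_jet (curlcurlj P k)"
  unfolding curlcurlj_def[abs_def]
  by (intro helmholtz_jet_diff helmholtz_jet_sum helmholtz_jet_shift assms)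

definition fld :: "(3 \<Rightarrow> 3 list \<Rightarrow> real^3 \<Rightarrow> real) \<Rightarrow> real^3 \<Rightarrow> real^3" where
  "fld U x = (\<chi> k. U k [] x)"

definition dfld :: "(3 \<Rightarrow> 3 list \<Rightarrow> real^3 \<Rightarrow> real) \<Rightarrow> real^3 \<Rightarrow> real^3 \<Rightarrow> real^3" where
  "dfld U x h = (\<chi> k. \<Sum>i\<in>UNIV. h $ i * U k [i] x)"

lemma fld_has_derivative:
  assumes "\<And>k. helmholtz_jet (U k)"
  shows "(fld U has_derivative dfld U x) (at x)"
proof -
  have "((\<lambda>x. \<chi> k. U k [] x) has_derivative (\<lambda>h. \<chi> k. \<Sum>i\<in>UNIV. h $ i * U k [i] x)) (at x)"
    using helmholtz_jetD(1)[OF assms]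
    by (subst has_derivative_componentwise_within) (auto simp: Basis_vec_def inner_axis)
  then show ?thesis by (simp add: fld_def[abs_def] dfld_def[abs_def])
qed

lemma helmholtz_jet_continuous:
  "helmholtz_jet u \<Longrightarrow> continuous_on A (u l)"
  by (intro continuous_at_imp_continuous_on ballI has_derivative_continuous[OF helmholtz_jetD(1)])

lemma continuous_on_vec_lambda': "(\<And>i. continuous_on A (\<lambda>x. f x i)) \<Longrightarrow> continuous_on A (\<lambda>x. \<chi> i. f x i)"
  by (rule continuous_on_vec_lambda)

lemma C1_tfield_exp:
  assumes U: "\<And>k. helmholtz_jet (U k)"
  shows "C1_tfield (\<lambda>t x. exp t *\<^sub>R fld U x)"
proof -
  define D where "D p q = exp (fst p) *\<^sub>R dfld U (snd p) (snd q) + (exp (fst p) * fst q) *\<^sub>R fld U (snd p)"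
    for p q :: "real \<times> (real^3)"
  have d: "((\<lambda>q. exp (fst q) *\<^sub>R fld U (snd q)) has_derivative D p) (at p)" for p
  proof -
    have 1: "((\<lambda>q. fld U (snd q)) has_derivative (\<lambda>q. dfld U (snd p) (snd q))) (at p)"
      by (rule has_derivative_compose[OF has_derivative_snd[OF has_derivative_ident] fld_has_derivative[OF U]])
    have 2: "((\<lambda>q. exp (fst q)) has_derivative (\<lambda>q. exp (fst p) * fst q)) (at p)"
      by (auto intro!: derivative_eq_intros simp: mult.commute)
    show ?thesis unfolding D_def by (rule has_derivative_scaleR[OF 2 1])
  qed
  then have bl: "bounded_linear (D p)" for p by (rule has_derivative_bounded_linear)
  have ap: "blinfun_apply (Blinfun (D p)) = D p" for p by (rule bounded_linear_Blinfun_apply[OF bl])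
  have cU: "continuous_on UNIV (\<lambda>p::real \<times> (real^3). U k l (snd p))" for k l
    by (rule continuous_on_compose2[OF helmholtz_jet_continuous[OF U, of UNIV]]) (auto intro!: continuous_intros)
  have "continuous_on UNIV (\<lambda>p. D p q)" for q
    unfolding D_def dfld_def fld_def
    by (intro continuous_intros continuous_on_vec_lambda' cU)
  \<comment> \<open>The domain is finite-dimensional, so continuity into the space of linear maps
    may be checked on one vector at a time.\<close>
  then have "continuous_on UNIV (\<lambda>p. Blinfun (D p))"
    by (intro continuous_on_blinfun_componentwise) (simp add: ap)
  then show ?thesis unfolding C1_tfield_def using d ap by (intro exI[of _ "\<lambda>p. Blinfun (D p)"]) auto
qed

lemma pderiv3_exp:
  assumes U: "\<And>k. helmholtz_jet (U k)"
  shows "pderiv3 (\<lambda>x. c *\<^sub>R fld U x) j x = (\<chi> k. c * U k [j] x)"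
proof -
  have 1: "((\<lambda>s. x + s *\<^sub>R axis j 1) has_derivative (\<lambda>s. s *\<^sub>R axis j 1)) (at 0)"
    by (auto intro!: derivative_eq_intros)
  have "(fld U has_derivative dfld U x) (at (x + 0 *\<^sub>R axis j 1))"
    using fld_has_derivative[of U x, OF U] by simp
  from has_derivative_scaleR_right[OF has_derivative_compose[OF 1 this], of c]
  have "((\<lambda>s. c *\<^sub>R fld U (x + s *\<^sub>R axis j 1)) has_vector_derivative (\<chi> k. c * U k [j] x)) (at 0)"
    unfolding has_vector_derivative_def
    by (rule has_derivative_eq_rhs)
      (auto simp: fun_eq_iff vec_eq_iff dfld_def axis_def if_distrib[of "\<lambda>a. a * _"] if_distrib[of "\<lambda>a. _ * a"] sum.delta cong: if_cong)
  then show ?thesis unfolding pderiv3_def by (rule vector_derivative_at)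
qed

lemma time_deriv_exp: "time_deriv (\<lambda>t x. exp t *\<^sub>R fld U x) t x = exp t *\<^sub>R fld U x"
  unfolding time_deriv_def
  by (intro vector_derivative_at) (auto intro!: derivative_eq_intros)

text \<open>After separating exp t the equations are u = curl b and b = - curl u. Both follow from
  curl curl curl F = - curl F, which holds because the divergence of a curl vanishes and the
  Laplacian acts as the identity.\<close>

theorem maxwell_exp:
  assumes P: "\<And>k. helmholtz_jet (P k)" and Q: "\<And>k. helmholtz_jet (Q k)"
  defines "E \<equiv> \<lambda>k l x. curlj P k l x + curlcurlj Q k l x"
    and "B \<equiv> \<lambda>k l x. curlj Q k l x - curlcurlj P k l x"
  shows "\<And>k. helmholtz_jet (E k)" "\<And>k. helmholtz_jet (B k)"
    "maxwell (\<lambda>t x. exp t *\<^sub>R fld E x) (\<lambda>t x. exp t *\<^sub>R fld B x)"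
proof -
  show E: "\<And>k. helmholtz_jet (E k)" and B: "\<And>k. helmholtz_jet (B k)"
    unfolding E_def B_def
    by (intro helmholtz_jet_add helmholtz_jet_diff helmholtz_jet_curlj helmholtz_jet_curlcurlj P Q)+
  \<comment> \<open>Sorting the directions here, and eliminating a double derivative in direction 3
    in \<open>lp\<close>, gives a normal form in which every claim is a linear identity.\<close>
  have sw: "P k [2,1] x = P k [1,2] x" "P k [3,1] x = P k [1,3] x" "P k [3,2] x = P k [2,3] x"
    "P k (2#1#l) x = P k (1#2#l) x" "P k (3#1#l) x = P k (1#3#l) x" "P k (3#2#l) x = P k (2#3#l) x"
    "Q k [2,1] x = Q k [1,2] x" "Q k [3,1] x = Q k [1,3] x" "Q k [3,2] x = Q k [2,3] x"
    "Q k (2#1#l) x = Q k (1#2#l) x" "Q k (3#1#l) x = Q k (1#3#l) x" "Q k (3#2#l) x = Q k (2#3#l) x" for k x l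
    by (rule helmholtz_jetD(2)[OF P] helmholtz_jetD(2)[OF Q])+
  have lp: "P k (3#3#l) x = P k l x - P k (1#1#l) x - P k (2#2#l) x"
    "Q k (3#3#l) x = Q k l x - Q k (1#1#l) x - Q k (2#2#l) x" for k x l
    using helmholtz_jetD(3)[OF P, of k l x] helmholtz_jetD(3)[OF Q, of k l x] unfolding sum_3 by linarith+
  note defs = E_def B_def curlj_def curlcurlj_def sum_3
  show "maxwell (\<lambda>t x. exp t *\<^sub>R fld E x) (\<lambda>t x. exp t *\<^sub>R fld B x)"
    unfolding maxwell_def
  proof (intro conjI allI C1_tfield_exp E B)
    fix t x
    show "div3 (\<lambda>x. exp t *\<^sub>R fld E x) x = 0" "div3 (\<lambda>x. exp t *\<^sub>R fld B x) x = 0"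
      by (simp_all add: div3_def pderiv3_exp E B flip: distrib_left) (simp_all add: defs sw lp)
    show "time_deriv (\<lambda>t x. exp t *\<^sub>R fld E x) t x = curl3 (\<lambda>x. exp t *\<^sub>R fld B x) x"
      unfolding time_deriv_exp curl3_def pderiv3_exp[OF B] vec_eq_iff forall_3
      by (simp add: fld_def flip: right_diff_distrib) (simp add: defs sw lp)
    show "time_deriv (\<lambda>t x. exp t *\<^sub>R fld B x) t x = - curl3 (\<lambda>x. exp t *\<^sub>R fld E x) x"
      unfolding time_deriv_exp curl3_def pderiv3_exp[OF E] vec_eq_iff forall_3
      by (simp add: fld_def flip: right_diff_distrib mult_minus_right) (simp add: defs sw lp)
  qed
qed

text \<open>Along an integral curve of a constant multiple of the field, the chain rule expresses
  the derivative of a jet coordinate through jet coordinates again. The algebra is therefore closed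
  under differentiation, which gives smoothness of the curve by iteration.\<close>

inductive_set jet_algebra :: "(3 \<Rightarrow> 3 list \<Rightarrow> real^3 \<Rightarrow> real) \<Rightarrow> (real \<Rightarrow> real^3) \<Rightarrow> (real \<Rightarrow> real) set"
  for U c where
  const: "(\<lambda>s. a) \<in> jet_algebra U c"
| gen: "(\<lambda>s. U k l (c s)) \<in> jet_algebra U c"
| add: "f \<in> jet_algebra U c \<Longrightarrow> g \<in> jet_algebra U c \<Longrightarrow> (\<lambda>s. f s + g s) \<in> jet_algebra U c"
| mult: "f \<in> jet_algebra U c \<Longrightarrow> g \<in> jet_algebra U c \<Longrightarrow> (\<lambda>s. f s * g s) \<in> jet_algebra U c"

lemma jet_algebra_deriv:
  assumes U: "\<And>k. helmholtz_jet (U k)"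
    and c: "\<And>s. (c has_vector_derivative K *\<^sub>R fld U (c s)) (at s)"
    and f: "f \<in> jet_algebra U c"
  shows "\<exists>g\<in>jet_algebra U c. \<forall>s. (f has_real_derivative g s) (at s)"
  using f
proof induction
  case (const a)
  show ?case by (intro bexI[of _ "\<lambda>s. 0"] jet_algebra.const) auto
next
  case (gen k l)
  show ?case
  proof (intro bexI allI)
    fix s
    have 1: "(U k l has_derivative (\<lambda>h. \<Sum>i\<in>UNIV. h$i * U k (i # l) (c s))) (at (c s))"
      by (rule helmholtz_jetD(1)[OF U])
    have "((\<lambda>s. U k l (c s)) has_derivative (\<lambda>h. \<Sum>i\<in>UNIV. (h *\<^sub>R (K *\<^sub>R fld U (c s)))$i * U k (i # l) (c s))) (at s)"
      using c[of s] unfolding has_vector_derivative_def by (rule has_derivative_compose[where f=c and g="U k l", OF _ 1])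
    then show "((\<lambda>s. U k l (c s)) has_real_derivative
      (K * (U 1 [] (c s) * U k (1#l) (c s)) + K * (U 2 [] (c s) * U k (2#l) (c s))) + K * (U 3 [] (c s) * U k (3#l) (c s))) (at s)"
      unfolding has_field_derivative_def
      by (rule has_derivative_eq_rhs) (auto simp: sum_3 fld_def algebra_simps)
  qed (intro jet_algebra.intros)
next
  case (add f g)
  then obtain f' g' where "f' \<in> jet_algebra U c" "g' \<in> jet_algebra U c"
    "\<And>s. (f has_real_derivative f' s) (at s)" "\<And>s. (g has_real_derivative g' s) (at s)" by blast
  then show ?case
    by (intro bexI[of _ "\<lambda>s. f' s + g' s"] jet_algebra.intros allI DERIV_add)
next
  case (mult f g)
  then obtain f' g' where *: "f' \<in> jet_algebra U c" "g' \<in> jet_algebra U c"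
    "\<And>s. (f has_real_derivative f' s) (at s)" "\<And>s. (g has_real_derivative g' s) (at s)" by blast
  then have "\<And>s. ((\<lambda>s. f s * g s) has_real_derivative (f' s * g s + g' s * f s)) (at s)"
    by (intro DERIV_mult)
  then show ?case using * mult.hyps
    by (intro bexI[of _ "\<lambda>s. f' s * g s + g' s * f s"] jet_algebra.intros allI) auto
qed

text \<open>The factor K is constant on purpose: the factor between the velocity of a closed orbit
  and the field is only known to be continuous, so orbits are first reparametrized by
  \<open>reparametrize_field_line\<close>.\<close>

lemma field_line_smooth:
  assumes U: "\<And>k. helmholtz_jet (U k)"
    and c: "\<And>s. (c has_vector_derivative K *\<^sub>R fld U (c s)) (at s)"
  shows "smooth_real_fun (\<lambda>s. c s $ i)"
proof -
  have d0: "((\<lambda>s. c s $ i) has_real_derivative K * U i [] (c s)) (at s)" for s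
  proof -
    have "((\<lambda>s. c s $ i) has_derivative (\<lambda>h. (h *\<^sub>R (K *\<^sub>R fld U (c s)))$i)) (at s)"
      using c[of s] unfolding has_vector_derivative_def by (rule bounded_linear.has_derivative[OF bounded_linear_vec_nth])
    then show ?thesis unfolding has_field_derivative_def
      by (rule has_derivative_eq_rhs) (auto simp: fld_def)
  qed
  have 1: "(deriv ^^ k) f \<in> jet_algebra U c" if "f \<in> jet_algebra U c" for k f
  proof (induction k)
    case (Suc k)
    from jet_algebra_deriv[OF U c Suc] obtain g where "g \<in> jet_algebra U c" "\<And>s. ((deriv ^^ k) f has_real_derivative g s) (at s)" by blast
    then have "(deriv ^^ Suc k) f = g" by (auto intro!: ext DERIV_imp_deriv)
    then show ?case using \<open>g \<in> _\<close> by simp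
  qed (use that in simp)
  have diff: "f differentiable (at x)" if "f \<in> jet_algebra U c" for f x
    using jet_algebra_deriv[OF U c that] real_differentiable_def by blast
  have dc: "deriv (\<lambda>s. c s $ i) = (\<lambda>s. K * U i [] (c s))"
    using d0 by (auto intro!: ext DERIV_imp_deriv)
  have "(deriv ^^ k) (\<lambda>s. c s $ i) differentiable (at x)" for k x
  proof (cases k)
    case 0 then show ?thesis using d0 real_differentiable_def by auto
  next
    case (Suc m)
    have "(deriv ^^ m) (\<lambda>s. K * U i [] (c s)) differentiable (at x)"
      by (intro diff 1 jet_algebra.intros)
    then show ?thesis unfolding Suc funpow_Suc_right o_apply dc .
  qed
  then show ?thesis by (simp add: smooth_real_fun_def)
qed

section \<open>Closed curves and perturbations of links\<close>

text \<open>The derivatives are carried as explicit functions. Two of them are enough for the Taylor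
  estimates along the curve.\<close>

definition C2loop :: "(real \<Rightarrow> real^3) \<Rightarrow> (real \<Rightarrow> real^3) \<Rightarrow> (real \<Rightarrow> real^3) \<Rightarrow> bool" where
  "C2loop g g1 g2 \<longleftrightarrow> (\<forall>s. g (s + 1) = g s) \<and> (\<forall>s. (g has_vector_derivative g1 s) (at s)) \<and>
     (\<forall>s. (g1 has_vector_derivative g2 s) (at s)) \<and> continuous_on UNIV g2 \<and>
     inj_on g {0..<1} \<and> (\<forall>s. g1 s \<noteq> 0)"

lemma has_vector_derivative_vec_lambda:
  assumes "\<And>i. ((\<lambda>s. f s $ i) has_real_derivative f' i) (at s)"
  shows "(f has_vector_derivative (\<chi> i. f' i)) (at (s::real))"
  unfolding has_vector_derivative_def
  using assms
  by (subst has_derivative_componentwise_within)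
    (auto simp: Basis_vec_def inner_axis has_field_derivative_def mult_commute_abs)

lemma C2loop_of_closed_curve_param:
  assumes "closed_curve_param g"
  obtains g1 g2 where "C2loop g g1 g2"
proof -
  define d where "d k s = (\<chi> i. (deriv ^^ k) (\<lambda>s. g s $ i) s)" for k s
  have D: "(d k has_vector_derivative d (Suc k) s) (at s)" for k s
  proof -
    have "((\<lambda>s. d k s $ i) has_real_derivative (deriv ^^ Suc k) (\<lambda>s. g s $ i) s) (at s)" for i
      using assms unfolding closed_curve_param_def smooth_real_fun_def d_def
      by (auto simp: DERIV_deriv_iff_real_differentiable)
    from has_vector_derivative_vec_lambda[OF this] show ?thesis by (simp add: d_def[abs_def])
  qed
  have d0: "d 0 = g" by (auto simp: d_def)
  have "d 1 s \<noteq> 0" for s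
    using D[of 0 s] assms unfolding d0 closed_curve_param_def by (auto dest: vector_derivative_at)
  moreover have "continuous_on UNIV (d 2)"
    using D[of 2] by (auto intro!: continuous_at_imp_continuous_on has_vector_derivative_continuous)
  ultimately have "C2loop g (d 1) (d 2)"
    using D[of 0] D[of 1] assms unfolding C2loop_def closed_curve_param_def d0
    by (auto simp: numeral_2_eq_2)
  then show ?thesis by (rule that)
qed

lemma periodic_int:
  assumes "\<And>s. g (s + 1) = g (s::real)"
  shows "g (s + of_int k) = g s"
proof -
  have *: "g (s + of_nat n) = g s" for n s
  proof (induction n)
    case (Suc n) then show ?case using assms[of "s + of_nat n"] by (simp add: add_ac)
  qed simp
  show ?thesis
  proof (cases "k \<ge> 0")
    case True then show ?thesis using *[of s "nat k"] by simp
  next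
    case False then show ?thesis using *[of "s + of_int k" "nat (-k)"] by simp
  qed
qed

lemma periodic_deriv:
  assumes "\<And>s. g (s + 1) = g (s::real)" and "\<And>s. (g has_vector_derivative g' s) (at s)"
  shows "g' (s + 1) = (g' s :: 'a::real_normed_vector)"
proof -
  have "((\<lambda>s. g (s + 1)) has_vector_derivative g' (s + 1)) (at s)"
    using assms(2)[of "s+1"]
    by (intro vector_diff_chain_at[of "\<lambda>s. s + 1" 1 s g "g' (s+1)", unfolded o_def, simplified])
      (auto intro!: derivative_eq_intros simp: has_vector_derivative_def)
  then have "(g has_vector_derivative g' (s + 1)) (at s)" by (simp only: assms(1))
  then show ?thesis by (rule vector_derivative_unique_at[OF _ assms(2)])
qed

lemma C2loopD:
  assumes "C2loop g g1 g2"
  shows "g (s + 1) = g s" "g1 (s + 1) = g1 s" "g2 (s + 1) = g2 s"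
    "(g has_vector_derivative g1 s) (at s)" "(g1 has_vector_derivative g2 s) (at s)"
    "g1 s \<noteq> 0" "continuous_on A g" "continuous_on A g1" "continuous_on A g2"
proof -
  have p: "\<And>s. g (s + 1) = g s" and d: "\<And>s. (g has_vector_derivative g1 s) (at s)" "\<And>s. (g1 has_vector_derivative g2 s) (at s)"
    and c: "continuous_on UNIV g2" and nz: "\<And>s. g1 s \<noteq> 0"
    using assms unfolding C2loop_def by blast+
  show "g (s + 1) = g s" "(g has_vector_derivative g1 s) (at s)" "(g1 has_vector_derivative g2 s) (at s)" "g1 s \<noteq> 0"
    by (fact p d nz)+
  show p1: "g1 (s + 1) = g1 s" for s by (rule periodic_deriv[OF p d(1)])
  show "g2 (s + 1) = g2 s" by (rule periodic_deriv[OF p1 d(2)])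
  show "continuous_on A g2" using c by (rule continuous_on_subset) simp
  show "continuous_on A g" "continuous_on A g1"
    using d by (auto intro!: continuous_at_imp_continuous_on has_vector_derivative_continuous)
qed

lemma C2loop_inj:
  assumes "C2loop g g1 g2" and "g s = g t"
  obtains k :: int where "s = t + of_int k"
proof -
  have p: "g (s + of_int k) = g s" for s k by (rule periodic_int[where g=g, OF C2loopD(1)[OF assms(1)]])
  have f: "g (frac s) = g s" for s using p[of s "- \<lfloor>s\<rfloor>"] by (simp add: frac_def)
  have "inj_on g {0..<1}" using assms(1) by (simp add: C2loop_def)
  moreover have "g (frac s) = g (frac t)" using f assms(2) by simp
  moreover have "frac s \<in> {0..<1}" "frac t \<in> {0..<1}" by (auto simp: frac_lt_1)
  ultimately have "frac s = frac t" by (auto simp: inj_on_def)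
  then show ?thesis by (intro that[of "\<lfloor>s\<rfloor> - \<lfloor>t\<rfloor>"]) (simp add: frac_def)
qed

lemma periodic_bounded:
  fixes f :: "real \<Rightarrow> 'a::real_normed_vector"
  assumes "\<And>s. f (s + 1) = f s" "continuous_on UNIV f"
  obtains M where "M > 0" "\<And>s. norm (f s) \<le> M"
proof -
  have "compact (f ` {0..1})"
    using assms(2) by (intro compact_continuous_image) (auto intro: continuous_on_subset)
  then obtain M where M: "M > 0" "\<And>s. s \<in> {0..1} \<Longrightarrow> norm (f s) \<le> M"
    by (metis bounded_pos compact_imp_bounded imageI)
  show ?thesis
  proof (rule that[OF M(1)])
    fix s
    have "f (frac s) = f s" using periodic_int[of f s "- \<lfloor>s\<rfloor>", OF assms(1)] by (simp add: frac_def)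
    moreover have "frac s \<in> {0..1}" using frac_lt_1[of s] by (simp add: less_imp_le)
    ultimately show "norm (f s) \<le> M" using M(2) by metis
  qed
qed

lemma periodic_bounded_below:
  fixes f :: "real \<Rightarrow> 'a::real_normed_vector"
  assumes p: "\<And>s. f (s + 1) = f s" and c: "continuous_on UNIV f" and nz: "\<And>s. f s \<noteq> 0"
  obtains m where "m > 0" "\<And>s. norm (f s) \<ge> m"
proof -
  have "continuous_on UNIV (\<lambda>s. 1 / norm (f s))" using c nz by (intro continuous_intros) auto
  from periodic_bounded[OF _ this] p obtain M where M: "M > 0" "\<And>s. norm (1 / norm (f s)) \<le> M" by auto
  show ?thesis
    by (rule that[of "1 / M"]) (use M nz in \<open>auto simp: field_simps\<close>)
qed

lemma deriv_bound_diff: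
  fixes f :: "real \<Rightarrow> 'a::real_normed_vector"
  assumes "\<And>s. (f has_vector_derivative f' s) (at s)" "\<And>s. norm (f' s) \<le> M"
  shows "norm (f s - f t) \<le> M * \<bar>s - t\<bar>"
proof -
  have "norm (f s - f t) \<le> M * norm (s - t)"
  proof (rule differentiable_bound[of UNIV f "\<lambda>s h. h *\<^sub>R f' s"])
    fix x show "(f has_derivative (\<lambda>h. h *\<^sub>R f' x)) (at x within UNIV)" using assms(1)[of x] by (simp add: has_vector_derivative_def)
    have "norm (h *\<^sub>R f' x) \<le> M * norm h" for h
      using mult_left_mono[OF assms(2)[of x], of "\<bar>h\<bar>"] by (simp add: mult.commute)
    then show "onorm (\<lambda>h. h *\<^sub>R f' x) \<le> M" by (rule onorm_le)
  qed auto
  then show ?thesis by simp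
qed

text \<open>For close parameters the speed dominates the second-order error; for the others
  compactness and injectivity give a positive distance. The bound 1/2 picks the shorter way round
  the loop, where the difference of parameters measures the distance on it.\<close>

lemma C2loop_bilipschitz:
  assumes g: "C2loop g g1 g2"
  obtains m where "m > 0" "\<And>s t. \<bar>s - t\<bar> \<le> 1/2 \<Longrightarrow> norm (g s - g t) \<ge> m * \<bar>s - t\<bar>"
proof -
  note G = C2loopD[OF g]
  obtain \<mu> where mu: "\<mu> > 0" "\<And>s. norm (g1 s) \<ge> \<mu>"
    using periodic_bounded_below[OF G(2) G(8) G(6)] by metis
  obtain M where M: "M > 0" "\<And>s. norm (g2 s) \<le> M"
    using periodic_bounded[OF G(3) G(9)] by metis
  define \<delta> where "\<delta> = min (1/2) (\<mu> / (2 * M))"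
  have \<delta>: "\<delta> > 0" "M * \<delta> \<le> \<mu> / 2" using mu M by (auto simp: \<delta>_def min_def field_simps)
  have near: "norm (g s - g t) \<ge> \<mu> / 2 * \<bar>s - t\<bar>" if "\<bar>s - t\<bar> \<le> \<delta>" for s t
  proof -
    have "norm (g s - g t - (s - t) *\<^sub>R g1 t) \<le> norm (s - t) * (M * \<delta>)"
    proof (rule differentiable_bound_linearization[of t s "cball t \<delta>" g "\<lambda>s h. h *\<^sub>R g1 s" t])
      fix x assume x: "x \<in> cball t \<delta>"
      show "(g has_derivative (\<lambda>h. h *\<^sub>R g1 x)) (at x within cball t \<delta>)"
        using G(4)[of x] by (simp add: has_vector_derivative_def has_derivative_at_withinI)
      have "norm (g1 x - g1 t) \<le> M * \<bar>x - t\<bar>" by (rule deriv_bound_diff[OF G(5) M(2)])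
      also have "\<dots> \<le> M * \<delta>" using M x by (intro mult_left_mono) (auto simp: dist_real_def)
      finally have *: "norm (g1 x - g1 t) \<le> M * \<delta>" .
      have "norm (h *\<^sub>R g1 x - h *\<^sub>R g1 t) \<le> M * \<delta> * norm h" for h
        using mult_left_mono[OF *, of "\<bar>h\<bar>"] by (simp add: mult_ac flip: scaleR_diff_right)
      then show "onorm ((\<lambda>h. h *\<^sub>R g1 x) - (\<lambda>h. h *\<^sub>R g1 t)) \<le> M * \<delta>"
        by (intro onorm_le) simp
    next
      fix u :: real assume u: "u \<in> {0..1}"
      have "\<bar>u\<bar> * \<bar>s - t\<bar> \<le> 1 * \<bar>s - t\<bar>" using u by (intro mult_right_mono) auto
      then show "t + u *\<^sub>R (s - t) \<in> cball t \<delta>"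
        using that by (simp add: dist_real_def abs_mult)
    qed (use \<delta> in auto)
    then have "norm ((s - t) *\<^sub>R g1 t) - norm (g s - g t) \<le> \<bar>s - t\<bar> * (\<mu> / 2)"
      using norm_triangle_ineq2[of "(s - t) *\<^sub>R g1 t" "g s - g t"] mult_left_mono[OF \<delta>(2), of "\<bar>s - t\<bar>"]
      by (simp add: norm_minus_commute)
    moreover have "norm ((s - t) *\<^sub>R g1 t) \<ge> \<bar>s - t\<bar> * \<mu>" using mu(2)[of t] by (simp add: mult_left_mono)
    ultimately show ?thesis by (simp add: algebra_simps)
  qed
  \<comment> \<open>Shifting both parameters by the same integer brings s into [0, 1], and then t
    into [-1, 2].\<close>
  define C where "C = {p \<in> {0..1} \<times> {-1..2}. \<delta> \<le> \<bar>fst p - snd p\<bar> \<and> \<bar>fst p - snd p\<bar> \<le> (1/2::real)}"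
  have "compact C"
  proof -
    have "C = ({0..1} \<times> {-1..2}) \<inter> ({p. \<delta> \<le> \<bar>fst p - snd p\<bar>} \<inter> {p. \<bar>fst p - snd p\<bar> \<le> (1/2::real)})"
      unfolding C_def by blast
    then show ?thesis
      by (auto intro!: compact_Int_closed closed_Int closed_Collect_le continuous_intros compact_Times)
  qed
  moreover have nz: "g (fst p) - g (snd p) \<noteq> 0" if "p \<in> C" for p
  proof
    assume "g (fst p) - g (snd p) = 0"
    then have "g (fst p) = g (snd p)" by simp
    from C2loop_inj[OF g this] obtain k :: int where "fst p = snd p + of_int k" by metis
    then have k: "fst p - snd p = of_int k" by simp
    then have "\<bar>of_int k\<bar> \<le> (1/2::real)" "\<bar>of_int k\<bar> \<ge> \<delta>" using that by (auto simp: C_def)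
    then have "k = 0" by linarith
    then show False using \<open>\<bar>of_int k\<bar> \<ge> \<delta>\<close> \<delta>(1) by simp
  qed
  moreover have "continuous_on C (\<lambda>p. norm (g (fst p) - g (snd p)))"
    by (intro continuous_intros continuous_on_compose2[OF G(7)[of UNIV]]) auto
  ultimately obtain m0 where m0: "m0 > 0" "\<And>p. p \<in> C \<Longrightarrow> norm (g (fst p) - g (snd p)) \<ge> m0"
  proof (cases "C = {}")
    case True then show ?thesis using that[of 1] by auto
  next
    case False
    from continuous_attains_inf[OF \<open>compact C\<close> this \<open>continuous_on C _\<close>] obtain p where
      "p \<in> C" "\<And>q. q \<in> C \<Longrightarrow> norm (g (fst p) - g (snd p)) \<le> norm (g (fst q) - g (snd q))" by blast
    then show ?thesis using nz that[of "norm (g (fst p) - g (snd p))"] by auto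
  qed
  show ?thesis
  proof (rule that[of "min (\<mu>/2) m0"])
    show "min (\<mu>/2) m0 > 0" using mu m0 by simp
    fix s t :: real assume st: "\<bar>s - t\<bar> \<le> 1/2"
    show "norm (g s - g t) \<ge> min (\<mu>/2) m0 * \<bar>s - t\<bar>"
    proof (cases "\<bar>s - t\<bar> \<le> \<delta>")
      case True
      have "min (\<mu>/2) m0 * \<bar>s - t\<bar> \<le> \<mu>/2 * \<bar>s - t\<bar>" by (intro mult_right_mono) auto
      then show ?thesis using near[OF True] by linarith
    next
      case False
      define z :: real where "z = of_int \<lfloor>s\<rfloor>"
      have z: "z \<le> s" "s < z + 1" unfolding z_def by linarith+
      define p where "p = (s - z, t - z)"
      have ps: "fst p - snd p = s - t" by (simp add: p_def)
      have "p \<in> C" using st False z by (auto simp: C_def p_def abs_if split: if_splits)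
      moreover have "g (fst p) = g s" "g (snd p) = g t"
        using periodic_int[where g=g, OF G(1), of s "- \<lfloor>s\<rfloor>"] periodic_int[where g=g, OF G(1), of t "- \<lfloor>s\<rfloor>"] by (auto simp: p_def z_def)
      ultimately have "norm (g s - g t) \<ge> m0" using m0(2) by metis
      moreover have "min (\<mu>/2) m0 * \<bar>s - t\<bar> \<le> m0 * 1" using st m0(1) by (intro mult_mono) auto
      ultimately show ?thesis by linarith
    qed
  qed
qed

section \<open>Lipschitz extension and straight-line isotopies\<close>

lemma lipschitz_extension_real:
  fixes f :: "'a::metric_space \<Rightarrow> real"
  assumes "A \<noteq> {}" and f: "\<And>a b. a \<in> A \<Longrightarrow> b \<in> A \<Longrightarrow> \<bar>f a - f b\<bar> \<le> k * dist a b" and k: "k \<ge> 0"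
  obtains F where "\<And>a. a \<in> A \<Longrightarrow> F a = f a" "\<And>x y. \<bar>F x - F y\<bar> \<le> k * dist x y"
proof -
  \<comment> \<open>The McShane extension.\<close>
  define F where "F x = (INF a\<in>A. f a + k * dist x a)" for x
  obtain a0 where a0: "a0 \<in> A" using assms(1) by blast
  have bb: "bdd_below ((\<lambda>a. f a + k * dist x a) ` A)" for x
  proof (rule bdd_belowI2[of _ "f a0 - k * dist x a0"])
    fix a assume a: "a \<in> A"
    have "f a0 - f a \<le> k * dist a0 a" using f[OF a0 a] by linarith
    also have "\<dots> \<le> k * (dist x a0 + dist x a)" using k by (intro mult_left_mono dist_triangle3) auto
    finally show "f a0 - k * dist x a0 \<le> f a + k * dist x a" by (simp add: algebra_simps)
  qed
  have le: "F x \<le> F y + k * dist x y" for x y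
  proof -
    have "F x - k * dist x y \<le> F y"
      unfolding F_def[of y]
    proof (rule cINF_greatest[OF assms(1)])
      fix a assume a: "a \<in> A"
      have "F x \<le> f a + k * dist x a" unfolding F_def by (rule cINF_lower[OF bb a])
      also have "\<dots> \<le> f a + k * (dist x y + dist y a)" using k by (intro add_left_mono mult_left_mono dist_triangle) auto
      finally show "F x - k * dist x y \<le> f a + k * dist y a" by (simp add: algebra_simps)
    qed
    then show ?thesis by simp
  qed
  show ?thesis
  proof (rule that[of F])
    fix a assume a: "a \<in> A"
    have "F a \<le> f a + k * dist a a" unfolding F_def by (rule cINF_lower[OF bb a])
    moreover have "f a \<le> F a" unfolding F_def
    proof (rule cINF_greatest[OF assms(1)])
      fix b assume "b \<in> A" then show "f a \<le> f b + k * dist a b" using f[OF a, of b] by linarith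
    qed
    ultimately show "F a = f a" by simp
  next
    fix x y show "\<bar>F x - F y\<bar> \<le> k * dist x y" using le[of x y] le[of y x] by (simp add: dist_commute abs_le_iff)
  qed
qed

text \<open>Extending coordinate by coordinate costs the factor 3. This is why the displacement of
  the link is later kept 1/6-Lipschitz: its extension is then a contraction with constant
  1/2.\<close>

lemma lipschitz_extension_vec:
  fixes f :: "real^3 \<Rightarrow> real^3"
  assumes f: "\<And>a b. a \<in> A \<Longrightarrow> b \<in> A \<Longrightarrow> norm (f a - f b) \<le> k * norm (a - b)" and k: "k \<ge> 0"
  obtains F where "\<And>a. a \<in> A \<Longrightarrow> F a = f a" "\<And>x y. norm (F x - F y) \<le> 3 * k * norm (x - y)"
proof (cases "A = {}")
  case True then show ?thesis using that[of "\<lambda>x. 0"] k by simp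
next
  case False
  have "\<exists>F. (\<forall>a\<in>A. F a = f a $ i) \<and> (\<forall>x y. \<bar>F x - F y\<bar> \<le> k * dist x y)" for i
  proof -
    have "\<bar>f a $ i - f b $ i\<bar> \<le> k * dist a b" if "a \<in> A" "b \<in> A" for a b
      using f[OF that] component_le_norm_cart[of "f a - f b" i] by (simp add: dist_norm)
    from lipschitz_extension_real[OF False this k] show ?thesis by metis
  qed
  then obtain F where F: "\<And>i a. a \<in> A \<Longrightarrow> F i a = f a $ i" "\<And>i x y. \<bar>F i x - F i y\<bar> \<le> k * dist x y" by metis
  show ?thesis
  proof (rule that[of "\<lambda>x. \<chi> i. F i x"])
    fix x y
    have "norm ((\<chi> i. F i x) - (\<chi> i. F i y)) \<le> (\<Sum>i\<in>UNIV. \<bar>F i x - F i y\<bar>)"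
      using norm_le_l1_cart[of "(\<chi> i. F i x) - (\<chi> i. F i y)"] by simp
    also have "\<dots> \<le> (\<Sum>i\<in>(UNIV::3 set). k * dist x y)" by (intro sum_mono F)
    finally show "norm ((\<chi> i. F i x) - (\<chi> i. F i y)) \<le> 3 * k * norm (x - y)" by (simp add: dist_norm)
  qed (simp add: F vec_eq_iff)
qed

text \<open>Solving x + V x = y means finding the fixed point of x \<mapsto> y - V x, a contraction.
  The inverse is Lipschitz with constant 1 / (1 - k).\<close>

lemma homeomorphism_id_plus_contraction:
  fixes V :: "'a::banach \<Rightarrow> 'a"
  assumes V: "\<And>x y. norm (V x - V y) \<le> k * norm (x - y)" and k: "0 \<le> k" "k < 1"
  obtains g where "homeomorphism UNIV UNIV (\<lambda>x. x + V x) g"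
proof -
  have low: "(1 - k) * norm (x - y) \<le> norm ((x + V x) - (y + V y))" for x y
    using V[of x y] norm_triangle_ineq2[of "x - y" "V y - V x"] by (simp add: algebra_simps norm_minus_commute)
  have inj: "x = y" if "x + V x = y + V y" for x y
    using low[of x y] that k by (simp add: mult_le_0_iff)
  have ex: "\<exists>x. x + V x = y" for y
  proof -
    have "\<exists>!x. y - V x = x"
      using k V by (intro banach_fix_type[of k]) (auto simp: dist_norm norm_minus_commute)
    then show ?thesis by (metis diff_add_cancel)
  qed
  define g where "g y = (SOME x. x + V x = y)" for y
  have g: "g y + V (g y) = y" for y unfolding g_def using someI_ex[OF ex[of y]] .
  have g': "g (x + V x) = x" for x using inj g by blast
  have contV: "continuous_on UNIV (\<lambda>x. x + V x)"
  proof -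
    have "k-lipschitz_on UNIV V" using V k by (intro lipschitz_onI) (auto simp: dist_norm)
    then show ?thesis by (intro continuous_intros lipschitz_on_continuous_on)
  qed
  moreover have "(1/(1-k))-lipschitz_on UNIV g"
  proof (rule lipschitz_onI)
    fix x y
    show "dist (g x) (g y) \<le> 1/(1-k) * dist x y"
      using low[of "g x" "g y"] k by (simp add: g dist_norm field_simps)
  qed (use k in auto)
  ultimately have "homeomorphism UNIV UNIV (\<lambda>x. x + V x) g"
    using g g' by (intro homeomorphismI) (auto intro: lipschitz_on_continuous_on)
  then show ?thesis by (rule that)
qed

text \<open>For t in [0, 1] the field t V is again a contraction, so every stage of the
  straight-line motion x + t V x is a homeomorphism.\<close>

lemma ambient_isotopic_displacement:
  fixes V :: "real^3 \<Rightarrow> real^3"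
  assumes V: "\<And>x y. norm (V x - V y) \<le> k * norm (x - y)" and k: "0 \<le> k" "k < 1"
    and c: "\<And>i s. i < n \<Longrightarrow> c i s = L i s + V (L i s)"
  shows "ambient_isotopic n L c"
  unfolding ambient_isotopic_def
proof (intro exI[of _ "\<lambda>t x. x + t *\<^sub>R V x"] conjI ballI allI impI)
  have "k-lipschitz_on UNIV V" using V k by (intro lipschitz_onI) (auto simp: dist_norm)
  then have "continuous_on UNIV V" by (rule lipschitz_on_continuous_on)
  then have "continuous_on ({0..1::real} \<times> UNIV) (\<lambda>p. V (snd p))"
    by (rule continuous_on_compose2) (auto intro!: continuous_intros)
  then show "continuous_on ({0..1} \<times> UNIV) (\<lambda>p. snd p + fst p *\<^sub>R V (snd p))"
    by (intro continuous_intros)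
  fix t :: real assume t: "t \<in> {0..1}"
  have "norm (t *\<^sub>R V x - t *\<^sub>R V y) \<le> k * norm (x - y)" for x y
  proof -
    have "norm (t *\<^sub>R V x - t *\<^sub>R V y) = t * norm (V x - V y)" using t by (simp flip: scaleR_diff_right)
    also have "\<dots> \<le> 1 * norm (V x - V y)" using t by (intro mult_right_mono) auto
    finally show ?thesis using V[of x y] by simp
  qed
  from homeomorphism_id_plus_contraction[OF this k]
  show "\<exists>g. homeomorphism UNIV UNIV (\<lambda>x. x + t *\<^sub>R V x) g" by metis
qed (auto simp: curve_set_def c)

text \<open>The displacement c - L has a small Lipschitz constant with respect to distance in space,
  not merely in the parameter: along one component by the bi-Lipschitz bound together with closeness
  of derivatives, across components because these are a distance D apart. It extends to a
  contraction V of the whole space, and x + V x carries L to c injectively.\<close>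

lemma link_perturbation:
  assumes L: "\<And>i. i < n \<Longrightarrow> C2loop (L i) (L1 i) (L2 i)"
    and disj: "\<And>i j. i < n \<Longrightarrow> j < n \<Longrightarrow> i \<noteq> j \<Longrightarrow> curve_set (L i) \<inter> curve_set (L j) = {}"
  obtains \<kappa> where "\<kappa> > 0"
    "\<And>c c1. (\<And>i s. i < n \<Longrightarrow> c i (s + 1) = c i s \<and> (c i has_vector_derivative c1 i s) (at s) \<and>
        norm (c i s - L i s) \<le> \<kappa> \<and> norm (c1 i s - L1 i s) \<le> \<kappa>) \<Longrightarrow>
      (\<forall>i<n. inj_on (c i) {0..<1}) \<and>
      (\<forall>i<n. \<forall>j<n. i \<noteq> j \<longrightarrow> curve_set (c i) \<inter> curve_set (c j) = {}) \<and> ambient_isotopic n L c"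
proof -
  have "\<exists>m>0. \<forall>s t. \<bar>s - t\<bar> \<le> 1/2 \<longrightarrow> norm (L i s - L i t) \<ge> m * \<bar>s - t\<bar>" if "i < n" for i
    using C2loop_bilipschitz[OF L[OF that]] by metis
  then obtain m' where m': "\<And>i. i < n \<Longrightarrow> m' i > 0" "\<And>i s t. i < n \<Longrightarrow> \<bar>s - t\<bar> \<le> 1/2 \<Longrightarrow> norm (L i s - L i t) \<ge> m' i * \<bar>s - t\<bar>"
    by metis
  define m where "m = Min (insert 1 (m' ` {..<n}))"
  have m: "m > 0" "\<And>i. i < n \<Longrightarrow> m \<le> m' i" using m' by (auto simp: m_def)
  have mb: "norm (L i s - L i t) \<ge> m * \<bar>s - t\<bar>" if "i < n" "\<bar>s - t\<bar> \<le> 1/2" for i s t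
    using m'(2)[OF that] mult_right_mono[OF m(2)[OF that(1)], of "\<bar>s - t\<bar>"] by linarith
  have per: "L i (s + of_int k) = L i s" if "i < n" for i s k
    by (rule periodic_int[where g="L i", OF C2loopD(1)[OF L[OF that]]])
  have mem: "L i s \<in> curve_set (L i)" if "i < n" for i s
  proof -
    have "L i (frac s) = L i s" using per[OF that, of s "- \<lfloor>s\<rfloor>"] by (simp add: frac_def)
    moreover have "frac s \<in> {0..1}" using frac_lt_1[of s] by (simp add: less_imp_le)
    ultimately show ?thesis unfolding curve_set_def by (metis imageI)
  qed
  have cmp: "compact (curve_set (L i))" if "i < n" for i
    unfolding curve_set_def using C2loopD(7)[OF L[OF that]] by (intro compact_continuous_image) auto
  have "\<exists>d>0. \<forall>x\<in>curve_set (L i). \<forall>y\<in>curve_set (L j). d \<le> dist x y" if "i < n" "j < n" "i \<noteq> j" for i j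
    using separate_compact_closed[OF cmp[OF that(1)] compact_imp_closed[OF cmp[OF that(2)]] disj[OF that]] .
  then obtain D' where D': "\<And>i j. i < n \<Longrightarrow> j < n \<Longrightarrow> i \<noteq> j \<Longrightarrow> D' i j > 0"
    "\<And>i j x y. i < n \<Longrightarrow> j < n \<Longrightarrow> i \<noteq> j \<Longrightarrow> x \<in> curve_set (L i) \<Longrightarrow> y \<in> curve_set (L j) \<Longrightarrow> D' i j \<le> dist x y" by metis
  define D where "D = Min (insert 1 ((\<lambda>(i,j). D' i j) ` {p\<in>{..<n}\<times>{..<n}. fst p \<noteq> snd p}))"
  have fin: "finite (insert 1 ((\<lambda>(i,j). D' i j) ` {p\<in>{..<n}\<times>{..<n}. fst p \<noteq> snd p}))" by auto
  have D: "D > 0" unfolding D_def using fin D'(1) by (subst Min_gr_iff) auto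
  have Dle: "D \<le> D' i j" if "i < n" "j < n" "i \<noteq> j" for i j
    unfolding D_def by (rule Min_le[OF fin]) (use that in force)
  have Db: "D \<le> norm (L i s - L j t)" if "i < n" "j < n" "i \<noteq> j" for i j s t
    using D'(2)[OF that mem[OF that(1)] mem[OF that(2)]] Dle[OF that] by (simp add: dist_norm) (meson order_trans)
  \<comment> \<open>The Lipschitz constant is at most 2 \<kappa> / D across components and \<kappa>
    / m along one of them; both become at most 1/6.\<close>
  define \<kappa> where "\<kappa> = min (D / 12) (m / 6)"
  have kap: "\<kappa> > 0" "\<kappa> \<le> D / 12" "\<kappa> \<le> m / 6" using D m by (auto simp: \<kappa>_def)
  show ?thesis
  proof (rule that[OF kap(1)])
    fix c c1 assume c: "\<And>i s. i < n \<Longrightarrow> c i (s + 1) = c i s \<and> (c i has_vector_derivative c1 i s) (at s) \<and>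
        norm (c i s - L i s) \<le> \<kappa> \<and> norm (c1 i s - L1 i s) \<le> \<kappa>"
    define w where "w i s = c i s - L i s" for i s
    have wp: "w i (s + of_int k) = w i s" if "i < n" for i s k
      using periodic_int[of "c i" s k] c[OF that] per[OF that] by (simp add: w_def)
    have wl: "norm (w i s - w i t) \<le> \<kappa> * \<bar>s - t\<bar>" if "i < n" for i s t
      by (rule deriv_bound_diff[where f' = "\<lambda>s. c1 i s - L1 i s"])
        (use c[OF that] C2loopD(4)[OF L[OF that]] in \<open>auto simp: w_def[abs_def] intro!: derivative_intros\<close>)
    have lip: "norm (w i s - w j t) \<le> (1/6) * norm (L i s - L j t)" if ij: "i < n" "j < n" for i j s t
    proof (cases "i = j")
      case False
      have "norm (w i s - w j t) \<le> \<kappa> + \<kappa>"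
        using norm_triangle_ineq4[of "w i s" "w j t"] c[OF ij(1), of s] c[OF ij(2), of t] by (simp add: w_def)
      also have "\<dots> \<le> D / 6" using kap by simp
      finally show ?thesis using Db[OF ij False, of s t] by simp
    next
      case True
      \<comment> \<open>The representative of t modulo 1 nearest to s, so that the bi-Lipschitz
        bound applies.\<close>
      define t' where "t' = t + of_int (round (s - t))"
      have t': "\<bar>s - t'\<bar> \<le> 1/2" using of_int_round_abs_le[of "s - t"] by (simp add: t'_def abs_minus_commute algebra_simps)
      have "norm (w i s - w i t') \<le> \<kappa> * \<bar>s - t'\<bar>" by (rule wl[OF ij(1)])
      also have "\<dots> \<le> m / 6 * \<bar>s - t'\<bar>" using kap by (intro mult_right_mono) auto
      also have "\<dots> \<le> (1/6) * norm (L i s - L i t')" using mb[OF ij(1) t'] by simp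
      finally show ?thesis unfolding True[symmetric] t'_def wp[OF ij(1)] per[OF ij(1)] .
    qed
    define A where "A = (\<Union>i<n. range (L i))"
    \<comment> \<open>The choice is harmless: by \<open>lip\<close>, parameters giving the same
      point of the link have the same displacement.\<close>
    define f where "f x = (SOME v. \<exists>i s. i < n \<and> x = L i s \<and> v = w i s)" for x
    have f: "f (L i s) = w i s" if "i < n" for i s
    proof -
      have "\<exists>j t. j < n \<and> L i s = L j t \<and> f (L i s) = w j t"
        unfolding f_def by (rule someI_ex[of "\<lambda>v. \<exists>j t. j < n \<and> L i s = L j t \<and> v = w j t"]) (use that in auto)
      then obtain j t where "j < n" "L i s = L j t" "f (L i s) = w j t" by blast
      then show ?thesis using lip[OF that, of j s t] by simp
    qed
    have "norm (f a - f b) \<le> (1/6) * norm (a - b)" if "a \<in> A" "b \<in> A" for a b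
      using that lip f by (auto simp: A_def)
    from lipschitz_extension_vec[OF this] obtain V where V: "\<And>a. a \<in> A \<Longrightarrow> V a = f a"
      "\<And>x y. norm (V x - V y) \<le> (1/2) * norm (x - y)" by (auto simp: mult.assoc) 
    have VL: "c i s = L i s + V (L i s)" if "i < n" for i s
    proof -
      have "L i s \<in> A" using that by (auto simp: A_def)
      from V(1)[OF this] show ?thesis using f[OF that, of s] by (simp add: w_def)
    qed
    have amb: "ambient_isotopic n L c"
      by (rule ambient_isotopic_displacement[OF V(2) _ _ VL]) auto
    have injH: "x = y" if "x + V x = y + V y" for x y
    proof -
      have "x - y = V y - V x" using that by (simp add: algebra_simps)
      then have "norm (x - y) \<le> (1/2) * norm (x - y)" using V(2)[of y x] by (simp add: norm_minus_commute)
      then show ?thesis by simp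
    qed
    have "inj_on (c i) {0..<1}" if "i < n" for i
    proof -
      have "inj_on (L i) {0..<1}" using L[OF that] by (simp add: C2loop_def)
      then show ?thesis using injH VL[OF that] unfolding inj_on_def by metis
    qed
    moreover have "curve_set (c i) \<inter> curve_set (c j) = {}" if "i < n" "j < n" "i \<noteq> j" for i j
    proof -
      have "c i s \<noteq> c j t" for s t
      proof
        assume "c i s = c j t"
        then have "L i s = L j t" using injH VL that by metis
        then show False using Db[OF that, of s t] D by simp
      qed
      then show ?thesis by (auto simp: curve_set_def)
    qed
    ultimately show "(\<forall>i<n. inj_on (c i) {0..<1}) \<and>
      (\<forall>i<n. \<forall>j<n. i \<noteq> j \<longrightarrow> curve_set (c i) \<inter> curve_set (c j) = {}) \<and> ambient_isotopic n L c" using amb by blast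
  qed
qed

section \<open>Closed orbits near a saddle\<close>

text \<open>At a maximum of the periodic solution the derivative vanishes, so \<sigma> y + h = 0
  there. The bound is independent of r, however stiff the equation becomes.\<close>

lemma periodic_ode_bound_upper:
  fixes y :: "real \<Rightarrow> real"
  assumes p: "\<And>s. y (s + 1) = y s" and d: "\<And>s. (y has_real_derivative (\<sigma> * y s + h s) / r) (at s)"
    and r: "r > 0" and \<sigma>: "\<sigma> = 1 \<or> \<sigma> = -1" and h: "\<And>s. \<bar>h s\<bar> \<le> M"
  shows "y s \<le> M"
proof -
  have c: "continuous_on UNIV y"
    using d by (auto intro!: continuous_at_imp_continuous_on DERIV_isCont)
  obtain s0 where s0: "\<And>s. s \<in> {0..1} \<Longrightarrow> y s \<le> y s0"
    using continuous_attains_sup[of "{0..1::real}" y] continuous_on_subset[OF c] by (metis atLeastAtMost_iff compact_Icc empty_iff subset_UNIV zero_le_one order_refl)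
  have le: "y s \<le> y s0" for s
  proof -
    have "y (frac s) = y s" using periodic_int[where g=y and k="- \<lfloor>s\<rfloor>" and s=s, OF p] by (simp add: frac_def)
    moreover have "frac s \<in> {0..1}" using frac_lt_1[of s] by (simp add: less_imp_le)
    ultimately show ?thesis using s0 by metis
  qed
  have "(\<sigma> * y s0 + h s0) / r = 0"
    by (rule DERIV_local_max[OF d zero_less_one]) (use le in auto)
  then have "\<sigma> * y s0 + h s0 = 0" using r by simp
  then have "y s0 \<le> M" using \<sigma> h[of s0] by auto
  then show ?thesis using le[of s] by linarith
qed

lemma periodic_ode_bound:
  fixes y :: "real \<Rightarrow> real"
  assumes p: "\<And>s. y (s + 1) = y s" and d: "\<And>s. (y has_real_derivative (\<sigma> * y s + h s) / r) (at s)"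
    and r: "r > 0" and \<sigma>: "\<sigma> = 1 \<or> \<sigma> = -1" and h: "\<And>s. \<bar>h s\<bar> \<le> M"
  shows "\<bar>y s\<bar> \<le> M"
proof -
  have "y s \<le> M" by (rule periodic_ode_bound_upper[OF p d r \<sigma> h])
  moreover have "- y s \<le> M"
  proof (rule periodic_ode_bound_upper[where y="\<lambda>s. - y s" and h="\<lambda>s. - h s"])
    fix s show "((\<lambda>s. - y s) has_real_derivative (\<sigma> * - y s + - h s) / r) (at s)"
      by (rule DERIV_cong[OF DERIV_minus[OF d]]) (simp add: diff_divide_distrib add_divide_distrib)
  qed (use p r \<sigma> h in auto)
  ultimately show ?thesis by linarith
qed

lemma periodic_ode_exists:
  fixes h :: "real \<Rightarrow> real"
  assumes p: "\<And>s. h (s + 1) = h s" and c: "continuous_on UNIV h" and r: "r > 0" and \<sigma>: "\<sigma> \<noteq> 0"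
  obtains y where "\<And>s. y (s + 1) = y s" "\<And>s. (y has_real_derivative (\<sigma> * y s + h s) / r) (at s)"
proof -
  define \<phi> where "\<phi> u = exp (- (\<sigma> * u / r)) * h u" for u
  have "isCont \<phi> x" for x
    unfolding \<phi>_def using c r by (intro continuous_intros) (simp_all add: continuous_on_eq_continuous_at)
  then obtain \<Phi> where \<Phi>: "\<And>x. (\<Phi> has_real_derivative \<phi> x) (at x)"
    using einterval_antiderivative[of "-\<infinity>" "\<infinity>" \<phi>] by (auto simp: has_real_derivative_iff_has_vector_derivative)
  \<comment> \<open>Variation of constants: A is the solution of y 1 = y 0, which exists because exp
    (\<sigma> / r) differs from 1.\<close>
  define A where "A = (\<Phi> 0 - exp (\<sigma> / r) * \<Phi> 1) / (r * (exp (\<sigma> / r) - 1))"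
  define y where "y s = exp (\<sigma> * s / r) * (\<Phi> s / r + A)" for s
  have ee: "exp (\<sigma> * s / r) * exp (- (\<sigma> * s / r)) = 1" for s by (simp flip: exp_add)
  have y: "(y has_real_derivative (\<sigma> * y s + h s) / r) (at s)" for s
  proof -
    have "(y has_real_derivative (exp (\<sigma> * s / r) * (\<sigma> / r)) * (\<Phi> s / r + A) + (\<phi> s / r) * exp (\<sigma> * s / r)) (at s)"
      unfolding y_def using r by (auto intro!: derivative_eq_intros \<Phi>)
    moreover have "(\<phi> s / r) * exp (\<sigma> * s / r) = (exp (\<sigma> * s / r) * exp (- (\<sigma> * s / r))) * h s / r"
      by (simp add: \<phi>_def)
    ultimately show ?thesis unfolding ee using r by (simp add: y_def add_divide_distrib mult_ac)
  qed
  \<comment> \<open>The difference of y and its translate solves the homogeneous equation, so this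
    product is constant; it vanishes at 0 by the choice of A.\<close>
  define u where "u s = (y (s + 1) - y s) * exp (- (\<sigma> * s / r))" for s
  have "(u has_real_derivative 0) (at s)" for s
  proof -
    have "((\<lambda>s. y (s + 1)) has_real_derivative ((\<sigma> * y (s + 1) + h (s + 1)) / r) * 1) (at s)"
      by (intro DERIV_chain2[OF y]) (auto intro!: derivative_eq_intros)
    then have "((\<lambda>s. y (s + 1) - y s) has_real_derivative (\<sigma> * (y (s + 1) - y s) / r)) (at s)"
      by (rule DERIV_cong[OF DERIV_diff[OF _ y]]) (simp add: p p[of s, unfolded add.commute[of s 1]] algebra_simps diff_divide_distrib[symmetric])
    moreover have "((\<lambda>s. exp (- (\<sigma> * s / r))) has_real_derivative exp (- (\<sigma> * s / r)) * (- (\<sigma> / r))) (at s)"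
      using r by (auto intro!: derivative_eq_intros)
    ultimately show ?thesis unfolding u_def
      by (rule DERIV_cong[OF DERIV_mult]) (simp add: algebra_simps)
  qed
  then have "u s = u 0" for s by (rule DERIV_isconst_all[rule_format]) 
  moreover have "u 0 = 0"
  proof -
    have "exp (\<sigma> / r) - 1 \<noteq> 0" using r \<sigma> by simp
    then have "exp (\<sigma> / r) * (\<Phi> 1 / r + A) - (\<Phi> 0 / r + A) = 0"
      using r by (simp add: A_def divide_simps) (simp add: algebra_simps)
    then show ?thesis by (simp add: u_def y_def)
  qed
  ultimately have "y (s + 1) = y s" for s unfolding u_def by (metis diff_eq_eq add_0 exp_not_eq_zero mult_eq_0_iff)
  then show ?thesis using y by (rule that)
qed

definition periodic_response :: "real \<Rightarrow> real \<Rightarrow> (real \<Rightarrow> real) \<Rightarrow> real \<Rightarrow> real" where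
  "periodic_response \<sigma> r h = (SOME y. (\<forall>s. y (s + 1) = y s) \<and> (\<forall>s. (y has_real_derivative (\<sigma> * y s + h s) / r) (at s)))"

lemma periodic_response:
  assumes "\<And>s. h (s + 1) = h s" "continuous_on UNIV h" "r > 0" "\<sigma> \<noteq> 0"
  shows "periodic_response \<sigma> r h (s + 1) = periodic_response \<sigma> r h s"
    "(periodic_response \<sigma> r h has_real_derivative (\<sigma> * periodic_response \<sigma> r h s + h s) / r) (at s)"
proof -
  have "\<exists>y. (\<forall>s. y (s + 1) = y s) \<and> (\<forall>s. (y has_real_derivative (\<sigma> * y s + h s) / r) (at s))"
    by (rule periodic_ode_exists[OF assms]) blast
  from someI_ex[OF this] show "periodic_response \<sigma> r h (s + 1) = periodic_response \<sigma> r h s"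
    "(periodic_response \<sigma> r h has_real_derivative (\<sigma> * periodic_response \<sigma> r h s + h s) / r) (at s)"
    unfolding periodic_response_def by blast+
qed

lemma periodic_response_bound:
  assumes "\<And>s. h (s + 1) = h s" "continuous_on UNIV h" "r > 0" "\<sigma> = 1 \<or> \<sigma> = -1" "\<And>s. \<bar>h s\<bar> \<le> M"
  shows "\<bar>periodic_response \<sigma> r h s\<bar> \<le> M"
  using assms(4) by (intro periodic_ode_bound[OF periodic_response[OF assms(1-3)] assms(3-5)]) auto

lemma periodic_response_diff_bound:
  assumes h: "\<And>s. h (s + 1) = h s" "continuous_on UNIV h" and k: "\<And>s. k (s + 1) = k s" "continuous_on UNIV k"
    and r: "r > 0" and \<sigma>: "\<sigma> = 1 \<or> \<sigma> = -1" and M: "\<And>s. \<bar>h s - k s\<bar> \<le> M"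
  shows "\<bar>periodic_response \<sigma> r h s - periodic_response \<sigma> r k s\<bar> \<le> M"
proof (rule periodic_ode_bound[where h="\<lambda>s. h s - k s" and y="\<lambda>s. periodic_response \<sigma> r h s - periodic_response \<sigma> r k s"])
  have s0: "\<sigma> \<noteq> 0" using \<sigma> by auto
  fix s
  show "((\<lambda>s. periodic_response \<sigma> r h s - periodic_response \<sigma> r k s) has_real_derivative
     (\<sigma> * (periodic_response \<sigma> r h s - periodic_response \<sigma> r k s) + (h s - k s)) / r) (at s)"
    by (rule DERIV_cong[OF DERIV_diff[OF periodic_response(2)[OF h r s0] periodic_response(2)[OF k r s0]]])
      (simp add: algebra_simps diff_divide_distrib[symmetric])
  show "periodic_response \<sigma> r h (s + 1) - periodic_response \<sigma> r k (s + 1) = periodic_response \<sigma> r h s - periodic_response \<sigma> r k s"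
    by (simp only: periodic_response(1)[OF h r s0] periodic_response(1)[OF k r s0])
qed (use r \<sigma> M in auto)

text \<open>Closed orbits are fixed points of the map that sends a periodic pair to the periodic
  responses to the forcing along it. Thanks to the hyperbolic linear part, a response is never
  larger than its forcing, whatever r is; hence smallness of g1 and g2 suffices, without any
  smallness of g1 / r.\<close>

lemma saddle_periodic_orbit:
  fixes g1 g2 :: "real \<times> real \<times> real \<Rightarrow> real"
  assumes r: "r > 0" and \<rho>: "\<rho> \<ge> 0"
    and c: "continuous_on (UNIV \<times> {-\<rho>..\<rho>} \<times> {-\<rho>..\<rho>}) g1" "continuous_on (UNIV \<times> {-\<rho>..\<rho>} \<times> {-\<rho>..\<rho>}) g2"
    and p: "\<And>s Y. g1 (s + 1, Y) = g1 (s, Y)" "\<And>s Y. g2 (s + 1, Y) = g2 (s, Y)"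
    and b: "\<And>s a b. \<bar>a\<bar> \<le> \<rho> \<Longrightarrow> \<bar>b\<bar> \<le> \<rho> \<Longrightarrow> \<bar>g1 (s, a, b)\<bar> \<le> \<rho>" "\<And>s a b. \<bar>a\<bar> \<le> \<rho> \<Longrightarrow> \<bar>b\<bar> \<le> \<rho> \<Longrightarrow> \<bar>g2 (s, a, b)\<bar> \<le> \<rho>"
    and l: "\<And>s a b a' b'. \<bar>a\<bar> \<le> \<rho> \<Longrightarrow> \<bar>b\<bar> \<le> \<rho> \<Longrightarrow> \<bar>a'\<bar> \<le> \<rho> \<Longrightarrow> \<bar>b'\<bar> \<le> \<rho> \<Longrightarrow>
        \<bar>g1 (s, a, b) - g1 (s, a', b')\<bar> \<le> (\<bar>a - a'\<bar> + \<bar>b - b'\<bar>) / 8"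
      "\<And>s a b a' b'. \<bar>a\<bar> \<le> \<rho> \<Longrightarrow> \<bar>b\<bar> \<le> \<rho> \<Longrightarrow> \<bar>a'\<bar> \<le> \<rho> \<Longrightarrow> \<bar>b'\<bar> \<le> \<rho> \<Longrightarrow>
        \<bar>g2 (s, a, b) - g2 (s, a', b')\<bar> \<le> (\<bar>a - a'\<bar> + \<bar>b - b'\<bar>) / 8"
  obtains y1 y2 where "\<And>s. y1 (s + 1) = y1 s" "\<And>s. y2 (s + 1) = y2 s"
    "\<And>s. \<bar>y1 s\<bar> \<le> \<rho>" "\<And>s. \<bar>y2 s\<bar> \<le> \<rho>"
    "\<And>s. (y1 has_real_derivative (y1 s + g1 (s, y1 s, y2 s)) / r) (at s)"
    "\<And>s. (y2 has_real_derivative (- y2 s + g2 (s, y1 s, y2 s)) / r) (at s)"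
proof -
  define Bx where "Bx = {-\<rho>..\<rho>} \<times> {-\<rho>..\<rho>}"
  define S where "S = {Y :: real \<Rightarrow>\<^sub>C (real \<times> real). \<forall>s. apply_bcontfun Y (s + 1) = apply_bcontfun Y s \<and> apply_bcontfun Y s \<in> Bx}"
  define h where "h g Y s = g (s, apply_bcontfun Y s)" for g :: "real \<times> real \<times> real \<Rightarrow> real" and Y s
  define T where "T Y = Bcontfun (\<lambda>s. (periodic_response 1 r (h g1 Y) s, periodic_response (-1) r (h g2 Y) s))" for Y
  have ev_cont: "continuous_on UNIV (\<lambda>Y :: real \<Rightarrow>\<^sub>C (real \<times> real). apply_bcontfun Y s)" for s
  proof -
    have "1-lipschitz_on UNIV (\<lambda>Y :: real \<Rightarrow>\<^sub>C (real \<times> real). apply_bcontfun Y s)"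
      by (intro lipschitz_onI) (auto simp: dist_bounded)
    then show ?thesis by (rule lipschitz_on_continuous_on)
  qed
  have "closed S"
  proof -
    have "S = (\<Inter>s. {Y. apply_bcontfun Y (s + 1) = apply_bcontfun Y s}) \<inter> (\<Inter>s. (\<lambda>Y. apply_bcontfun Y s) -` Bx)"
      unfolding S_def by auto
    moreover have "closed Bx" unfolding Bx_def by (intro closed_Times) auto
    ultimately show ?thesis
      by (auto intro!: closed_Int closed_INT closed_Collect_eq ev_cont closed_vimage)
  qed
  have hp: "h g Y (s + 1) = h g Y s" if "Y \<in> S" "\<And>s Y. g (s + 1, Y) = g (s, Y)" for g Y s
    using that by (simp add: h_def S_def)
  have hc: "continuous_on UNIV (h g Y)" if "Y \<in> S" "continuous_on (UNIV \<times> {-\<rho>..\<rho>} \<times> {-\<rho>..\<rho>}) g" for g Y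
    unfolding h_def[abs_def]
  proof (rule continuous_on_compose2[OF that(2)])
    show "continuous_on UNIV (\<lambda>s. (s, apply_bcontfun Y s))" by (intro continuous_intros) simp
    show "range (\<lambda>s. (s, apply_bcontfun Y s)) \<subseteq> UNIV \<times> {-\<rho>..\<rho>} \<times> {-\<rho>..\<rho>}"
      using that(1) unfolding S_def Bx_def by blast
  qed
  have box: "\<bar>fst (apply_bcontfun Y s)\<bar> \<le> \<rho>" "\<bar>snd (apply_bcontfun Y s)\<bar> \<le> \<rho>" if "Y \<in> S" for Y s
    using that by (auto simp: S_def Bx_def abs_le_iff mem_Times_iff) (smt (verit))+
  have hb: "\<bar>h g1 Y s\<bar> \<le> \<rho>" "\<bar>h g2 Y s\<bar> \<le> \<rho>" if "Y \<in> S" for Y s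
    using b(1)[OF box[OF that, of s], of s] b(2)[OF box[OF that, of s], of s] by (simp_all add: h_def)
  have TY: "apply_bcontfun (T Y) = (\<lambda>s. (periodic_response 1 r (h g1 Y) s, periodic_response (-1) r (h g2 Y) s))" if Y: "Y \<in> S" for Y
  proof -
    have "continuous_on UNIV (periodic_response 1 r (h g1 Y))" "continuous_on UNIV (periodic_response (-1) r (h g2 Y))"
      using periodic_response(2)[OF hp[OF Y p(1)] hc[OF Y c(1)] r, of 1] periodic_response(2)[OF hp[OF Y p(2)] hc[OF Y c(2)] r, of "-1"]
      by (auto intro!: continuous_at_imp_continuous_on DERIV_isCont)
    moreover have "norm (periodic_response 1 r (h g1 Y) s, periodic_response (-1) r (h g2 Y) s) \<le> \<rho> + \<rho>" for s
    proof -
      have "\<bar>periodic_response 1 r (h g1 Y) s\<bar> \<le> \<rho>"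
        by (rule periodic_response_bound[OF hp[OF Y p(1)] hc[OF Y c(1)] r _ hb(1)[OF Y]]) simp
      moreover have "\<bar>periodic_response (-1) r (h g2 Y) s\<bar> \<le> \<rho>"
        by (rule periodic_response_bound[OF hp[OF Y p(2)] hc[OF Y c(2)] r _ hb(2)[OF Y]]) simp
      ultimately show ?thesis using norm_Pair_le[of "periodic_response 1 r (h g1 Y) s" "periodic_response (-1) r (h g2 Y) s"] by simp
    qed
    ultimately have "(\<lambda>s. (periodic_response 1 r (h g1 Y) s, periodic_response (-1) r (h g2 Y) s)) \<in> bcontfun"
      by (intro bcontfun_normI continuous_intros)
    then show ?thesis unfolding T_def by (simp add: Bcontfun_inverse)
  qed
  have TS: "T ` S \<subseteq> S"
  proof safe
    fix Y assume Y: "Y \<in> S"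
    have 1: "\<bar>periodic_response 1 r (h g1 Y) s\<bar> \<le> \<rho>" for s
      by (rule periodic_response_bound[OF hp[OF Y p(1)] hc[OF Y c(1)] r _ hb(1)[OF Y]]) simp
    have 2: "\<bar>periodic_response (-1) r (h g2 Y) s\<bar> \<le> \<rho>" for s
      by (rule periodic_response_bound[OF hp[OF Y p(2)] hc[OF Y c(2)] r _ hb(2)[OF Y]]) simp
    show "T Y \<in> S" unfolding S_def
      using 1 2 periodic_response(1)[OF hp[OF Y p(1)] hc[OF Y c(1)] r, of 1] periodic_response(1)[OF hp[OF Y p(2)] hc[OF Y c(2)] r, of "-1"]
      by (auto simp: TY[OF Y] Bx_def abs_le_iff minus_le_iff)
  qed
  \<comment> \<open>Each response changes by at most a quarter of the distance, two coordinate
    differences over 8; the norm of the pair is at most the sum of both.\<close>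
  have lip: "dist (T Y) (T Z) \<le> (1/2) * dist Y Z" if YZ: "Y \<in> S" "Z \<in> S" for Y Z
  proof (rule dist_bound)
    fix s
    have sm: "(\<bar>fst (apply_bcontfun Y s) - fst (apply_bcontfun Z s)\<bar> + \<bar>snd (apply_bcontfun Y s) - snd (apply_bcontfun Z s)\<bar>) / 8 \<le> dist Y Z / 4" for s
    proof -
      have "\<bar>fst (apply_bcontfun Y s) - fst (apply_bcontfun Z s)\<bar> \<le> dist Y Z" "\<bar>snd (apply_bcontfun Y s) - snd (apply_bcontfun Z s)\<bar> \<le> dist Y Z"
        using dist_fst_le[of "apply_bcontfun Y s" "apply_bcontfun Z s"] dist_snd_le[of "apply_bcontfun Y s" "apply_bcontfun Z s"] dist_bounded[of Y s Z]
        by (auto simp: dist_real_def)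
      then show ?thesis by simp
    qed
    have 1: "\<bar>periodic_response 1 r (h g1 Y) s - periodic_response 1 r (h g1 Z) s\<bar> \<le> dist Y Z / 4"
    proof (rule periodic_response_diff_bound[OF hp[OF YZ(1) p(1)] hc[OF YZ(1) c(1)] hp[OF YZ(2) p(1)] hc[OF YZ(2) c(1)] r])
      fix s show "\<bar>h g1 Y s - h g1 Z s\<bar> \<le> dist Y Z / 4"
        using order_trans[OF l(1)[OF box[OF YZ(1), of s] box[OF YZ(2), of s], of s] sm[of s]] by (simp add: h_def)
    qed simp
    have 2: "\<bar>periodic_response (-1) r (h g2 Y) s - periodic_response (-1) r (h g2 Z) s\<bar> \<le> dist Y Z / 4"
    proof (rule periodic_response_diff_bound[OF hp[OF YZ(1) p(2)] hc[OF YZ(1) c(2)] hp[OF YZ(2) p(2)] hc[OF YZ(2) c(2)] r])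
      fix s show "\<bar>h g2 Y s - h g2 Z s\<bar> \<le> dist Y Z / 4"
        using order_trans[OF l(2)[OF box[OF YZ(1), of s] box[OF YZ(2), of s], of s] sm[of s]] by (simp add: h_def)
    qed simp
    have "dist (apply_bcontfun (T Y) s) (apply_bcontfun (T Z) s) \<le>
      \<bar>periodic_response 1 r (h g1 Y) s - periodic_response 1 r (h g1 Z) s\<bar> + \<bar>periodic_response (-1) r (h g2 Y) s - periodic_response (-1) r (h g2 Z) s\<bar>"
      unfolding TY[OF YZ(1)] TY[OF YZ(2)] dist_norm diff_Pair by (rule order_trans[OF norm_Pair_le]) simp
    then show "dist (apply_bcontfun (T Y) s) (apply_bcontfun (T Z) s) \<le> (1/2) * dist Y Z" using 1 2 by linarith
  qed
  have "const_bcontfun (0,0) \<in> S" using \<rho> by (simp add: S_def Bx_def const_bcontfun.rep_eq)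
  then have "S \<noteq> {}" by blast
  then have "\<exists>!Y\<in>S. T Y = Y"
    using \<open>closed S\<close> TS lip by (intro Banach_fix[of S "1/2"]) (auto simp: complete_eq_closed)
  then obtain Y where Y: "Y \<in> S" "T Y = Y" by blast
  define y1 where "y1 s = fst (apply_bcontfun Y s)" for s
  define y2 where "y2 s = snd (apply_bcontfun Y s)" for s
  have e: "y1 = periodic_response 1 r (h g1 Y)" "y2 = periodic_response (-1) r (h g2 Y)"
    using TY[OF Y(1)] Y(2) by (auto simp: y1_def y2_def)
  have hh: "h g Y s = g (s, y1 s, y2 s)" for g s by (simp add: h_def y1_def y2_def)
  show ?thesis
  proof (rule that[of y1 y2])
    fix s
    show "y1 (s + 1) = y1 s" "y2 (s + 1) = y2 s" using Y(1) by (auto simp: S_def y1_def y2_def)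
    show "\<bar>y1 s\<bar> \<le> \<rho>" "\<bar>y2 s\<bar> \<le> \<rho>" using box[OF Y(1), of s] by (auto simp: y1_def y2_def)
    show "(y1 has_real_derivative (y1 s + g1 (s, y1 s, y2 s)) / r) (at s)"
      using periodic_response(2)[OF hp[OF Y(1) p(1)] hc[OF Y(1) c(1)] r, of 1 s] unfolding e[symmetric] hh by simp
    show "(y2 has_real_derivative (- y2 s + g2 (s, y1 s, y2 s)) / r) (at s)"
      using periodic_response(2)[OF hp[OF Y(1) p(2)] hc[OF Y(1) c(2)] r, of "-1" s] unfolding e[symmetric] hh by simp
  qed
qed

section \<open>Closed orbits in a tube, in coordinates of a moving frame\<close>

definition normal_frame :: "(real \<Rightarrow> real^3) \<Rightarrow> (real \<Rightarrow> real^3) \<Rightarrow> (real \<Rightarrow> real^3) \<Rightarrow> (real \<Rightarrow> real^3) \<Rightarrow> (real \<Rightarrow> real^3) \<Rightarrow> bool" where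
  "normal_frame g1 n1 n2 m1 m2 \<longleftrightarrow>
    (\<forall>s. n1 (s + 1) = n1 s \<and> n2 (s + 1) = n2 s \<and> m1 (s + 1) = m1 s \<and> m2 (s + 1) = m2 s \<and>
       (n1 has_vector_derivative m1 s) (at s) \<and> (n2 has_vector_derivative m2 s) (at s) \<and>
       n1 s \<bullet> n1 s = 1 \<and> n2 s \<bullet> n2 s = 1 \<and> n1 s \<bullet> n2 s = 0 \<and> n1 s \<bullet> g1 s = 0 \<and> n2 s \<bullet> g1 s = 0 \<and>
       cross3 (n1 s) (n2 s) = (1 / norm (g1 s)) *\<^sub>R g1 s) \<and>
     continuous_on UNIV m1 \<and> continuous_on UNIV m2"

lemma orthogonal_triple_zero:
  fixes a b c w :: "real^3"
  assumes nz: "a \<noteq> 0" "b \<noteq> 0" "c \<noteq> 0" and o: "a \<bullet> b = 0" "a \<bullet> c = 0" "b \<bullet> c = 0"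
    and w: "w \<bullet> a = 0" "w \<bullet> b = 0" "w \<bullet> c = 0"
  shows "w = 0"
proof (rule ccontr)
  assume "w \<noteq> 0"
  have d: "a \<noteq> b" "a \<noteq> c" "b \<noteq> c" "w \<noteq> a" "w \<noteq> b" "w \<noteq> c"
    using nz o w by auto
  have "pairwise orthogonal {w, a, b, c}"
    using o w by (auto simp: pairwise_def orthogonal_def inner_commute)
  then have "independent {w, a, b, c}"
    using nz \<open>w \<noteq> 0\<close> by (intro pairwise_orthogonal_independent) auto
  then have "card {w, a, b, c} \<le> 3" using independent_bound[of "{w,a,b,c}"] by simp
  then show False using d by simp
qed

lemma product_lipschitz:
  fixes p p' a a' :: real
  assumes "\<bar>p\<bar> \<le> A" "\<bar>p - p'\<bar> \<le> B" "\<bar>a'\<bar> \<le> C" "\<bar>a - a'\<bar> \<le> D" "A \<ge> 0" "B \<ge> 0"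
  shows "\<bar>p * a - p' * a'\<bar> \<le> A * D + B * C"
proof -
  have "p * a - p' * a' = p * (a - a') + (p - p') * a'" by (simp add: algebra_simps)
  then have "\<bar>p * a - p' * a'\<bar> \<le> \<bar>p\<bar> * \<bar>a - a'\<bar> + \<bar>p - p'\<bar> * \<bar>a'\<bar>"
    by (metis abs_mult abs_triangle_ineq)
  also have "\<dots> \<le> A * D + B * C" using assms by (intro add_mono mult_mono) auto
  finally show ?thesis .
qed

lemma onorm_scaleR_le:
  assumes "norm D \<le> C"
  shows "onorm (\<lambda>h::real. h *\<^sub>R D) \<le> C"
  using mult_left_mono[OF assms abs_ge_zero] by (intro onorm_le) (simp add: mult.commute)

text \<open>In the coordinates a, b of the tube, measured in units of r, the hypotheses say that (r
  / 2) V is g1 + a (n1 + g1) - b n2 up to a remainder that is small together with its Lipschitz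
  constant. Requiring the curve with coordinates y1, y2 to be tangent to V, the g1-component
  determines the speed factor, and the two normal components become a system for
  \<open>saddle_periodic_orbit\<close>.\<close>

lemma tube_orbit:
  assumes g: "C2loop g g1 g2" and fr: "normal_frame g1 n1 n2 m1 m2" and \<kappa>: "\<kappa> > 0"
  obtains \<rho>0 r0 where "\<rho>0 > 0" "r0 > 0"
    "\<And>\<rho> r V DV. \<lbrakk>0 < \<rho>; \<rho> \<le> \<rho>0; 0 < r; r \<le> r0; \<And>x. (V has_derivative DV x) (at x);
       \<And>s. norm (r *\<^sub>R V (g s) - 2 *\<^sub>R g1 s) \<le> \<rho> / 2;
       \<And>s a b. \<bar>a\<bar> \<le> \<rho> \<Longrightarrow> \<bar>b\<bar> \<le> \<rho> \<Longrightarrow>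
         norm (r\<^sup>2 *\<^sub>R DV (g s + (r * a) *\<^sub>R n1 s + (r * b) *\<^sub>R n2 s) (n1 s) - 2 *\<^sub>R (n1 s + g1 s)) \<le> 1/16;
       \<And>s a b. \<bar>a\<bar> \<le> \<rho> \<Longrightarrow> \<bar>b\<bar> \<le> \<rho> \<Longrightarrow>
         norm (r\<^sup>2 *\<^sub>R DV (g s + (r * a) *\<^sub>R n1 s + (r * b) *\<^sub>R n2 s) (n2 s) + 2 *\<^sub>R n2 s) \<le> 1/16\<rbrakk> \<Longrightarrow>
     \<exists>c c1 \<mu>. (\<forall>s. c (s + 1) = c s \<and> (c has_vector_derivative c1 s) (at s) \<and> norm (c s - g s) \<le> \<kappa> \<and>
        norm (c1 s - g1 s) \<le> \<kappa> \<and> c1 s = \<mu> s *\<^sub>R V (c s) \<and> \<mu> s > 0) \<and> continuous_on UNIV (\<mu> :: real \<Rightarrow> real)"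
proof -
  note G = C2loopD[OF g]
  have F: "n1 (s + 1) = n1 s" "n2 (s + 1) = n2 s" "m1 (s + 1) = m1 s" "m2 (s + 1) = m2 s"
    "(n1 has_vector_derivative m1 s) (at s)" "(n2 has_vector_derivative m2 s) (at s)"
    "n1 s \<bullet> n1 s = 1" "n2 s \<bullet> n2 s = 1" "n1 s \<bullet> n2 s = 0" "n1 s \<bullet> g1 s = 0" "n2 s \<bullet> g1 s = 0"
    "continuous_on UNIV m1" "continuous_on UNIV m2" for s
    using fr unfolding normal_frame_def by blast+
  have nn: "norm (n1 s) = 1" "norm (n2 s) = 1" for s using F(7,8)[of s] by (auto simp: norm_eq_sqrt_inner)
  have Fc: "continuous_on UNIV n1" "continuous_on UNIV n2"
    using F(5,6) by (auto intro!: continuous_at_imp_continuous_on has_vector_derivative_continuous)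
  obtain v0 where v0: "v0 > 0" "\<And>s. norm (g1 s) \<ge> v0"
    using periodic_bounded_below[of g1, OF G(2) G(8) G(6)] by metis
  obtain v1 where v1: "v1 > 0" "\<And>s. norm (g1 s) \<le> v1"
    using periodic_bounded[of g1, OF G(2) G(8)] by metis
  obtain M1 where M1: "M1 > 0" "\<And>s. norm (m1 s) \<le> M1"
    using periodic_bounded[of m1, OF F(3) F(12)] by metis
  obtain M2 where M2: "M2 > 0" "\<And>s. norm (m2 s) \<le> M2"
    using periodic_bounded[of m2, OF F(4) F(13)] by metis
  define M where "M = max M1 M2"
  have M: "M > 0" "\<And>s. norm (m1 s) \<le> M" "\<And>s. norm (m2 s) \<le> M" using M1 M2 by (auto simp: M_def le_max_iff_disj)
  \<comment> \<open>K2 \<rho> will bound the deviation of the speed factor \<phi> from 1, and K3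
    will be a Lipschitz constant of \<phi>.\<close>
  define K2 where "K2 = 2 * (2 * v1 + v1\<^sup>2) / v0\<^sup>2"
  define K3 where "K3 = (6 * v1 + 4 * v1\<^sup>2) / v0\<^sup>2"
  have K: "K2 > 0" "K3 > 0" using v0 v1 by (auto simp: K2_def K3_def intro!: divide_pos_pos add_pos_pos)
  \<comment> \<open>In turn the entries keep 1 + a above 3/4, the tangential error small enough for
    \<open>Bd\<close> to be at least v0^2 / 2, \<phi> within 1/128 of 1, the variation of \<phi> in
    the forcing below 1/32, and the velocity of the orbit within \<kappa> of g1.\<close>
  define \<rho>0 where "\<rho>0 = Min {1/4, v0\<^sup>2 / (2 * v1), 1 / (128 * K2), 1 / (64 * K3), \<kappa> / 5}"
  define r0 where "r0 = min 1 (1 / (32 * M))"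
  have pos: "\<rho>0 > 0" "r0 > 0" using v0 v1 K \<kappa> M by (auto simp: \<rho>0_def r0_def)
  show ?thesis
  proof (rule that[OF pos])
    fix \<rho> r and V :: "real^3 \<Rightarrow> real^3" and DV
    assume \<rho>: "0 < \<rho>" "\<rho> \<le> \<rho>0" and r: "0 < r" "r \<le> r0" and V: "\<And>x. (V has_derivative DV x) (at x)"
      and H0: "\<And>s. norm (r *\<^sub>R V (g s) - 2 *\<^sub>R g1 s) \<le> \<rho> / 2"
      and H1: "\<And>s a b. \<bar>a\<bar> \<le> \<rho> \<Longrightarrow> \<bar>b\<bar> \<le> \<rho> \<Longrightarrow>
         norm (r\<^sup>2 *\<^sub>R DV (g s + (r * a) *\<^sub>R n1 s + (r * b) *\<^sub>R n2 s) (n1 s) - 2 *\<^sub>R (n1 s + g1 s)) \<le> 1/16"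
      and H2: "\<And>s a b. \<bar>a\<bar> \<le> \<rho> \<Longrightarrow> \<bar>b\<bar> \<le> \<rho> \<Longrightarrow>
         norm (r\<^sup>2 *\<^sub>R DV (g s + (r * a) *\<^sub>R n1 s + (r * b) *\<^sub>R n2 s) (n2 s) + 2 *\<^sub>R n2 s) \<le> 1/16"
    have \<rho>s: "\<rho> \<le> 1/4" "v1 * \<rho> \<le> v0\<^sup>2 / 2" "128 * (K2 * \<rho>) \<le> 1" "64 * (K3 * \<rho>) \<le> 1" "5 * \<rho> \<le> \<kappa>"
      using \<rho> v1 K unfolding \<rho>0_def by (simp_all add: field_simps)
    have rs: "r \<le> 1" "32 * (r * M) \<le> 1" using r M unfolding r0_def by (simp_all add: field_simps)
    define X where "X s a b = g s + (r * a) *\<^sub>R n1 s + (r * b) *\<^sub>R n2 s" for s a b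
    define W where "W s a b = (r / 2) *\<^sub>R V (X s a b)" for s a b
    \<comment> \<open>What remains of the rescaled field W after the model saddle with its
      tangential shear a g1 is subtracted.\<close>
    define R where "R s a b = W s a b - (g1 s + a *\<^sub>R (n1 s + g1 s) - b *\<^sub>R n2 s)" for s a b
    have lin: "linear (DV x)" for x using has_derivative_linear[OF V] .
    have Ra: "norm (R s a b - R s a' b) \<le> 1/32 * \<bar>a - a'\<bar>" if "\<bar>a\<bar> \<le> \<rho>" "\<bar>a'\<bar> \<le> \<rho>" "\<bar>b\<bar> \<le> \<rho>" for s a a' b
    proof -
      have "norm (R s a b - R s a' b) \<le> 1/32 * norm (a - a')"
      proof (rule differentiable_bound[of "{-\<rho>..\<rho>}" "\<lambda>a. R s a b" "\<lambda>a h. h *\<^sub>R ((1/2) *\<^sub>R (r\<^sup>2 *\<^sub>R DV (X s a b) (n1 s) - 2 *\<^sub>R (n1 s + g1 s)))"])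
        fix x assume x: "x \<in> {-\<rho>..\<rho>}"
        have "((\<lambda>a. X s a b) has_derivative (\<lambda>h. (r * h) *\<^sub>R n1 s)) (at x)"
          unfolding X_def by (auto intro!: derivative_eq_intros)
        from has_derivative_scaleR_right[OF has_derivative_compose[OF this V], of "r/2"]
        have "((\<lambda>a. W s a b) has_derivative (\<lambda>h. (r/2) *\<^sub>R DV (X s x b) ((r * h) *\<^sub>R n1 s))) (at x)"
          by (simp add: W_def)
        then have "((\<lambda>a. R s a b) has_derivative (\<lambda>h. (r/2) *\<^sub>R DV (X s x b) ((r * h) *\<^sub>R n1 s) - h *\<^sub>R (n1 s + g1 s))) (at x)"
          unfolding R_def by (auto intro!: derivative_eq_intros)
        then have "((\<lambda>a. R s a b) has_derivative (\<lambda>h. h *\<^sub>R ((1/2) *\<^sub>R (r\<^sup>2 *\<^sub>R DV (X s x b) (n1 s) - 2 *\<^sub>R (n1 s + g1 s))))) (at x)"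
          by (rule has_derivative_eq_rhs) (auto simp: linear_cmul[OF lin] power2_eq_square algebra_simps)
        then show "((\<lambda>a. R s a b) has_derivative (\<lambda>h. h *\<^sub>R ((1/2) *\<^sub>R (r\<^sup>2 *\<^sub>R DV (X s x b) (n1 s) - 2 *\<^sub>R (n1 s + g1 s))))) (at x within {-\<rho>..\<rho>})"
          by (rule has_derivative_at_withinI)
        have "norm (r\<^sup>2 *\<^sub>R DV (X s x b) (n1 s) - 2 *\<^sub>R (n1 s + g1 s)) \<le> 1/16"
          unfolding X_def using x that(3) by (intro H1) auto
        then show "onorm (\<lambda>h. h *\<^sub>R ((1/2) *\<^sub>R (r\<^sup>2 *\<^sub>R DV (X s x b) (n1 s) - 2 *\<^sub>R (n1 s + g1 s)))) \<le> 1/32"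
          by (intro onorm_scaleR_le) simp
      qed (use that in auto)
      then show ?thesis by simp
    qed
    have Rb: "norm (R s a b - R s a b') \<le> 1/32 * \<bar>b - b'\<bar>" if "\<bar>a\<bar> \<le> \<rho>" "\<bar>b\<bar> \<le> \<rho>" "\<bar>b'\<bar> \<le> \<rho>" for s a b b'
    proof -
      have "norm (R s a b - R s a b') \<le> 1/32 * norm (b - b')"
      proof (rule differentiable_bound[of "{-\<rho>..\<rho>}" "\<lambda>b. R s a b" "\<lambda>b h. h *\<^sub>R ((1/2) *\<^sub>R (r\<^sup>2 *\<^sub>R DV (X s a b) (n2 s) + 2 *\<^sub>R n2 s))"])
        fix x assume x: "x \<in> {-\<rho>..\<rho>}"
        have "((\<lambda>b. X s a b) has_derivative (\<lambda>h. (r * h) *\<^sub>R n2 s)) (at x)"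
          unfolding X_def by (auto intro!: derivative_eq_intros)
        from has_derivative_scaleR_right[OF has_derivative_compose[OF this V], of "r/2"]
        have "((\<lambda>b. W s a b) has_derivative (\<lambda>h. (r/2) *\<^sub>R DV (X s a x) ((r * h) *\<^sub>R n2 s))) (at x)"
          by (simp add: W_def)
        then have "((\<lambda>b. R s a b) has_derivative (\<lambda>h. (r/2) *\<^sub>R DV (X s a x) ((r * h) *\<^sub>R n2 s) + h *\<^sub>R n2 s)) (at x)"
          unfolding R_def by (auto intro!: derivative_eq_intros)
        then have "((\<lambda>b. R s a b) has_derivative (\<lambda>h. h *\<^sub>R ((1/2) *\<^sub>R (r\<^sup>2 *\<^sub>R DV (X s a x) (n2 s) + 2 *\<^sub>R n2 s)))) (at x)"
          by (rule has_derivative_eq_rhs) (auto simp: linear_cmul[OF lin] power2_eq_square algebra_simps)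
        then show "((\<lambda>b. R s a b) has_derivative (\<lambda>h. h *\<^sub>R ((1/2) *\<^sub>R (r\<^sup>2 *\<^sub>R DV (X s a x) (n2 s) + 2 *\<^sub>R n2 s)))) (at x within {-\<rho>..\<rho>})"
          by (rule has_derivative_at_withinI)
        have "norm (r\<^sup>2 *\<^sub>R DV (X s a x) (n2 s) + 2 *\<^sub>R n2 s) \<le> 1/16"
          unfolding X_def using x that(1) by (intro H2) auto
        then show "onorm (\<lambda>h. h *\<^sub>R ((1/2) *\<^sub>R (r\<^sup>2 *\<^sub>R DV (X s a x) (n2 s) + 2 *\<^sub>R n2 s))) \<le> 1/32"
          by (intro onorm_scaleR_le) simp
      qed (use that in auto)
      then show ?thesis by simp
    qed
    have Rl: "norm (R s a b - R s a' b') \<le> (\<bar>a - a'\<bar> + \<bar>b - b'\<bar>) / 32"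
      if "\<bar>a\<bar> \<le> \<rho>" "\<bar>b\<bar> \<le> \<rho>" "\<bar>a'\<bar> \<le> \<rho>" "\<bar>b'\<bar> \<le> \<rho>" for s a b a' b'
      using norm_triangle_ineq[of "R s a b - R s a' b" "R s a' b - R s a' b'"]
        Ra[OF that(1,3,2), of s] Rb[OF that(3,2,4), of s] by simp
    have R0: "norm (R s a b) \<le> \<rho> / 2" if "\<bar>a\<bar> \<le> \<rho>" "\<bar>b\<bar> \<le> \<rho>" for s a b
    proof -
      have "R s 0 0 = (1/2) *\<^sub>R (r *\<^sub>R V (g s) - 2 *\<^sub>R g1 s)"
        by (simp add: R_def W_def X_def algebra_simps)
      then have "norm (R s 0 0) \<le> \<rho> / 4" using H0[of s] by simp
      then show ?thesis
        using Rl[OF that, of 0 0 s] that \<rho>(1) norm_triangle_ineq2[of "R s a b" "R s 0 0"] by (simp add: field_simps)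
    qed
    have ip: "\<bar>R s a b \<bullet> n1 s - R s a' b' \<bullet> n1 s\<bar> \<le> norm (R s a b - R s a' b')"
      "\<bar>R s a b \<bullet> n2 s - R s a' b' \<bullet> n2 s\<bar> \<le> norm (R s a b - R s a' b')"
      "\<bar>R s a b \<bullet> g1 s - R s a' b' \<bullet> g1 s\<bar> \<le> v1 * norm (R s a b - R s a' b')"
      "\<bar>R s a b \<bullet> n1 s\<bar> \<le> norm (R s a b)" "\<bar>R s a b \<bullet> n2 s\<bar> \<le> norm (R s a b)" "\<bar>R s a b \<bullet> g1 s\<bar> \<le> v1 * norm (R s a b)" for s a b a' b'
    proof -
      have *: "\<bar>x \<bullet> g1 s\<bar> \<le> v1 * norm x" for x
        using Cauchy_Schwarz_ineq2[of x "g1 s"] mult_left_mono[OF v1(2)[of s], of "norm x"] by (simp add: mult.commute)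
      show "\<bar>R s a b \<bullet> n1 s - R s a' b' \<bullet> n1 s\<bar> \<le> norm (R s a b - R s a' b')"
        using Cauchy_Schwarz_ineq2[of "R s a b - R s a' b'" "n1 s"] by (simp add: nn inner_diff_left)
      show "\<bar>R s a b \<bullet> n2 s - R s a' b' \<bullet> n2 s\<bar> \<le> norm (R s a b - R s a' b')"
        using Cauchy_Schwarz_ineq2[of "R s a b - R s a' b'" "n2 s"] by (simp add: nn inner_diff_left)
      show "\<bar>R s a b \<bullet> g1 s - R s a' b' \<bullet> g1 s\<bar> \<le> v1 * norm (R s a b - R s a' b')"
        using *[of "R s a b - R s a' b'"] by (simp add: inner_diff_left)
      show "\<bar>R s a b \<bullet> n1 s\<bar> \<le> norm (R s a b)" "\<bar>R s a b \<bullet> n2 s\<bar> \<le> norm (R s a b)"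
        using Cauchy_Schwarz_ineq2[of "R s a b" "n1 s"] Cauchy_Schwarz_ineq2[of "R s a b" "n2 s"] by (simp_all add: nn)
      show "\<bar>R s a b \<bullet> g1 s\<bar> \<le> v1 * norm (R s a b)" by (rule *)
    qed
    \<comment> \<open>The contribution of the turning frame to the velocity of the curve.\<close>
    define Q where "Q s a b = r *\<^sub>R (a *\<^sub>R m1 s + b *\<^sub>R m2 s)" for s a b
    have Ql: "norm (Q s a b - Q s a' b') \<le> (\<bar>a - a'\<bar> + \<bar>b - b'\<bar>) / 32" for s a b a' b'
    proof -
      have "Q s a b - Q s a' b' = r *\<^sub>R ((a - a') *\<^sub>R m1 s + (b - b') *\<^sub>R m2 s)" by (simp add: Q_def algebra_simps)
      then have "norm (Q s a b - Q s a' b') \<le> r * (\<bar>a - a'\<bar> * norm (m1 s) + \<bar>b - b'\<bar> * norm (m2 s))"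
        using norm_triangle_ineq[of "(a - a') *\<^sub>R m1 s" "(b - b') *\<^sub>R m2 s"] r by simp
      also have "\<dots> \<le> r * (\<bar>a - a'\<bar> * M + \<bar>b - b'\<bar> * M)"
        using M r by (intro mult_left_mono add_mono) auto
      also have "\<dots> = (r * M) * (\<bar>a - a'\<bar> + \<bar>b - b'\<bar>)" by (simp add: algebra_simps)
      also have "\<dots> \<le> (1/32) * (\<bar>a - a'\<bar> + \<bar>b - b'\<bar>)" using rs by (intro mult_right_mono) auto
      finally show ?thesis by simp
    qed
    have Q0: "norm (Q s a b) \<le> \<rho> / 16" if "\<bar>a\<bar> \<le> \<rho>" "\<bar>b\<bar> \<le> \<rho>" for s a b
      using Ql[of s a b 0 0] that by (simp add: Q_def)
    have iq: "\<bar>Q s a b \<bullet> n1 s - Q s a' b' \<bullet> n1 s\<bar> \<le> norm (Q s a b - Q s a' b')"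
      "\<bar>Q s a b \<bullet> n2 s - Q s a' b' \<bullet> n2 s\<bar> \<le> norm (Q s a b - Q s a' b')"
      "\<bar>Q s a b \<bullet> g1 s - Q s a' b' \<bullet> g1 s\<bar> \<le> v1 * norm (Q s a b - Q s a' b')"
      "\<bar>Q s a b \<bullet> n1 s\<bar> \<le> norm (Q s a b)" "\<bar>Q s a b \<bullet> n2 s\<bar> \<le> norm (Q s a b)" "\<bar>Q s a b \<bullet> g1 s\<bar> \<le> v1 * norm (Q s a b)" for s a b a' b'
    proof -
      have *: "\<bar>x \<bullet> g1 s\<bar> \<le> v1 * norm x" for x
        using Cauchy_Schwarz_ineq2[of x "g1 s"] mult_left_mono[OF v1(2)[of s], of "norm x"] by (simp add: mult.commute)
      show "\<bar>Q s a b \<bullet> n1 s - Q s a' b' \<bullet> n1 s\<bar> \<le> norm (Q s a b - Q s a' b')"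
        using Cauchy_Schwarz_ineq2[of "Q s a b - Q s a' b'" "n1 s"] by (simp add: nn inner_diff_left)
      show "\<bar>Q s a b \<bullet> n2 s - Q s a' b' \<bullet> n2 s\<bar> \<le> norm (Q s a b - Q s a' b')"
        using Cauchy_Schwarz_ineq2[of "Q s a b - Q s a' b'" "n2 s"] by (simp add: nn inner_diff_left)
      show "\<bar>Q s a b \<bullet> g1 s - Q s a' b' \<bullet> g1 s\<bar> \<le> v1 * norm (Q s a b - Q s a' b')"
        using *[of "Q s a b - Q s a' b'"] by (simp add: inner_diff_left)
      show "\<bar>Q s a b \<bullet> n1 s\<bar> \<le> norm (Q s a b)" "\<bar>Q s a b \<bullet> n2 s\<bar> \<le> norm (Q s a b)"
        using Cauchy_Schwarz_ineq2[of "Q s a b" "n1 s"] Cauchy_Schwarz_ineq2[of "Q s a b" "n2 s"] by (simp_all add: nn)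
      show "\<bar>Q s a b \<bullet> g1 s\<bar> \<le> v1 * norm (Q s a b)" by (rule *)
    qed
    define v where "v s = g1 s \<bullet> g1 s" for s
    have v: "v0\<^sup>2 \<le> v s" "v s \<le> v1\<^sup>2" for s
      using power_mono[OF v0(2)[of s], of 2] power_mono[OF v1(2)[of s], of 2] v0(1) by (auto simp: v_def power2_norm_eq_inner)
    have vn: "0 \<le> v s" for s by (simp add: v_def)
    \<comment> \<open>\<open>N\<close> and \<open>Bd\<close> are the inner products with g1 of the
      velocity of the curve and of W; their quotient \<phi> is the only factor that can make the
      velocity equal to \<phi> W.\<close>
    define N where "N s a b = v s + Q s a b \<bullet> g1 s" for s a b
    define Bd where "Bd s a b = v s * (1 + a) + R s a b \<bullet> g1 s" for s a b
    define \<phi> where "\<phi> s a b = N s a b / Bd s a b" for s a b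
    have vp: "v0\<^sup>2 > 0" using v0(1) by simp
    have Bpos: "Bd s a b \<ge> v0\<^sup>2 / 2" if ab: "\<bar>a\<bar> \<le> \<rho>" "\<bar>b\<bar> \<le> \<rho>" for s a b
    proof -
      have "\<bar>R s a b \<bullet> g1 s\<bar> \<le> v1 * (\<rho> / 2)"
        using ip(6)[of s a b] mult_left_mono[OF R0[OF ab, of s], of v1] v1 by linarith
      moreover have "v s * (1 + a) \<ge> v s * (3/4)" using ab(1) \<rho>s(1) vn[of s] by (intro mult_left_mono) auto
      ultimately show ?thesis using \<rho>s(2) v(1)[of s] unfolding Bd_def by linarith
    qed
    have Npos: "N s a b > 0" if ab: "\<bar>a\<bar> \<le> \<rho>" "\<bar>b\<bar> \<le> \<rho>" for s a b
    proof -
      have "\<bar>Q s a b \<bullet> g1 s\<bar> \<le> v1 * (\<rho> / 16)"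
        using iq(6)[of s a b] mult_left_mono[OF Q0[OF ab, of s], of v1] v1 by linarith
      then show ?thesis using \<rho>s(2) v(1)[of s] vp unfolding N_def by linarith
    qed
    have \<phi>1: "\<bar>\<phi> s a b - 1\<bar> \<le> 1/128" if ab: "\<bar>a\<bar> \<le> \<rho>" "\<bar>b\<bar> \<le> \<rho>" for s a b
    proof -
      have 1: "\<bar>Q s a b \<bullet> g1 s\<bar> \<le> v1 * (\<rho> / 16)"
        using iq(6)[of s a b] mult_left_mono[OF Q0[OF ab, of s], of v1] v1 by linarith
      have 2: "\<bar>R s a b \<bullet> g1 s\<bar> \<le> v1 * (\<rho> / 2)"
        using ip(6)[of s a b] mult_left_mono[OF R0[OF ab, of s], of v1] v1 by linarith
      have 3: "\<bar>v s * a\<bar> \<le> v1\<^sup>2 * \<rho>"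
        unfolding abs_mult using v[of s] vn[of s] ab by (intro mult_mono) auto
      have "N s a b - Bd s a b = Q s a b \<bullet> g1 s - v s * a - R s a b \<bullet> g1 s" by (simp add: N_def Bd_def algebra_simps)
      then have "\<bar>N s a b - Bd s a b\<bar> \<le> v1 * (\<rho> / 16) + v1\<^sup>2 * \<rho> + v1 * (\<rho> / 2)" using 1 2 3 by linarith
      also have "\<dots> \<le> (2 * v1 + v1\<^sup>2) * \<rho>" using v1(1) \<rho>(1) by (simp add: algebra_simps)
      also have "\<dots> = (K2 * \<rho>) * (v0\<^sup>2 / 2)" using v0 by (simp add: K2_def field_simps)
      also have "\<dots> \<le> (1/128) * Bd s a b" using \<rho>s(3) Bpos[OF ab, of s] K(1) \<rho>(1) vp by (intro mult_mono) auto
      finally have "\<bar>N s a b - Bd s a b\<bar> \<le> (1/128) * Bd s a b" .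
      moreover have "Bd s a b > 0" using Bpos[OF ab, of s] vp by linarith
      moreover have "\<phi> s a b - 1 = (N s a b - Bd s a b) / Bd s a b" using \<open>Bd s a b > 0\<close> by (simp add: \<phi>_def field_simps)
      ultimately show ?thesis by (simp add: abs_divide divide_le_eq)
    qed
    have \<phi>l: "\<bar>\<phi> s a b - \<phi> s a' b'\<bar> \<le> K3 * (\<bar>a - a'\<bar> + \<bar>b - b'\<bar>)"
      if ab: "\<bar>a\<bar> \<le> \<rho>" "\<bar>b\<bar> \<le> \<rho>" and ab': "\<bar>a'\<bar> \<le> \<rho>" "\<bar>b'\<bar> \<le> \<rho>" for s a b a' b'
    proof -
      define d where "d = \<bar>a - a'\<bar> + \<bar>b - b'\<bar>"
      have d0: "d \<ge> 0" by (simp add: d_def)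
      have Bp: "Bd s a b > 0" "Bd s a' b' > 0" using Bpos[OF ab, of s] Bpos[OF ab', of s] vp by linarith+
      have 1: "\<bar>N s a b - N s a' b'\<bar> \<le> v1 * (d / 32)"
      proof -
        have "N s a b - N s a' b' = Q s a b \<bullet> g1 s - Q s a' b' \<bullet> g1 s" by (simp add: N_def)
        moreover have "v1 * norm (Q s a b - Q s a' b') \<le> v1 * (d / 32)"
          using v1(1) Ql[of s a b a' b'] by (intro mult_left_mono) (auto simp: d_def)
        ultimately show ?thesis using iq(3)[of s a b a' b'] by linarith
      qed
      have 2: "\<bar>Bd s a b - Bd s a' b'\<bar> \<le> v1\<^sup>2 * d + v1 * (d / 32)"
      proof -
        have "Bd s a b - Bd s a' b' = v s * (a - a') + (R s a b \<bullet> g1 s - R s a' b' \<bullet> g1 s)" by (simp add: Bd_def algebra_simps)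
        moreover have "\<bar>v s * (a - a')\<bar> \<le> v1\<^sup>2 * d"
          unfolding abs_mult using v[of s] vn[of s] by (intro mult_mono) (auto simp: d_def)
        moreover have "\<bar>R s a b \<bullet> g1 s - R s a' b' \<bullet> g1 s\<bar> \<le> v1 * (d / 32)"
        proof -
          have "v1 * norm (R s a b - R s a' b') \<le> v1 * (d / 32)"
            using v1(1) Rl[OF ab ab', of s] by (intro mult_left_mono) (auto simp: d_def)
          then show ?thesis using ip(3)[of s a b a' b'] by linarith
        qed
        ultimately show ?thesis by linarith
      qed
      have f2: "\<bar>\<phi> s a' b'\<bar> \<le> 2" using \<phi>1[OF ab', of s] by linarith
      have "\<phi> s a b - \<phi> s a' b' = ((N s a b - N s a' b') - \<phi> s a' b' * (Bd s a b - Bd s a' b')) / Bd s a b"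
        using Bp by (simp add: \<phi>_def field_simps)
      then have "\<bar>\<phi> s a b - \<phi> s a' b'\<bar> = \<bar>(N s a b - N s a' b') - \<phi> s a' b' * (Bd s a b - Bd s a' b')\<bar> / Bd s a b"
        using Bp by simp
      also have "\<dots> \<le> (v1 * (d / 32) + 2 * (v1\<^sup>2 * d + v1 * (d / 32))) / (v0\<^sup>2 / 2)"
      proof (rule frac_le)
        have "\<bar>\<phi> s a' b' * (Bd s a b - Bd s a' b')\<bar> \<le> 2 * (v1\<^sup>2 * d + v1 * (d / 32))"
          unfolding abs_mult using f2 2 by (intro mult_mono) auto
        then show "\<bar>(N s a b - N s a' b') - \<phi> s a' b' * (Bd s a b - Bd s a' b')\<bar> \<le> v1 * (d / 32) + 2 * (v1\<^sup>2 * d + v1 * (d / 32))"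
          using 1 by linarith
      qed (use Bpos[OF ab, of s] vp v1 d0 in auto)
      also have "\<dots> \<le> K3 * d"
      proof -
        have "(v1 * (d / 32) + 2 * (v1\<^sup>2 * d + v1 * (d / 32))) \<le> (3 * v1 + 2 * v1\<^sup>2) * d"
          using v1(1) d0 by (simp add: algebra_simps)
        then have "(v1 * (d / 32) + 2 * (v1\<^sup>2 * d + v1 * (d / 32))) / (v0\<^sup>2 / 2) \<le> ((3 * v1 + 2 * v1\<^sup>2) * d) / (v0\<^sup>2 / 2)"
          using vp by (intro divide_right_mono) auto
        also have "\<dots> = K3 * d" by (simp add: K3_def)
        finally show ?thesis .
      qed
      finally show ?thesis by (simp add: d_def)
    qed
    \<comment> \<open>With a and b the coordinates of the curve, these are r a' - a and r b' + b
      when velocity = \<phi> W is read off along n1 and n2.\<close>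
    define f1 where "f1 p = (case p of (s, a, b) \<Rightarrow> (\<phi> s a b - 1) * (a + R s a b \<bullet> n1 s) + R s a b \<bullet> n1 s - Q s a b \<bullet> n1 s)" for p
    define f2 where "f2 p = (case p of (s, a, b) \<Rightarrow> (\<phi> s a b - 1) * (- b + R s a b \<bullet> n2 s) + R s a b \<bullet> n2 s - Q s a b \<bullet> n2 s)" for p
    have Vc: "continuous_on UNIV V" using V by (intro continuous_at_imp_continuous_on ballI has_derivative_continuous)
    have Xc: "continuous_on A (\<lambda>p. X (fst p) (fst (snd p)) (snd (snd p)))" for A
      unfolding X_def
      by (intro continuous_intros continuous_on_compose2[OF G(7)[of UNIV]] continuous_on_compose2[OF Fc(1)] continuous_on_compose2[OF Fc(2)]) auto
    have g1c: "continuous_on A (\<lambda>p::real\<times>real\<times>real. g1 (fst p))" for A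
      by (rule continuous_on_compose2[OF G(8)[of UNIV]]) (auto intro!: continuous_intros)
    have n1c: "continuous_on A (\<lambda>p::real\<times>real\<times>real. n1 (fst p))" for A
      by (rule continuous_on_compose2[OF Fc(1)]) (auto intro!: continuous_intros)
    have n2c: "continuous_on A (\<lambda>p::real\<times>real\<times>real. n2 (fst p))" for A
      by (rule continuous_on_compose2[OF Fc(2)]) (auto intro!: continuous_intros)
    have m1c: "continuous_on A (\<lambda>p::real\<times>real\<times>real. m1 (fst p))" for A
      by (rule continuous_on_compose2[OF F(12)]) (auto intro!: continuous_intros)
    have m2c: "continuous_on A (\<lambda>p::real\<times>real\<times>real. m2 (fst p))" for A
      by (rule continuous_on_compose2[OF F(13)]) (auto intro!: continuous_intros)
    have VXc: "continuous_on A (\<lambda>p. V (X (fst p) (fst (snd p)) (snd (snd p))))" for A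
      by (rule continuous_on_compose2[OF Vc Xc]) auto
    have Rc: "continuous_on A (\<lambda>p. R (fst p) (fst (snd p)) (snd (snd p)))" for A
      unfolding R_def W_def by (intro continuous_intros VXc g1c n1c n2c)
    have Qc: "continuous_on A (\<lambda>p. Q (fst p) (fst (snd p)) (snd (snd p)))" for A
      unfolding Q_def by (intro continuous_intros m1c m2c)
    define Bx where "Bx = (UNIV :: real set) \<times> {-\<rho>..\<rho>} \<times> {-\<rho>..\<rho>}"
    have \<phi>c: "continuous_on Bx (\<lambda>p. \<phi> (fst p) (fst (snd p)) (snd (snd p)))"
      unfolding \<phi>_def N_def Bd_def v_def
    proof (intro continuous_intros Rc Qc g1c ballI)
      fix p assume "p \<in> Bx"
      then have "\<bar>fst (snd p)\<bar> \<le> \<rho>" "\<bar>snd (snd p)\<bar> \<le> \<rho>" by (auto simp: Bx_def)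
      from Bpos[OF this, of "fst p"] vp
      show "g1 (fst p) \<bullet> g1 (fst p) * (1 + fst (snd p)) + R (fst p) (fst (snd p)) (snd (snd p)) \<bullet> g1 (fst p) \<noteq> 0"
        unfolding Bd_def v_def by linarith
    qed
    have fc: "continuous_on Bx f1" "continuous_on Bx f2"
      unfolding f1_def[abs_def] f2_def[abs_def] case_prod_beta
      by (intro continuous_intros \<phi>c Rc Qc n1c n2c)+
    have per: "X (s + 1) a b = X s a b" "R (s + 1) a b = R s a b" "Q (s + 1) a b = Q s a b" "\<phi> (s + 1) a b = \<phi> s a b" for s a b
      by (simp_all add: X_def R_def W_def Q_def \<phi>_def N_def Bd_def v_def G F)
    have fb: "\<bar>(\<phi> s a b - 1) * (x + y) + y - z\<bar> \<le> \<rho>"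
      if "\<bar>a\<bar> \<le> \<rho>" "\<bar>b\<bar> \<le> \<rho>" "\<bar>x\<bar> \<le> \<rho>" "\<bar>y\<bar> \<le> norm (R s a b)" "\<bar>z\<bar> \<le> norm (Q s a b)" for s a b x y z
    proof -
      have y: "\<bar>y\<bar> \<le> \<rho> / 2" "\<bar>z\<bar> \<le> \<rho> / 16" using that R0[OF that(1,2), of s] Q0[OF that(1,2), of s] by auto
      have "\<bar>(\<phi> s a b - 1) * (x + y)\<bar> \<le> (1/128) * (2 * \<rho>)"
        unfolding abs_mult using \<phi>1[OF that(1,2), of s] that(3) y by (intro mult_mono) auto
      then show ?thesis using y by linarith
    qed
    \<comment> \<open>The budget is 1/64 + 1/32 for the product and 1/32 each for the two linear
      terms, together below 1/8.\<close>
    have fl: "\<bar>((\<phi> s a b - 1) * (x + y) + y - z) - ((\<phi> s a' b' - 1) * (x' + y') + y' - z')\<bar> \<le> (\<bar>a - a'\<bar> + \<bar>b - b'\<bar>) / 8"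
      if ab: "\<bar>a\<bar> \<le> \<rho>" "\<bar>b\<bar> \<le> \<rho>" and ab': "\<bar>a'\<bar> \<le> \<rho>" "\<bar>b'\<bar> \<le> \<rho>" and
        "\<bar>x'\<bar> \<le> \<rho>" "\<bar>x - x'\<bar> \<le> \<bar>a - a'\<bar> + \<bar>b - b'\<bar>" "\<bar>y'\<bar> \<le> norm (R s a' b')" "\<bar>y - y'\<bar> \<le> norm (R s a b - R s a' b')"
        "\<bar>z - z'\<bar> \<le> norm (Q s a b - Q s a' b')" for s a b a' b' x y z x' y' z'
    proof -
      define d where "d = \<bar>a - a'\<bar> + \<bar>b - b'\<bar>"
      have d0: "d \<ge> 0" by (simp add: d_def)
      have y: "\<bar>y - y'\<bar> \<le> d / 32" "\<bar>z - z'\<bar> \<le> d / 32" "\<bar>x - x'\<bar> \<le> d" "\<bar>y'\<bar> \<le> \<rho> / 2"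
        using that(6-9) Rl[OF ab ab', of s] Ql[of s a b a' b'] R0[OF ab', of s] unfolding d_def by linarith+
      have "\<bar>(\<phi> s a b - 1) * (x + y) - (\<phi> s a' b' - 1) * (x' + y')\<bar> \<le> (1/128) * (2 * d) + (K3 * d) * (2 * \<rho>)"
      proof (rule product_lipschitz)
        show "\<bar>\<phi> s a b - 1 - (\<phi> s a' b' - 1)\<bar> \<le> K3 * d" using \<phi>l[OF ab ab', of s] by (simp add: d_def)
        show "\<bar>x' + y'\<bar> \<le> 2 * \<rho>" using that(5) y(4) \<rho>(1) by linarith
        show "\<bar>x + y - (x' + y')\<bar> \<le> 2 * d" using y d0 by linarith
        show "0 \<le> K3 * d" using K d0 by simp
      qed (use \<phi>1[OF ab, of s] in auto)
      also have "\<dots> = d / 64 + 2 * (K3 * \<rho>) * d" by (simp add: algebra_simps)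
      also have "\<dots> \<le> d / 64 + (1/32) * d" using \<rho>s(4) d0 by (intro add_left_mono mult_right_mono) auto
      finally show ?thesis using y unfolding d_def[symmetric] by linarith
    qed
    obtain y1 y2 where y: "\<And>s. y1 (s + 1) = y1 s" "\<And>s. y2 (s + 1) = y2 s"
      "\<And>s. \<bar>y1 s\<bar> \<le> \<rho>" "\<And>s. \<bar>y2 s\<bar> \<le> \<rho>"
      "\<And>s. (y1 has_real_derivative (y1 s + f1 (s, y1 s, y2 s)) / r) (at s)"
      "\<And>s. (y2 has_real_derivative (- y2 s + f2 (s, y1 s, y2 s)) / r) (at s)"
    proof (rule saddle_periodic_orbit[OF r(1) less_imp_le[OF \<rho>(1)] fc[unfolded Bx_def]])
      show "f1 (s + 1, Y) = f1 (s, Y)" "f2 (s + 1, Y) = f2 (s, Y)" for s Y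
        by (cases Y; simp add: f1_def f2_def per F)+
      show "\<bar>f1 (s, a, b)\<bar> \<le> \<rho>" "\<bar>f2 (s, a, b)\<bar> \<le> \<rho>" if "\<bar>a\<bar> \<le> \<rho>" "\<bar>b\<bar> \<le> \<rho>" for s a b
        unfolding f1_def f2_def prod.case using that by (intro fb ip iq; simp)+
      show "\<bar>f1 (s, a, b) - f1 (s, a', b')\<bar> \<le> (\<bar>a - a'\<bar> + \<bar>b - b'\<bar>) / 8"
        "\<bar>f2 (s, a, b) - f2 (s, a', b')\<bar> \<le> (\<bar>a - a'\<bar> + \<bar>b - b'\<bar>) / 8"
        if "\<bar>a\<bar> \<le> \<rho>" "\<bar>b\<bar> \<le> \<rho>" "\<bar>a'\<bar> \<le> \<rho>" "\<bar>b'\<bar> \<le> \<rho>" for s a b a' b'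
        unfolding f1_def f2_def prod.case using that by (intro fl ip iq; simp)+
    qed (rule that)
    define c where "c s = X s (y1 s) (y2 s)" for s
    define p1 where "p1 s = (y1 s + f1 (s, y1 s, y2 s)) / r" for s
    define p2 where "p2 s = (- y2 s + f2 (s, y1 s, y2 s)) / r" for s
    define c1 where "c1 s = g1 s + Q s (y1 s) (y2 s) + (r * p1 s) *\<^sub>R n1 s + (r * p2 s) *\<^sub>R n2 s" for s
    define \<mu> where "\<mu> s = \<phi> s (y1 s) (y2 s) * (r / 2)" for s
    have c1: "(c has_vector_derivative c1 s) (at s)" for s
    proof -
      have 1: "((\<lambda>s. (r * y1 s) *\<^sub>R n1 s) has_vector_derivative ((r * y1 s) *\<^sub>R m1 s + (r * p1 s) *\<^sub>R n1 s)) (at s)"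
        by (intro has_vector_derivative_scaleR F DERIV_cmult) (use y(5) in \<open>simp add: p1_def\<close>)
      have 2: "((\<lambda>s. (r * y2 s) *\<^sub>R n2 s) has_vector_derivative ((r * y2 s) *\<^sub>R m2 s + (r * p2 s) *\<^sub>R n2 s)) (at s)"
        by (intro has_vector_derivative_scaleR F DERIV_cmult) (use y(6) in \<open>simp add: p2_def\<close>)
      have "((\<lambda>s. g s + (r * y1 s) *\<^sub>R n1 s + (r * y2 s) *\<^sub>R n2 s) has_vector_derivative
        (g1 s + ((r * y1 s) *\<^sub>R m1 s + (r * p1 s) *\<^sub>R n1 s) + ((r * y2 s) *\<^sub>R m2 s + (r * p2 s) *\<^sub>R n2 s))) (at s)"
        by (intro has_vector_derivative_add G 1 2)
      moreover have "g1 s + ((r * y1 s) *\<^sub>R m1 s + (r * p1 s) *\<^sub>R n1 s) + ((r * y2 s) *\<^sub>R m2 s + (r * p2 s) *\<^sub>R n2 s) = c1 s"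
        by (simp add: c1_def Q_def algebra_simps)
      ultimately show ?thesis by (simp add: c_def[abs_def] X_def)
    qed
    have rp: "r * p1 s = y1 s + f1 (s, y1 s, y2 s)" "r * p2 s = - y2 s + f2 (s, y1 s, y2 s)" for s
      using r by (simp_all add: p1_def p2_def)
    have fbd: "\<bar>f1 (s, y1 s, y2 s)\<bar> \<le> \<rho>" "\<bar>f2 (s, y1 s, y2 s)\<bar> \<le> \<rho>" for s
      unfolding f1_def f2_def prod.case using y(3,4)[of s] by (intro fb ip iq; simp)+
    have c1V: "c1 s = \<mu> s *\<^sub>R V (c s)" for s
    proof -
      define a where "a = y1 s" define b where "b = y2 s"
      have ab: "\<bar>a\<bar> \<le> \<rho>" "\<bar>b\<bar> \<le> \<rho>" using y(3,4)[of s] by (auto simp: a_def b_def)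
      have Bp: "Bd s a b \<noteq> 0" using Bpos[OF ab, of s] vp by linarith
      have Weq: "W s a b = R s a b + (g1 s + a *\<^sub>R (n1 s + g1 s) - b *\<^sub>R n2 s)" by (simp add: R_def)
      have "n2 s \<bullet> n1 s = 0" "g1 s \<bullet> n1 s = 0" "g1 s \<bullet> n2 s = 0"
        using F(9-11)[of s] by (simp_all only: inner_commute[of "n2 s" "n1 s"] inner_commute[of "g1 s" "n1 s"] inner_commute[of "g1 s" "n2 s"])
      note Fs = F(7-11)[of s] this
      \<comment> \<open>Along n1 and n2 the equality is the differential equation for y1 and y2;
        along g1 it is the definition of \<phi>.\<close>
      have "c1 s - \<phi> s a b *\<^sub>R W s a b = 0"
      proof (rule orthogonal_triple_zero[of "n1 s" "n2 s" "g1 s"])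
        show "(c1 s - \<phi> s a b *\<^sub>R W s a b) \<bullet> n1 s = 0"
          unfolding c1_def rp a_def[symmetric] b_def[symmetric] f1_def f2_def prod.case Weq
          by (simp add: inner_add_left inner_diff_left Fs algebra_simps)
        show "(c1 s - \<phi> s a b *\<^sub>R W s a b) \<bullet> n2 s = 0"
          unfolding c1_def rp a_def[symmetric] b_def[symmetric] f1_def f2_def prod.case Weq
          by (simp add: inner_add_left inner_diff_left Fs algebra_simps)
        have "(c1 s - \<phi> s a b *\<^sub>R W s a b) \<bullet> g1 s = N s a b - \<phi> s a b * Bd s a b"
          unfolding c1_def a_def[symmetric] b_def[symmetric] Weq N_def Bd_def v_def
          by (simp add: inner_add_left inner_diff_left Fs algebra_simps)
        then show "(c1 s - \<phi> s a b *\<^sub>R W s a b) \<bullet> g1 s = 0" using Bp by (simp add: \<phi>_def)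
      qed (use Fs G(6)[of s] in \<open>auto\<close>)
      then show ?thesis by (simp add: \<mu>_def c_def W_def a_def b_def)
    qed
    have Qb: "norm (Q s (y1 s) (y2 s)) \<le> \<rho>" for s using Q0[OF y(3,4), of s s s] \<rho>(1) by linarith
    have "norm (c s - g s) \<le> \<kappa>" for s
    proof -
      have "norm (c s - g s) \<le> norm ((r * y1 s) *\<^sub>R n1 s) + norm ((r * y2 s) *\<^sub>R n2 s)"
        unfolding c_def X_def using norm_triangle_ineq[of "(r * y1 s) *\<^sub>R n1 s" "(r * y2 s) *\<^sub>R n2 s"] by (simp add: algebra_simps)
      also have "\<dots> = r * (\<bar>y1 s\<bar> + \<bar>y2 s\<bar>)" using r by (simp add: nn abs_mult algebra_simps)
      also have "\<dots> \<le> 1 * (\<rho> + \<rho>)" using rs r y(3,4)[of s] \<rho>(1) by (intro mult_mono add_mono) auto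
      also have "\<dots> \<le> \<kappa>" using \<rho>s(5) \<rho>(1) by simp
      finally show ?thesis .
    qed
    moreover have "norm (c1 s - g1 s) \<le> \<kappa>" for s
    proof -
      have "norm (c1 s - g1 s) \<le> norm (Q s (y1 s) (y2 s)) + norm ((r * p1 s) *\<^sub>R n1 s) + norm ((r * p2 s) *\<^sub>R n2 s)"
        unfolding c1_def
        using norm_triangle_ineq[of "Q s (y1 s) (y2 s) + (r * p1 s) *\<^sub>R n1 s" "(r * p2 s) *\<^sub>R n2 s"]
          norm_triangle_ineq[of "Q s (y1 s) (y2 s)" "(r * p1 s) *\<^sub>R n1 s"] by (simp add: algebra_simps)
      also have "\<dots> \<le> \<rho> + 2 * \<rho> + 2 * \<rho>"
        unfolding norm_scaleR nn rp using Qb[of s] y(3,4)[of s] fbd[of s] by auto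
      also have "\<dots> \<le> \<kappa>" using \<rho>s(5) \<rho>(1) by simp
      finally show ?thesis .
    qed
    moreover have "\<mu> s > 0" for s
    proof -
      have "Bd s (y1 s) (y2 s) > 0" using Bpos[OF y(3,4), of s s s] vp by linarith
      then show ?thesis using Npos[OF y(3,4), of s s s] r(1) by (simp add: \<mu>_def \<phi>_def)
    qed
    moreover have "continuous_on UNIV \<mu>"
    proof -
      have yc: "continuous_on UNIV y1" "continuous_on UNIV y2"
        using y(5,6) by (auto intro!: continuous_at_imp_continuous_on DERIV_isCont)
      have "continuous_on UNIV (\<lambda>s. \<phi> (fst (s, y1 s, y2 s)) (fst (snd (s, y1 s, y2 s))) (snd (snd (s, y1 s, y2 s))))"
        by (rule continuous_on_compose2[OF \<phi>c]) (use y(3,4) in \<open>auto intro!: continuous_intros yc simp: Bx_def abs_le_iff minus_le_iff\<close>)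
      then show ?thesis unfolding \<mu>_def fst_conv snd_conv by (intro continuous_intros)
    qed
    moreover have "c (s + 1) = c s" for s by (simp add: c_def per y)
    ultimately show "\<exists>c c1 \<mu>. (\<forall>s. c (s + 1) = c s \<and> (c has_vector_derivative c1 s) (at s) \<and> norm (c s - g s) \<le> \<kappa> \<and>
        norm (c1 s - g1 s) \<le> \<kappa> \<and> c1 s = \<mu> s *\<^sub>R V (c s) \<and> \<mu> s > 0) \<and> continuous_on UNIV \<mu>"
      using c1 c1V by blast
  qed
qed

section \<open>Frames and escaping rays\<close>

text \<open>The integral of \<mu> is a new time in which the curve is an integral curve of V, with
  some period P. Rescaling that period to 1 leaves the constant factor P. The image does not
  change.\<close>

lemma reparametrize_field_line:
  fixes V :: "real^3 \<Rightarrow> real^3"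
  assumes p: "\<And>s. c (s + 1) = c s" and d: "\<And>s. (c has_vector_derivative \<mu> s *\<^sub>R V (c s)) (at s)"
    and \<mu>: "\<And>s. \<mu> s > 0" "continuous_on UNIV \<mu>" and nz: "\<And>s. V (c s) \<noteq> 0"
    and inj: "inj_on c {0..<1}"
  obtains b K where "K > 0" "\<And>s. b (s + 1) = b s" "\<And>s. (b has_vector_derivative K *\<^sub>R V (b s)) (at s)"
    "curve_set b = curve_set c" "inj_on b {0..<1}"
proof -
  \<comment> \<open>The velocity and V along c are periodic, and V does not vanish there, so their
    ratio is periodic too.\<close>
  have \<mu>p: "\<mu> (s + 1) = \<mu> s" for s
    using periodic_deriv[of c "\<lambda>s. \<mu> s *\<^sub>R V (c s)" s, OF p d] nz[of s] by (simp add: p)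
  obtain \<Phi> where \<Phi>: "\<And>x. (\<Phi> has_real_derivative \<mu> x) (at x)"
    using einterval_antiderivative[of "-\<infinity>" "\<infinity>" \<mu>] \<mu>(2)
    by (auto simp: has_real_derivative_iff_has_vector_derivative continuous_on_eq_continuous_at)
  define \<tau> where "\<tau> s = \<Phi> s - \<Phi> 0" for s
  have \<tau>: "(\<tau> has_real_derivative \<mu> s) (at s)" for s unfolding \<tau>_def by (auto intro!: derivative_eq_intros \<Phi>)
  have \<tau>0: "\<tau> 0 = 0" by (simp add: \<tau>_def)
  have mono: "\<tau> s < \<tau> t" if "s < t" for s t
    using DERIV_pos_imp_increasing[OF that, of \<tau>] \<tau> \<mu>(1) by blast
  define P where "P = \<tau> 1"
  have P: "P > 0" using mono[of 0 1] by (simp add: P_def \<tau>0)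
  have \<tau>p: "\<tau> (s + 1) = \<tau> s + P" for s
  proof -
    have "((\<lambda>s. \<tau> (s + 1) - \<tau> s) has_real_derivative 0) (at s)" for s
    proof -
      have "((\<lambda>s. \<tau> (s + 1)) has_real_derivative \<mu> (s + 1) * 1) (at s)"
        by (intro DERIV_chain2[OF \<tau>]) (auto intro!: derivative_eq_intros)
      from DERIV_diff[OF this \<tau>] show ?thesis by (simp add: \<mu>p)
    qed
    then have "\<tau> (s + 1) - \<tau> s = \<tau> (0 + 1) - \<tau> 0" by (rule DERIV_isconst_all[rule_format])
    then show ?thesis by (simp add: P_def \<tau>0)
  qed
  have \<tau>n: "\<tau> (of_int k) = of_int k * P" for k :: int
  proof (induction k rule: int_induct[of _ 0])
    case (step1 i) then show ?case using \<tau>p[of "of_int i"] by (simp add: algebra_simps)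
  next
    case (step2 i) then show ?case using \<tau>p[of "of_int i - 1"] by (simp add: algebra_simps)
  qed (simp add: \<tau>0)
  have \<tau>c: "continuous_on A \<tau>" for A using \<tau> by (auto intro!: continuous_at_imp_continuous_on DERIV_isCont)
  have ex: "\<exists>s. \<tau> s = u" for u
  proof -
    define k where "k = \<lfloor>u / P\<rfloor>"
    have "of_int k \<le> u / P" "u / P \<le> of_int (k + 1)" unfolding k_def by linarith+
    then have "\<tau> (of_int k) \<le> u" "u \<le> \<tau> (of_int (k + 1))"
      unfolding \<tau>n using P by (simp_all add: field_simps)
    from IVT'[OF this _ \<tau>c] show ?thesis by auto
  qed
  have inj\<tau>: "s = t" if "\<tau> s = \<tau> t" for s t using mono[of s t] mono[of t s] that by (cases s t rule: linorder_cases) auto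
  define \<sigma> where "\<sigma> u = (THE s. \<tau> s = u)" for u
  have \<sigma>: "\<tau> (\<sigma> u) = u" for u
    unfolding \<sigma>_def by (rule theI') (use ex[of u] inj\<tau> in metis)
  have \<sigma>': "\<sigma> (\<tau> s) = s" for s using inj\<tau> \<sigma> by blast
  have d\<sigma>: "(\<sigma> has_real_derivative inverse (\<mu> (\<sigma> u))) (at u)" for u
  proof -
    have "(\<sigma> has_derivative (*) (inverse (\<mu> (\<sigma> u)))) (at (\<tau> (\<sigma> u)))"
      using \<mu>(1)[of "\<sigma> u"]
      by (intro has_derivative_inverse_strong[OF open_UNIV UNIV_I \<tau>c \<sigma>' \<tau>[unfolded has_field_derivative_def]]) (auto simp: fun_eq_iff)
    then have "(\<sigma> has_real_derivative inverse (\<mu> (\<sigma> u))) (at (\<tau> (\<sigma> u)))" by (simp add: has_field_derivative_def)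
    then show ?thesis by (simp add: \<sigma>)
  qed
  have \<sigma>p: "\<sigma> (u + P) = \<sigma> u + 1" for u
    by (rule inj\<tau>) (simp add: \<sigma> \<tau>p)
  have \<sigma>mono: "\<sigma> u < \<sigma> w" if "u < w" for u w
    using mono[of "\<sigma> w" "\<sigma> u"] that \<sigma> by (metis less_irrefl less_asym linorder_neqE)
  have \<sigma>01: "\<sigma> 0 = 0" "\<sigma> P = 1" using \<sigma>'[of 0] \<sigma>'[of 1] by (auto simp: \<tau>0 P_def)
  define b where "b u = c (\<sigma> (P * u))" for u
  show ?thesis
  proof (rule that[OF P, of b])
    fix s
    show "b (s + 1) = b s" by (simp add: b_def distrib_left \<sigma>p p)
    have "((\<lambda>u. \<sigma> (P * u)) has_real_derivative inverse (\<mu> (\<sigma> (P * s))) * P) (at s)"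
      by (intro DERIV_chain2[OF d\<sigma>]) (auto intro!: derivative_eq_intros)
    then have "((\<lambda>u. \<sigma> (P * u)) has_vector_derivative inverse (\<mu> (\<sigma> (P * s))) * P) (at s)"
      by (simp add: has_real_derivative_iff_has_vector_derivative)
    from vector_diff_chain_at[OF this d]
    have "(b has_vector_derivative (inverse (\<mu> (\<sigma> (P * s))) * P) *\<^sub>R (\<mu> (\<sigma> (P * s)) *\<^sub>R V (b s))) (at s)"
      by (simp add: o_def b_def[abs_def])
    then show "(b has_vector_derivative P *\<^sub>R V (b s)) (at s)"
    proof -
      have "inverse (\<mu> (\<sigma> (P * s))) * P * \<mu> (\<sigma> (P * s)) = P"
        using \<mu>(1)[of "\<sigma> (P * s)"] by (simp add: field_simps)
      then show ?thesis using \<open>(b has_vector_derivative _) _\<close> by (simp only: scaleR_scaleR)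
    qed
  next
    have sub: "\<sigma> (P * u) \<in> {0..1}" if "u \<in> {0..1}" for u
      using that P \<sigma>mono[of 0 "P * u"] \<sigma>mono[of "P * u" P] \<sigma>01 by (cases "u = 0"; cases "u = 1") auto
    show "curve_set b = curve_set c"
    proof (intro equalityI subsetI)
      fix x assume "x \<in> curve_set b" then show "x \<in> curve_set c" using sub by (auto simp: curve_set_def b_def)
    next
      fix x assume "x \<in> curve_set c"
      then obtain s where s: "s \<in> {0..1}" "x = c s" by (auto simp: curve_set_def)
      have "\<tau> s \<in> {0..P}" using s(1) mono[of 0 s] mono[of s 1] \<tau>0 P_def by (cases "s = 0"; cases "s = 1") auto
      then have "\<tau> s / P \<in> {0..1}" using P by simp
      moreover have "x = b (\<tau> s / P)" using P by (simp add: b_def \<sigma>' s)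
      ultimately show "x \<in> curve_set b" by (auto simp: curve_set_def)
    qed
    show "inj_on b {0..<1}"
    proof (rule inj_onI)
      fix u w assume uw: "u \<in> {0..<1}" "w \<in> {0..<1}" "b u = b w"
      have "\<sigma> (P * u) \<in> {0..<1}" if "u \<in> {0..<1}" for u
        using that P \<sigma>mono[of 0 "P * u"] \<sigma>mono[of "P * u" P] \<sigma>01 by (cases "u = 0") auto
      then have "\<sigma> (P * u) = \<sigma> (P * w)" using uw inj by (auto simp: b_def inj_on_def)
      then have "P * u = P * w" using \<sigma> by metis
      then show "u = w" using P by simp
    qed
  qed
qed

text \<open>The cone is a differentiable image of a plane in a three-dimensional space. It serves
  twice: for the tangent directions of a loop, and for the directions in which the link is seen from
  a point.\<close>

lemma negligible_cone:
  assumes g: "\<And>s. (g has_vector_derivative g1 s) (at s)"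
  shows "negligible {l *\<^sub>R (g s - a :: real^3) | l s :: real. True}"
proof -
  define f where "f p = fst p *\<^sub>R (g (snd p) - a)" for p :: "real \<times> real"
  have "f differentiable (at p)" for p
  proof -
    have "((\<lambda>p::real\<times>real. g (snd p)) has_derivative (\<lambda>h. snd h *\<^sub>R g1 (snd p))) (at p)"
      by (rule has_derivative_compose[OF has_derivative_snd[OF has_derivative_ident] g[unfolded has_vector_derivative_def]])
    then have "(\<lambda>p::real\<times>real. g (snd p)) differentiable (at p)" unfolding differentiable_def by blast
    then show ?thesis unfolding f_def
      by (intro differentiable_scaleR differentiable_diff differentiable_const) (auto simp: differentiable_def intro!: exI derivative_eq_intros)
  qed
  then have "negligible (f ` UNIV)"
    by (intro negligible_differentiable_image_lowdim) (auto simp: differentiable_on_def intro: differentiable_at_withinI)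
  moreover have "f ` UNIV = {l *\<^sub>R (g s - a) | l s. True}" by (auto simp: f_def image_def)
  ultimately show ?thesis by simp
qed

lemma bounded_bilinear_cross3: "bounded_bilinear cross3"
  using bilinear_cross bilinear_conv_bounded_bilinear by blast

lemma has_vector_derivative_normalize:
  fixes c :: "real \<Rightarrow> 'a::real_inner"
  assumes d: "(c has_vector_derivative c') (at s)" and nz: "c s \<noteq> 0"
  shows "((\<lambda>s. (1 / norm (c s)) *\<^sub>R c s) has_vector_derivative
     (1 / norm (c s)) *\<^sub>R c' + (- (c s \<bullet> c') / norm (c s) ^ 3) *\<^sub>R c s) (at s)"
proof -
  have "((\<lambda>s. c s \<bullet> c s) has_vector_derivative (c s \<bullet> c' + c' \<bullet> c s)) (at s)"
    by (rule bounded_bilinear.has_vector_derivative[OF bounded_bilinear_inner d d])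
  then have 1: "((\<lambda>s. c s \<bullet> c s) has_real_derivative 2 * (c s \<bullet> c')) (at s)"
    by (simp add: has_real_derivative_iff_has_vector_derivative inner_commute)
  have pos: "c s \<bullet> c s > 0" using nz by simp
  have "((\<lambda>s. 1 / sqrt (c s \<bullet> c s)) has_real_derivative
     - ((inverse (sqrt (c s \<bullet> c s)) / 2 * (2 * (c s \<bullet> c'))) / (sqrt (c s \<bullet> c s))^2)) (at s)"
    using pos nz by (auto intro!: derivative_eq_intros 1 simp: power2_eq_square simp del: inner_gt_zero_iff)
  then have "((\<lambda>s. 1 / norm (c s)) has_real_derivative (- (c s \<bullet> c') / norm (c s) ^ 3)) (at s)"
    using nz by (simp add: norm_eq_sqrt_inner[symmetric] field_simps power3_eq_cube power2_eq_square)
  then show ?thesis by (intro has_vector_derivative_scaleR d)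
qed

text \<open>Tangent directions fill only a null cone, so some fixed vector a is parallel to none of
  them. Then a x g1 never vanishes, and normalising it gives a normal field that closes up after one
  period, with no holonomy to correct.\<close>

lemma normal_frame_exists:
  assumes g: "C2loop g g1 g2"
  obtains n1 n2 m1 m2 where
    "\<And>s. n1 (s + 1) = n1 s" "\<And>s. n2 (s + 1) = n2 s" "\<And>s. m1 (s + 1) = m1 s" "\<And>s. m2 (s + 1) = m2 s"
    "\<And>s. (n1 has_vector_derivative m1 s) (at s)" "\<And>s. (n2 has_vector_derivative m2 s) (at s)"
    "\<And>s. n1 s \<bullet> n1 s = 1" "\<And>s. n2 s \<bullet> n2 s = 1" "\<And>s. n1 s \<bullet> n2 s = 0" "\<And>s. n1 s \<bullet> g1 s = 0" "\<And>s. n2 s \<bullet> g1 s = 0"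
    "\<And>s. cross3 (n1 s) (n2 s) = (1 / norm (g1 s)) *\<^sub>R g1 s" "continuous_on UNIV m1" "continuous_on UNIV m2"
proof -
  note G = C2loopD[OF g]
  have "negligible {l *\<^sub>R (g1 s - 0) | l s :: real. True}" by (rule negligible_cone[OF G(5)])
  then have "{l *\<^sub>R (g1 s - 0) | l s :: real. True} \<noteq> UNIV"
    using non_negligible_UNIV[where 'a="real^3"] by force
  then obtain a where a: "a \<notin> {l *\<^sub>R (g1 s - 0) | l s :: real. True}"
    by blast
  define c where "c s = cross3 a (g1 s)" for s
  define c' where "c' s = cross3 a (g2 s)" for s
  have cnz: "c s \<noteq> 0" for s
  proof
    assume "c s = 0"
    then have "collinear {0, a, g1 s}" by (simp add: c_def cross_eq_0)
    then have "a = 0 \<or> g1 s = 0 \<or> (\<exists>k. g1 s = k *\<^sub>R a)" by (simp add: collinear_lemma)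
    moreover have "a \<noteq> 0" using a by (metis (mono_tags, lifting) mem_Collect_eq scaleR_zero_left)
    ultimately obtain k where k: "g1 s = k *\<^sub>R a" using G(6) by blast
    then have "k \<noteq> 0" using G(6)[of s] by auto
    then have "a = (1/k) *\<^sub>R (g1 s - 0)" using k by simp
    then show False using a by blast
  qed
  have dc: "(c has_vector_derivative c' s) (at s)" for s
    unfolding c_def[abs_def] c'_def
    using bounded_bilinear.has_vector_derivative[OF bounded_bilinear_cross3 has_vector_derivative_const G(5), of a s]
    by simp
  define n1 where "n1 s = (1 / norm (c s)) *\<^sub>R c s" for s
  define m1 where "m1 s = (1 / norm (c s)) *\<^sub>R c' s + (- (c s \<bullet> c' s) / norm (c s) ^ 3) *\<^sub>R c s" for s
  define T where "T s = (1 / norm (g1 s)) *\<^sub>R g1 s" for s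
  define T' where "T' s = (1 / norm (g1 s)) *\<^sub>R g2 s + (- (g1 s \<bullet> g2 s) / norm (g1 s) ^ 3) *\<^sub>R g1 s" for s
  have d1: "(n1 has_vector_derivative m1 s) (at s)" for s
    unfolding n1_def[abs_def] m1_def by (rule has_vector_derivative_normalize[OF dc cnz])
  have dT: "(T has_vector_derivative T' s) (at s)" for s
    unfolding T_def[abs_def] T'_def by (rule has_vector_derivative_normalize[OF G(5) G(6)])
  \<comment> \<open>The order of the factors makes n1 x n2 the unit tangent T.\<close>
  define n2 where "n2 s = cross3 (T s) (n1 s)" for s
  define m2 where "m2 s = cross3 (T s) (m1 s) + cross3 (T' s) (n1 s)" for s
  have d2: "(n2 has_vector_derivative m2 s) (at s)" for s
    unfolding n2_def[abs_def] m2_def by (rule bounded_bilinear.has_vector_derivative[OF bounded_bilinear_cross3 dT d1])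
  have cc: "continuous_on UNIV c" "continuous_on UNIV c'"
    unfolding c_def[abs_def] c'_def[abs_def]
    by (intro bounded_bilinear.continuous_on[OF bounded_bilinear_cross3] continuous_intros G)+
  have m1c: "continuous_on UNIV m1" unfolding m1_def[abs_def]
    using cnz by (intro continuous_intros cc) auto
  have n1c: "continuous_on UNIV n1" unfolding n1_def[abs_def]
    using cnz by (intro continuous_intros cc) auto
  have Tc: "continuous_on UNIV T" "continuous_on UNIV T'" unfolding T_def[abs_def] T'_def[abs_def]
    using G(6) by (intro continuous_intros G; auto)+
  have m2c: "continuous_on UNIV m2" unfolding m2_def[abs_def]
    by (intro continuous_intros bounded_bilinear.continuous_on[OF bounded_bilinear_cross3] Tc n1c m1c)
  have nn: "n1 s \<bullet> n1 s = 1" for s using cnz[of s] by (simp add: n1_def dot_square_norm power2_eq_square)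
  have TT: "T s \<bullet> T s = 1" for s using G(6)[of s] by (simp add: T_def dot_square_norm power2_eq_square)
  have n1g: "n1 s \<bullet> g1 s = 0" for s by (simp add: n1_def c_def dot_cross_self)
  have n1T: "n1 s \<bullet> T s = 0" for s by (simp add: T_def n1g)
  have n2g: "n2 s \<bullet> g1 s = 0" for s by (simp add: n2_def T_def cross_mult_left dot_cross_self)
  have n12: "n1 s \<bullet> n2 s = 0" for s by (simp add: n2_def dot_cross_self)
  have cr: "cross3 (n1 s) (n2 s) = T s" for s
    by (simp add: n2_def Lagrange nn n1T)
  have n22: "n2 s \<bullet> n2 s = 1" for s
    by (simp add: n2_def dot_cross nn TT n1T inner_commute[of "T s"])
  show ?thesis
    by (rule that[of n1 n2 m1 m2, OF _ _ _ _ d1 d2 nn n22 n12 n1g n2g cr[unfolded T_def] m1c m2c])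
      (simp_all add: n1_def m1_def n2_def m2_def c_def c'_def T_def T'_def G)
qed

text \<open>The directions from p that meet the link lie in finitely many null cones, while an open
  half-space is not null.\<close>

lemma escape_direction:
  fixes g g1 g2 :: "nat \<Rightarrow> real \<Rightarrow> real^3" and p :: "real^3"
  assumes g: "\<And>j. j < n \<Longrightarrow> C2loop (g j) (g1 j) (g2 j)" and e: "e \<noteq> (0::real^3)"
  obtains v where "norm v = 1" "v \<bullet> e > 0" "\<And>t j s. t > 0 \<Longrightarrow> j < n \<Longrightarrow> p + t *\<^sub>R v \<noteq> g j s"
proof -
  define B where "B = (\<Union>j<n. {l *\<^sub>R (g j s - p) | l s :: real. True})"
  have "negligible B" unfolding B_def
  proof (rule negligible_Union)
    fix t assume "t \<in> (\<lambda>j. {l *\<^sub>R (g j s - p) | l s :: real. True}) ` {..<n}"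
    then obtain j where j: "j < n" "t = {l *\<^sub>R (g j s - p) | l s :: real. True}" by blast
    show "negligible t" unfolding j(2) by (rule negligible_cone[OF C2loopD(4)[OF g[OF j(1)]]])
  qed simp
  have "open {v. v \<bullet> e > 0}" by (intro open_Collect_less continuous_intros)
  moreover have "e \<in> {v. v \<bullet> e > 0}" using e by simp
  ultimately have "\<not> negligible {v. v \<bullet> e > 0}" using open_not_negligible by blast
  then obtain u where u: "u \<bullet> e > 0" "u \<notin> B"
    using \<open>negligible B\<close> negligible_subset[of B "{v. v \<bullet> e > 0}"] by blast
  then have u0: "u \<noteq> 0" by auto
  show ?thesis
  proof (rule that[of "(1 / norm u) *\<^sub>R u"])
    show "norm ((1 / norm u) *\<^sub>R u) = 1" "((1 / norm u) *\<^sub>R u) \<bullet> e > 0" using u u0 by auto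
    fix t :: real and j s assume *: "t > 0" "j < n"
    show "p + t *\<^sub>R ((1 / norm u) *\<^sub>R u) \<noteq> g j s"
    proof
      assume "p + t *\<^sub>R ((1 / norm u) *\<^sub>R u) = g j s"
      then have "(t / norm u) *\<^sub>R u = g j s - p" by (metis add_diff_cancel_left' scaleR_scaleR times_divide_eq_right mult.right_neutral)
      then have "(norm u / t) *\<^sub>R (t / norm u) *\<^sub>R u = (norm u / t) *\<^sub>R (g j s - p)" by simp
      then have "u = (norm u / t) *\<^sub>R (g j s - p)" using * u0 by simp
      then show False using u(2) * unfolding B_def by blast
    qed
  qed
qed

lemma isCont_tendsto_nhds: "isCont f x \<Longrightarrow> (f \<longlongrightarrow> f x) (nhds x)"
  by (simp add: isCont_def tendsto_at_iff_tendsto_nhds)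

text \<open>One direction v serves all parameters near s0. Against the nearby arc the test vector e
  = d s0 is used: the displacement contributes order r, the ray contributes a positive multiple of
  t, and the arc contributes little because its tangent is nearly orthogonal to e. The rest of the
  link has positive distance from the ray issuing at g i s0, which absorbs small changes of s and
  r.\<close>

lemma ray_escape_local:
  fixes g g1 g2 :: "nat \<Rightarrow> real \<Rightarrow> real^3"
  assumes g: "\<And>j. j < n \<Longrightarrow> C2loop (g j) (g1 j) (g2 j)"
    and disj: "\<And>i j. i < n \<Longrightarrow> j < n \<Longrightarrow> i \<noteq> j \<Longrightarrow> range (g i) \<inter> range (g j) = {}"
    and i: "i < n" and dc: "continuous_on UNIV d" and dn: "\<And>s. d s \<bullet> g1 i s = 0" "\<And>s. d s \<noteq> 0"
  obtains c \<delta> v where "c > 0" "\<delta> > 0" "norm v = 1"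
    "\<And>s r t j \<sigma>. \<bar>s - s0\<bar> < \<delta> \<Longrightarrow> 0 < r \<Longrightarrow> r < \<delta> \<Longrightarrow> 0 \<le> t \<Longrightarrow> j < n \<Longrightarrow>
       c * r \<le> norm (g i s + r *\<^sub>R d s + t *\<^sub>R v - g j \<sigma>)"
proof -
  note G = C2loopD[OF g]
  define e where "e = d s0"
  have e: "e \<noteq> 0" using dn(2) by (simp add: e_def)
  obtain v where v: "norm v = 1" "v \<bullet> e > 0" "\<And>t j s. t > 0 \<Longrightarrow> j < n \<Longrightarrow> g i s0 + t *\<^sub>R v \<noteq> g j s"
    using escape_direction[of n g g1 g2 e "g i s0", OF g e] by metis
  obtain m where m: "m > 0" "\<And>s t. \<bar>s - t\<bar> \<le> 1/2 \<Longrightarrow> norm (g i s - g i t) \<ge> m * \<bar>s - t\<bar>"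
    using C2loop_bilipschitz[OF g[OF i]] by metis
  define b where "b = v \<bullet> e"
  define D where "D = norm e + 1"
  have D: "D > 0" by (simp add: D_def add_nonneg_pos)
  \<comment> \<open>The slope of the arc in direction e. The three entries of the minimum let the
    drift of the arc be absorbed by the terms in r, in t and in norm w respectively.\<close>
  define \<epsilon> where "\<epsilon> = m * min (min ((norm e)\<^sup>2 / (4 * D)) b) (norm e)"
  have eps: "\<epsilon> > 0" "\<epsilon> / m * D \<le> (norm e)\<^sup>2 / 4" "\<epsilon> / m \<le> b" "\<epsilon> / m \<le> norm e"
  proof -
    have x: "\<epsilon> / m = min (min ((norm e)\<^sup>2 / (4 * D)) b) (norm e)" using m(1) by (simp add: \<epsilon>_def)
    show "\<epsilon> > 0" using m(1) D e v(2) by (simp add: \<epsilon>_def b_def)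
    show "\<epsilon> / m \<le> b" "\<epsilon> / m \<le> norm e" unfolding x by auto
    have "\<epsilon> / m \<le> (norm e)\<^sup>2 / (4 * D)" unfolding x by auto
    from mult_right_mono[OF this less_imp_le[OF D]] show "\<epsilon> / m * D \<le> (norm e)\<^sup>2 / 4" using D by simp
  qed
  have "isCont (\<lambda>s. g1 i s \<bullet> e) s0" "isCont (\<lambda>s. d s \<bullet> e) s0" "isCont d s0"
    using G(8)[OF i, of UNIV] dc by (auto simp: continuous_on_eq_continuous_at intro!: continuous_intros)
  then have "eventually (\<lambda>s. \<bar>g1 i s \<bullet> e\<bar> < \<epsilon> \<and> (norm e)\<^sup>2 / 2 < d s \<bullet> e \<and> norm (d s) < D) (nhds s0)"
  proof (intro eventually_conj)
    assume *: "isCont (\<lambda>s. g1 i s \<bullet> e) s0" "isCont (\<lambda>s. d s \<bullet> e) s0" "isCont d s0"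
    have "((\<lambda>s. \<bar>g1 i s \<bullet> e\<bar>) \<longlongrightarrow> \<bar>g1 i s0 \<bullet> e\<bar>) (nhds s0)"
      by (intro tendsto_rabs isCont_tendsto_nhds[OF *(1)])
    moreover have "g1 i s0 \<bullet> e = 0" using dn(1)[of s0] by (simp add: e_def inner_commute)
    ultimately show "eventually (\<lambda>s. \<bar>g1 i s \<bullet> e\<bar> < \<epsilon>) (nhds s0)" using eps(1) by (auto dest!: order_tendstoD(2))
    have "((\<lambda>s. d s \<bullet> e) \<longlongrightarrow> d s0 \<bullet> e) (nhds s0)" by (rule isCont_tendsto_nhds[OF *(2)])
    moreover have "(norm e)\<^sup>2 / 2 < d s0 \<bullet> e" using e by (simp add: e_def power2_norm_eq_inner)
    ultimately show "eventually (\<lambda>s. (norm e)\<^sup>2 / 2 < d s \<bullet> e) (nhds s0)" by (rule order_tendstoD(1))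
    have "((\<lambda>s. norm (d s)) \<longlongrightarrow> norm (d s0)) (nhds s0)" by (intro tendsto_norm isCont_tendsto_nhds[OF *(3)])
    then show "eventually (\<lambda>s. norm (d s) < D) (nhds s0)" by (rule order_tendstoD(2)) (simp add: D_def e_def)
  qed
  then obtain \<delta>1 where \<delta>1: "\<delta>1 > 0" "\<And>s. \<bar>s - s0\<bar> < \<delta>1 \<Longrightarrow> \<bar>g1 i s \<bullet> e\<bar> < \<epsilon> \<and> (norm e)\<^sup>2 / 2 < d s \<bullet> e \<and> norm (d s) < D"
    unfolding eventually_nhds_metric by (auto simp: dist_real_def)
  define \<delta>2 where "\<delta>2 = min \<delta>1 (1/4)"
  have \<delta>2: "\<delta>2 > 0" "\<delta>2 \<le> \<delta>1" "\<delta>2 \<le> 1/4" using \<delta>1 by (auto simp: \<delta>2_def)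
  have near: "norm e / 8 * r \<le> norm (g i s + r *\<^sub>R d s + t *\<^sub>R v - g i \<sigma>)"
    if s: "\<bar>s - s0\<bar> < \<delta>2" "\<bar>\<sigma> - s0\<bar> < \<delta>2" "0 < r" "0 \<le> t" for s \<sigma> r t
  proof -
    define w where "w = g i s + r *\<^sub>R d s + t *\<^sub>R v - g i \<sigma>"
    have S: "\<bar>g i \<sigma> \<bullet> e - g i s \<bullet> e\<bar> \<le> \<epsilon> * \<bar>\<sigma> - s\<bar>"
    proof -
      have "norm (g i \<sigma> \<bullet> e - g i s \<bullet> e) \<le> \<epsilon> * norm (\<sigma> - s)"
      proof (rule differentiable_bound[of "{s0-\<delta>2<..<s0+\<delta>2}" "\<lambda>x. g i x \<bullet> e" "\<lambda>x h. h *\<^sub>R (g1 i x \<bullet> e)"])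
        fix x assume x: "x \<in> {s0-\<delta>2<..<s0+\<delta>2}"
        have "((\<lambda>x. g i x \<bullet> e) has_derivative (\<lambda>h. (h *\<^sub>R g1 i x) \<bullet> e)) (at x)"
          using G(4)[OF i, of x] unfolding has_vector_derivative_def by (rule has_derivative_inner_left)
        then show "((\<lambda>x. g i x \<bullet> e) has_derivative (\<lambda>h. h *\<^sub>R (g1 i x \<bullet> e))) (at x within {s0-\<delta>2<..<s0+\<delta>2})"
          by (simp add: has_derivative_at_withinI)
        have "\<bar>x - s0\<bar> < \<delta>1" using x \<delta>2 by (auto simp: abs_less_iff)
        then show "onorm (\<lambda>h. h *\<^sub>R (g1 i x \<bullet> e)) \<le> \<epsilon>" using \<delta>1(2) by (intro onorm_scaleR_le) (simp add: less_imp_le)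
      qed (use s in \<open>auto simp: abs_less_iff\<close>)
      then show ?thesis by simp
    qed
    have ds: "(norm e)\<^sup>2 / 2 < d s \<bullet> e" "norm (d s) < D" using \<delta>1(2)[of s] s \<delta>2 by auto
    have st: "\<bar>\<sigma> - s\<bar> \<le> 1/2" using s \<delta>2 by linarith
    \<comment> \<open>The gap between the parameters is itself bounded through norm w, the quantity
      to be estimated from below; \<epsilon> is small enough for that circular dependence to
      close.\<close>
    have "m * \<bar>\<sigma> - s\<bar> \<le> norm (g i \<sigma> - g i s)" by (rule m(2)[OF st])
    also have "g i \<sigma> - g i s = r *\<^sub>R d s + t *\<^sub>R v - w" by (simp add: w_def)
    also have "norm \<dots> \<le> norm (r *\<^sub>R d s) + norm (t *\<^sub>R v) + norm w"
      using norm_triangle_ineq4[of "r *\<^sub>R d s + t *\<^sub>R v" w] norm_triangle_ineq[of "r *\<^sub>R d s" "t *\<^sub>R v"] by linarith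
    also have "\<dots> \<le> r * D + t + norm w" using s ds v(1) by simp
    finally have up: "\<bar>\<sigma> - s\<bar> \<le> (r * D + t + norm w) / m" using m(1) by (simp add: field_simps)
    have "\<epsilon> * \<bar>\<sigma> - s\<bar> \<le> \<epsilon> * ((r * D + t + norm w) / m)" using eps(1) up by (intro mult_left_mono) auto
    also have "\<dots> = r * (\<epsilon> / m * D) + t * (\<epsilon> / m) + norm w * (\<epsilon> / m)" by (simp add: algebra_simps add_divide_distrib)
    also have "\<dots> \<le> r * ((norm e)\<^sup>2 / 4) + t * b + norm w * norm e"
      using s eps by (intro add_mono mult_left_mono) auto
    finally have 1: "\<epsilon> * \<bar>\<sigma> - s\<bar> \<le> r * ((norm e)\<^sup>2 / 4) + t * b + norm w * norm e" .
    have "w \<bullet> e = r * (d s \<bullet> e) + t * b - (g i \<sigma> \<bullet> e - g i s \<bullet> e)"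
      by (simp add: w_def b_def inner_add_left inner_diff_left)
    moreover have "r * (d s \<bullet> e) \<ge> r * ((norm e)\<^sup>2 / 2)" using s ds by (intro mult_left_mono) auto
    moreover have "w \<bullet> e \<le> norm w * norm e" by (rule norm_cauchy_schwarz)
    ultimately have "r * ((norm e)\<^sup>2 / 4) \<le> 2 * (norm w * norm e)" using 1 S by linarith
    then have "(norm e / 8 * r) * norm e \<le> norm w * norm e" by (simp add: power2_eq_square mult_ac)
    then show ?thesis using e by (simp add: w_def mult.commute)
  qed
  \<comment> \<open>The whole link except the arc of component i around s0.\<close>
  define A where "A = (\<Union>j\<in>{..<n} - {i}. g j ` {0..1}) \<union> g i ` {s0 + \<delta>2..s0 + 1 - \<delta>2}"
  have cA: "compact A" unfolding A_def
    using G(7) i by (intro compact_Un compact_UN compact_continuous_image) auto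
  have rg: "g j \<sigma> \<in> g j ` {0..1}" if "j < n" for j \<sigma>
  proof -
    have "g j (frac \<sigma>) = g j \<sigma>" using periodic_int[where g="g j" and k="- \<lfloor>\<sigma>\<rfloor>" and s=\<sigma>, OF G(1)[OF that]] by (simp add: frac_def)
    moreover have "frac \<sigma> \<in> {0..1}" using frac_lt_1[of \<sigma>] by (simp add: less_imp_le)
    ultimately show ?thesis by (metis imageI)
  qed
  define Ry where "Ry = (\<lambda>t. g i s0 + t *\<^sub>R v) ` {0..}"
  have cR: "closed Ry"
  proof -
    have v0: "v \<noteq> 0" using v(1) by auto
    have "closed ((\<lambda>x. g i s0 + x) ` (\<lambda>t. t *\<^sub>R v) ` {0..})"
      using closed_injective_linear_image[of "{0..}" "\<lambda>t. t *\<^sub>R v"] v0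
      by (intro closed_translation) (auto simp: inj_on_def linear_iff algebra_simps)
    then show ?thesis by (simp add: Ry_def image_image)
  qed
  have disjA: "Ry \<inter> A = {}"
  proof -
    have "g i s0 + t *\<^sub>R v \<notin> A" if "t \<ge> 0" for t
    proof (cases "t = 0")
      case False
      then have "t > 0" using that by simp
      from v(3)[OF this] i show ?thesis by (auto simp: A_def)
    next
      case True
      have "g i s0 \<noteq> g j x" if "j < n" "j \<noteq> i" for j x using disj[OF i that(1)] that by blast
      moreover have "g i s0 \<noteq> g i x" if x: "x \<in> {s0 + \<delta>2..s0 + 1 - \<delta>2}" for x
      proof
        assume "g i s0 = g i x"
        from C2loop_inj[OF g[OF i] this] obtain k :: int where k: "s0 = x + of_int k" by metis
        then have "(of_int k :: real) < of_int 0" "of_int (-1) < (of_int k :: real)" using x \<delta>2 by auto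
        then have "k < 0" "-1 < k" unfolding of_int_less_iff by auto
        then show False by linarith
      qed
      ultimately have "g i s0 \<notin> A" unfolding A_def by blast
      then show ?thesis using True by simp
    qed
    then show ?thesis by (auto simp: Ry_def)
  qed
  obtain \<eta> where \<eta>: "\<eta> > 0" "\<And>x y. x \<in> A \<Longrightarrow> y \<in> Ry \<Longrightarrow> \<eta> \<le> dist x y"
    using separate_compact_closed[OF cA cR] disjA by (metis Int_commute)
  have "isCont (g i) s0" using G(7)[OF i, of UNIV] by (simp add: continuous_on_eq_continuous_at)
  then obtain \<delta>3 where \<delta>3: "\<delta>3 > 0" "\<And>s. \<bar>s - s0\<bar> < \<delta>3 \<Longrightarrow> norm (g i s - g i s0) < \<eta> / 4"
    using \<eta>(1) unfolding continuous_at_eps_delta by (metis dist_norm real_norm_def zero_less_divide_iff zero_less_numeral)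
  define \<delta> where "\<delta> = Min {\<delta>2, \<delta>3, \<eta> / (4 * D)}"
  have \<delta>: "\<delta> > 0" "\<delta> \<le> \<delta>2" "\<delta> \<le> \<delta>3" "\<delta> \<le> \<eta> / (4 * D)" using \<delta>2 \<delta>3 \<eta> D by (auto simp: \<delta>_def)
  define c where "c = min (norm e / 8) D"
  have c: "c > 0" "c \<le> norm e / 8" "c \<le> D" using e D by (auto simp: c_def)
  show ?thesis
  proof (rule that[OF c(1) \<delta>(1) v(1)])
    fix s r t \<sigma> :: real and j assume h: "\<bar>s - s0\<bar> < \<delta>" "0 < r" "r < \<delta>" "0 \<le> t" "j < n"
    have far: "c * r \<le> norm (g i s + r *\<^sub>R d s + t *\<^sub>R v - x)" if "x \<in> A" for x
    proof -
      have "\<eta> \<le> dist x (g i s0 + t *\<^sub>R v)" using that h by (intro \<eta>(2)) (auto simp: Ry_def)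
      also have "\<dots> \<le> norm (g i s + r *\<^sub>R d s + t *\<^sub>R v - x) + norm (g i s - g i s0 + r *\<^sub>R d s)"
        using norm_triangle_ineq4[of "g i s + r *\<^sub>R d s + t *\<^sub>R v - x" "g i s - g i s0 + r *\<^sub>R d s"]
        by (simp add: dist_norm norm_minus_commute algebra_simps)
      finally have A1: "\<eta> \<le> norm (g i s + r *\<^sub>R d s + t *\<^sub>R v - x) + norm (g i s - g i s0 + r *\<^sub>R d s)" .
      have A2: "norm (g i s - g i s0 + r *\<^sub>R d s) \<le> \<eta> / 4 + r * D"
      proof -
        have "norm (g i s - g i s0) \<le> \<eta> / 4" using \<delta>3(2)[of s] h \<delta> by simp
        moreover have "norm (d s) \<le> D" using \<delta>1(2)[of s] h \<delta> \<delta>2 by simp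
        then have "norm (r *\<^sub>R d s) \<le> r * D" using h by simp
        ultimately show ?thesis using norm_triangle_ineq[of "g i s - g i s0" "r *\<^sub>R d s"] by linarith
      qed
      have A3: "r * D \<le> \<eta> / 4"
      proof -
        have "r \<le> \<eta> / (4 * D)" using h \<delta> by linarith
        from mult_right_mono[OF this less_imp_le[OF D]] show ?thesis using D by simp
      qed
      have "norm (g i s + r *\<^sub>R d s + t *\<^sub>R v - x) \<ge> \<eta> / 4" using A1 A2 A3 \<eta>(1) by linarith
      moreover have "c * r \<le> r * D" using c(3) h(2) by (simp add: mult.commute)
      then have "c * r \<le> \<eta> / 4" using A3 by linarith
      ultimately show ?thesis by linarith
    qed
    show "c * r \<le> norm (g i s + r *\<^sub>R d s + t *\<^sub>R v - g j \<sigma>)"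
    proof (cases "j = i")
      case False
      then have "g j \<sigma> \<in> A" using rg[OF h(5), of \<sigma>] h(5) by (auto simp: A_def)
      then show ?thesis by (rule far)
    next
      case True
      define k where "k = \<lfloor>\<sigma> - (s0 - \<delta>2)\<rfloor>"
      define \<sigma>' where "\<sigma>' = \<sigma> - of_int k"
      have \<sigma>': "s0 - \<delta>2 \<le> \<sigma>'" "\<sigma>' < s0 - \<delta>2 + 1" unfolding \<sigma>'_def k_def by linarith+
      have ge: "g i \<sigma>' = g i \<sigma>" using periodic_int[where g="g i" and k="-k" and s=\<sigma>, OF G(1)[OF i]] by (simp add: \<sigma>'_def)
      show ?thesis
      proof (cases "\<bar>\<sigma>' - s0\<bar> < \<delta>2")
        case near': True
        have "c * r \<le> norm e / 8 * r" using c h by (intro mult_right_mono) auto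
        also have "\<dots> \<le> norm (g i s + r *\<^sub>R d s + t *\<^sub>R v - g i \<sigma>')" using near[OF _ near' h(2,4)] h \<delta> by auto
        finally show ?thesis using True ge by simp
      next
        case far': False
        show ?thesis
        proof (cases "\<sigma>' = s0 - \<delta>2")
          case True
          moreover have "s0 + 1 - \<delta>2 = (s0 - \<delta>2) + 1" by simp
          ultimately have "g i \<sigma> = g i (s0 + 1 - \<delta>2)" using ge G(1)[OF i, of "s0 - \<delta>2"] by metis
          moreover have "s0 + 1 - \<delta>2 \<in> {s0 + \<delta>2..s0 + 1 - \<delta>2}" using \<delta>2 by auto
          ultimately have "g i \<sigma> \<in> A" by (auto simp: A_def)
          then show ?thesis using far \<open>j = i\<close> by simp
        next
          case False
          then have "\<sigma>' \<in> {s0 + \<delta>2..s0 + 1 - \<delta>2}" using \<sigma>' far' by auto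
          then have "g i \<sigma> \<in> A" unfolding A_def ge[symmetric] by blast
          then show ?thesis using far \<open>j = i\<close> by simp
        qed
      qed
    qed
  qed
qed

text \<open>Finitely many of the local directions cover the period, so c and \<delta> become
  uniform. The direction may jump with s, which does no harm as each source is moved
  separately.\<close>

lemma ray_escape:
  fixes g g1 g2 :: "nat \<Rightarrow> real \<Rightarrow> real^3"
  assumes g: "\<And>j. j < n \<Longrightarrow> C2loop (g j) (g1 j) (g2 j)"
    and disj: "\<And>i j. i < n \<Longrightarrow> j < n \<Longrightarrow> i \<noteq> j \<Longrightarrow> range (g i) \<inter> range (g j) = {}"
    and i: "i < n" and dc: "continuous_on UNIV d" and dn: "\<And>s. d s \<bullet> g1 i s = 0" "\<And>s. d s \<noteq> 0"
  obtains c \<delta> where "c > 0" "\<delta> > 0"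
    "\<And>s r. s \<in> {0..1} \<Longrightarrow> 0 < r \<Longrightarrow> r < \<delta> \<Longrightarrow> \<exists>v. norm v = 1 \<and>
       (\<forall>t\<ge>0. \<forall>j<n. \<forall>\<sigma>. c * r \<le> norm (g i s + r *\<^sub>R d s + t *\<^sub>R v - g j \<sigma>))"
proof -
  have "\<exists>c \<delta> v. c > 0 \<and> \<delta> > 0 \<and> norm v = 1 \<and> (\<forall>s r t j \<sigma>. \<bar>s - s0\<bar> < \<delta> \<longrightarrow> 0 < r \<longrightarrow> r < \<delta> \<longrightarrow> 0 \<le> t \<longrightarrow> j < n \<longrightarrow>
       c * r \<le> norm (g i s + r *\<^sub>R d s + t *\<^sub>R v - g j \<sigma>))" for s0
    by (rule ray_escape_local[of n g g1 g2 i d s0, OF g disj i dc dn]) blast+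
  then obtain C \<Delta> v where X: "\<And>s0. C s0 > 0" "\<And>s0. \<Delta> s0 > 0" "\<And>s0. norm (v s0) = 1"
    "\<And>s0 s r t j \<sigma>. \<bar>s - s0\<bar> < \<Delta> s0 \<Longrightarrow> 0 < r \<Longrightarrow> r < \<Delta> s0 \<Longrightarrow> 0 \<le> t \<Longrightarrow> j < n \<Longrightarrow>
       C s0 * r \<le> norm (g i s + r *\<^sub>R d s + t *\<^sub>R v s0 - g j \<sigma>)"
    by metis
  have "{0..1::real} \<subseteq> (\<Union>s0\<in>{0..1}. ball s0 (\<Delta> s0))" using X(2) by auto
  from compactE_image[OF compact_Icc _ this] obtain F where F: "F \<subseteq> {0..1}" "finite F" "{0..1} \<subseteq> (\<Union>s0\<in>F. ball s0 (\<Delta> s0))"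
    by (metis open_ball)
  have "F \<noteq> {}" using F(3) by force
  define c where "c = Min (C ` F)"
  define \<delta> where "\<delta> = Min (\<Delta> ` F)"
  have cd: "c > 0" "\<delta> > 0" using F(2) \<open>F \<noteq> {}\<close> X(1,2) by (auto simp: c_def \<delta>_def)
  show ?thesis
  proof (rule that[OF cd])
    fix s r :: real assume h: "s \<in> {0..1}" "0 < r" "r < \<delta>"
    then obtain s0 where s0: "s0 \<in> F" "\<bar>s - s0\<bar> < \<Delta> s0" using F(3) by (auto simp: dist_real_def abs_minus_commute)
    have "c \<le> C s0" "\<delta> \<le> \<Delta> s0" using s0 F(2) by (auto simp: c_def \<delta>_def)
    then have "c * r \<le> norm (g i s + r *\<^sub>R d s + t *\<^sub>R v s0 - g j \<sigma>)" if "t \<ge> 0" "j < n" for t j \<sigma>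
      using X(4)[OF s0(2) h(2) _ that, of \<sigma>] h mult_right_mono[of c "C s0" r] by linarith
    then show "\<exists>v. norm v = 1 \<and> (\<forall>t\<ge>0. \<forall>j<n. \<forall>\<sigma>. c * r \<le> norm (g i s + r *\<^sub>R d s + t *\<^sub>R v - g j \<sigma>))"
      using X(3) by blast
  qed
qed

section \<open>Thin wires\<close>

lemma continuous_antiderivative:
  fixes f :: "real \<Rightarrow> real"
  assumes "continuous_on UNIV f"
  obtains F where "\<And>x. (F has_real_derivative f x) (at x)"
    "\<And>a b. a \<le> b \<Longrightarrow> integral {a..b} f = F b - F a"
proof -
  obtain F where F: "\<And>x. (F has_real_derivative f x) (at x)"
    using einterval_antiderivative[of "-\<infinity>" "\<infinity>" f] assms
    by (auto simp: has_real_derivative_iff_has_vector_derivative continuous_on_eq_continuous_at)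
  show ?thesis
  proof (rule that[OF F])
    fix a b :: real assume "a \<le> b"
    then have "(f has_integral (F b - F a)) {a..b}"
      using F by (intro fundamental_theorem_of_calculus)
        (auto simp: has_real_derivative_iff_has_vector_derivative intro: has_vector_derivative_at_within)
    then show "integral {a..b} f = F b - F a" by (rule integral_unique)
  qed
qed

lemma integral_periodic_window:
  fixes f :: "real \<Rightarrow> real"
  assumes p: "\<And>s. f (s + 1) = f s" and c: "continuous_on UNIV f"
  shows "integral {a..a+1} f = integral {b..b+1} f"
proof -
  obtain F where F: "\<And>x. (F has_real_derivative f x) (at x)"
    "\<And>a b. a \<le> b \<Longrightarrow> integral {a..b} f = F b - F a" using continuous_antiderivative[OF c] by metis
  have "((\<lambda>s. F (s + 1) - F s) has_real_derivative 0) (at s)" for s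
  proof -
    have "((\<lambda>s. F (s + 1)) has_real_derivative f (s + 1) * 1) (at s)"
      by (intro DERIV_chain2[OF F(1)]) (auto intro!: derivative_eq_intros)
    from DERIV_diff[OF this F(1)] show ?thesis by (simp add: p)
  qed
  then have "F (a + 1) - F a = F (b + 1) - F b" by (rule DERIV_isconst_all[rule_format])
  then show ?thesis by (simp add: F(2))
qed

lemma integral_rescale:
  fixes f :: "real \<Rightarrow> real"
  assumes c: "continuous_on UNIV f" and r: "r > 0" and l: "l \<ge> 0"
  shows "(1 / r) * integral {a - r * l..a + r * l} f = integral {-l..l} (\<lambda>\<sigma>. f (a + r * \<sigma>))"
proof -
  obtain F where F: "\<And>x. (F has_real_derivative f x) (at x)"
    "\<And>a b. a \<le> b \<Longrightarrow> integral {a..b} f = F b - F a" using continuous_antiderivative[OF c] by metis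
  have "((\<lambda>\<sigma>. F (a + r * \<sigma>) / r) has_real_derivative f (a + r * \<sigma>)) (at \<sigma>)" for \<sigma>
    using r by (auto intro!: derivative_eq_intros DERIV_chain2[OF F(1)])
  then have "((\<lambda>\<sigma>. f (a + r * \<sigma>)) has_integral (F (a + r * l) / r - F (a + r * (-l)) / r)) {-l..l}"
    using l by (intro fundamental_theorem_of_calculus)
      (auto simp: has_real_derivative_iff_has_vector_derivative[symmetric] intro: has_field_derivative_at_within)
  then have "integral {-l..l} (\<lambda>\<sigma>. f (a + r * \<sigma>)) = (F (a + r * l) - F (a - r * l)) / r"
    by (simp add: integral_unique diff_divide_distrib)
  moreover have "a - r * l \<le> a + r * l" using r l by (simp add: mult_nonneg_nonneg order_trans[of _ 0])
  ultimately show ?thesis by (simp add: F(2))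
qed

lemma integrable_inverse_one_plus_square: "(\<lambda>x::real. 1 / (1 + x\<^sup>2)) integrable_on UNIV"
proof -
  define f where "f k x = (if x \<in> {- real k..real k} then 1 / (1 + x\<^sup>2) else 0)" for k and x :: real
  have pos: "1 + x\<^sup>2 > 0" for x :: real by (rule add_pos_nonneg) simp_all
  have D: "(arctan has_vector_derivative 1 / (1 + x\<^sup>2)) (at x within A)" for x A
    using DERIV_arctan[of x] unfolding has_real_derivative_iff_has_vector_derivative inverse_eq_divide
    by (rule has_vector_derivative_at_within)
  have I: "((\<lambda>x. 1 / (1 + x\<^sup>2)) has_integral (arctan (real k) - arctan (- real k))) {- real k..real k}" for k
    by (rule fundamental_theorem_of_calculus[OF _ D]) simp
  then have J: "(f k has_integral (arctan (real k) - arctan (- real k))) UNIV" for k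
    unfolding f_def[abs_def] by (simp only: has_integral_restrict_UNIV)
  have "(\<lambda>x::real. 1 / (1 + x\<^sup>2)) integrable_on UNIV \<and> (\<lambda>k. integral UNIV (f k)) \<longlonglongrightarrow> integral UNIV (\<lambda>x::real. 1 / (1 + x\<^sup>2))"
  proof (rule monotone_convergence_increasing[where S=UNIV])
    show "f k integrable_on UNIV" for k using J by blast
    show "f k x \<le> f (Suc k) x" for k x using pos[of x] by (auto simp: f_def less_imp_le)
    show "(\<lambda>k. f k x) \<longlonglongrightarrow> 1 / (1 + x\<^sup>2)" for x
    proof (rule tendsto_eventually)
      obtain N where "\<bar>x\<bar> \<le> real N" using real_arch_simple by blast
      then show "eventually (\<lambda>k. f k x = 1 / (1 + x\<^sup>2)) sequentially"
        by (intro eventually_sequentiallyI[of N]) (auto simp: f_def abs_le_iff)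
    qed
    have "\<bar>integral UNIV (f k)\<bar> \<le> pi" for k
      using arctan_ubound[of "real k"] arctan_lbound[of "real k"] unfolding integral_unique[OF J] by (simp add: arctan_minus)
    then show "bounded (range (\<lambda>k. integral UNIV (f k)))" by (auto simp: bounded_iff)
  qed
  then show ?thesis ..
qed

lemma improper_integral_UNIV:
  fixes g F :: "real \<Rightarrow> real"
  assumes d: "\<And>x. (F has_real_derivative g x) (at x)" and b: "\<And>x. \<bar>g x\<bar> \<le> C / (1 + x\<^sup>2)"
    and l: "(\<lambda>k. F (real k) - F (- real k)) \<longlonglongrightarrow> L"
  shows "integral UNIV g = L"
proof -
  define f where "f k x = (if x \<in> {- real k..real k} then g x else 0)" for k x
  have "(g has_integral (F (real k) - F (- real k))) {- real k..real k}" for k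
    using d by (intro fundamental_theorem_of_calculus)
      (auto simp: has_real_derivative_iff_has_vector_derivative intro: has_vector_derivative_at_within)
  then have J: "(f k has_integral (F (real k) - F (- real k))) UNIV" for k
    unfolding f_def[abs_def] by (simp only: has_integral_restrict_UNIV)
  have C: "C / (1 + x\<^sup>2) \<ge> 0" for x using b[of x] by linarith
  have "(\<lambda>k. integral UNIV (f k)) \<longlonglongrightarrow> integral UNIV g"
  proof (rule dominated_convergence(2))
    show "f k integrable_on UNIV" for k using J by blast
    show "(\<lambda>x. C / (1 + x\<^sup>2)) integrable_on UNIV"
      using integrable_on_cmult_left[OF integrable_inverse_one_plus_square, of C] by simp
    show "norm (f k x) \<le> C / (1 + x\<^sup>2)" for k x using b[of x] C[of x] by (simp add: f_def)
    show "(\<lambda>k. f k x) \<longlonglongrightarrow> g x" for x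
    proof (rule tendsto_eventually)
      obtain N where "\<bar>x\<bar> \<le> real N" using real_arch_simple by blast
      then show "eventually (\<lambda>k. f k x = g x) sequentially"
        by (intro eventually_sequentiallyI[of N]) (auto simp: f_def abs_le_iff)
    qed
  qed
  then have "(\<lambda>k. F (real k) - F (- real k)) \<longlonglongrightarrow> integral UNIV g" by (simp add: integral_unique[OF J])
  then show ?thesis using l LIMSEQ_unique by blast
qed

section \<open>Blow-up of a thin wire\<close>

lemma C2loop_taylor:
  assumes g: "C2loop g g1 g2"
  obtains M where "M > 0" "\<And>s t. norm (g s - g t - (s - t) *\<^sub>R g1 t) \<le> M * (s - t)\<^sup>2"
proof -
  note G = C2loopD[OF g]
  obtain M where M: "M > 0" "\<And>s. norm (g2 s) \<le> M"
    using periodic_bounded[of g2, OF G(3) G(9)] by metis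
  show ?thesis
  proof (rule that[OF M(1)])
    fix s t :: real
    define \<delta> where "\<delta> = \<bar>s - t\<bar>"
    have "norm (g s - g t - (s - t) *\<^sub>R g1 t) \<le> norm (s - t) * (M * \<delta>)"
    proof (rule differentiable_bound_linearization[of t s "cball t \<delta>" g "\<lambda>s h. h *\<^sub>R g1 s" t])
      fix x assume x: "x \<in> cball t \<delta>"
      show "(g has_derivative (\<lambda>h. h *\<^sub>R g1 x)) (at x within cball t \<delta>)"
        using G(4)[of x] by (simp add: has_vector_derivative_def has_derivative_at_withinI)
      have "norm (g1 x - g1 t) \<le> M * \<bar>x - t\<bar>" by (rule deriv_bound_diff[OF G(5) M(2)])
      also have "\<dots> \<le> M * \<delta>" using M x by (intro mult_left_mono) (auto simp: dist_real_def)
      finally have *: "norm (g1 x - g1 t) \<le> M * \<delta>" .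
      have "(\<lambda>h. h *\<^sub>R g1 x) - (\<lambda>h. h *\<^sub>R g1 t) = (\<lambda>h. h *\<^sub>R (g1 x - g1 t))"
        by (auto simp: fun_eq_iff scaleR_diff_right)
      then show "onorm ((\<lambda>h. h *\<^sub>R g1 x) - (\<lambda>h. h *\<^sub>R g1 t)) \<le> M * \<delta>"
        using onorm_scaleR_le[OF *] by simp
    next
      fix u :: real assume u: "u \<in> {0..1}"
      have "\<bar>u\<bar> * \<bar>s - t\<bar> \<le> 1 * \<bar>s - t\<bar>" using u by (intro mult_right_mono) auto
      then show "t + u *\<^sub>R (s - t) \<in> cball t \<delta>"
        by (simp add: dist_real_def abs_mult \<delta>_def)
    qed (simp add: \<delta>_def)
    then show "norm (g s - g t - (s - t) *\<^sub>R g1 t) \<le> M * (s - t)\<^sup>2"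
      by (simp add: \<delta>_def power2_eq_square abs_mult_self_eq mult_ac)
  qed
qed

text \<open>The vector joins the wire point of parameter s to the point at relative offset w from g
  s0. If |s - s0| is large compared with r, the bi-Lipschitz bound dominates. Otherwise pairing with
  d s shows the full displacement, while the curve enters only to second order because d is
  orthogonal to the tangent.\<close>

lemma displaced_lower_bound:
  assumes g: "C2loop g g1 g2" and d: "\<And>s. d (s + 1) = d s" "continuous_on UNIV d"
    "\<And>s. d s \<bullet> g1 s = 0" "\<And>s. d s \<noteq> (0::real^3)"
  obtains c r0 w0 where "c > 0" "r0 > 0" "w0 > 0"
    "\<And>r w s s0. 0 < r \<Longrightarrow> r \<le> r0 \<Longrightarrow> norm w \<le> w0 \<Longrightarrow> \<bar>s - s0\<bar> \<le> 1/2 \<Longrightarrow>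
       c * (r + \<bar>s - s0\<bar>) \<le> norm (g s0 - g s + r *\<^sub>R (w - d s))"
proof -
  obtain m where m: "m > 0" "\<And>s t. \<bar>s - t\<bar> \<le> 1/2 \<Longrightarrow> norm (g s - g t) \<ge> m * \<bar>s - t\<bar>"
    using C2loop_bilipschitz[OF g] by metis
  obtain M where M: "M > 0" "\<And>s t. norm (g s - g t - (s - t) *\<^sub>R g1 t) \<le> M * (s - t)\<^sup>2"
    using C2loop_taylor[OF g] by metis
  obtain D where D: "D > 0" "\<And>s. norm (d s) \<le> D" using periodic_bounded[of d, OF d(1,2)] by metis
  obtain e where e: "e > 0" "\<And>s. norm (d s) \<ge> e" using periodic_bounded_below[of d, OF d(1,2,4)] by metis
  \<comment> \<open>Against the term r e^2 of the displacement, the offset w may cost one half, and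
    the curvature, through r0, one quarter.\<close>
  define w0 where "w0 = e\<^sup>2 / (2 * D)"
  have w0: "w0 > 0" using D e by (simp add: w0_def)
  \<comment> \<open>The ratio of |s - s0| to r from which on the displacement and the offset use up
    at most half of the bi-Lipschitz bound.\<close>
  define \<Lambda> where "\<Lambda> = 2 * (D + w0) / m"
  have \<Lambda>: "\<Lambda> > 0" using D w0 m by (simp add: \<Lambda>_def)
  define r0 where "r0 = e\<^sup>2 / (4 * D * M * \<Lambda>\<^sup>2)"
  have r0: "r0 > 0" using D M e \<Lambda> by (simp add: r0_def)
  define c where "c = min (m / (2 * (1 + 1 / \<Lambda>))) (e\<^sup>2 / (4 * D * (1 + \<Lambda>)))"
  have c: "c > 0" using m \<Lambda> e D by (auto simp: c_def intro!: divide_pos_pos mult_pos_pos add_pos_pos)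
  show ?thesis
  proof (rule that[OF c r0 w0])
    fix r w s s0 assume h: "0 < r" "r \<le> r0" "norm (w :: real^3) \<le> w0" "\<bar>s - s0\<bar> \<le> (1/2::real)"
    define a where "a = \<bar>s - s0\<bar>"
    define v where "v = g s0 - g s + r *\<^sub>R (w - d s)"
    have wd: "norm (w - d s) \<le> D + w0" using norm_triangle_ineq4[of w "d s"] D(2)[of s] h(3) by linarith
    show "c * (r + \<bar>s - s0\<bar>) \<le> norm (g s0 - g s + r *\<^sub>R (w - d s))"
    proof (cases "\<Lambda> * r \<le> a")
      case True
      have "norm v \<ge> norm (g s0 - g s) - norm (r *\<^sub>R (w - d s))"
        unfolding v_def using norm_diff_ineq[of "g s0 - g s" "r *\<^sub>R (w - d s)"] by simp
      moreover have "norm (g s0 - g s) \<ge> m * a" using m(2)[of s0 s] h(4) by (simp add: a_def abs_minus_commute)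
      moreover have "norm (r *\<^sub>R (w - d s)) \<le> r * (D + w0)" using wd h by simp
      moreover have "r * (D + w0) \<le> m * a / 2"
      proof -
        have "r * (D + w0) = m / 2 * (\<Lambda> * r)" using m by (simp add: \<Lambda>_def)
        also have "\<dots> \<le> m / 2 * a" using True m by (intro mult_left_mono) auto
        finally show ?thesis by simp
      qed
      ultimately have "norm v \<ge> m / 2 * a" by simp
      moreover have "c * (r + a) \<le> m / 2 * a"
      proof -
        have "r \<le> a / \<Lambda>" using True \<Lambda> by (simp add: field_simps)
        then have "c * (r + a) \<le> c * (a / \<Lambda> + a)" using c by (intro mult_left_mono) auto
        also have "\<dots> = c * (1 + 1 / \<Lambda>) * a" by (simp add: algebra_simps)
        also have "\<dots> \<le> m / (2 * (1 + 1 / \<Lambda>)) * (1 + 1 / \<Lambda>) * a"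
          using \<Lambda> by (intro mult_right_mono) (auto simp: c_def a_def)
        also have "\<dots> = m / 2 * a"
        proof -
          have "1 + 1 / \<Lambda> \<noteq> 0" using \<Lambda> by (metis add_pos_pos less_irrefl zero_less_divide_1_iff zero_less_one)
          then show ?thesis by (simp add: divide_simps)
        qed
        finally show ?thesis .
      qed
      ultimately show ?thesis by (simp add: v_def a_def)
    next
      case False
      have x: "d s \<bullet> v = d s \<bullet> (g s0 - g s - (s0 - s) *\<^sub>R g1 s) + r * (d s \<bullet> w) - r * (d s \<bullet> d s)"
        by (simp add: v_def inner_add_right inner_diff_right d(3) algebra_simps)
      have a2: "a\<^sup>2 \<le> (\<Lambda> * r) * (\<Lambda> * r0)"
      proof -
        have "a * a \<le> (\<Lambda> * r) * (\<Lambda> * r0)"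
        proof (rule mult_mono)
          show "a \<le> \<Lambda> * r" using False by simp
          have "\<Lambda> * r \<le> \<Lambda> * r0" using h \<Lambda> by (intro mult_left_mono) auto
          then show "a \<le> \<Lambda> * r0" using False by linarith
        qed (use \<Lambda> h in \<open>auto simp: a_def\<close>)
        then show ?thesis by (simp add: power2_eq_square)
      qed
      have "\<bar>d s \<bullet> (g s0 - g s - (s0 - s) *\<^sub>R g1 s)\<bar> \<le> norm (d s) * norm (g s0 - g s - (s0 - s) *\<^sub>R g1 s)"
        by (rule Cauchy_Schwarz_ineq2)
      also have "\<dots> \<le> D * (M * (s0 - s)\<^sup>2)" using D M(2) by (intro mult_mono) auto
      also have "(s0 - s)\<^sup>2 = a\<^sup>2" by (simp add: a_def power2_commute)
      also have "D * (M * a\<^sup>2) \<le> D * (M * ((\<Lambda> * r) * (\<Lambda> * r0)))" using D M a2 by (intro mult_left_mono) auto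
      also have "\<dots> = r * (e\<^sup>2 / 4)" using D M \<Lambda> by (simp add: r0_def power2_eq_square)
      finally have 1: "\<bar>d s \<bullet> (g s0 - g s - (s0 - s) *\<^sub>R g1 s)\<bar> \<le> r * (e\<^sup>2 / 4)" .
      have "\<bar>d s \<bullet> w\<bar> \<le> D * w0" using Cauchy_Schwarz_ineq2[of "d s" w] mult_mono[OF D(2)[of s] h(3)] D by (smt (verit) norm_ge_zero)
      also have "D * w0 = e\<^sup>2 / 2" using D by (simp add: w0_def)
      finally have 2: "r * \<bar>d s \<bullet> w\<bar> \<le> r * (e\<^sup>2 / 2)" using h by (intro mult_left_mono) auto
      have "e\<^sup>2 \<le> d s \<bullet> d s" using power_mono[OF e(2)[of s], of 2] e(1) by (simp add: power2_norm_eq_inner)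
      then have 3: "r * e\<^sup>2 \<le> r * (d s \<bullet> d s)" using h by (intro mult_left_mono) auto
      have "\<bar>r * (d s \<bullet> w)\<bar> = r * \<bar>d s \<bullet> w\<bar>" using h by (simp add: abs_mult)
      then have "\<bar>d s \<bullet> v\<bar> \<ge> r * (e\<^sup>2 / 4)" using x 1 2 3 by linarith
      moreover have "\<bar>d s \<bullet> v\<bar> \<le> D * norm v"
        using Cauchy_Schwarz_ineq2[of "d s" v] mult_right_mono[OF D(2)[of s], of "norm v"] by simp
      ultimately have "r * (e\<^sup>2 / 4) \<le> D * norm v" by linarith
      then have nv: "r * (e\<^sup>2 / (4 * D)) \<le> norm v" using D by (simp add: field_simps)
      have "c * (r + a) \<le> c * (r + \<Lambda> * r)" using c False by (intro mult_left_mono) auto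
      also have "\<dots> = c * (1 + \<Lambda>) * r" by (simp add: algebra_simps)
      also have "\<dots> \<le> e\<^sup>2 / (4 * D * (1 + \<Lambda>)) * (1 + \<Lambda>) * r"
        using \<Lambda> h by (intro mult_right_mono) (auto simp: c_def)
      also have "\<dots> = r * (e\<^sup>2 / (4 * D))" using \<Lambda> D by simp
      finally show ?thesis using nv by (simp add: v_def a_def)
    qed
  qed
qed

text \<open>Substituting s = S n + r n \<sigma> straightens the wire into the line - d - \<sigma>
  g1. The lower bound for the distance becomes linear growth in \<sigma>, so the decay like 1 /
  (norm Z)^2, assumed uniformly in r, gives the majorant 1 / (1 + \<sigma>^2) for dominated
  convergence. The base point S n and the offset w n vary with n, which is what makes the limit
  uniform later.\<close>

lemma wire_limit:
  fixes k :: "real \<Rightarrow> real^3 \<Rightarrow> real"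
  assumes g: "C2loop g g1 g2" and d: "\<And>s. d (s + 1) = d s" "continuous_on UNIV d"
    "\<And>s. d s \<bullet> g1 s = 0" "\<And>s. d s \<noteq> (0::real^3)"
    and m: "\<And>s. m (s + 1) = m s" "continuous_on UNIV m"
    and kc: "continuous_on {p. snd p \<noteq> 0} (\<lambda>p. k (fst p) (snd p))"
    and kb: "\<And>c. c > 0 \<Longrightarrow> \<exists>C. \<forall>r\<ge>0. \<forall>Z. norm Z \<ge> c \<longrightarrow> \<bar>k r Z\<bar> \<le> C / (norm Z)\<^sup>2"
    and r: "\<And>n. r n > 0" "r \<longlonglongrightarrow> 0" and s: "S \<longlonglongrightarrow> s'" and w: "w \<longlonglongrightarrow> 0"
  shows "(\<lambda>n. (1 / r n) * integral {S n - 1/2..S n + 1/2} (\<lambda>s. k (r n) ((1 / r n) *\<^sub>R (g (S n) - g s) + w n - d s) * m s))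
    \<longlonglongrightarrow> integral UNIV (\<lambda>\<sigma>. k 0 (- d s' - \<sigma> *\<^sub>R g1 s') * m s')"
proof -
  note G = C2loopD[OF g]
  obtain c r0 w0 where c: "c > 0" "r0 > 0" "w0 > 0"
    "\<And>r w s s0. 0 < r \<Longrightarrow> r \<le> r0 \<Longrightarrow> norm w \<le> w0 \<Longrightarrow> \<bar>s - s0\<bar> \<le> 1/2 \<Longrightarrow>
       c * (r + \<bar>s - s0\<bar>) \<le> norm (g s0 - g s + r *\<^sub>R (w - d s))"
    using displaced_lower_bound[OF g d] by metis
  obtain C where C: "\<And>r Z. r \<ge> 0 \<Longrightarrow> norm Z \<ge> c \<Longrightarrow> \<bar>k r Z\<bar> \<le> C / (norm Z)\<^sup>2" using kb[OF c(1)] by blast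
  obtain B where B: "B > 0" "\<And>s. norm (m s) \<le> B" using periodic_bounded[of m, OF m] by metis
  obtain M where M: "M > 0" "\<And>s t. norm (g s - g t - (s - t) *\<^sub>R g1 t) \<le> M * (s - t)\<^sup>2"
    using C2loop_taylor[OF g] by metis
  define Z where "Z n s = (1 / r n) *\<^sub>R (g (S n) - g s) + w n - d s" for n s
  define \<sigma>' where "\<sigma>' n \<sigma> = S n + r n * \<sigma>" for n \<sigma>
  define f where "f n \<sigma> = (if \<sigma> \<in> {-(1/(2*r n))..1/(2*r n)} then k (r n) (Z n (\<sigma>' n \<sigma>)) * m (\<sigma>' n \<sigma>) else 0)" for n \<sigma>
  have "eventually (\<lambda>n. r n < r0) sequentially" using order_tendstoD(2)[OF r(2) c(2)] .
  moreover have "eventually (\<lambda>n. norm (w n) < w0) sequentially"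
    using order_tendstoD(2)[OF tendsto_norm[OF w], of w0] c(3) by simp
  ultimately have "eventually (\<lambda>n. r n < r0 \<and> norm (w n) < w0) sequentially" by eventually_elim simp
  then obtain N where N: "\<And>n. n \<ge> N \<Longrightarrow> r n < r0" "\<And>n. n \<ge> N \<Longrightarrow> norm (w n) < w0"
    unfolding eventually_sequentially by blast
  have low: "c * (1 + \<bar>\<sigma>\<bar>) \<le> norm (Z n (\<sigma>' n \<sigma>))" if n: "n \<ge> N" and \<sigma>: "\<sigma> \<in> {-(1/(2*r n))..1/(2*r n)}" for n \<sigma>
  proof -
    have rp: "r n > 0" by (rule r)
    have ab: "r n * \<bar>\<sigma>\<bar> \<le> 1/2"
    proof -
      have "\<bar>\<sigma>\<bar> \<le> 1/(2*r n)" using \<sigma> by (auto simp: abs_le_iff)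
      then have "r n * \<bar>\<sigma>\<bar> \<le> r n * (1/(2*r n))" using rp by (intro mult_left_mono) auto
      then show ?thesis using rp by simp
    qed
    have e: "\<sigma>' n \<sigma> - S n = r n * \<sigma>" by (simp add: \<sigma>'_def)
    have "c * (r n + \<bar>\<sigma>' n \<sigma> - S n\<bar>) \<le> norm (g (S n) - g (\<sigma>' n \<sigma>) + r n *\<^sub>R (w n - d (\<sigma>' n \<sigma>)))"
      using N[OF n] rp ab by (intro c(4)) (auto simp: e abs_mult)
    also have "g (S n) - g (\<sigma>' n \<sigma>) + r n *\<^sub>R (w n - d (\<sigma>' n \<sigma>)) = r n *\<^sub>R Z n (\<sigma>' n \<sigma>)"
      using rp by (simp add: Z_def algebra_simps)
    finally have "r n * (c * (1 + \<bar>\<sigma>\<bar>)) \<le> r n * norm (Z n (\<sigma>' n \<sigma>))"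
      using rp unfolding e by (simp add: abs_mult algebra_simps)
    then show ?thesis using rp by simp
  qed
  have bound: "norm (f n \<sigma>) \<le> (\<bar>C\<bar> * B / c\<^sup>2) / (1 + \<sigma>\<^sup>2)" if n: "n \<ge> N" for n \<sigma>
  proof (cases "\<sigma> \<in> {-(1/(2*r n))..1/(2*r n)}")
    case True
    have p: "1 + \<sigma>\<^sup>2 > 0" by (rule add_pos_nonneg) simp_all
    have l: "c * (1 + \<bar>\<sigma>\<bar>) \<le> norm (Z n (\<sigma>' n \<sigma>))" by (rule low[OF n True])
    have cc: "c \<le> c * (1 + \<bar>\<sigma>\<bar>)" using c(1) by simp
    have "(c * (1 + \<bar>\<sigma>\<bar>))\<^sup>2 \<le> (norm (Z n (\<sigma>' n \<sigma>)))\<^sup>2" using l c(1) by (intro power_mono) auto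
    moreover have "c\<^sup>2 * (1 + \<sigma>\<^sup>2) \<le> (c * (1 + \<bar>\<sigma>\<bar>))\<^sup>2"
    proof -
      have "1 + \<sigma>\<^sup>2 \<le> (1 + \<bar>\<sigma>\<bar>)\<^sup>2" by (simp add: power2_sum)
      then show ?thesis unfolding power_mult_distrib by (intro mult_left_mono) auto
    qed
    ultimately have z2: "c\<^sup>2 * (1 + \<sigma>\<^sup>2) \<le> (norm (Z n (\<sigma>' n \<sigma>)))\<^sup>2" by linarith
    have "\<bar>k (r n) (Z n (\<sigma>' n \<sigma>))\<bar> \<le> C / (norm (Z n (\<sigma>' n \<sigma>)))\<^sup>2"
      using r(1)[of n] l cc by (intro C) auto
    also have "\<dots> \<le> \<bar>C\<bar> / (norm (Z n (\<sigma>' n \<sigma>)))\<^sup>2" by (intro divide_right_mono) auto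
    also have "\<dots> \<le> \<bar>C\<bar> / (c\<^sup>2 * (1 + \<sigma>\<^sup>2))" 
    proof -
      have den: "0 < c\<^sup>2 * (1 + \<sigma>\<^sup>2)" by (rule mult_pos_pos[OF zero_less_power[OF c(1), of 2] p])
      then have num: "0 < (norm (Z n (\<sigma>' n \<sigma>)))\<^sup>2" using z2 by linarith
      show ?thesis by (rule divide_left_mono[OF z2 abs_ge_zero mult_pos_pos[OF num den]])
    qed
    finally have "\<bar>k (r n) (Z n (\<sigma>' n \<sigma>))\<bar> \<le> \<bar>C\<bar> / (c\<^sup>2 * (1 + \<sigma>\<^sup>2))" .
    moreover have "\<bar>m (\<sigma>' n \<sigma>)\<bar> \<le> B" using B(2)[of "\<sigma>' n \<sigma>"] by simp
    ultimately have "\<bar>k (r n) (Z n (\<sigma>' n \<sigma>))\<bar> * \<bar>m (\<sigma>' n \<sigma>)\<bar> \<le> \<bar>C\<bar> / (c\<^sup>2 * (1 + \<sigma>\<^sup>2)) * B"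
      using c(1) p by (intro mult_mono) auto
    then show ?thesis using True by (simp add: f_def abs_mult)
  next
    case False
    have "1 + \<sigma>\<^sup>2 > 0" by (rule add_pos_nonneg) simp_all
    moreover have "f n \<sigma> = 0" using False unfolding f_def by (rule if_not_P)
    ultimately show ?thesis using B(1) by simp
  qed
  have Zc: "continuous_on UNIV (Z n)" for n
    unfolding Z_def[abs_def] by (intro continuous_intros G d)
  have lim: "(\<lambda>n. f n \<sigma>) \<longlonglongrightarrow> k 0 (- d s' - \<sigma> *\<^sub>R g1 s') * m s'" for \<sigma>
  proof -
    have sl: "(\<lambda>n. \<sigma>' n \<sigma>) \<longlonglongrightarrow> s'"
      unfolding \<sigma>'_def using tendsto_add[OF s tendsto_mult[OF r(2) tendsto_const[of \<sigma>]]] by simp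
    have ct: "isCont m s'" "isCont d s'" "isCont g1 s'"
      using m(2) d(2) G(8)[of UNIV] by (auto simp: continuous_on_eq_continuous_at)
    have ml: "(\<lambda>n. m (\<sigma>' n \<sigma>)) \<longlonglongrightarrow> m s'" by (rule isCont_tendsto_compose[OF ct(1) sl])
    have dl: "(\<lambda>n. d (\<sigma>' n \<sigma>)) \<longlonglongrightarrow> d s'" by (rule isCont_tendsto_compose[OF ct(2) sl])
    have g1l: "(\<lambda>n. g1 (S n)) \<longlonglongrightarrow> g1 s'" by (rule isCont_tendsto_compose[OF ct(3) s])
    have el: "(\<lambda>n. (1 / r n) *\<^sub>R (g (\<sigma>' n \<sigma>) - g (S n) - (\<sigma>' n \<sigma> - S n) *\<^sub>R g1 (S n))) \<longlonglongrightarrow> 0"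
    proof (rule Lim_null_comparison)
      show "eventually (\<lambda>n. norm ((1 / r n) *\<^sub>R (g (\<sigma>' n \<sigma>) - g (S n) - (\<sigma>' n \<sigma> - S n) *\<^sub>R g1 (S n))) \<le> M * \<sigma>\<^sup>2 * r n) sequentially"
      proof (rule always_eventually, rule allI)
        fix n
        have "norm ((1 / r n) *\<^sub>R (g (\<sigma>' n \<sigma>) - g (S n) - (\<sigma>' n \<sigma> - S n) *\<^sub>R g1 (S n))) \<le> (1 / r n) * (M * (\<sigma>' n \<sigma> - S n)\<^sup>2)"
          using M(2)[of "\<sigma>' n \<sigma>" "S n"] r(1)[of n] by (simp add: divide_right_mono)
        also have "\<dots> = M * \<sigma>\<^sup>2 * r n" using r(1)[of n] by (simp add: \<sigma>'_def power2_eq_square)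
        finally show "norm ((1 / r n) *\<^sub>R (g (\<sigma>' n \<sigma>) - g (S n) - (\<sigma>' n \<sigma> - S n) *\<^sub>R g1 (S n))) \<le> M * \<sigma>\<^sup>2 * r n" .
      qed
      show "(\<lambda>n. M * \<sigma>\<^sup>2 * r n) \<longlonglongrightarrow> 0" using tendsto_mult[OF tendsto_const r(2), of "M * \<sigma>\<^sup>2"] by simp
    qed
    have Zeq: "Z n (\<sigma>' n \<sigma>) = - ((1 / r n) *\<^sub>R (g (\<sigma>' n \<sigma>) - g (S n) - (\<sigma>' n \<sigma> - S n) *\<^sub>R g1 (S n))) - \<sigma> *\<^sub>R g1 (S n) + w n - d (\<sigma>' n \<sigma>)" for n
      using r(1)[of n] by (simp add: Z_def \<sigma>'_def algebra_simps)
    have "(\<lambda>n. - ((1 / r n) *\<^sub>R (g (\<sigma>' n \<sigma>) - g (S n) - (\<sigma>' n \<sigma> - S n) *\<^sub>R g1 (S n))) - \<sigma> *\<^sub>R g1 (S n) + w n - d (\<sigma>' n \<sigma>)) \<longlonglongrightarrow> - 0 - \<sigma> *\<^sub>R g1 s' + 0 - d s'"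
      by (intro tendsto_intros el g1l w dl)
    moreover have "- 0 - \<sigma> *\<^sub>R g1 s' + 0 - d s' = - d s' - \<sigma> *\<^sub>R g1 s'" by simp
    ultimately have Zl: "(\<lambda>n. Z n (\<sigma>' n \<sigma>)) \<longlonglongrightarrow> - d s' - \<sigma> *\<^sub>R g1 s'" by (simp only: Zeq)
    have nz: "- d s' - \<sigma> *\<^sub>R g1 s' \<noteq> 0"
    proof
      assume "- d s' - \<sigma> *\<^sub>R g1 s' = 0"
      then have "d s' \<bullet> (- d s' - \<sigma> *\<^sub>R g1 s') = 0" by simp
      then show False using d(3,4)[of s'] by (simp add: inner_diff_right)
    qed
    have "open {p :: real \<times> (real^3). snd p \<noteq> 0}"
      by (intro open_Collect_neq continuous_intros)
    then have "isCont (\<lambda>p. k (fst p) (snd p)) (0, - d s' - \<sigma> *\<^sub>R g1 s')"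
      using kc nz by (auto simp: continuous_on_eq_continuous_at)
    from isCont_tendsto_compose[OF this tendsto_Pair[OF r(2) Zl]]
    have kl: "(\<lambda>n. k (r n) (Z n (\<sigma>' n \<sigma>))) \<longlonglongrightarrow> k 0 (- d s' - \<sigma> *\<^sub>R g1 s')" by simp
    have "eventually (\<lambda>n. r n < 1 / (2 * (\<bar>\<sigma>\<bar> + 1))) sequentially" by (rule order_tendstoD(2)[OF r(2)]) simp
    then have "eventually (\<lambda>n. k (r n) (Z n (\<sigma>' n \<sigma>)) * m (\<sigma>' n \<sigma>) = f n \<sigma>) sequentially"
    proof eventually_elim
      case (elim n)
      have "\<bar>\<sigma>\<bar> * (2 * r n) \<le> (\<bar>\<sigma>\<bar> + 1) * (2 * r n)" using r(1)[of n] by (intro mult_right_mono) auto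
      also have "\<dots> \<le> 1" using elim by (simp add: field_simps)
      finally have "\<bar>\<sigma>\<bar> \<le> 1 / (2 * r n)" using r(1)[of n] by (simp add: field_simps)
      then have "\<sigma> \<in> {-(1/(2*r n))..1/(2*r n)}" by (auto simp: abs_le_iff)
      then show ?case by (simp add: f_def)
    qed
    from Lim_transform_eventually[OF tendsto_mult[OF kl ml] this] show ?thesis .
  qed
  have int: "f n integrable_on UNIV \<and> integral UNIV (f n) = (1 / r n) * integral {S n - 1/2..S n + 1/2} (\<lambda>s. k (r n) (Z n s) * m s)" if n: "n \<ge> N" for n
  proof -
    have rp: "r n > 0" by (rule r)
    define h where "h s = k (r n) (Z n s) * m s" for s
    \<comment> \<open>Clamping the parameter to the window gives a function that is continuous on
      the whole line, as \<open>integral_rescale\<close> demands, with the same integral over the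
      window.\<close>
    define h' where "h' s = h (max (S n - 1/2) (min (S n + 1/2) s))" for s
    have cl: "max (S n - 1/2) (min (S n + 1/2) s) = S n + r n * \<sigma> \<and> \<sigma> \<in> {-(1/(2*r n))..1/(2*r n)}"
      if "\<sigma> = (max (S n - 1/2) (min (S n + 1/2) s) - S n) / r n" for s \<sigma>
    proof -
      have b: "S n - 1/2 \<le> max (S n - 1/2) (min (S n + 1/2) s)" "max (S n - 1/2) (min (S n + 1/2) s) \<le> S n + 1/2"
        by auto
      have "-(1/2) / r n \<le> \<sigma>" unfolding that using rp b by (intro divide_right_mono) linarith+
      moreover have "\<sigma> \<le> (1/2) / r n" unfolding that using rp b by (intro divide_right_mono) linarith+
      moreover have "max (S n - 1/2) (min (S n + 1/2) s) = S n + r n * \<sigma>" unfolding that using rp by simp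
      ultimately show ?thesis by simp
    qed
    have nzz: "Z n (max (S n - 1/2) (min (S n + 1/2) s)) \<noteq> 0" for s
    proof -
      define \<sigma> where "\<sigma> = (max (S n - 1/2) (min (S n + 1/2) s) - S n) / r n"
      have "Z n (\<sigma>' n \<sigma>) \<noteq> 0" using low[OF n, of \<sigma>] cl[OF \<sigma>_def] c(1) by (smt (verit) mult_pos_pos norm_zero abs_ge_zero)
      then show ?thesis using cl[OF \<sigma>_def] by (simp add: \<sigma>'_def)
    qed
    have h'c: "continuous_on UNIV h'"
    proof -
      have cm: "continuous_on UNIV (\<lambda>s. max (S n - 1/2) (min (S n + 1/2) s))" by (intro continuous_intros)
      have 1: "continuous_on UNIV (\<lambda>s. Z n (max (S n - 1/2) (min (S n + 1/2) s)))"
        by (rule continuous_on_compose2[OF Zc cm]) simp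
      have 2: "continuous_on UNIV (\<lambda>s. m (max (S n - 1/2) (min (S n + 1/2) s)))"
        by (rule continuous_on_compose2[OF m(2) cm]) simp
      have 3: "continuous_on UNIV (\<lambda>s. k (fst (r n, Z n (max (S n - 1/2) (min (S n + 1/2) s)))) (snd (r n, Z n (max (S n - 1/2) (min (S n + 1/2) s)))))"
        by (rule continuous_on_compose2[OF kc]) (use nzz in \<open>auto intro!: continuous_intros 1\<close>)
      show ?thesis unfolding h'_def[abs_def] h_def using continuous_on_mult[OF 3 2] by simp
    qed
    have hh: "h' s = h s" if "s \<in> {S n - 1/2..S n + 1/2}" for s
    proof -
      have "max (S n - 1/2) (min (S n + 1/2) s) = s" using that by auto
      then show ?thesis by (simp only: h'_def)
    qed
    have e1: "integral {S n - 1/2..S n + 1/2} h = integral {S n - 1/2..S n + 1/2} h'"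
      by (rule integral_cong) (simp add: hh)
    have e2: "(1 / r n) * integral {S n - r n * (1/(2*r n))..S n + r n * (1/(2*r n))} h' = integral {-(1/(2*r n))..1/(2*r n)} (\<lambda>\<sigma>. h' (S n + r n * \<sigma>))"
      using rp by (intro integral_rescale[OF h'c]) auto
    have e3: "f n = (\<lambda>\<sigma>. if \<sigma> \<in> {-(1/(2*r n))..1/(2*r n)} then h' (S n + r n * \<sigma>) else 0)"
    proof
      fix \<sigma>
      have "h' (S n + r n * \<sigma>) = h (S n + r n * \<sigma>)" if "\<sigma> \<in> {-(1/(2*r n))..1/(2*r n)}"
      proof (rule hh)
        have "r n * (-(1/(2*r n))) \<le> r n * \<sigma>" "r n * \<sigma> \<le> r n * (1/(2*r n))" using that rp by (intro mult_left_mono; simp)+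
        then show "S n + r n * \<sigma> \<in> {S n - 1/2..S n + 1/2}" using rp by simp
      qed
      then show "f n \<sigma> = (if \<sigma> \<in> {-(1/(2*r n))..1/(2*r n)} then h' (S n + r n * \<sigma>) else 0)"
        by (simp add: f_def h_def \<sigma>'_def)
    qed
    have "(\<lambda>\<sigma>. h' (S n + r n * \<sigma>)) integrable_on {-(1/(2*r n))..1/(2*r n)}"
      by (intro integrable_continuous_interval continuous_on_compose2[OF h'c] continuous_intros) auto
    then have "f n integrable_on UNIV" unfolding e3 by (simp only: integrable_restrict_UNIV)
    moreover have "integral UNIV (f n) = integral {-(1/(2*r n))..1/(2*r n)} (\<lambda>\<sigma>. h' (S n + r n * \<sigma>))"
      unfolding e3 by (simp only: integral_restrict_UNIV)
    moreover have e4: "r n * (1/(2*r n)) = 1/2" using rp by simp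
    ultimately show ?thesis using e1 e2[unfolded e4] by (simp add: h_def[abs_def])
  qed
  have "(\<lambda>n. integral UNIV (f (n + N))) \<longlonglongrightarrow> integral UNIV (\<lambda>\<sigma>. k 0 (- d s' - \<sigma> *\<^sub>R g1 s') * m s')"
  proof (rule dominated_convergence(2))
    show "f (n + N) integrable_on UNIV" for n using int[of "n + N"] by simp
    show "(\<lambda>\<sigma>. (\<bar>C\<bar> * B / c\<^sup>2) / (1 + \<sigma>\<^sup>2)) integrable_on UNIV"
      using integrable_on_cmult_left[OF integrable_inverse_one_plus_square, of "\<bar>C\<bar> * B / c\<^sup>2"] by simp
    show "norm (f (n + N) \<sigma>) \<le> (\<bar>C\<bar> * B / c\<^sup>2) / (1 + \<sigma>\<^sup>2)" for n \<sigma> by (rule bound) simp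
    show "(\<lambda>n. f (n + N) \<sigma>) \<longlonglongrightarrow> k 0 (- d s' - \<sigma> *\<^sub>R g1 s') * m s'" for \<sigma>
      by (rule LIMSEQ_ignore_initial_segment[OF lim])
  qed
  then have "(\<lambda>n. (1 / r (n + N)) * integral {S (n + N) - 1/2..S (n + N) + 1/2} (\<lambda>s. k (r (n + N)) (Z (n + N) s) * m s))
     \<longlonglongrightarrow> integral UNIV (\<lambda>\<sigma>. k 0 (- d s' - \<sigma> *\<^sub>R g1 s') * m s')"
    using int by simp
  then show ?thesis unfolding Z_def by (rule LIMSEQ_offset)
qed

section \<open>Rescaled kernels and their decay\<close>

lemma gev_jet1: "gev (jet [i]) z = - exp (- norm z) * z $ i * (1 / norm z ^ 2 + 1 / norm z ^ 3)"
  by (simp add: algebra_simps power2_eq_square power3_eq_cube)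

lemma gev_jet2:
  "gev (jet [i, j]) z = exp (- norm z) * (z $ i * z $ j * (1 / norm z ^ 3 + 3 / norm z ^ 4 + 3 / norm z ^ 5)
     - (if i = j then 1 else 0) * (1 / norm z ^ 2 + 1 / norm z ^ 3))"
  by (simp add: algebra_simps eval_nat_numeral)

text \<open>For r > 0 this is r^2 times the gradient of the Yukawa potential at r z, and
  \<open>k2\<close> is r^3 times its Hessian. The scaling leaves a limit at r = 0: the derivatives
  of 1 / norm z.\<close>

definition k1 :: "3 \<Rightarrow> real \<Rightarrow> real^3 \<Rightarrow> real" where
  "k1 i r z = - exp (- (r * norm z)) * z $ i * (r / norm z ^ 2 + 1 / norm z ^ 3)"

definition k2 :: "3 \<Rightarrow> 3 \<Rightarrow> real \<Rightarrow> real^3 \<Rightarrow> real" where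
  "k2 i j r z = exp (- (r * norm z)) * (z $ i * z $ j * (r\<^sup>2 / norm z ^ 3 + 3 * r / norm z ^ 4 + 3 / norm z ^ 5)
     - (if i = j then 1 else 0) * (r / norm z ^ 2 + 1 / norm z ^ 3))"

lemma gev_jet1_scale:
  assumes "r > 0" shows "gev (jet [i]) (r *\<^sub>R z) = k1 i r z / r\<^sup>2"
  using assms unfolding gev_jet1 k1_def
  by (cases "z = 0") (simp_all add: power_mult_distrib divide_simps, simp_all add: algebra_simps eval_nat_numeral)

lemma gev_jet2_scale:
  assumes "r > 0" shows "gev (jet [i, j]) (r *\<^sub>R z) = k2 i j r z / r ^ 3"
  using assms unfolding gev_jet2 k2_def
  by (cases "z = 0") (simp_all add: power_mult_distrib divide_simps, simp_all add: algebra_simps eval_nat_numeral)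

lemma continuous_on_k1: "continuous_on {p. snd p \<noteq> 0} (\<lambda>p. k1 i (fst p) (snd p))"
  unfolding k1_def by (intro continuous_intros) auto

lemma continuous_on_k2: "continuous_on {p. snd p \<noteq> 0} (\<lambda>p. k2 i j (fst p) (snd p))"
  unfolding k2_def by (intro continuous_intros) auto

text \<open>With x = r norm z, the exponential pays for all additional powers of x, so the kernels
  decay as in the limit r = 0, uniformly in r.\<close>

lemma exp_decay_bounds:
  fixes x :: real assumes "x \<ge> 0"
  shows "exp (- x) * (1 + x) \<le> 1" "exp (- x) * (x\<^sup>2 + 4 * x + 4) \<le> 4"
proof -
  have "1 + x \<le> exp x" by (rule exp_ge_add_one_self)
  then show "exp (- x) * (1 + x) \<le> 1" by (simp add: exp_minus field_simps)
  have "1 + x + x\<^sup>2 / 2 \<le> exp x" by (rule exp_lower_Taylor_quadratic[OF assms])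
  then have "x\<^sup>2 + 4 * x + 4 \<le> 4 * exp x" using zero_le_power2[of x] by linarith
  then show "exp (- x) * (x\<^sup>2 + 4 * x + 4) \<le> 4" by (simp add: exp_minus field_simps)
qed

lemma k1_bound:
  assumes "r \<ge> 0" "z \<noteq> 0" shows "\<bar>k1 i r z\<bar> \<le> 1 / (norm z)\<^sup>2"
proof -
  define n where "n = norm z"
  have n: "n > 0" using assms by (simp add: n_def)
  have "\<bar>k1 i r z\<bar> = exp (- (r * n)) * \<bar>z $ i\<bar> * (r / n ^ 2 + 1 / n ^ 3)"
    using n assms by (simp add: k1_def n_def[symmetric] abs_mult)
  also have "\<dots> \<le> exp (- (r * n)) * n * (r / n ^ 2 + 1 / n ^ 3)"
    using n assms component_le_norm_cart[of z i] by (intro mult_right_mono mult_left_mono) (auto simp: n_def)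
  also have "\<dots> = (exp (- (r * n)) * (1 + r * n)) / n\<^sup>2"
    using n by (simp add: field_simps eval_nat_numeral)
  also have "\<dots> \<le> 1 / n\<^sup>2" using exp_decay_bounds(1)[of "r * n"] n assms by (intro divide_right_mono) auto
  finally show ?thesis by (simp add: n_def)
qed

lemma k2_bound:
  assumes "r \<ge> 0" "z \<noteq> 0" shows "\<bar>k2 i j r z\<bar> \<le> 4 / norm z ^ 3"
proof -
  define n where "n = norm z"
  have n: "n > 0" using assms by (simp add: n_def)
  define A where "A = r\<^sup>2 / n ^ 3 + 3 * r / n ^ 4 + 3 / n ^ 5"
  define B where "B = r / n ^ 2 + 1 / n ^ 3"
  have AB: "A \<ge> 0" "B \<ge> 0" using n assms by (auto simp: A_def B_def)
  have "\<bar>z $ i * z $ j\<bar> \<le> n * n"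
    unfolding abs_mult n_def by (intro mult_mono component_le_norm_cart) auto
  then have "\<bar>z $ i * z $ j * A\<bar> \<le> n * n * A" unfolding abs_mult[of _ A] using AB by (intro mult_mono) auto
  then have "\<bar>z $ i * z $ j * A - (if i = j then 1 else 0) * B\<bar> \<le> n * n * A + B"
    using AB by (auto simp: abs_le_iff)
  then have "\<bar>k2 i j r z\<bar> \<le> exp (- (r * n)) * (n * n * A + B)"
    unfolding k2_def n_def[symmetric] A_def[symmetric] B_def[symmetric] abs_mult[of "exp _"] by (simp add: mult_left_mono)
  also have "n * n * A + B = ((r * n)\<^sup>2 + 4 * (r * n) + 4) / n ^ 3"
    using n by (simp add: A_def B_def field_simps eval_nat_numeral)
  also have "exp (- (r * n)) * (((r * n)\<^sup>2 + 4 * (r * n) + 4) / n ^ 3) \<le> 4 / n ^ 3"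
    using exp_decay_bounds(2)[of "r * n"] n assms by (simp add: divide_right_mono)
  finally show ?thesis by (simp add: n_def)
qed

lemma k1_decay: "c > 0 \<Longrightarrow> \<exists>C. \<forall>r\<ge>0. \<forall>z. norm z \<ge> c \<longrightarrow> \<bar>k1 i r z\<bar> \<le> C / (norm z)\<^sup>2"
  by (intro exI[of _ 1] allI impI k1_bound) auto

lemma k2_decay:
  assumes "c > 0" shows "\<exists>C. \<forall>r\<ge>0. \<forall>z. norm z \<ge> c \<longrightarrow> \<bar>k2 i j r z\<bar> \<le> C / (norm z)\<^sup>2"
proof (intro exI[of _ "4 / c"] allI impI)
  fix r :: real and z :: "real^3" assume h: "r \<ge> 0" "norm z \<ge> c"
  then have z: "z \<noteq> 0" using assms by auto
  have "\<bar>k2 i j r z\<bar> \<le> 4 / norm z ^ 3" by (rule k2_bound[OF h(1) z])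
  also have "\<dots> = (4 / norm z) / (norm z)\<^sup>2" by (simp add: eval_nat_numeral)
  also have "\<dots> \<le> (4 / c) / (norm z)\<^sup>2" using h assms z by (intro divide_right_mono divide_left_mono mult_pos_pos) auto
  finally show "\<bar>k2 i j r z\<bar> \<le> 4 / c / (norm z)\<^sup>2" .
qed

section \<open>The limit kernels integrated along a straight line\<close>

lemma line_norm:
  assumes "d \<bullet> t = 0"
  shows "norm (- d - \<sigma> *\<^sub>R t) = sqrt ((norm d)\<^sup>2 + (norm t)\<^sup>2 * \<sigma>\<^sup>2)"
proof -
  have "(norm (- d - \<sigma> *\<^sub>R t))\<^sup>2 = (norm d)\<^sup>2 + (norm t)\<^sup>2 * \<sigma>\<^sup>2"
    unfolding power2_norm_eq_inner using assms by (simp add: inner_diff_left inner_diff_right inner_commute[of t d] power2_eq_square)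
  then show ?thesis by (metis norm_ge_zero real_sqrt_unique)
qed

lemma line_decay:
  fixes k :: "real \<Rightarrow> real^3 \<Rightarrow> real"
  assumes kb: "\<And>c. c > 0 \<Longrightarrow> \<exists>C. \<forall>r\<ge>0. \<forall>z. norm z \<ge> c \<longrightarrow> \<bar>k r z\<bar> \<le> C / (norm z)\<^sup>2"
    and o: "d \<bullet> t = 0" "d \<noteq> 0" "t \<noteq> 0"
  obtains C where "\<And>\<sigma>. \<bar>k 0 (- d - \<sigma> *\<^sub>R t)\<bar> \<le> C / (1 + \<sigma>\<^sup>2)"
proof -
  define c where "c = min (norm d) (norm t)"
  have c: "c > 0" using o by (simp add: c_def)
  obtain C where C: "\<And>r z. r \<ge> 0 \<Longrightarrow> norm z \<ge> c \<Longrightarrow> \<bar>k r z\<bar> \<le> C / (norm z)\<^sup>2" using kb[OF c] by blast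
  have "\<bar>k 0 (- d - \<sigma> *\<^sub>R t)\<bar> \<le> (\<bar>C\<bar> / c\<^sup>2) / (1 + \<sigma>\<^sup>2)" for \<sigma>
  proof -
    define z where "z = - d - \<sigma> *\<^sub>R t"
    have nz: "(norm z)\<^sup>2 = (norm d)\<^sup>2 + (norm t)\<^sup>2 * \<sigma>\<^sup>2" unfolding z_def line_norm[OF o(1)] by (simp add: add_nonneg_nonneg)
    have "c\<^sup>2 \<le> (norm d)\<^sup>2" "c\<^sup>2 \<le> (norm t)\<^sup>2" using c by (auto simp: c_def intro!: power_mono)
    then have "c\<^sup>2 + c\<^sup>2 * \<sigma>\<^sup>2 \<le> (norm z)\<^sup>2" unfolding nz by (intro add_mono mult_right_mono) auto
    then have z2: "c\<^sup>2 * (1 + \<sigma>\<^sup>2) \<le> (norm z)\<^sup>2" by (simp add: algebra_simps)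
    have "c\<^sup>2 * 1 \<le> c\<^sup>2 * (1 + \<sigma>\<^sup>2)" by (intro mult_left_mono) auto
    then have "c\<^sup>2 \<le> (norm z)\<^sup>2" using z2 by simp
    then have zc: "c \<le> norm z" by (rule power2_le_imp_le) simp
    have p: "c\<^sup>2 * (1 + \<sigma>\<^sup>2) > 0" using c by (intro mult_pos_pos add_pos_nonneg) auto
    have "\<bar>k 0 z\<bar> \<le> C / (norm z)\<^sup>2" using zc by (intro C) auto
    also have "\<dots> \<le> \<bar>C\<bar> / (norm z)\<^sup>2" by (intro divide_right_mono) auto
    also have "\<dots> \<le> \<bar>C\<bar> / (c\<^sup>2 * (1 + \<sigma>\<^sup>2))"
    proof -
      have num: "0 < (norm z)\<^sup>2" using p z2 by linarith
      show ?thesis by (rule divide_left_mono[OF z2 abs_ge_zero mult_pos_pos[OF num p]])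
    qed
    finally show ?thesis by (simp add: z_def)
  qed
  then show ?thesis by (rule that)
qed

lemma line_quotient_limits:
  fixes \<omega> v :: real
  assumes "\<omega> > 0" "v > 0"
  defines "q \<equiv> \<lambda>\<sigma>. sqrt (\<omega>\<^sup>2 + v\<^sup>2 * \<sigma>\<^sup>2)"
  shows "(\<lambda>k. real k / q (real k)) \<longlonglongrightarrow> 1 / v" "(\<lambda>k. 1 / q (real k)) \<longlonglongrightarrow> 0"
proof -
  have i: "(\<lambda>k. 1 / real k) \<longlonglongrightarrow> 0" by (rule lim_1_over_n)
  have "(\<lambda>k. 1 / sqrt (\<omega>\<^sup>2 * (1 / real k)\<^sup>2 + v\<^sup>2)) \<longlonglongrightarrow> 1 / sqrt (\<omega>\<^sup>2 * 0\<^sup>2 + v\<^sup>2)"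
    using assms by (intro tendsto_intros i) auto
  then have a: "(\<lambda>k. 1 / sqrt (\<omega>\<^sup>2 * (1 / real k)\<^sup>2 + v\<^sup>2)) \<longlonglongrightarrow> 1 / v" using assms by simp
  have ev: "real k / q (real k) = 1 / sqrt (\<omega>\<^sup>2 * (1 / real k)\<^sup>2 + v\<^sup>2)" if "k \<ge> 1" for k
  proof -
    have "sqrt (\<omega>\<^sup>2 * (1 / real k)\<^sup>2 + v\<^sup>2) = sqrt ((\<omega>\<^sup>2 + v\<^sup>2 * (real k)\<^sup>2) / (real k)\<^sup>2)"
      using that by (simp add: field_simps)
    also have "\<dots> = q (real k) / real k" using that by (simp add: q_def real_sqrt_divide)
    finally show ?thesis by simp
  qed
  show "(\<lambda>k. real k / q (real k)) \<longlonglongrightarrow> 1 / v"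
    by (rule Lim_transform_eventually[OF a]) (auto intro!: eventually_sequentiallyI[of 1] simp: ev)
  from tendsto_mult[OF this i] have "(\<lambda>k. real k / q (real k) * (1 / real k)) \<longlonglongrightarrow> 0" by simp
  then show "(\<lambda>k. 1 / q (real k)) \<longlonglongrightarrow> 0"
    by (rule Lim_transform_eventually) (rule eventually_sequentiallyI[of 1], simp)
qed

text \<open>Integrating the gradient of 1 / norm z along a line gives the gradient of the planar
  potential -2 log of the distance, divided by the speed norm t. The part along t is odd up to
  parametrisation and drops out.\<close>

lemma integral_k1_line:
  assumes o: "d \<bullet> t = 0" "d \<noteq> 0" "t \<noteq> 0"
  shows "integral UNIV (\<lambda>\<sigma>. k1 i 0 (- d - \<sigma> *\<^sub>R t)) = 2 * d $ i / (norm t * (norm d)\<^sup>2)"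
proof -
  define \<omega> where "\<omega> = norm d" define v where "v = norm t"
  have p: "\<omega> > 0" "v > 0" using o by (auto simp: \<omega>_def v_def)
  define q where "q \<sigma> = sqrt (\<omega>\<^sup>2 + v\<^sup>2 * \<sigma>\<^sup>2)" for \<sigma>
  have r: "\<omega>\<^sup>2 + v\<^sup>2 * \<sigma>\<^sup>2 > 0" for \<sigma> using p by (intro add_pos_nonneg) auto
  have q: "q \<sigma> > 0" "(q \<sigma>)\<^sup>2 = \<omega>\<^sup>2 + v\<^sup>2 * \<sigma>\<^sup>2" for \<sigma> using r[of \<sigma>] by (auto simp: q_def)
  have dq: "(q has_real_derivative v\<^sup>2 * \<sigma> / q \<sigma>) (at \<sigma>)" for \<sigma>
    unfolding q_def[abs_def] using r[of \<sigma>] by (auto intro!: derivative_eq_intros simp: field_simps)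
  define F where "F \<sigma> = d $ i * \<sigma> / (\<omega>\<^sup>2 * q \<sigma>) - t $ i / (v\<^sup>2 * q \<sigma>)" for \<sigma>
  obtain C where C: "\<And>\<sigma>. \<bar>k1 i 0 (- d - \<sigma> *\<^sub>R t)\<bar> \<le> C / (1 + \<sigma>\<^sup>2)" using line_decay[OF k1_decay o] by metis
  show ?thesis
  proof (rule improper_integral_UNIV[OF _ C])
    fix \<sigma>
    have n: "norm (- d - \<sigma> *\<^sub>R t) = q \<sigma>" by (simp add: line_norm[OF o(1)] q_def \<omega>_def v_def)
    have A: "((\<lambda>\<sigma>. \<sigma> / q \<sigma>) has_real_derivative \<omega>\<^sup>2 / q \<sigma> ^ 3) (at \<sigma>)"
    proof -
      have "((\<lambda>\<sigma>. \<sigma> / q \<sigma>) has_real_derivative (1 * q \<sigma> - \<sigma> * (v\<^sup>2 * \<sigma> / q \<sigma>)) / (q \<sigma> * q \<sigma>)) (at \<sigma>)"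
        using q(1)[of \<sigma>] by (intro derivative_intros dq) auto
      moreover have "(1 * q \<sigma> - \<sigma> * (v\<^sup>2 * \<sigma> / q \<sigma>)) / (q \<sigma> * q \<sigma>) = ((q \<sigma>)\<^sup>2 - v\<^sup>2 * \<sigma>\<^sup>2) / q \<sigma> ^ 3"
        using q(1)[of \<sigma>] by (simp add: field_simps eval_nat_numeral)
      ultimately show ?thesis by (simp add: q(2))
    qed
    have B: "((\<lambda>\<sigma>. 1 / q \<sigma>) has_real_derivative - (v\<^sup>2 * \<sigma>) / q \<sigma> ^ 3) (at \<sigma>)"
      using q(1)[of \<sigma>] by (auto intro!: derivative_eq_intros dq simp: field_simps eval_nat_numeral)
    have "(F has_real_derivative (d $ i / \<omega>\<^sup>2) * (\<omega>\<^sup>2 / q \<sigma> ^ 3) - (t $ i / v\<^sup>2) * (- (v\<^sup>2 * \<sigma>) / q \<sigma> ^ 3)) (at \<sigma>)"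
      using DERIV_diff[OF DERIV_cmult[OF A, of "d $ i / \<omega>\<^sup>2"] DERIV_cmult[OF B, of "t $ i / v\<^sup>2"]]
      by (simp add: F_def[abs_def])
    moreover have "(d $ i / \<omega>\<^sup>2) * (\<omega>\<^sup>2 / q \<sigma> ^ 3) - (t $ i / v\<^sup>2) * (- (v\<^sup>2 * \<sigma>) / q \<sigma> ^ 3) = k1 i 0 (- d - \<sigma> *\<^sub>R t)"
      unfolding k1_def n using p q(1)[of \<sigma>] by (simp add: field_simps)
    ultimately show "(F has_real_derivative k1 i 0 (- d - \<sigma> *\<^sub>R t)) (at \<sigma>)" by simp
  next
    note l = line_quotient_limits[OF p, folded q_def]
    have "F (real k) - F (- real k) = 2 * (d $ i / \<omega>\<^sup>2) * (real k / q (real k))" for k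
      by (simp add: F_def q_def)
    moreover have "(\<lambda>k. 2 * (d $ i / \<omega>\<^sup>2) * (real k / q (real k))) \<longlonglongrightarrow> 2 * (d $ i / \<omega>\<^sup>2) * (1 / v)"
      by (intro tendsto_intros l)
    ultimately show "(\<lambda>k. F (real k) - F (- real k)) \<longlonglongrightarrow> 2 * d $ i / (norm t * (norm d)\<^sup>2)"
      by (simp add: \<omega>_def v_def mult.commute)
  qed
qed

text \<open>The Hessian of the same planar potential. The term in t reduces the identity matrix to
  the normal plane, since the potential is constant along the wire.\<close>

lemma integral_k2_line:
  assumes o: "d \<bullet> t = 0" "d \<noteq> 0" "t \<noteq> 0"
  shows "integral UNIV (\<lambda>\<sigma>. k2 i j 0 (- d - \<sigma> *\<^sub>R t)) = 4 * d $ i * d $ j / (norm t * norm d ^ 4)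
      + 2 * t $ i * t $ j / (norm t ^ 3 * (norm d)\<^sup>2) - (if i = j then 2 else 0) / (norm t * (norm d)\<^sup>2)"
proof -
  define \<omega> where "\<omega> = norm d" define v where "v = norm t"
  have p: "\<omega> > 0" "v > 0" using o by (auto simp: \<omega>_def v_def)
  define q where "q \<sigma> = sqrt (\<omega>\<^sup>2 + v\<^sup>2 * \<sigma>\<^sup>2)" for \<sigma>
  have r: "\<omega>\<^sup>2 + v\<^sup>2 * \<sigma>\<^sup>2 > 0" for \<sigma> using p by (intro add_pos_nonneg) auto
  have q: "q \<sigma> > 0" "(q \<sigma>)\<^sup>2 = \<omega>\<^sup>2 + v\<^sup>2 * \<sigma>\<^sup>2" for \<sigma> using r[of \<sigma>] by (auto simp: q_def)
  have dq: "(q has_real_derivative v\<^sup>2 * \<sigma> / q \<sigma>) (at \<sigma>)" for \<sigma>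
    unfolding q_def[abs_def] using r[of \<sigma>] by (auto intro!: derivative_eq_intros simp: field_simps)
  define \<delta> :: real where "\<delta> = (if i = j then 1 else 0)"
  \<comment> \<open>In x = \<sigma> / q and y = 1 / q the antiderivative is a polynomial, and at
    infinity these tend to 1 / v and 0.\<close>
  define x where "x \<sigma> = \<sigma> / q \<sigma>" for \<sigma>
  define y where "y \<sigma> = 1 / q \<sigma>" for \<sigma>
  define F where "F \<sigma> = 3 * d $ i * d $ j * (x \<sigma> * (y \<sigma>)\<^sup>2 / \<omega>\<^sup>2 + 2 * v\<^sup>2 * x \<sigma> ^ 3 / (3 * \<omega> ^ 4))
     - (d $ i * t $ j + d $ j * t $ i) * y \<sigma> ^ 3 / v\<^sup>2 + t $ i * t $ j * x \<sigma> ^ 3 / \<omega>\<^sup>2 - \<delta> * x \<sigma> / \<omega>\<^sup>2" for \<sigma>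
  obtain C where C: "\<And>\<sigma>. \<bar>k2 i j 0 (- d - \<sigma> *\<^sub>R t)\<bar> \<le> C / (1 + \<sigma>\<^sup>2)" using line_decay[OF k2_decay o] by metis
  show ?thesis
  proof (rule improper_integral_UNIV[OF _ C])
    fix \<sigma>
    have n: "norm (- d - \<sigma> *\<^sub>R t) = q \<sigma>" by (simp add: line_norm[OF o(1)] q_def \<omega>_def v_def)
    define Y where "Y = y \<sigma>"
    have Yq: "Y * q \<sigma> = 1" using q(1)[of \<sigma>] by (simp add: Y_def y_def)
    have xY: "x \<sigma> = \<sigma> * Y" by (simp add: Y_def x_def y_def)
    have A: "(x has_real_derivative \<omega>\<^sup>2 * Y ^ 3) (at \<sigma>)"
    proof -
      have "(x has_real_derivative (1 * q \<sigma> - \<sigma> * (v\<^sup>2 * \<sigma> / q \<sigma>)) / (q \<sigma> * q \<sigma>)) (at \<sigma>)"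
        unfolding x_def[abs_def] using q(1)[of \<sigma>] by (intro derivative_intros dq) auto
      moreover have "(1 * q \<sigma> - \<sigma> * (v\<^sup>2 * \<sigma> / q \<sigma>)) / (q \<sigma> * q \<sigma>) = ((q \<sigma>)\<^sup>2 - v\<^sup>2 * \<sigma>\<^sup>2) / q \<sigma> ^ 3"
        using q(1)[of \<sigma>] by (simp add: field_simps eval_nat_numeral)
      ultimately show ?thesis by (simp add: q(2) Y_def y_def power_divide)
    qed
    have B: "(y has_real_derivative - (v\<^sup>2 * \<sigma>) * Y ^ 3) (at \<sigma>)"
      unfolding y_def[abs_def] Y_def using q(1)[of \<sigma>] by (auto intro!: derivative_eq_intros dq simp: field_simps eval_nat_numeral)
    have A3: "((\<lambda>\<sigma>. x \<sigma> ^ 3) has_real_derivative 3 * (\<sigma> * Y)\<^sup>2 * (\<omega>\<^sup>2 * Y ^ 3)) (at \<sigma>)"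
      using DERIV_power[OF A, of 3] by (simp add: xY mult_ac)
    have B3: "((\<lambda>\<sigma>. y \<sigma> ^ 3) has_real_derivative - 3 * v\<^sup>2 * \<sigma> * Y ^ 5) (at \<sigma>)"
      using DERIV_power[OF B, of 3] by (simp add: Y_def[symmetric] mult_ac eval_nat_numeral)
    have AB: "((\<lambda>\<sigma>. x \<sigma> * (y \<sigma>)\<^sup>2) has_real_derivative \<omega>\<^sup>2 * Y ^ 5 - 2 * v\<^sup>2 * \<sigma>\<^sup>2 * Y ^ 5) (at \<sigma>)"
      using DERIV_mult[OF A DERIV_power[OF B, of 2]]
      by (simp add: Y_def[symmetric] xY mult_ac eval_nat_numeral)
    have "(F has_real_derivative 3 * d $ i * d $ j * ((\<omega>\<^sup>2 * Y ^ 5 - 2 * v\<^sup>2 * \<sigma>\<^sup>2 * Y ^ 5) / \<omega>\<^sup>2 + 2 * v\<^sup>2 * (3 * (\<sigma> * Y)\<^sup>2 * (\<omega>\<^sup>2 * Y ^ 3)) / (3 * \<omega> ^ 4))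
     - (d $ i * t $ j + d $ j * t $ i) * (- 3 * v\<^sup>2 * \<sigma> * Y ^ 5) / v\<^sup>2 + t $ i * t $ j * (3 * (\<sigma> * Y)\<^sup>2 * (\<omega>\<^sup>2 * Y ^ 3)) / \<omega>\<^sup>2 - \<delta> * (\<omega>\<^sup>2 * Y ^ 3) / \<omega>\<^sup>2) (at \<sigma>)"
      unfolding F_def[abs_def]
      by (intro DERIV_add DERIV_diff DERIV_cmult DERIV_cdivide A B3 A3 AB)
    moreover have "3 * d $ i * d $ j * ((\<omega>\<^sup>2 * Y ^ 5 - 2 * v\<^sup>2 * \<sigma>\<^sup>2 * Y ^ 5) / \<omega>\<^sup>2 + 2 * v\<^sup>2 * (3 * (\<sigma> * Y)\<^sup>2 * (\<omega>\<^sup>2 * Y ^ 3)) / (3 * \<omega> ^ 4))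
     - (d $ i * t $ j + d $ j * t $ i) * (- 3 * v\<^sup>2 * \<sigma> * Y ^ 5) / v\<^sup>2 + t $ i * t $ j * (3 * (\<sigma> * Y)\<^sup>2 * (\<omega>\<^sup>2 * Y ^ 3)) / \<omega>\<^sup>2 - \<delta> * (\<omega>\<^sup>2 * Y ^ 3) / \<omega>\<^sup>2
      = 3 * ((d $ i + \<sigma> * t $ i) * (d $ j + \<sigma> * t $ j)) * Y ^ 5 - \<delta> * Y ^ 3"
      using p by (simp add: field_simps eval_nat_numeral)
    moreover have "k2 i j 0 (- d - \<sigma> *\<^sub>R t) = 3 * ((d $ i + \<sigma> * t $ i) * (d $ j + \<sigma> * t $ j)) * Y ^ 5 - \<delta> * Y ^ 3"
      unfolding k2_def n Y_def y_def \<delta>_def by (simp add: power_divide algebra_simps)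
    ultimately show "(F has_real_derivative k2 i j 0 (- d - \<sigma> *\<^sub>R t)) (at \<sigma>)" by simp
  next
    have l: "(\<lambda>k. x (real k)) \<longlonglongrightarrow> 1 / v" "(\<lambda>k. y (real k)) \<longlonglongrightarrow> 0"
      using line_quotient_limits[OF p] by (simp_all add: x_def y_def q_def)
    have xm: "x (- real k) = - x (real k)" "y (- real k) = y (real k)" for k by (simp_all add: x_def y_def q_def)
    have "F (real k) - F (- real k) = 2 * (3 * d $ i * d $ j * (x (real k) * (y (real k))\<^sup>2 / \<omega>\<^sup>2 + 2 * v\<^sup>2 * x (real k) ^ 3 / (3 * \<omega> ^ 4))
      + t $ i * t $ j * x (real k) ^ 3 / \<omega>\<^sup>2 - \<delta> * x (real k) / \<omega>\<^sup>2)" for k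
      unfolding F_def xm by (simp add: algebra_simps add_divide_distrib diff_divide_distrib)
    moreover have "(\<lambda>k. 2 * (3 * d $ i * d $ j * (x (real k) * (y (real k))\<^sup>2 / \<omega>\<^sup>2 + 2 * v\<^sup>2 * x (real k) ^ 3 / (3 * \<omega> ^ 4))
      + t $ i * t $ j * x (real k) ^ 3 / \<omega>\<^sup>2 - \<delta> * x (real k) / \<omega>\<^sup>2)) \<longlonglongrightarrow>
        2 * (3 * d $ i * d $ j * ((1/v) * 0\<^sup>2 / \<omega>\<^sup>2 + 2 * v\<^sup>2 * (1/v) ^ 3 / (3 * \<omega> ^ 4))
      + t $ i * t $ j * (1/v) ^ 3 / \<omega>\<^sup>2 - \<delta> * (1/v) / \<omega>\<^sup>2)"
      using p by (intro tendsto_intros l) auto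
    moreover have "2 * (3 * d $ i * d $ j * ((1/v) * 0\<^sup>2 / \<omega>\<^sup>2 + 2 * v\<^sup>2 * (1/v) ^ 3 / (3 * \<omega> ^ 4))
      + t $ i * t $ j * (1/v) ^ 3 / \<omega>\<^sup>2 - \<delta> * (1/v) / \<omega>\<^sup>2) = 4 * d $ i * d $ j / (v * \<omega> ^ 4)
      + 2 * t $ i * t $ j / (v ^ 3 * \<omega>\<^sup>2) - (if i = j then 2 else 0) / (v * \<omega>\<^sup>2)"
      using p by (simp add: \<delta>_def field_simps eval_nat_numeral)
    ultimately show "(\<lambda>k. F (real k) - F (- real k)) \<longlonglongrightarrow> 4 * d $ i * d $ j / (norm t * norm d ^ 4)
      + 2 * t $ i * t $ j / (norm t ^ 3 * (norm d)\<^sup>2) - (if i = j then 2 else 0) / (norm t * (norm d)\<^sup>2)"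
      by (simp add: \<omega>_def v_def)
  qed
qed

text \<open>The distance r of the wire tends to 0 from the right while the relative offset w of the
  observer tends to 0 independently; the points considered are g s + r w.\<close>

definition small :: "(real \<times> (real^3)) filter" where "small = at_right 0 \<times>\<^sub>F nhds 0"

lemma eventually_small:
  "eventually P small \<longleftrightarrow> (\<exists>\<delta>>0. \<forall>r w. 0 < r \<longrightarrow> r < \<delta> \<longrightarrow> norm w < \<delta> \<longrightarrow> P (r, w))"
proof
  assume "eventually P small"
  then obtain Pf Pg where P: "eventually Pf (at_right (0::real))" "eventually Pg (nhds (0::real^3))" "\<And>x y. Pf x \<Longrightarrow> Pg y \<Longrightarrow> P (x, y)"
    unfolding small_def eventually_prod_filter by blast
  obtain a where a: "a > 0" "\<And>y. 0 < y \<Longrightarrow> y < a \<Longrightarrow> Pf y" using P(1) by (auto simp: eventually_at_right[OF zero_less_one])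
  obtain b where b: "b > 0" "\<And>y. norm y < b \<Longrightarrow> Pg y" using P(2) by (auto simp: eventually_nhds_metric)
  show "\<exists>\<delta>>0. \<forall>r w. 0 < r \<longrightarrow> r < \<delta> \<longrightarrow> norm w < \<delta> \<longrightarrow> P (r, w)"
    using a b P(3) by (intro exI[of _ "min a b"]) auto
next
  assume "\<exists>\<delta>>0. \<forall>r w. 0 < r \<longrightarrow> r < \<delta> \<longrightarrow> norm w < \<delta> \<longrightarrow> P (r, w)"
  then obtain \<delta> where d: "\<delta> > 0" "\<And>r w. 0 < r \<Longrightarrow> r < \<delta> \<Longrightarrow> norm w < \<delta> \<Longrightarrow> P (r, w)" by blast
  have "eventually (\<lambda>r. 0 < r \<and> r < \<delta>) (at_right (0::real))"
    using d(1) by (auto simp: eventually_at_right[OF zero_less_one] intro!: exI[of _ \<delta>])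
  moreover have "eventually (\<lambda>w. norm w < \<delta>) (nhds (0::real^3))"
    using d(1) by (auto simp: eventually_nhds_metric intro!: exI[of _ \<delta>])
  ultimately show "eventually P small" unfolding small_def eventually_prod_filter using d(2) by blast
qed

lemma displaced_nonzero:
  assumes g: "C2loop g g1 g2" and d: "\<And>s. d (s + 1) = d s" "continuous_on UNIV d"
    "\<And>s. d s \<bullet> g1 s = 0" "\<And>s. d s \<noteq> (0::real^3)"
  shows "eventually (\<lambda>p. \<forall>s u. (1 / fst p) *\<^sub>R (g s - g u) + snd p - d u \<noteq> 0) small"
proof -
  obtain c r0 w0 where c: "c > 0" "r0 > 0" "w0 > 0"
    "\<And>r w s s0. 0 < r \<Longrightarrow> r \<le> r0 \<Longrightarrow> norm w \<le> w0 \<Longrightarrow> \<bar>s - s0\<bar> \<le> 1/2 \<Longrightarrow>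
       c * (r + \<bar>s - s0\<bar>) \<le> norm (g s0 - g s + r *\<^sub>R (w - d s))"
    using displaced_lower_bound[OF g d] by metis
  show ?thesis unfolding eventually_small fst_conv snd_conv
  proof (intro exI[of _ "min r0 w0"] conjI allI impI)
    show "min r0 w0 > 0" using c by simp
    fix r :: real and w :: "real^3" and s u :: real
    assume h: "0 < r" "r < min r0 w0" "norm w < min r0 w0"
    define u' where "u' = u + of_int (round (s - u))"
    have u': "\<bar>u' - s\<bar> \<le> 1/2" using of_int_round_abs_le[of "s - u"] by (simp add: u'_def algebra_simps)
    have e: "g u' = g u" "d u' = d u"
      unfolding u'_def using periodic_int[where g=g, OF C2loopD(1)[OF g]] periodic_int[where g=d, OF d(1)] by auto
    have "0 < c * (r + \<bar>u' - s\<bar>)" using c h by (intro mult_pos_pos add_pos_nonneg) auto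
    also have "\<dots> \<le> norm (g s - g u' + r *\<^sub>R (w - d u'))" using h u' by (intro c(4)) auto
    finally have "g s - g u + r *\<^sub>R (w - d u) \<noteq> 0" using e by auto
    moreover have "g s - g u + r *\<^sub>R (w - d u) = r *\<^sub>R ((1 / r) *\<^sub>R (g s - g u) + w - d u)" using h by (simp add: algebra_simps)
    ultimately show "(1 / r) *\<^sub>R (g s - g u) + w - d u \<noteq> 0" by auto
  qed
qed

text \<open>If uniformity failed, there would be offending parameters, by periodicity all in [0, 1].
  Along a convergent subsequence \<open>wire_limit\<close> and continuity of L give the same limit,
  a contradiction.\<close>

lemma wire_uniform:
  fixes k :: "real \<Rightarrow> real^3 \<Rightarrow> real"
  assumes g: "C2loop g g1 g2" and d: "\<And>s. d (s + 1) = d s" "continuous_on UNIV d"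
    "\<And>s. d s \<bullet> g1 s = 0" "\<And>s. d s \<noteq> (0::real^3)"
    and m: "\<And>s. m (s + 1) = m s" "continuous_on UNIV m"
    and kc: "continuous_on {p. snd p \<noteq> 0} (\<lambda>p. k (fst p) (snd p))"
    and kb: "\<And>c. c > 0 \<Longrightarrow> \<exists>C. \<forall>r\<ge>0. \<forall>Z. norm Z \<ge> c \<longrightarrow> \<bar>k r Z\<bar> \<le> C / (norm Z)\<^sup>2"
    and L: "\<And>s. integral UNIV (\<lambda>\<sigma>. k 0 (- d s - \<sigma> *\<^sub>R g1 s)) * m s = L s" and Lc: "continuous_on UNIV L"
  shows "uniform_limit UNIV (\<lambda>p s. (1 / fst p) * integral {0..1} (\<lambda>u. k (fst p) ((1 / fst p) *\<^sub>R (g s - g u) + snd p - d u) * m u)) L small"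
proof (rule ccontr)
  note G = C2loopD[OF g]
  define I where "I r w s = (1 / r) * integral {0..1} (\<lambda>u. k r ((1 / r) *\<^sub>R (g s - g u) + w - d u) * m u)" for r w s
  have Lp: "L (s + 1) = L s" for s using L[of s] L[of "s + 1"] by (simp add: d m G)
  assume "\<not> ?thesis"
  then obtain \<eta> where \<eta>: "\<eta> > 0" "\<not> eventually (\<lambda>p. \<forall>s. dist (I (fst p) (snd p) s) (L s) < \<eta>) small"
    unfolding uniform_limit_iff I_def by auto
  obtain \<delta>0 where \<delta>0: "\<delta>0 > 0" "\<And>r w s u. 0 < r \<Longrightarrow> r < \<delta>0 \<Longrightarrow> norm w < \<delta>0 \<Longrightarrow> (1 / r) *\<^sub>R (g s - g u) + w - d u \<noteq> 0"
    using displaced_nonzero[OF g d] unfolding eventually_small by auto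
  have "\<exists>r w s. 0 < r \<and> r < min \<delta>0 (1 / real (Suc n)) \<and> norm w < min \<delta>0 (1 / real (Suc n)) \<and> s \<in> {0..1} \<and> \<not> dist (I r w s) (L s) < \<eta>" for n
  proof -
    obtain r w s where h: "0 < r" "r < min \<delta>0 (1 / real (Suc n))" "norm w < min \<delta>0 (1 / real (Suc n))" "\<not> dist (I r w s) (L s) < \<eta>"
      using \<eta>(2) \<delta>0(1) unfolding eventually_small
      by (metis (no_types, lifting) fst_conv snd_conv min_less_iff_conj of_nat_0_less_iff zero_less_Suc zero_less_divide_1_iff)
    have "I r w (frac s) = I r w s" "L (frac s) = L s"
      using periodic_int[where g=g and k="-\<lfloor>s\<rfloor>" and s=s, OF G(1)] periodic_int[where g=L and k="-\<lfloor>s\<rfloor>" and s=s, OF Lp]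
      by (simp_all add: I_def frac_def)
    moreover have "frac s \<in> {0..1}" using frac_lt_1[of s] by (simp add: less_imp_le)
    ultimately show ?thesis using h by metis
  qed
  then obtain r w S where h: "\<And>n. 0 < r n" "\<And>n. r n < min \<delta>0 (1 / real (Suc n))" "\<And>n. norm (w n) < min \<delta>0 (1 / real (Suc n))"
    "\<And>n. S n \<in> {0..1}" "\<And>n. \<not> dist (I (r n) (w n) (S n)) (L (S n)) < \<eta>" by metis
  obtain s' \<phi> where s': "strict_mono \<phi>" "(S \<circ> \<phi>) \<longlonglongrightarrow> s'"
    using compact_Icc[of "0::real" 1] h(4) unfolding compact_eq_seq_compact_metric seq_compact_def by metis
  have rl: "r \<longlonglongrightarrow> 0"
    by (rule tendsto_sandwich[OF _ _ tendsto_const LIMSEQ_inverse_real_of_nat])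
      (use h(1,2) in \<open>auto simp: inverse_eq_divide intro!: always_eventually less_imp_le\<close>)
  have wl: "w \<longlonglongrightarrow> 0"
    by (rule Lim_null_comparison[OF _ LIMSEQ_inverse_real_of_nat])
      (use h(3) in \<open>auto simp: inverse_eq_divide intro!: always_eventually less_imp_le\<close>)
  \<comment> \<open>Periodicity moves the integral from [0, 1] to the window centred at S n, where
    \<open>wire_limit\<close> works.\<close>
  have win: "I (r n) (w n) (S n) = (1 / r n) * integral {S n - 1/2..S n + 1/2} (\<lambda>u. k (r n) ((1 / r n) *\<^sub>R (g (S n) - g u) + w n - d u) * m u)" for n
  proof -
    have nz: "(1 / r n) *\<^sub>R (g (S n) - g u) + w n - d u \<noteq> 0" for u using h(1-3)[of n] by (intro \<delta>0(2)) auto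
    have zc: "continuous_on UNIV (\<lambda>u. (1 / r n) *\<^sub>R (g (S n) - g u) + w n - d u)" by (intro continuous_intros G d)
    have "continuous_on UNIV (\<lambda>u. k (fst (r n, (1 / r n) *\<^sub>R (g (S n) - g u) + w n - d u)) (snd (r n, (1 / r n) *\<^sub>R (g (S n) - g u) + w n - d u)))"
      by (rule continuous_on_compose2[OF kc]) (use nz in \<open>auto intro!: continuous_intros zc\<close>)
    then have c: "continuous_on UNIV (\<lambda>u. k (r n) ((1 / r n) *\<^sub>R (g (S n) - g u) + w n - d u) * m u)"
      using continuous_on_mult[OF _ m(2)] by simp
    have "integral {0..0+1} (\<lambda>u. k (r n) ((1 / r n) *\<^sub>R (g (S n) - g u) + w n - d u) * m u)
      = integral {S n - 1/2..S n - 1/2 + 1} (\<lambda>u. k (r n) ((1 / r n) *\<^sub>R (g (S n) - g u) + w n - d u) * m u)"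
      by (rule integral_periodic_window[OF _ c]) (simp add: G d m)
    moreover have "S n - 1/2 + 1 = S n + 1/2" by simp
    ultimately show ?thesis unfolding I_def by (simp only: add_0_left)
  qed
  have "(\<lambda>n. (1 / (r \<circ> \<phi>) n) * integral {(S \<circ> \<phi>) n - 1/2..(S \<circ> \<phi>) n + 1/2} (\<lambda>u. k ((r \<circ> \<phi>) n) ((1 / (r \<circ> \<phi>) n) *\<^sub>R (g ((S \<circ> \<phi>) n) - g u) + (w \<circ> \<phi>) n - d u) * m u))
    \<longlonglongrightarrow> integral UNIV (\<lambda>\<sigma>. k 0 (- d s' - \<sigma> *\<^sub>R g1 s') * m s')"
    using h(1) by (intro wire_limit[OF g d m kc kb _ LIMSEQ_subseq_LIMSEQ[OF rl s'(1)] s'(2) LIMSEQ_subseq_LIMSEQ[OF wl s'(1)]]) auto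
  moreover have "integral UNIV (\<lambda>\<sigma>. k 0 (- d s' - \<sigma> *\<^sub>R g1 s') * m s') = L s'" using L[of s'] by simp
  ultimately have 1: "(\<lambda>n. I (r (\<phi> n)) (w (\<phi> n)) (S (\<phi> n))) \<longlonglongrightarrow> L s'" by (simp add: win o_def)
  have "isCont L s'" using Lc by (simp add: continuous_on_eq_continuous_at)
  from isCont_tendsto_compose[OF this s'(2)] have 2: "(\<lambda>n. L (S (\<phi> n))) \<longlonglongrightarrow> L s'" by simp
  from tendsto_dist[OF 1 2] have "(\<lambda>n. dist (I (r (\<phi> n)) (w (\<phi> n)) (S (\<phi> n))) (L (S (\<phi> n)))) \<longlonglongrightarrow> 0" by simp
  then have "eventually (\<lambda>n. dist (I (r (\<phi> n)) (w (\<phi> n)) (S (\<phi> n))) (L (S (\<phi> n))) < \<eta>) sequentially"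
    using \<eta>(1) by (rule order_tendstoD)
  then obtain n where "dist (I (r (\<phi> n)) (w (\<phi> n)) (S (\<phi> n))) (L (S (\<phi> n))) < \<eta>"
    by (auto simp: eventually_sequentially)
  then show False using h(5) by blast
qed

text \<open>The vector potential, in component k, of a wire displaced by r d that carries Yukawa
  sources of density m. Derivatives are taken on the kernel by definition: the integrals are only
  compared with jets and never differentiated themselves.\<close>

definition wint :: "(real \<Rightarrow> real^3) \<Rightarrow> (real \<Rightarrow> real^3) \<Rightarrow> (real \<Rightarrow> real^3) \<Rightarrow> real \<Rightarrow> 3 \<Rightarrow> 3 list \<Rightarrow> real^3 \<Rightarrow> real" where
  "wint g d m r k l x = integral {0..1} (\<lambda>u. gev (jet l) (x - g u - r *\<^sub>R d u) * m u $ k)"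

text \<open>The kernels scale like r^-2 and r^-3, and integration over the part of the wire of
  length r gives back one factor r; hence the weights r and r^2.\<close>

lemma uniform_limit_wint:
  assumes g: "C2loop g g1 g2" and d: "\<And>s. d (s + 1) = d s" "continuous_on UNIV d"
    "\<And>s. d s \<bullet> g1 s = 0" "\<And>s. d s \<noteq> (0::real^3)"
    and m: "\<And>s. m (s + 1) = m s" "continuous_on UNIV m"
  shows "uniform_limit UNIV (\<lambda>p s. fst p * wint g d m (fst p) k [i] (g s + fst p *\<^sub>R snd p))
      (\<lambda>s. 2 * d s $ i / (norm (g1 s) * (norm (d s))\<^sup>2) * m s $ k) small"
    and "uniform_limit UNIV (\<lambda>p s. (fst p)\<^sup>2 * wint g d m (fst p) k [i, j] (g s + fst p *\<^sub>R snd p))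
      (\<lambda>s. (4 * d s $ i * d s $ j / (norm (g1 s) * norm (d s) ^ 4)
      + 2 * g1 s $ i * g1 s $ j / (norm (g1 s) ^ 3 * (norm (d s))\<^sup>2) - (if i = j then 2 else 0) / (norm (g1 s) * (norm (d s))\<^sup>2)) * m s $ k) small"
proof -
  note G = C2loopD[OF g]
  have mk: "m (s + 1) $ k = m s $ k" "continuous_on UNIV (\<lambda>s. m s $ k)" for s by (simp add: m) (intro continuous_intros m)
  have pos: "eventually (\<lambda>p. fst p > 0) small" unfolding eventually_small by (intro exI[of _ 1]) auto
  have arg: "g s + r *\<^sub>R w - g u - r *\<^sub>R d u = r *\<^sub>R ((1 / r) *\<^sub>R (g s - g u) + w - d u)" if "r > 0" for r w s u
    using that by (simp add: algebra_simps)
  have 1: "uniform_limit UNIV (\<lambda>p s. (1 / fst p) * integral {0..1} (\<lambda>u. k1 i (fst p) ((1 / fst p) *\<^sub>R (g s - g u) + snd p - d u) * m u $ k))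
     (\<lambda>s. 2 * d s $ i / (norm (g1 s) * (norm (d s))\<^sup>2) * m s $ k) small"
  proof (rule wire_uniform[OF g d mk continuous_on_k1 k1_decay])
    show "integral UNIV (\<lambda>\<sigma>. k1 i 0 (- d s - \<sigma> *\<^sub>R g1 s)) * m s $ k = 2 * d s $ i / (norm (g1 s) * (norm (d s))\<^sup>2) * m s $ k" for s
      by (simp add: integral_k1_line[OF d(3,4) G(6)])
    show "continuous_on UNIV (\<lambda>s. 2 * d s $ i / (norm (g1 s) * (norm (d s))\<^sup>2) * m s $ k)"
      using d(4) G(6) by (intro continuous_intros d(2) G(8) m(2)) auto
  qed
  show "uniform_limit UNIV (\<lambda>p s. fst p * wint g d m (fst p) k [i] (g s + fst p *\<^sub>R snd p))
      (\<lambda>s. 2 * d s $ i / (norm (g1 s) * (norm (d s))\<^sup>2) * m s $ k) small"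
  proof (rule uniform_limit_cong[THEN iffD1, OF _ _ 1])
    show "eventually (\<lambda>p. \<forall>s\<in>UNIV. (1 / fst p) * integral {0..1} (\<lambda>u. k1 i (fst p) ((1 / fst p) *\<^sub>R (g s - g u) + snd p - d u) * m u $ k)
      = fst p * wint g d m (fst p) k [i] (g s + fst p *\<^sub>R snd p)) small"
      using pos
    proof eventually_elim
      case (elim p)
      then show ?case
        by (simp only: wint_def arg gev_jet1_scale times_divide_eq_left integral_divide) (simp add: power2_eq_square)
    qed
  qed simp
  have 2: "uniform_limit UNIV (\<lambda>p s. (1 / fst p) * integral {0..1} (\<lambda>u. k2 i j (fst p) ((1 / fst p) *\<^sub>R (g s - g u) + snd p - d u) * m u $ k))
     (\<lambda>s. (4 * d s $ i * d s $ j / (norm (g1 s) * norm (d s) ^ 4)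
      + 2 * g1 s $ i * g1 s $ j / (norm (g1 s) ^ 3 * (norm (d s))\<^sup>2) - (if i = j then 2 else 0) / (norm (g1 s) * (norm (d s))\<^sup>2)) * m s $ k) small"
  proof (rule wire_uniform[OF g d mk continuous_on_k2 k2_decay])
    show "integral UNIV (\<lambda>\<sigma>. k2 i j 0 (- d s - \<sigma> *\<^sub>R g1 s)) * m s $ k = (4 * d s $ i * d s $ j / (norm (g1 s) * norm (d s) ^ 4)
      + 2 * g1 s $ i * g1 s $ j / (norm (g1 s) ^ 3 * (norm (d s))\<^sup>2) - (if i = j then 2 else 0) / (norm (g1 s) * (norm (d s))\<^sup>2)) * m s $ k" for s
      by (simp only: integral_k2_line[OF d(3,4) G(6)])
    show "continuous_on UNIV (\<lambda>s. (4 * d s $ i * d s $ j / (norm (g1 s) * norm (d s) ^ 4)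
      + 2 * g1 s $ i * g1 s $ j / (norm (g1 s) ^ 3 * (norm (d s))\<^sup>2) - (if i = j then 2 else 0) / (norm (g1 s) * (norm (d s))\<^sup>2)) * m s $ k)"
      using d(4) G(6) by (intro continuous_intros d(2) G(8) m(2)) auto
  qed
  show "uniform_limit UNIV (\<lambda>p s. (fst p)\<^sup>2 * wint g d m (fst p) k [i, j] (g s + fst p *\<^sub>R snd p))
      (\<lambda>s. (4 * d s $ i * d s $ j / (norm (g1 s) * norm (d s) ^ 4)
      + 2 * g1 s $ i * g1 s $ j / (norm (g1 s) ^ 3 * (norm (d s))\<^sup>2) - (if i = j then 2 else 0) / (norm (g1 s) * (norm (d s))\<^sup>2)) * m s $ k) small"
  proof (rule uniform_limit_cong[THEN iffD1, OF _ _ 2])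
    show "eventually (\<lambda>p. \<forall>s\<in>UNIV. (1 / fst p) * integral {0..1} (\<lambda>u. k2 i j (fst p) ((1 / fst p) *\<^sub>R (g s - g u) + snd p - d u) * m u $ k)
      = (fst p)\<^sup>2 * wint g d m (fst p) k [i, j] (g s + fst p *\<^sub>R snd p)) small"
      using pos
    proof eventually_elim
      case (elim p)
      then show ?case
        by (simp only: wint_def arg gev_jet2_scale times_divide_eq_left integral_divide) (simp add: eval_nat_numeral)
    qed
  qed simp
qed

section \<open>The curl of the wires near the curve\<close>

lemma uniform_limit_scale:
  fixes f :: "'b \<Rightarrow> 'a \<Rightarrow> real"
  assumes "uniform_limit S f L F" and c: "\<And>s. \<bar>c s\<bar> \<le> C"
  shows "uniform_limit S (\<lambda>p s. c s * f p s) (\<lambda>s. c s * L s) F"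
proof (rule uniform_limitI)
  fix e :: real assume e: "e > 0"
  define C' where "C' = \<bar>C\<bar> + 1"
  have "\<bar>c s\<bar> \<le> C'" for s using c[of s] unfolding C'_def by linarith
  then have C': "C' > 0" "\<And>s. \<bar>c s\<bar> \<le> C'" by (auto simp: C'_def)
  from uniform_limitD[OF assms(1), of "e / C'"] e C'
  have "eventually (\<lambda>p. \<forall>s\<in>S. dist (f p s) (L s) < e / C') F" by simp
  then show "eventually (\<lambda>p. \<forall>s\<in>S. dist (c s * f p s) (c s * L s) < e) F"
  proof eventually_elim
    case (elim p)
    show ?case
    proof
      fix s assume "s \<in> S"
      have "dist (c s * f p s) (c s * L s) = \<bar>c s\<bar> * dist (f p s) (L s)"
        by (simp add: dist_real_def abs_mult flip: right_diff_distrib)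
      also have "\<dots> \<le> C' * dist (f p s) (L s)" using C' by (intro mult_right_mono) auto
      also have "\<dots> < C' * (e / C')" using elim \<open>s \<in> S\<close> C' by (intro mult_strict_left_mono) auto
      finally show "dist (c s * f p s) (c s * L s) < e" using C' by simp
    qed
  qed
qed

lemma wire_curl_limit:
  assumes g: "C2loop g g1 g2" and d: "\<And>s. d (s + 1) = d s" "continuous_on UNIV d"
    "\<And>s. d s \<bullet> g1 s = 0" "\<And>s. d s \<noteq> (0::real^3)"
    and m: "\<And>s. m (s + 1) = m s" "continuous_on UNIV m"
  shows "uniform_limit UNIV (\<lambda>p s. fst p * curlj (wint g d m (fst p)) k [] (g s + fst p *\<^sub>R snd p))
      (\<lambda>s. cross3 ((2 / (norm (g1 s) * (norm (d s))\<^sup>2)) *\<^sub>R d s) (m s) $ k) small"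
proof -
  note w = uniform_limit_wint(1)[OF g d m]
  consider "k = 1" | "k = 2" | "k = 3" using exhaust_3 by blast
  then show ?thesis
  proof cases
    case 1
    show ?thesis using uniform_limit_minus[OF w[of 3 2] w[of 2 3]]
      unfolding 1 by (simp add: curlj_def cross3_def right_diff_distrib)
  next
    case 2
    show ?thesis using uniform_limit_minus[OF w[of 1 3] w[of 3 1]]
      unfolding 2 by (simp add: curlj_def cross3_def right_diff_distrib)
  next
    case 3
    show ?thesis using uniform_limit_minus[OF w[of 2 1] w[of 1 2]]
      unfolding 3 by (simp add: curlj_def cross3_def right_diff_distrib)
  qed
qed

text \<open>Only directions h normal to the curve occur, which removes the tangential term of the
  Hessian.\<close>

lemma wire_hessian_contract:
  fixes d t h :: "real^3"
  assumes "t \<bullet> h = 0"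
  shows "(\<Sum>j\<in>UNIV. h $ j * (4 * d $ j * d $ i / a + 2 * t $ j * t $ i / b - (if j = i then 2 else 0) / c))
    = ((4 * (d \<bullet> h) / a) *\<^sub>R d - (2 / c) *\<^sub>R h) $ i"
proof -
  have 0: "t $ 1 * h $ 1 + t $ 2 * h $ 2 + t $ 3 * h $ 3 = 0" using assms by (simp add: inner_vec_def sum_3)
  have "(\<Sum>j\<in>UNIV. h $ j * (4 * d $ j * d $ i / a + 2 * t $ j * t $ i / b - (if j = i then 2 else 0) / c))
    = (4 * (d \<bullet> h) / a) * d $ i + (2 * (t $ 1 * h $ 1 + t $ 2 * h $ 2 + t $ 3 * h $ 3) / b) * t $ i - (2 / c) * h $ i"
    using exhaust_3[of i] by (auto simp: sum_3 inner_vec_def ring_distribs add_divide_distrib algebra_simps)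
  then show ?thesis unfolding 0 by simp
qed

lemma wire_curl_deriv_limit:
  assumes g: "C2loop g g1 g2" and d: "\<And>s. d (s + 1) = d s" "continuous_on UNIV d"
    "\<And>s. d s \<bullet> g1 s = 0" "\<And>s. d s \<noteq> (0::real^3)"
    and m: "\<And>s. m (s + 1) = m s" "continuous_on UNIV m"
    and h: "\<And>s. h s \<bullet> h s = 1" "\<And>s. g1 s \<bullet> h s = 0"
  shows "uniform_limit UNIV (\<lambda>p s. (fst p)\<^sup>2 * (\<Sum>j\<in>UNIV. h s $ j * curlj (wint g d m (fst p)) k [j] (g s + fst p *\<^sub>R snd p)))
      (\<lambda>s. cross3 ((4 * (d s \<bullet> h s) / (norm (g1 s) * norm (d s) ^ 4)) *\<^sub>R d s - (2 / (norm (g1 s) * (norm (d s))\<^sup>2)) *\<^sub>R h s) (m s) $ k) small"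
proof -
  have h1: "\<bar>h s $ j\<bar> \<le> 1" for s j
    using component_le_norm_cart[of "h s" j] h(1)[of s] by (simp add: norm_eq_sqrt_inner)
  define A where "A s i j = 4 * d s $ i * d s $ j / (norm (g1 s) * norm (d s) ^ 4)
      + 2 * g1 s $ i * g1 s $ j / (norm (g1 s) ^ 3 * (norm (d s))\<^sup>2) - (if i = j then 2 else 0) / (norm (g1 s) * (norm (d s))\<^sup>2)" for s i j
  define e where "e s = (4 * (d s \<bullet> h s) / (norm (g1 s) * norm (d s) ^ 4)) *\<^sub>R d s - (2 / (norm (g1 s) * (norm (d s))\<^sup>2)) *\<^sub>R h s" for s
  have e: "(\<Sum>j\<in>UNIV. h s $ j * A s j i) = e s $ i" for s i
    unfolding A_def e_def by (rule wire_hessian_contract[OF h(2)])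
  define W where "W j i k' p s = (fst p)\<^sup>2 * wint g d m (fst p) k' [j, i] (g s + fst p *\<^sub>R snd p)" for j i k' p s
  have w: "uniform_limit UNIV (W j i k') (\<lambda>s. A s j i * m s $ k') small" for j i k'
    unfolding A_def W_def by (rule uniform_limit_wint(2)[OF g d m])
  have hw: "uniform_limit UNIV (\<lambda>p s. h s $ j * W j i k' p s) (\<lambda>s. h s $ j * (A s j i * m s $ k')) small" for j i k'
    by (rule uniform_limit_scale[OF w h1])
  have H: "uniform_limit UNIV (\<lambda>p s. \<Sum>j\<in>UNIV. h s $ j * W j i k' p s) (\<lambda>s. e s $ i * m s $ k') small" for i k'
  proof -
    have "(\<Sum>j\<in>UNIV. h s $ j * (A s j i * m s $ k')) = e s $ i * m s $ k'" for s
      unfolding e[symmetric] by (simp only: sum_distrib_right mult.assoc)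
    then show ?thesis
      using uniform_limit_add[OF uniform_limit_add[OF hw[of 1 i k'] hw[of 2 i k']] hw[of 3 i k']] by (simp add: sum_3)
  qed
  have c: "(fst p)\<^sup>2 * (\<Sum>j\<in>UNIV. h s $ j * (wint g d m (fst p) a [j, i] (g s + fst p *\<^sub>R snd p) - wint g d m (fst p) a' [j, i'] (g s + fst p *\<^sub>R snd p)))
     = (\<Sum>j\<in>UNIV. h s $ j * W j i a p s) - (\<Sum>j\<in>UNIV. h s $ j * W j i' a' p s)" for p s a i a' i'
    by (simp add: W_def sum_3 algebra_simps)
  consider "k = 1" | "k = 2" | "k = 3" using exhaust_3 by blast
  then show ?thesis
  proof cases
    case 1
    show ?thesis using uniform_limit_minus[OF H[of 2 3] H[of 3 2]]
      unfolding 1 e_def[symmetric] by (simp add: curlj_def cross3_def c)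
  next
    case 2
    show ?thesis using uniform_limit_minus[OF H[of 3 1] H[of 1 3]]
      unfolding 2 e_def[symmetric] by (simp add: curlj_def cross3_def c)
  next
    case 3
    show ?thesis using uniform_limit_minus[OF H[of 1 2] H[of 2 1]]
      unfolding 3 e_def[symmetric] by (simp add: curlj_def cross3_def c)
  qed
qed

text \<open>For the first wire the density norm (g1)^2 n2 makes the limit of the curl exactly 2 g1;
  its derivative is 2 g1 along n1 and 0 along n2. The two opposite wires have cancelling values on
  the curve, but their derivatives add up to 2 n1 along n1 and - 2 n2 along n2.\<close>

definition triple_wire :: "(real \<Rightarrow> real^3) \<Rightarrow> (real \<Rightarrow> real^3) \<Rightarrow> (real \<Rightarrow> real^3) \<Rightarrow> (real \<Rightarrow> real^3) \<Rightarrow> real \<Rightarrow> 3 \<Rightarrow> 3 list \<Rightarrow> real^3 \<Rightarrow> real" where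
  "triple_wire g g1 n1 n2 r k l x =
     wint g n1 (\<lambda>s. (norm (g1 s))\<^sup>2 *\<^sub>R n2 s) r k l x
     + wint g (\<lambda>s. n1 s + n2 s) g1 r k l x + wint g (\<lambda>s. - n1 s - n2 s) g1 r k l x"

lemma normal_frameD:
  assumes "normal_frame g1 n1 n2 m1 m2"
  shows "\<And>s. n1 (s + 1) = n1 s" "\<And>s. n2 (s + 1) = n2 s" "continuous_on A n1" "continuous_on A n2"
    "\<And>s. n1 s \<bullet> n1 s = 1" "\<And>s. n2 s \<bullet> n2 s = 1" "\<And>s. n1 s \<bullet> n2 s = 0" "\<And>s. n1 s \<bullet> g1 s = 0" "\<And>s. n2 s \<bullet> g1 s = 0"
    "\<And>s. cross3 (n1 s) (n2 s) = (1 / norm (g1 s)) *\<^sub>R g1 s"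
proof -
  have "\<And>s. (n1 has_vector_derivative m1 s) (at s)" "\<And>s. (n2 has_vector_derivative m2 s) (at s)"
    using assms by (simp_all add: normal_frame_def)
  then show "continuous_on A n1" "continuous_on A n2"
    by (meson continuous_at_imp_continuous_on has_vector_derivative_continuous)+
qed (use assms in \<open>simp_all add: normal_frame_def\<close>)

text \<open>The result is expansion along n1 and contraction along n2. The additional 2 g1 in the
  derivative along n1 is a tangential shear from the first wire; \<open>tube_orbit\<close> absorbs
  it into the speed factor.\<close>

lemma triple_wire_limit:
  assumes g: "C2loop g g1 g2" and f: "normal_frame g1 n1 n2 m1 m2"
  shows "uniform_limit UNIV (\<lambda>p s. fst p * curlj (triple_wire g g1 n1 n2 (fst p)) k [] (g s + fst p *\<^sub>R snd p)) (\<lambda>s. 2 * g1 s $ k) small"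
    and "uniform_limit UNIV (\<lambda>p s. (fst p)\<^sup>2 * (\<Sum>j\<in>UNIV. n1 s $ j * curlj (triple_wire g g1 n1 n2 (fst p)) k [j] (g s + fst p *\<^sub>R snd p)))
      (\<lambda>s. 2 * (n1 s + g1 s) $ k) small"
    and "uniform_limit UNIV (\<lambda>p s. (fst p)\<^sup>2 * (\<Sum>j\<in>UNIV. n2 s $ j * curlj (triple_wire g g1 n1 n2 (fst p)) k [j] (g s + fst p *\<^sub>R snd p)))
      (\<lambda>s. - 2 * n2 s $ k) small"
proof -
  note G = C2loopD[OF g] and F = normal_frameD[OF f]
  have F': "g1 s \<bullet> n1 s = 0" "g1 s \<bullet> n2 s = 0" "n2 s \<bullet> n1 s = 0" for s using F(7-9)[of s] by (simp_all add: inner_commute)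
  have n1: "norm (n1 s) = 1" and n2: "norm (n2 s) = 1" for s using F(5,6)[of s] by (simp_all add: norm_eq_sqrt_inner)
  have n12: "(norm (n1 s + n2 s))\<^sup>2 = 2" "(norm (- n1 s - n2 s))\<^sup>2 = 2" for s
    by (simp_all add: power2_norm_eq_inner inner_simps F F')
  have p4: "x ^ 4 = (x\<^sup>2)\<^sup>2" for x :: real by simp
  have n12': "norm (n1 s + n2 s) ^ 4 = 4" "norm (- n1 s - n2 s) ^ 4 = 4" for s unfolding p4 n12 by simp_all
  have nz: "n1 s \<noteq> 0" "n1 s + n2 s \<noteq> 0" "- n1 s - n2 s \<noteq> 0" for s
    using n1[of s] n12[of s] by fastforce+
  have x1: "cross3 (n2 s) (g1 s) = norm (g1 s) *\<^sub>R n1 s" and x2: "cross3 (n1 s) (g1 s) = - norm (g1 s) *\<^sub>R n2 s" for s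
  proof -
    have "cross3 (n2 s) ((1 / norm (g1 s)) *\<^sub>R g1 s) = n1 s" "cross3 (n1 s) ((1 / norm (g1 s)) *\<^sub>R g1 s) = - n2 s"
      unfolding F(10)[symmetric] by (simp_all add: Lagrange F(5-9) F')
    then have "norm (g1 s) *\<^sub>R ((1 / norm (g1 s)) *\<^sub>R cross3 (n2 s) (g1 s)) = norm (g1 s) *\<^sub>R n1 s"
      "norm (g1 s) *\<^sub>R ((1 / norm (g1 s)) *\<^sub>R cross3 (n1 s) (g1 s)) = norm (g1 s) *\<^sub>R - n2 s"
      unfolding cross_mult_right by simp_all
    then show "cross3 (n2 s) (g1 s) = norm (g1 s) *\<^sub>R n1 s" "cross3 (n1 s) (g1 s) = - norm (g1 s) *\<^sub>R n2 s"
      using G(6)[of s] by simp_all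
  qed
  have D1: "n1 (s + 1) = n1 s" "n1 s \<bullet> g1 s = 0"
    and D2: "n1 (s + 1) + n2 (s + 1) = n1 s + n2 s" "(n1 s + n2 s) \<bullet> g1 s = 0"
    and D3: "- n1 (s + 1) - n2 (s + 1) = - n1 s - n2 s" "(- n1 s - n2 s) \<bullet> g1 s = 0" for s
    by (simp_all add: F inner_simps)
  have c2: "continuous_on UNIV (\<lambda>s. n1 s + n2 s)" and c3: "continuous_on UNIV (\<lambda>s. - n1 s - n2 s)"
    and cm: "continuous_on UNIV (\<lambda>s. (norm (g1 s))\<^sup>2 *\<^sub>R n2 s)" by (intro continuous_intros F G)+
  have mp: "(norm (g1 (s + 1)))\<^sup>2 *\<^sub>R n2 (s + 1) = (norm (g1 s))\<^sup>2 *\<^sub>R n2 s" for s by (simp add: F G)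
  have lin: "curlj (triple_wire g g1 n1 n2 r) k l x = curlj (wint g n1 (\<lambda>s. (norm (g1 s))\<^sup>2 *\<^sub>R n2 s) r) k l x
     + curlj (wint g (\<lambda>s. n1 s + n2 s) g1 r) k l x + curlj (wint g (\<lambda>s. - n1 s - n2 s) g1 r) k l x" for r l x
    by (simp add: curlj_def triple_wire_def)
  show "uniform_limit UNIV (\<lambda>p s. fst p * curlj (triple_wire g g1 n1 n2 (fst p)) k [] (g s + fst p *\<^sub>R snd p)) (\<lambda>s. 2 * g1 s $ k) small"
  proof -
    have e: "cross3 ((2 / (norm (g1 s) * (norm (n1 s))\<^sup>2)) *\<^sub>R n1 s) ((norm (g1 s))\<^sup>2 *\<^sub>R n2 s) $ k
       + cross3 ((2 / (norm (g1 s) * (norm (n1 s + n2 s))\<^sup>2)) *\<^sub>R (n1 s + n2 s)) (g1 s) $ k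
       + cross3 ((2 / (norm (g1 s) * (norm (- n1 s - n2 s))\<^sup>2)) *\<^sub>R (- n1 s - n2 s)) (g1 s) $ k = 2 * g1 s $ k" for s
      using G(6)[of s] unfolding n12 n1 cross_mult_left cross_mult_right F(10)
      by (simp add: cross_add_left cross_minus_left left_diff_distrib Cross3.left_diff_distrib power2_eq_square algebra_simps)
    show ?thesis
      using uniform_limit_add[OF uniform_limit_add[OF wire_curl_limit[OF g D1(1) F(3) D1(2) nz(1) mp cm, of k]
         wire_curl_limit[OF g D2(1) c2 D2(2) nz(2) G(2) G(8), of k]] wire_curl_limit[OF g D3(1) c3 D3(2) nz(3) G(2) G(8), of k]]
      unfolding e lin distrib_left[symmetric] .
  qed
  have dist: "a * (\<Sum>j\<in>UNIV. (h::real^3) $ j * b j) + a * (\<Sum>j\<in>UNIV. h $ j * c j) + a * (\<Sum>j\<in>UNIV. h $ j * d j)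
     = a * (\<Sum>j\<in>UNIV. h $ j * (b j + c j + d j))" for a h b c d
    by (simp add: sum_3 algebra_simps)
  show "uniform_limit UNIV (\<lambda>p s. (fst p)\<^sup>2 * (\<Sum>j\<in>UNIV. n1 s $ j * curlj (triple_wire g g1 n1 n2 (fst p)) k [j] (g s + fst p *\<^sub>R snd p)))
      (\<lambda>s. 2 * (n1 s + g1 s) $ k) small"
  proof -
    have e: "cross3 ((4 * (n1 s \<bullet> n1 s) / (norm (g1 s) * norm (n1 s) ^ 4)) *\<^sub>R n1 s - (2 / (norm (g1 s) * (norm (n1 s))\<^sup>2)) *\<^sub>R n1 s) ((norm (g1 s))\<^sup>2 *\<^sub>R n2 s) $ k
       + cross3 ((4 * ((n1 s + n2 s) \<bullet> n1 s) / (norm (g1 s) * norm (n1 s + n2 s) ^ 4)) *\<^sub>R (n1 s + n2 s) - (2 / (norm (g1 s) * (norm (n1 s + n2 s))\<^sup>2)) *\<^sub>R n1 s) (g1 s) $ k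
       + cross3 ((4 * ((- n1 s - n2 s) \<bullet> n1 s) / (norm (g1 s) * norm (- n1 s - n2 s) ^ 4)) *\<^sub>R (- n1 s - n2 s) - (2 / (norm (g1 s) * (norm (- n1 s - n2 s))\<^sup>2)) *\<^sub>R n1 s) (g1 s) $ k
       = 2 * (n1 s + g1 s) $ k" for s
    proof -
      have "(4 * (n1 s \<bullet> n1 s) / (norm (g1 s) * norm (n1 s) ^ 4)) *\<^sub>R n1 s - (2 / (norm (g1 s) * (norm (n1 s))\<^sup>2)) *\<^sub>R n1 s = (2 / norm (g1 s)) *\<^sub>R n1 s"
        by (simp add: n1 F flip: scaleR_left_diff_distrib)
      moreover have "(4 * ((n1 s + n2 s) \<bullet> n1 s) / (norm (g1 s) * norm (n1 s + n2 s) ^ 4)) *\<^sub>R (n1 s + n2 s) - (2 / (norm (g1 s) * (norm (n1 s + n2 s))\<^sup>2)) *\<^sub>R n1 s = (1 / norm (g1 s)) *\<^sub>R n2 s"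
        unfolding n12 n12' by (simp add: inner_simps F F' algebra_simps)
      moreover have "(4 * ((- n1 s - n2 s) \<bullet> n1 s) / (norm (g1 s) * norm (- n1 s - n2 s) ^ 4)) *\<^sub>R (- n1 s - n2 s) - (2 / (norm (g1 s) * (norm (- n1 s - n2 s))\<^sup>2)) *\<^sub>R n1 s = (1 / norm (g1 s)) *\<^sub>R n2 s"
        unfolding n12 n12' by (simp add: inner_simps F F' algebra_simps)
      ultimately show ?thesis using G(6)[of s]
        by (simp add: cross_mult_left cross_mult_right F(10) x1 power2_eq_square)
    qed
    show ?thesis
      using uniform_limit_add[OF uniform_limit_add[OF wire_curl_deriv_limit[OF g D1(1) F(3) D1(2) nz(1) mp cm F(5) F'(1), of k]
         wire_curl_deriv_limit[OF g D2(1) c2 D2(2) nz(2) G(2) G(8) F(5) F'(1), of k]] wire_curl_deriv_limit[OF g D3(1) c3 D3(2) nz(3) G(2) G(8) F(5) F'(1), of k]]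
      unfolding e lin dist .
  qed
  show "uniform_limit UNIV (\<lambda>p s. (fst p)\<^sup>2 * (\<Sum>j\<in>UNIV. n2 s $ j * curlj (triple_wire g g1 n1 n2 (fst p)) k [j] (g s + fst p *\<^sub>R snd p)))
      (\<lambda>s. - 2 * n2 s $ k) small"
  proof -
    have e: "cross3 ((4 * (n1 s \<bullet> n2 s) / (norm (g1 s) * norm (n1 s) ^ 4)) *\<^sub>R n1 s - (2 / (norm (g1 s) * (norm (n1 s))\<^sup>2)) *\<^sub>R n2 s) ((norm (g1 s))\<^sup>2 *\<^sub>R n2 s) $ k
       + cross3 ((4 * ((n1 s + n2 s) \<bullet> n2 s) / (norm (g1 s) * norm (n1 s + n2 s) ^ 4)) *\<^sub>R (n1 s + n2 s) - (2 / (norm (g1 s) * (norm (n1 s + n2 s))\<^sup>2)) *\<^sub>R n2 s) (g1 s) $ k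
       + cross3 ((4 * ((- n1 s - n2 s) \<bullet> n2 s) / (norm (g1 s) * norm (- n1 s - n2 s) ^ 4)) *\<^sub>R (- n1 s - n2 s) - (2 / (norm (g1 s) * (norm (- n1 s - n2 s))\<^sup>2)) *\<^sub>R n2 s) (g1 s) $ k
       = - 2 * n2 s $ k" for s
    proof -
      have "(4 * (n1 s \<bullet> n2 s) / (norm (g1 s) * norm (n1 s) ^ 4)) *\<^sub>R n1 s - (2 / (norm (g1 s) * (norm (n1 s))\<^sup>2)) *\<^sub>R n2 s = (- 2 / norm (g1 s)) *\<^sub>R n2 s"
        by (simp add: n1 F)
      moreover have "(4 * ((n1 s + n2 s) \<bullet> n2 s) / (norm (g1 s) * norm (n1 s + n2 s) ^ 4)) *\<^sub>R (n1 s + n2 s) - (2 / (norm (g1 s) * (norm (n1 s + n2 s))\<^sup>2)) *\<^sub>R n2 s = (1 / norm (g1 s)) *\<^sub>R n1 s"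
        unfolding n12 n12' by (simp add: inner_simps F F' algebra_simps)
      moreover have "(4 * ((- n1 s - n2 s) \<bullet> n2 s) / (norm (g1 s) * norm (- n1 s - n2 s) ^ 4)) *\<^sub>R (- n1 s - n2 s) - (2 / (norm (g1 s) * (norm (- n1 s - n2 s))\<^sup>2)) *\<^sub>R n2 s = (1 / norm (g1 s)) *\<^sub>R n1 s"
        unfolding n12 n12' by (simp add: inner_simps F F' algebra_simps)
      ultimately show ?thesis using G(6)[of s]
        by (simp add: cross_mult_left cross_mult_right x2)
    qed
    show ?thesis
      using uniform_limit_add[OF uniform_limit_add[OF wire_curl_deriv_limit[OF g D1(1) F(3) D1(2) nz(1) mp cm F(6) F'(2), of k]
         wire_curl_deriv_limit[OF g D2(1) c2 D2(2) nz(2) G(2) G(8) F(6) F'(2), of k]] wire_curl_deriv_limit[OF g D3(1) c3 D3(2) nz(3) G(2) G(8) F(6) F'(2), of k]]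
      unfolding e lin dist .
  qed
qed

section \<open>Approximation of wire potentials\<close>

lemma continuous_on_gev: "continuous_on {z. z \<noteq> 0} (gev e)"
proof (induction e)
  case Ui
  have "continuous_on {z::real^3. z \<noteq> 0} (\<lambda>z. 1 / norm z)" by (intro continuous_intros) auto
  then show ?case by (simp cong: continuous_on_cong)
qed (auto intro!: continuous_intros simp: continuous_on_exp)

lemma finite_short_lists: "finite {l :: 3 list. length l \<le> N}"
  using finite_lists_length_le[of "UNIV :: 3 set" N] by simp

lemma compact_range_periodic:
  fixes g :: "real \<Rightarrow> 'a::t2_space"
  assumes "\<And>s. g (s + 1) = g s" "continuous_on UNIV g" shows "compact (range g)"
proof -
  have "range g \<subseteq> g ` {0..1}"
  proof
    fix y assume "y \<in> range g"
    then obtain s where "y = g s" by blast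
    moreover have "g (frac s) = g s" using periodic_int[where g=g and k="-\<lfloor>s\<rfloor>" and s=s, OF assms(1)] by (simp add: frac_def)
    moreover have "frac s \<in> {0..1}" using frac_lt_1[of s] by (simp add: less_imp_le)
    ultimately show "y \<in> g ` {0..1}" by (metis image_eqI)
  qed
  then have "range g = g ` {0..1}" by blast
  then show ?thesis
    using compact_continuous_image[OF continuous_on_subset[OF assms(2) subset_UNIV] compact_Icc] by simp
qed

text \<open>Distinct components are a distance e0 apart, and for small r the displaced wire and the
  observer together use up at most half of it. On the remaining compact shell all derivatives of the
  kernel are bounded, independently of r.\<close>

lemma far_wire_bounded:
  assumes g: "C2loop g g1 g2" and g': "C2loop g' g1' g2'" and disj: "range g \<inter> range g' = {}"
    and d: "\<And>s. d (s + 1) = d s" "continuous_on UNIV d"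
    and m: "\<And>s. m (s + 1) = m s" "continuous_on UNIV m"
  shows "\<exists>C. eventually (\<lambda>p. \<forall>s k l. length l \<le> 3 \<longrightarrow> \<bar>wint g' d m (fst p) k l (g s + fst p *\<^sub>R snd p)\<bar> \<le> C) small"
proof -
  note G = C2loopD[OF g] and G' = C2loopD[OF g']
  obtain e0 where e0: "e0 > 0" "\<And>s u. e0 \<le> norm (g s - g' u)"
    using separate_compact_closed[OF compact_range_periodic[OF G(1) G(7)] compact_imp_closed[OF compact_range_periodic[OF G'(1) G'(7)]] disj]
    by (auto simp: dist_norm)
  obtain D where D: "D > 0" "\<And>s. norm (d s) \<le> D" using periodic_bounded[of d, OF d] by metis
  obtain M where M: "M > 0" "\<And>s. norm (m s) \<le> M" using periodic_bounded[of m, OF m] by metis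
  obtain B where B: "B > 0" "\<And>s. norm (g s) \<le> B" using periodic_bounded[of g, OF G(1) G(7)] by metis
  obtain B' where B': "B' > 0" "\<And>s. norm (g' s) \<le> B'" using periodic_bounded[of g', OF G'(1) G'(7)] by metis
  define e where "e = e0 / 2"
  define A where "A = {z :: real^3. e \<le> norm z \<and> norm z \<le> B + B' + e}"
  have e: "e > 0" using e0 by (simp add: e_def)
  have "A = cball 0 (B + B' + e) - ball 0 e" by (auto simp: A_def)
  then have A: "compact A" by (simp add: compact_diff)
  have "\<exists>C. \<forall>z\<in>A. \<bar>gev (jet l) z\<bar> \<le> C" for l
  proof -
    have "continuous_on A (gev (jet l))" using e by (intro continuous_on_subset[OF continuous_on_gev]) (auto simp: A_def)
    from compact_imp_bounded[OF compact_continuous_image[OF this A]] show ?thesis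
      by (auto simp: bounded_iff)
  qed
  then obtain Cl where Cl: "\<And>l z. z \<in> A \<Longrightarrow> \<bar>gev (jet l) z\<bar> \<le> Cl l" by metis
  define C where "C = (\<Sum>l\<in>{l :: 3 list. length l \<le> 3}. \<bar>Cl l\<bar>)"
  have C: "\<bar>gev (jet l) z\<bar> \<le> C" if "z \<in> A" "length l \<le> 3" for l z
  proof -
    have "\<bar>Cl l\<bar> \<le> C" unfolding C_def using that(2) by (intro member_le_sum finite_short_lists) auto
    then show ?thesis using Cl[OF that(1), of l] by linarith
  qed
  have C0: "C \<ge> 0" by (simp add: C_def sum_nonneg)
  define \<delta> where "\<delta> = min 1 (e / (1 + D))"
  have \<delta>: "\<delta> > 0" "\<delta> \<le> 1" "\<delta> * (1 + D) \<le> e"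
  proof -
    have "\<delta> * (1 + D) \<le> e / (1 + D) * (1 + D)" using D by (intro mult_right_mono) (auto simp: \<delta>_def)
    then show "\<delta> * (1 + D) \<le> e" using D by simp
  qed (use e D in \<open>auto simp: \<delta>_def\<close>)
  show ?thesis unfolding eventually_small fst_conv snd_conv
  proof (rule exI[of _ "C * M"], intro exI[of _ \<delta>] conjI allI impI \<delta>(1))
    fix r :: real and w :: "real^3" and s :: real and k :: 3 and l :: "3 list"
    assume h: "0 < r" "r < \<delta>" "norm w < \<delta>" "length l \<le> 3"
    have zA: "g s + r *\<^sub>R w - g' u - r *\<^sub>R d u \<in> A" for u
    proof -
      have "norm (r *\<^sub>R (w - d u)) \<le> \<delta> * (1 + D)"
        using h \<delta> D(2)[of u] norm_triangle_ineq4[of w "d u"] by (auto intro!: mult_mono)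
      then have 1: "norm (r *\<^sub>R (w - d u)) \<le> e" using \<delta>(3) by linarith
      have 2: "g s + r *\<^sub>R w - g' u - r *\<^sub>R d u = (g s - g' u) + r *\<^sub>R (w - d u)" by (simp add: algebra_simps)
      show ?thesis unfolding A_def 2
        using 1 e0(2)[of s u] norm_triangle_ineq[of "g s - g' u" "r *\<^sub>R (w - d u)"] norm_diff_ineq[of "g s - g' u" "r *\<^sub>R (w - d u)"]
          norm_triangle_ineq4[of "g s" "g' u"] B(2)[of s] B'(2)[of u] by (simp add: e_def)
    qed
    have "\<bar>gev (jet l) (g s + r *\<^sub>R w - g' u - r *\<^sub>R d u) * m u $ k\<bar> \<le> C * M" for u
      unfolding abs_mult using C[OF zA h(4), of u] component_le_norm_cart[of "m u" k] M(2)[of u] C0 by (intro mult_mono) auto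
    moreover have "continuous_on {0..1} (\<lambda>u. gev (jet l) (g s + r *\<^sub>R w - g' u - r *\<^sub>R d u) * m u $ k)"
    proof (intro continuous_intros continuous_on_subset[OF m(2)] continuous_on_compose2[OF continuous_on_gev] G' continuous_on_subset[OF d(2)])
      show "(\<lambda>u. g s + r *\<^sub>R w - g' u - r *\<^sub>R d u) ` {0..1} \<subseteq> {z. z \<noteq> 0}"
      proof (rule image_subsetI)
        fix u show "g s + r *\<^sub>R w - g' u - r *\<^sub>R d u \<in> {z. z \<noteq> 0}" using zA[of u] e unfolding A_def by force
      qed
    qed auto
    ultimately show "\<bar>wint g' d m r k l (g s + r *\<^sub>R w)\<bar> \<le> C * M"
      unfolding wint_def using integral_bound[of 0 1 "\<lambda>u. gev (jet l) (g s + r *\<^sub>R w - g' u - r *\<^sub>R d u) * m u $ k" "C * M"] by simp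
  qed
qed

text \<open>Compactness lets one set of nodes serve every x in K, as is needed when a wire is
  replaced by finitely many fixed point sources.\<close>

lemma riemann_sum_uniform:
  fixes f :: "'a::metric_space \<Rightarrow> real \<Rightarrow> real"
  assumes K: "compact K" and f: "continuous_on (K \<times> {0..1}) (\<lambda>p. f (fst p) (snd p))" and e: "\<epsilon> > 0"
  shows "eventually (\<lambda>N. \<forall>x\<in>K. \<bar>(1 / real N) * (\<Sum>q<N. f x (real q / real N)) - integral {0..1} (f x)\<bar> \<le> \<epsilon>) sequentially"
proof -
  have "uniformly_continuous_on (K \<times> {0..1}) (\<lambda>p. f (fst p) (snd p))"
    by (rule compact_uniformly_continuous[OF f compact_Times[OF K compact_Icc]])
  then obtain \<delta> where \<delta>: "\<delta> > 0" "\<And>p p'. p \<in> K \<times> {0..1} \<Longrightarrow> p' \<in> K \<times> {0..1} \<Longrightarrow> dist p' p < \<delta> \<Longrightarrow> dist (f (fst p') (snd p')) (f (fst p) (snd p)) < \<epsilon>"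
    using e unfolding uniformly_continuous_on_def by metis
  have uc: "\<bar>f x u - f x v\<bar> \<le> \<epsilon>" if "x \<in> K" "u \<in> {0..1}" "v \<in> {0..1}" "\<bar>u - v\<bar> < \<delta>" for x u v
    using \<delta>(2)[of "(x, v)" "(x, u)"] that by (simp add: dist_Pair_Pair dist_real_def less_imp_le)
  have fc: "continuous_on {0..1} (f x)" if "x \<in> K" for x
    using continuous_on_compose2[OF f continuous_on_Pair[OF continuous_on_const[of "{0..1}" x] continuous_on_id]] that by auto
  obtain N0 where N0: "N0 > 0" "1 / real N0 < \<delta>" using real_arch_inverse[of \<delta>] \<delta>(1) by (auto simp: inverse_eq_divide)
  have "\<bar>(1 / real N) * (\<Sum>q<N. f x (real q / real N)) - integral {0..1} (f x)\<bar> \<le> \<epsilon>" if N: "N \<ge> N0" and x: "x \<in> K" for N x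
  proof -
    have Np: "real N > 0" using N N0 by simp
    have "1 / real N \<le> 1 / real N0" using N N0(1) by (intro divide_left_mono) auto
    then have small: "1 / real N < \<delta>" using N0(2) by linarith
    have "\<bar>(1 / real N) * (\<Sum>q<Q. f x (real q / real N)) - integral {0..real Q / real N} (f x)\<bar> \<le> \<epsilon> * (real Q / real N)" if "Q \<le> N" for Q
      using that
    proof (induction Q)
      case 0
      show ?case by simp
    next
      case (Suc Q)
      define a b where "a = real Q / real N" and "b = real (Suc Q) / real N"
      have ab: "0 \<le> a" "a \<le> b" "b \<le> 1" "b - a = 1 / real N" using Suc.prems Np by (auto simp: a_def b_def field_simps)
      have c: "continuous_on {0..b} (f x)" "continuous_on {a..b} (f x)"
        using fc[OF x] ab by (auto intro: continuous_on_subset)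
      have "norm (integral {a..b} (\<lambda>u. f x a - f x u)) \<le> \<epsilon> * (b - a)"
      proof (rule integral_bound[OF ab(2)])
        show "norm (f x a - f x u) \<le> \<epsilon>" if "u \<in> {a..b}" for u
          unfolding real_norm_def using that ab small by (intro uc[OF x]) auto
      qed (intro continuous_intros c)
      moreover have "integral {a..b} (\<lambda>u. f x a - f x u) = (1 / real N) * f x a - integral {a..b} (f x)"
        using ab integrable_continuous_interval[OF c(2)] by (subst integral_diff) (auto simp flip: ab(4))
      moreover have "integral {0..a} (f x) + integral {a..b} (f x) = integral {0..b} (f x)"
        using ab by (intro Henstock_Kurzweil_Integration.integral_combine integrable_continuous_interval[OF c(1)]) auto
      moreover have "\<bar>(1 / real N) * (\<Sum>q<Q. f x (real q / real N)) - integral {0..a} (f x)\<bar> \<le> \<epsilon> * a"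
        using Suc by (simp add: a_def)
      moreover have "(1 / real N) * (\<Sum>q<Suc Q. f x (real q / real N)) = (1 / real N) * (\<Sum>q<Q. f x (real q / real N)) + (1 / real N) * f x a"
        by (simp add: a_def distrib_left)
      moreover have "\<epsilon> * (b - a) = \<epsilon> * b - \<epsilon> * a" by (simp add: algebra_simps)
      ultimately show ?case unfolding b_def[symmetric] real_norm_def by linarith
    qed
    from this[of N] Np show ?thesis by simp
  qed
  then show ?thesis unfolding eventually_sequentially by blast
qed

text \<open>A Riemann sum replaces the wire by point sources, and each source is sent to infinity
  along its own ray. Each of the two replacements may use half of the tolerance.\<close>

lemma wire_approx:
  fixes \<gamma> m :: "real \<Rightarrow> real^3"
  assumes K: "compact K" and c: "continuous_on {0..1} \<gamma>" "continuous_on {0..1} m" and e: "\<epsilon> > 0"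
    and esc: "\<And>u. u \<in> {0..1} \<Longrightarrow> \<exists>v. norm v = 1 \<and> (\<forall>t\<ge>0. \<gamma> u + t *\<^sub>R v \<notin> K)"
  shows "\<exists>P. (\<forall>k. helmholtz_jet (P k)) \<and>
    (\<forall>k l x. length l \<le> 3 \<longrightarrow> x \<in> K \<longrightarrow> \<bar>P k l x - integral {0..1} (\<lambda>u. gev (jet l) (x - \<gamma> u) * m u $ k)\<bar> \<le> \<epsilon>)"
proof -
  have nz: "x - \<gamma> u \<noteq> 0" if "x \<in> K" "u \<in> {0..1}" for x u using esc[OF that(2)] that(1) by fastforce
  have "bounded (m ` {0..1})" by (rule compact_imp_bounded[OF compact_continuous_image[OF c(2) compact_Icc]])
  then obtain M where M: "M > 0" "\<And>u. u \<in> {0..1} \<Longrightarrow> norm (m u) \<le> M" unfolding bounded_pos by auto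
  have fc: "continuous_on (K \<times> {0..1}) (\<lambda>p. gev (jet l) (fst p - \<gamma> (snd p)) * m (snd p) $ k)" for l k
  proof (intro continuous_intros continuous_on_compose2[OF continuous_on_gev] continuous_on_compose2[OF c(1)] continuous_on_compose2[OF c(2)])
    show "(\<lambda>p. fst p - \<gamma> (snd p)) ` (K \<times> {0..1}) \<subseteq> {z. z \<noteq> 0}" using nz by fastforce
  qed auto
  have "eventually (\<lambda>N. \<forall>k\<in>UNIV. \<forall>l\<in>{l. length l \<le> 3}. \<forall>x\<in>K.
     \<bar>(1 / real N) * (\<Sum>q<N. gev (jet l) (x - \<gamma> (real q / real N)) * m (real q / real N) $ k)
       - integral {0..1} (\<lambda>u. gev (jet l) (x - \<gamma> u) * m u $ k)\<bar> \<le> \<epsilon> / 2) sequentially"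
    using e by (intro eventually_ball_finite ballI finite_short_lists finite_class.finite_UNIV riemann_sum_uniform[OF K fc]) auto
  from eventually_conj[OF this eventually_gt_at_top[of 0]] obtain N where N: "N > 0"
    "\<And>k l x. length l \<le> 3 \<Longrightarrow> x \<in> K \<Longrightarrow> \<bar>(1 / real N) * (\<Sum>q<N. gev (jet l) (x - \<gamma> (real q / real N)) * m (real q / real N) $ k)
       - integral {0..1} (\<lambda>u. gev (jet l) (x - \<gamma> u) * m u $ k)\<bar> \<le> \<epsilon> / 2"
    by (auto simp: eventually_sequentially)
  \<comment> \<open>N sources of weight at most M / N with this error contribute \<epsilon> / 2 in
    total.\<close>
  define \<eta> where "\<eta> = \<epsilon> / (2 * M)"
  have \<eta>: "\<eta> > 0" using e M by (simp add: \<eta>_def)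
  have "\<exists>u. helmholtz_jet u \<and> (\<forall>l x. length l \<le> 3 \<longrightarrow> x \<in> K \<longrightarrow> \<bar>u l x - gev (jet l) (x - \<gamma> s)\<bar> < \<eta>)" if s: "s \<in> {0..1}" for s
  proof -
    obtain v where v: "norm v = 1" "\<And>t. t \<ge> 0 \<Longrightarrow> \<gamma> s + t *\<^sub>R v \<notin> K" using esc[OF s] by blast
    obtain u where "helmholtz_jet u" "\<And>l x. length l \<le> 3 \<Longrightarrow> x \<in> K \<Longrightarrow> \<bar>u l x - gev (jet l) (x - \<gamma> s)\<bar> < \<eta>"
      using runge_point_source[OF K v \<eta>] by metis
    then show ?thesis by blast
  qed
  then obtain u where u: "\<And>s. s \<in> {0..1} \<Longrightarrow> helmholtz_jet (u s)"
    "\<And>s l x. s \<in> {0..1} \<Longrightarrow> length l \<le> 3 \<Longrightarrow> x \<in> K \<Longrightarrow> \<bar>u s l x - gev (jet l) (x - \<gamma> s)\<bar> < \<eta>" by metis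
  have q: "real q / real N \<in> {0..1}" if "q < N" for q using that by simp
  define P where "P k l x = (\<Sum>q<N. (m (real q / real N) $ k / real N) * u (real q / real N) l x)" for k l x
  have "helmholtz_jet (P k)" for k
    unfolding P_def by (intro helmholtz_jet_sum helmholtz_jet_cmult u) (use q in auto)
  moreover have "\<bar>P k l x - integral {0..1} (\<lambda>u. gev (jet l) (x - \<gamma> u) * m u $ k)\<bar> \<le> \<epsilon>" if l: "length l \<le> 3" and x: "x \<in> K" for k l x
  proof -
    have "\<bar>(m (real q / real N) $ k / real N) * (u (real q / real N) l x - gev (jet l) (x - \<gamma> (real q / real N)))\<bar> \<le> M / real N * \<eta>" if "q < N" for q
      unfolding abs_mult
      using component_le_norm_cart[of "m (real q / real N)" k] M(2)[OF q[OF that]] u(2)[OF q[OF that] l x] N(1) M(1)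
      by (intro mult_mono) (auto intro!: divide_right_mono)
    then have "\<bar>\<Sum>q<N. (m (real q / real N) $ k / real N) * (u (real q / real N) l x - gev (jet l) (x - \<gamma> (real q / real N)))\<bar> \<le> (\<Sum>q<N. M / real N * \<eta>)"
      by (intro order_trans[OF sum_abs] sum_mono) auto
    also have "\<dots> = \<epsilon> / 2" using N(1) M(1) by (simp add: \<eta>_def)
    finally have "\<bar>P k l x - (1 / real N) * (\<Sum>q<N. gev (jet l) (x - \<gamma> (real q / real N)) * m (real q / real N) $ k)\<bar> \<le> \<epsilon> / 2"
      by (simp add: P_def sum_distrib_left sum_subtractf algebra_simps)
    then show ?thesis using N(2)[OF l x, of k] by linarith
  qed
  ultimately show ?thesis by blast
qed

lemma norm_le_3:
  fixes x :: "real^3" assumes "\<And>k. \<bar>x $ k\<bar> \<le> e" shows "norm x \<le> 3 * e"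
  using norm_le_l1_cart[of x] assms[of 1] assms[of 2] assms[of 3] by (simp add: sum_3)

text \<open>A perturbation bounded by C is multiplied by r in the value and by r^2 in the
  derivative, so it disappears for small r. The radius \<rho> comes before r: the derivative needs
  only an absolute accuracy, which fixes \<rho>1, but on the curve the value must be accurate to
  \<rho> / 2.\<close>

lemma triple_wire_orbit:
  assumes g: "C2loop g g1 g2" and f: "normal_frame g1 n1 n2 m1 m2" and \<kappa>: "\<kappa> > 0" and C: "C \<ge> 0"
  obtains \<rho>1 where "\<rho>1 > 0"
    "\<And>\<rho>. 0 < \<rho> \<Longrightarrow> \<rho> \<le> \<rho>1 \<Longrightarrow> \<exists>r1>0. \<forall>r U. 0 < r \<longrightarrow> r \<le> r1 \<longrightarrow> (\<forall>k. helmholtz_jet (U k)) \<longrightarrow>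
       (\<forall>k l s a b. length l \<le> 1 \<longrightarrow> \<bar>a\<bar> \<le> \<rho> \<longrightarrow> \<bar>b\<bar> \<le> \<rho> \<longrightarrow>
          \<bar>U k l (g s + (r * a) *\<^sub>R n1 s + (r * b) *\<^sub>R n2 s) - curlj (triple_wire g g1 n1 n2 r) k l (g s + (r * a) *\<^sub>R n1 s + (r * b) *\<^sub>R n2 s)\<bar> \<le> C) \<longrightarrow>
       (\<exists>c c1 \<mu>. (\<forall>s. c (s + 1) = c s \<and> (c has_vector_derivative c1 s) (at s) \<and> norm (c s - g s) \<le> \<kappa> \<and>
          norm (c1 s - g1 s) \<le> \<kappa> \<and> c1 s = \<mu> s *\<^sub>R fld U (c s) \<and> \<mu> s > 0) \<and> continuous_on UNIV (\<mu> :: real \<Rightarrow> real))"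
proof -
  note F = normal_frameD[OF f]
  note lim = triple_wire_limit[OF g f]
  have n1: "norm (n1 s) = 1" and n2: "norm (n2 s) = 1" for s using F(5,6)[of s] by (simp_all add: norm_eq_sqrt_inner)
  define Y where "Y r s a b = g s + (r * a) *\<^sub>R n1 s + (r * b) *\<^sub>R n2 s" for r s a b
  define W where "W = triple_wire g g1 n1 n2"
  have Y: "g s + r *\<^sub>R (a *\<^sub>R n1 s + b *\<^sub>R n2 s) = Y r s a b" for r s a b by (simp add: Y_def algebra_simps)
  show thesis
  proof (rule tube_orbit[OF g f \<kappa>])
  fix \<rho>0 r0 :: real
  assume T: "\<rho>0 > 0" "r0 > 0"
    "\<And>\<rho> r V DV. \<lbrakk>0 < \<rho>; \<rho> \<le> \<rho>0; 0 < r; r \<le> r0; \<And>x. (V has_derivative DV x) (at x);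
       \<And>s. norm (r *\<^sub>R V (g s) - 2 *\<^sub>R g1 s) \<le> \<rho> / 2;
       \<And>s a b. \<bar>a\<bar> \<le> \<rho> \<Longrightarrow> \<bar>b\<bar> \<le> \<rho> \<Longrightarrow>
         norm (r\<^sup>2 *\<^sub>R DV (g s + (r * a) *\<^sub>R n1 s + (r * b) *\<^sub>R n2 s) (n1 s) - 2 *\<^sub>R (n1 s + g1 s)) \<le> 1/16;
       \<And>s a b. \<bar>a\<bar> \<le> \<rho> \<Longrightarrow> \<bar>b\<bar> \<le> \<rho> \<Longrightarrow>
         norm (r\<^sup>2 *\<^sub>R DV (g s + (r * a) *\<^sub>R n1 s + (r * b) *\<^sub>R n2 s) (n2 s) + 2 *\<^sub>R n2 s) \<le> 1/16\<rbrakk> \<Longrightarrow>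
     \<exists>c c1 \<mu>. (\<forall>s. c (s + 1) = c s \<and> (c has_vector_derivative c1 s) (at s) \<and> norm (c s - g s) \<le> \<kappa> \<and>
        norm (c1 s - g1 s) \<le> \<kappa> \<and> c1 s = \<mu> s *\<^sub>R V (c s) \<and> \<mu> s > 0) \<and> continuous_on UNIV (\<mu> :: real \<Rightarrow> real)"
  \<comment> \<open>The limit and the perturbation may each cost 1/96 per component;
    \<open>norm_le_3\<close> turns the sum 1/48 into the 1/16 required by
    \<open>tube_orbit\<close>.\<close>
  have "eventually (\<lambda>p. \<forall>k\<in>UNIV.
      (\<forall>s\<in>UNIV. dist ((fst p)\<^sup>2 * (\<Sum>j\<in>UNIV. n1 s $ j * curlj (W (fst p)) k [j] (g s + fst p *\<^sub>R snd p))) (2 * (n1 s + g1 s) $ k) < 1/96) \<and>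
      (\<forall>s\<in>UNIV. dist ((fst p)\<^sup>2 * (\<Sum>j\<in>UNIV. n2 s $ j * curlj (W (fst p)) k [j] (g s + fst p *\<^sub>R snd p))) (- 2 * n2 s $ k) < 1/96)) small"
    unfolding W_def by (intro eventually_ball_finite finite_class.finite_UNIV ballI eventually_conj uniform_limitD lim) auto
  then obtain \<delta>1 where \<delta>1: "\<delta>1 > 0"
    "\<And>r w k s. 0 < r \<Longrightarrow> r < \<delta>1 \<Longrightarrow> norm w < \<delta>1 \<Longrightarrow> \<bar>r\<^sup>2 * (\<Sum>j\<in>UNIV. n1 s $ j * curlj (W r) k [j] (g s + r *\<^sub>R w)) - 2 * (n1 s + g1 s) $ k\<bar> < 1/96"
    "\<And>r w k s. 0 < r \<Longrightarrow> r < \<delta>1 \<Longrightarrow> norm w < \<delta>1 \<Longrightarrow> \<bar>r\<^sup>2 * (\<Sum>j\<in>UNIV. n2 s $ j * curlj (W r) k [j] (g s + r *\<^sub>R w)) - - 2 * n2 s $ k\<bar> < 1/96"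
    unfolding eventually_small fst_conv snd_conv dist_real_def by blast
  \<comment> \<open>The offset a n1 + b n2 has norm at most 2 \<rho>, which stays below
    \<delta>1.\<close>
  define \<rho>1 where "\<rho>1 = min \<rho>0 (\<delta>1 / 3)"
  have "\<rho>1 > 0" using T(1) \<delta>1(1) by (simp add: \<rho>1_def)
  then show thesis
  proof (rule that)
    fix \<rho> :: real assume \<rho>: "0 < \<rho>" "\<rho> \<le> \<rho>1"
    have "eventually (\<lambda>p. \<forall>k\<in>UNIV. \<forall>s\<in>UNIV. dist (fst p * curlj (W (fst p)) k [] (g s + fst p *\<^sub>R snd p)) (2 * g1 s $ k) < \<rho> / 12) small"
      unfolding W_def using \<rho> by (intro eventually_ball_finite finite_class.finite_UNIV ballI uniform_limitD lim) auto
    then obtain \<delta>2 where \<delta>2: "\<delta>2 > 0"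
      "\<And>r w k s. 0 < r \<Longrightarrow> r < \<delta>2 \<Longrightarrow> norm w < \<delta>2 \<Longrightarrow> \<bar>r * curlj (W r) k [] (g s + r *\<^sub>R w) - 2 * g1 s $ k\<bar> < \<rho> / 12"
      unfolding eventually_small fst_conv snd_conv dist_real_def by blast
    \<comment> \<open>The last two entries make r C at most \<rho> / 12 and 3 r^2 C at most 1/96.
      Adding 1 to C guards against a zero denominator.\<close>
    define r1 where "r1 = min (min (min r0 (\<delta>1 / 2)) (min (\<delta>2 / 2) 1)) (min (\<rho> / 12 / (C + 1)) (1 / 288 / (C + 1)))"
    have r1: "r1 > 0" "r1 \<le> r0" "r1 < \<delta>1" "r1 < \<delta>2" "r1 \<le> 1" using T(2) \<delta>1(1) \<delta>2(1) \<rho> C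
      by (auto simp: r1_def)
    have r1b: "r1 * (C + 1) \<le> \<rho> / 12" "r1 * (C + 1) \<le> 1 / 288"
    proof -
      have e: "x / (C + 1) * (C + 1) = x" for x using C by simp
      have "r1 * (C + 1) \<le> \<rho> / 12 / (C + 1) * (C + 1)" "r1 * (C + 1) \<le> 1 / 288 / (C + 1) * (C + 1)"
        using C by (intro mult_right_mono; simp add: r1_def)+
      then show "r1 * (C + 1) \<le> \<rho> / 12" "r1 * (C + 1) \<le> 1 / 288" unfolding e .
    qed
    show "\<exists>r1>0. \<forall>r U. 0 < r \<longrightarrow> r \<le> r1 \<longrightarrow> (\<forall>k. helmholtz_jet (U k)) \<longrightarrow>
       (\<forall>k l s a b. length l \<le> 1 \<longrightarrow> \<bar>a\<bar> \<le> \<rho> \<longrightarrow> \<bar>b\<bar> \<le> \<rho> \<longrightarrow>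
          \<bar>U k l (g s + (r * a) *\<^sub>R n1 s + (r * b) *\<^sub>R n2 s) - curlj (triple_wire g g1 n1 n2 r) k l (g s + (r * a) *\<^sub>R n1 s + (r * b) *\<^sub>R n2 s)\<bar> \<le> C) \<longrightarrow>
       (\<exists>c c1 \<mu>. (\<forall>s. c (s + 1) = c s \<and> (c has_vector_derivative c1 s) (at s) \<and> norm (c s - g s) \<le> \<kappa> \<and>
          norm (c1 s - g1 s) \<le> \<kappa> \<and> c1 s = \<mu> s *\<^sub>R fld U (c s) \<and> \<mu> s > 0) \<and> continuous_on UNIV (\<mu> :: real \<Rightarrow> real))"
      unfolding W_def[symmetric] Y_def[symmetric]
    proof (intro exI[of _ r1] conjI r1(1) allI impI)
      fix r U assume r: "0 < r" "r \<le> r1" and U: "\<forall>k. helmholtz_jet (U k)"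
        and ap: "\<forall>k l s a b. length l \<le> 1 \<longrightarrow> \<bar>a\<bar> \<le> \<rho> \<longrightarrow> \<bar>b\<bar> \<le> \<rho> \<longrightarrow> \<bar>U k l (Y r s a b) - curlj (W r) k l (Y r s a b)\<bar> \<le> C"
      have "r * (C + 1) \<le> r1 * (C + 1)" using r C by (intro mult_right_mono) auto
      moreover have "r * C \<le> r * (C + 1)" using r by (simp add: algebra_simps)
      moreover have "r\<^sup>2 * C \<le> r * C" using r r1(5) C by (intro mult_right_mono) (auto simp: power2_eq_square intro: mult_left_le_one_le)
      ultimately have rC: "r * C \<le> \<rho> / 12" "r\<^sup>2 * (3 * C) \<le> 1/96" using r1b by linarith+
      have hw: "norm (a *\<^sub>R n1 s + b *\<^sub>R n2 s) < \<delta>1" if "\<bar>a\<bar> \<le> \<rho>" "\<bar>b\<bar> \<le> \<rho>" for s a b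
        using norm_triangle_ineq[of "a *\<^sub>R n1 s" "b *\<^sub>R n2 s"] that \<rho> \<delta>1(1) by (simp add: n1 n2 \<rho>1_def)
      have dev: "\<bar>r\<^sup>2 * (\<Sum>j\<in>UNIV. h $ j * U k [j] (Y r s a b)) - r\<^sup>2 * (\<Sum>j\<in>UNIV. h $ j * curlj (W r) k [j] (Y r s a b))\<bar> \<le> 1/96"
        if ab: "\<bar>a\<bar> \<le> \<rho>" "\<bar>b\<bar> \<le> \<rho>" and h: "norm h = 1" for h :: "real^3" and k s a b
      proof -
        have "\<bar>h $ j * (U k [j] (Y r s a b) - curlj (W r) k [j] (Y r s a b))\<bar> \<le> C" for j
        proof -
          have "\<bar>h $ j\<bar> * \<bar>U k [j] (Y r s a b) - curlj (W r) k [j] (Y r s a b)\<bar> \<le> 1 * C"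
            using component_le_norm_cart[of h j] h ap ab by (intro mult_mono) auto
          then show ?thesis by (simp add: abs_mult)
        qed
        then have "\<bar>\<Sum>j\<in>UNIV. h $ j * (U k [j] (Y r s a b) - curlj (W r) k [j] (Y r s a b))\<bar> \<le> (\<Sum>j\<in>(UNIV :: 3 set). C)"
          by (intro order_trans[OF sum_abs] sum_mono)
        then have "r\<^sup>2 * \<bar>\<Sum>j\<in>UNIV. h $ j * (U k [j] (Y r s a b) - curlj (W r) k [j] (Y r s a b))\<bar> \<le> r\<^sup>2 * (3 * C)"
          by (intro mult_left_mono) (auto simp: sum_3)
        also have "r\<^sup>2 * \<bar>\<Sum>j\<in>UNIV. h $ j * (U k [j] (Y r s a b) - curlj (W r) k [j] (Y r s a b))\<bar>
          = \<bar>r\<^sup>2 * (\<Sum>j\<in>UNIV. h $ j * (U k [j] (Y r s a b) - curlj (W r) k [j] (Y r s a b)))\<bar>" by (simp add: abs_mult)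
        finally show ?thesis using rC(2) by (simp add: right_diff_distrib sum_subtractf)
      qed
      show "\<exists>c c1 \<mu>. (\<forall>s. c (s + 1) = c s \<and> (c has_vector_derivative c1 s) (at s) \<and> norm (c s - g s) \<le> \<kappa> \<and>
          norm (c1 s - g1 s) \<le> \<kappa> \<and> c1 s = \<mu> s *\<^sub>R fld U (c s) \<and> \<mu> s > 0) \<and> continuous_on UNIV (\<mu> :: real \<Rightarrow> real)"
      proof (rule T(3)[of \<rho> r "fld U" "dfld U"])
        show "0 < \<rho>" "\<rho> \<le> \<rho>0" "0 < r" "r \<le> r0" using \<rho> r r1 by (auto simp: \<rho>1_def)
        show "(fld U has_derivative dfld U x) (at x)" for x using U by (intro fld_has_derivative) auto
        show "norm (r *\<^sub>R fld U (g s) - 2 *\<^sub>R g1 s) \<le> \<rho> / 2" for s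
        proof -
          have "\<bar>(r *\<^sub>R fld U (g s) - 2 *\<^sub>R g1 s) $ k\<bar> \<le> \<rho> / 6" for k
          proof -
            have "\<bar>U k [] (g s) - curlj (W r) k [] (g s)\<bar> \<le> C"
              using ap[rule_format, of "[]" 0 0 k s] \<rho> by (simp add: Y_def)
            then have "r * \<bar>U k [] (g s) - curlj (W r) k [] (g s)\<bar> \<le> r * C" using r by (intro mult_left_mono) auto
            also have "r * \<bar>U k [] (g s) - curlj (W r) k [] (g s)\<bar> = \<bar>r * U k [] (g s) - r * curlj (W r) k [] (g s)\<bar>"
              using r by (simp add: abs_mult flip: right_diff_distrib)
            finally have "\<bar>r * U k [] (g s) - r * curlj (W r) k [] (g s)\<bar> \<le> \<rho> / 12" using rC(1) by linarith
            moreover have "\<bar>r * curlj (W r) k [] (g s) - 2 * g1 s $ k\<bar> < \<rho> / 12"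
              using \<delta>2(2)[of r 0 k s] r r1 \<delta>2(1) by simp
            moreover have "(r *\<^sub>R fld U (g s) - 2 *\<^sub>R g1 s) $ k = r * U k [] (g s) - 2 * g1 s $ k" by (simp add: fld_def)
            ultimately show ?thesis by linarith
          qed
          from norm_le_3[OF this] show ?thesis by simp
        qed
        fix s a b :: real assume ab: "\<bar>a\<bar> \<le> \<rho>" "\<bar>b\<bar> \<le> \<rho>"
        have rd: "0 < r" "r < \<delta>1" using r r1 by auto
        show "norm (r\<^sup>2 *\<^sub>R dfld U (g s + (r * a) *\<^sub>R n1 s + (r * b) *\<^sub>R n2 s) (n1 s) - 2 *\<^sub>R (n1 s + g1 s)) \<le> 1/16"
        proof -
          have "\<bar>(r\<^sup>2 *\<^sub>R dfld U (Y r s a b) (n1 s) - 2 *\<^sub>R (n1 s + g1 s)) $ k\<bar> \<le> 1/48" for k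
          proof -
            have "(r\<^sup>2 *\<^sub>R dfld U (Y r s a b) (n1 s) - 2 *\<^sub>R (n1 s + g1 s)) $ k
              = r\<^sup>2 * (\<Sum>j\<in>UNIV. n1 s $ j * U k [j] (Y r s a b)) - 2 * (n1 s + g1 s) $ k" by (simp add: dfld_def)
            then show ?thesis using dev[OF ab n1, of s k s] \<delta>1(2)[OF rd hw[OF ab], of s k s] unfolding Y by linarith
          qed
          from norm_le_3[OF this] show ?thesis by (simp add: Y_def)
        qed
        show "norm (r\<^sup>2 *\<^sub>R dfld U (g s + (r * a) *\<^sub>R n1 s + (r * b) *\<^sub>R n2 s) (n2 s) + 2 *\<^sub>R n2 s) \<le> 1/16"
        proof -
          have "\<bar>(r\<^sup>2 *\<^sub>R dfld U (Y r s a b) (n2 s) + 2 *\<^sub>R n2 s) $ k\<bar> \<le> 1/48" for k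
          proof -
            have "(r\<^sup>2 *\<^sub>R dfld U (Y r s a b) (n2 s) + 2 *\<^sub>R n2 s) $ k
              = r\<^sup>2 * (\<Sum>j\<in>UNIV. n2 s $ j * U k [j] (Y r s a b)) - - 2 * n2 s $ k" by (simp add: dfld_def)
            then show ?thesis using dev[OF ab n2, of s k s] \<delta>1(3)[OF rd hw[OF ab], of s k s] unfolding Y by linarith
          qed
          from norm_le_3[OF this] show ?thesis by (simp add: Y_def)
        qed
      qed
    qed
  qed
  qed
qed

section \<open>Field lines along a link\<close>

text \<open>The rays of \<open>ray_escape\<close> keep the distance c r from the link, so they
  cannot meet a compact set that lies in thinner tubes. The constant is independent of r, which
  permits tubes of radius proportional to r.\<close>

lemma wint_approx:
  fixes g g1 g2 :: "nat \<Rightarrow> real \<Rightarrow> real^3"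
  assumes g: "\<And>j. j < n \<Longrightarrow> C2loop (g j) (g1 j) (g2 j)"
    and disj: "\<And>i j. i < n \<Longrightarrow> j < n \<Longrightarrow> i \<noteq> j \<Longrightarrow> range (g i) \<inter> range (g j) = {}"
    and i: "i < n" and d: "continuous_on UNIV d" "\<And>s. d s \<bullet> g1 i s = 0" "\<And>s. d s \<noteq> 0"
    and m: "continuous_on UNIV m"
  shows "\<exists>c>0. \<forall>r K \<epsilon>. 0 < r \<longrightarrow> r < c \<longrightarrow> compact K \<longrightarrow> (\<forall>x\<in>K. \<exists>j<n. \<exists>\<sigma>. norm (x - g j \<sigma>) < c * r) \<longrightarrow> \<epsilon> > 0 \<longrightarrow>
    (\<exists>P. (\<forall>k. helmholtz_jet (P k)) \<and> (\<forall>k l x. length l \<le> 3 \<longrightarrow> x \<in> K \<longrightarrow> \<bar>P k l x - wint (g i) d m r k l x\<bar> \<le> \<epsilon>))"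
proof -
  obtain c \<delta> where c: "c > 0" "\<delta> > 0" "\<And>s r. s \<in> {0..1} \<Longrightarrow> 0 < r \<Longrightarrow> r < \<delta> \<Longrightarrow> \<exists>v. norm v = 1 \<and>
       (\<forall>t\<ge>0. \<forall>j<n. \<forall>\<sigma>. c * r \<le> norm (g i s + r *\<^sub>R d s + t *\<^sub>R v - g j \<sigma>))"
    by (rule ray_escape[of n g g1 g2 i d, OF g disj i d]) blast+
  show ?thesis
  proof (intro exI[of _ "min c \<delta>"] conjI allI impI)
    show "min c \<delta> > 0" using c by simp
    fix r :: real and K :: "(real^3) set" and \<epsilon> :: real
    assume r: "0 < r" "r < min c \<delta>" and K: "compact K" "\<forall>x\<in>K. \<exists>j<n. \<exists>\<sigma>. norm (x - g j \<sigma>) < min c \<delta> * r" and e: "\<epsilon> > 0"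
    have "\<exists>v. norm v = 1 \<and> (\<forall>t\<ge>0. (g i u + r *\<^sub>R d u) + t *\<^sub>R v \<notin> K)" if u: "u \<in> {0..1}" for u
    proof -
      obtain v where v: "norm v = 1" "\<And>t j \<sigma>. t \<ge> 0 \<Longrightarrow> j < n \<Longrightarrow> c * r \<le> norm (g i u + r *\<^sub>R d u + t *\<^sub>R v - g j \<sigma>)"
        using c(3)[OF u r(1)] r(2) by auto
      have "g i u + r *\<^sub>R d u + t *\<^sub>R v \<notin> K" if t: "t \<ge> 0" for t
      proof
        assume "g i u + r *\<^sub>R d u + t *\<^sub>R v \<in> K"
        then obtain j \<sigma> where j: "j < n" "norm (g i u + r *\<^sub>R d u + t *\<^sub>R v - g j \<sigma>) < min c \<delta> * r" using K(2) by blast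
        have "min c \<delta> * r \<le> c * r" using r by (intro mult_right_mono) auto
        then show False using v(2)[OF t j(1), of \<sigma>] j(2) by linarith
      qed
      then show ?thesis using v(1) by blast
    qed
    moreover have "continuous_on {0..1} (\<lambda>u. g i u + r *\<^sub>R d u)"
      by (intro continuous_intros C2loopD(7)[OF g[OF i]] continuous_on_subset[OF d(1)]) auto
    ultimately show "\<exists>P. (\<forall>k. helmholtz_jet (P k)) \<and> (\<forall>k l x. length l \<le> 3 \<longrightarrow> x \<in> K \<longrightarrow> \<bar>P k l x - wint (g i) d m r k l x\<bar> \<le> \<epsilon>)"
      unfolding wint_def diff_diff_eq using continuous_on_subset[OF m subset_UNIV]
      by (intro wire_approx K(1) e) auto
  qed
qed

lemma normal_frame_wires:
  assumes g: "C2loop g g1 g2" and f: "normal_frame g1 n1 n2 m1 m2"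
  shows "n1 s \<noteq> 0" "n1 s + n2 s \<noteq> 0" "- n1 s - n2 s \<noteq> 0"
    "(n1 s + n2 s) \<bullet> g1 s = 0" "(- n1 s - n2 s) \<bullet> g1 s = 0"
    "continuous_on UNIV (\<lambda>s. n1 s + n2 s)" "continuous_on UNIV (\<lambda>s. - n1 s - n2 s)"
    "continuous_on UNIV (\<lambda>s. (norm (g1 s))\<^sup>2 *\<^sub>R n2 s)"
proof -
  note F = normal_frameD[OF f]
  have F': "n2 s \<bullet> n1 s = 0" using F(7)[of s] by (simp add: inner_commute)
  have "(n1 s + n2 s) \<bullet> (n1 s + n2 s) = 2" "(- n1 s - n2 s) \<bullet> (- n1 s - n2 s) = 2"
    by (simp_all add: inner_simps F F')
  then show "n1 s \<noteq> 0" "n1 s + n2 s \<noteq> 0" "- n1 s - n2 s \<noteq> 0" using F(5)[of s] by fastforce+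
  show "(n1 s + n2 s) \<bullet> g1 s = 0" "(- n1 s - n2 s) \<bullet> g1 s = 0" by (simp_all add: inner_simps F)
qed (intro continuous_intros normal_frameD[OF f] C2loopD[OF g])+

lemma triple_wire_approx:
  fixes g g1 g2 :: "nat \<Rightarrow> real \<Rightarrow> real^3"
  assumes g: "\<And>j. j < n \<Longrightarrow> C2loop (g j) (g1 j) (g2 j)"
    and disj: "\<And>i j. i < n \<Longrightarrow> j < n \<Longrightarrow> i \<noteq> j \<Longrightarrow> range (g i) \<inter> range (g j) = {}"
    and i: "i < n" and f: "normal_frame (g1 i) n1 n2 m1 m2"
  shows "\<exists>c>0. \<forall>r K \<epsilon>. 0 < r \<longrightarrow> r < c \<longrightarrow> compact K \<longrightarrow> (\<forall>x\<in>K. \<exists>j<n. \<exists>\<sigma>. norm (x - g j \<sigma>) < c * r) \<longrightarrow> \<epsilon> > 0 \<longrightarrow>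
    (\<exists>P. (\<forall>k. helmholtz_jet (P k)) \<and> (\<forall>k l x. length l \<le> 3 \<longrightarrow> x \<in> K \<longrightarrow> \<bar>P k l x - triple_wire (g i) (g1 i) n1 n2 r k l x\<bar> \<le> \<epsilon>))"
proof -
  note F = normal_frameD[OF f] and W = normal_frame_wires[OF g[OF i] f]
  let ?Q = "\<lambda>c d m. \<forall>r K \<epsilon>. 0 < r \<longrightarrow> r < c \<longrightarrow> compact K \<longrightarrow> (\<forall>x\<in>K. \<exists>j<n. \<exists>\<sigma>. norm (x - g j \<sigma>) < c * r) \<longrightarrow> \<epsilon> > 0 \<longrightarrow>
    (\<exists>P. (\<forall>k. helmholtz_jet (P k)) \<and> (\<forall>k l x. length l \<le> 3 \<longrightarrow> x \<in> K \<longrightarrow> \<bar>P k l x - wint (g i) d m r k l x\<bar> \<le> \<epsilon>))"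
  have "\<exists>c>0. ?Q c n1 (\<lambda>s. (norm (g1 i s))\<^sup>2 *\<^sub>R n2 s)" by (rule wint_approx[of n g g1 g2 i, OF g disj i F(3) F(8) W(1) W(8)])
  then obtain c1 where c1: "c1 > 0" "?Q c1 n1 (\<lambda>s. (norm (g1 i s))\<^sup>2 *\<^sub>R n2 s)" by (elim exE conjE) (rule that)
  have "\<exists>c>0. ?Q c (\<lambda>s. n1 s + n2 s) (g1 i)" by (rule wint_approx[of n g g1 g2 i, OF g disj i W(6) W(4) W(2) C2loopD(8)[OF g[OF i]]])
  then obtain c2 where c2: "c2 > 0" "?Q c2 (\<lambda>s. n1 s + n2 s) (g1 i)" by (elim exE conjE) (rule that)
  have "\<exists>c>0. ?Q c (\<lambda>s. - n1 s - n2 s) (g1 i)" by (rule wint_approx[of n g g1 g2 i, OF g disj i W(7) W(5) W(3) C2loopD(8)[OF g[OF i]]])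
  then obtain c3 where c3: "c3 > 0" "?Q c3 (\<lambda>s. - n1 s - n2 s) (g1 i)" by (elim exE conjE) (rule that)
  define c where "c = min c1 (min c2 c3)"
  show ?thesis
  proof (intro exI[of _ c] conjI allI impI)
    show "c > 0" using c1 c2 c3 by (simp add: c_def)
    fix r :: real and K :: "(real^3) set" and \<epsilon> :: real
    assume r: "0 < r" "r < c" and K: "compact K" "\<forall>x\<in>K. \<exists>j<n. \<exists>\<sigma>. norm (x - g j \<sigma>) < c * r" and e: "\<epsilon> > 0"
    have K': "\<forall>x\<in>K. \<exists>j<n. \<exists>\<sigma>. norm (x - g j \<sigma>) < c' * r" if "c \<le> c'" for c'
      using K(2) mult_right_mono[OF that less_imp_le[OF r(1)]] by (meson less_le_trans)
    have e3: "\<epsilon> / 3 > 0" using e by simp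
    have cc: "c \<le> c1" "c \<le> c2" "c \<le> c3" by (auto simp: c_def)
    obtain P1 where P1: "\<And>k. helmholtz_jet (P1 k)" "\<And>k l x. length l \<le> 3 \<Longrightarrow> x \<in> K \<Longrightarrow> \<bar>P1 k l x - wint (g i) n1 (\<lambda>s. (norm (g1 i s))\<^sup>2 *\<^sub>R n2 s) r k l x\<bar> \<le> \<epsilon> / 3"
      using c1(2)[THEN spec[of _ r], THEN spec[of _ K], THEN spec[of _ "\<epsilon> / 3"], THEN mp, OF r(1), THEN mp, OF less_le_trans[OF r(2) cc(1)],
        THEN mp, OF K(1), THEN mp, OF K'[OF cc(1)], THEN mp, OF e3] by (elim exE conjE) (rule that; blast)
    obtain P2 where P2: "\<And>k. helmholtz_jet (P2 k)" "\<And>k l x. length l \<le> 3 \<Longrightarrow> x \<in> K \<Longrightarrow> \<bar>P2 k l x - wint (g i) (\<lambda>s. n1 s + n2 s) (g1 i) r k l x\<bar> \<le> \<epsilon> / 3"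
      using c2(2)[THEN spec[of _ r], THEN spec[of _ K], THEN spec[of _ "\<epsilon> / 3"], THEN mp, OF r(1), THEN mp, OF less_le_trans[OF r(2) cc(2)],
        THEN mp, OF K(1), THEN mp, OF K'[OF cc(2)], THEN mp, OF e3] by (elim exE conjE) (rule that; blast)
    obtain P3 where P3: "\<And>k. helmholtz_jet (P3 k)" "\<And>k l x. length l \<le> 3 \<Longrightarrow> x \<in> K \<Longrightarrow> \<bar>P3 k l x - wint (g i) (\<lambda>s. - n1 s - n2 s) (g1 i) r k l x\<bar> \<le> \<epsilon> / 3"
      using c3(2)[THEN spec[of _ r], THEN spec[of _ K], THEN spec[of _ "\<epsilon> / 3"], THEN mp, OF r(1), THEN mp, OF less_le_trans[OF r(2) cc(3)],
        THEN mp, OF K(1), THEN mp, OF K'[OF cc(3)], THEN mp, OF e3] by (elim exE conjE) (rule that; blast)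
    show "\<exists>P. (\<forall>k. helmholtz_jet (P k)) \<and> (\<forall>k l x. length l \<le> 3 \<longrightarrow> x \<in> K \<longrightarrow> \<bar>P k l x - triple_wire (g i) (g1 i) n1 n2 r k l x\<bar> \<le> \<epsilon>)"
    proof (intro exI[of _ "\<lambda>k l x. P1 k l x + P2 k l x + P3 k l x"] conjI allI impI)
      show "helmholtz_jet (\<lambda>l x. P1 k l x + P2 k l x + P3 k l x)" for k by (intro helmholtz_jet_add P1 P2 P3)
      fix k l x assume "length (l :: 3 list) \<le> 3" "x \<in> K"
      from P1(2)[OF this, of k] P2(2)[OF this, of k] P3(2)[OF this, of k]
      show "\<bar>P1 k l x + P2 k l x + P3 k l x - triple_wire (g i) (g1 i) n1 n2 r k l x\<bar> \<le> \<epsilon>"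
        unfolding triple_wire_def by linarith
    qed
  qed
qed

lemma far_triple_wire_bounded:
  assumes g: "C2loop g g1 g2" and g': "C2loop g' g1' g2'" and disj: "range g \<inter> range g' = {}"
    and f: "normal_frame g1' n1 n2 m1 m2"
  shows "\<exists>C. eventually (\<lambda>p. \<forall>s k l. length l \<le> 3 \<longrightarrow> \<bar>triple_wire g' g1' n1 n2 (fst p) k l (g s + fst p *\<^sub>R snd p)\<bar> \<le> C) small"
proof -
  note F = normal_frameD[OF f] and W = normal_frame_wires[OF g' f] and A = far_wire_bounded[OF g g' disj] and G' = C2loopD[OF g']
  have p: "n1 (s + 1) + n2 (s + 1) = n1 s + n2 s" "- n1 (s + 1) - n2 (s + 1) = - n1 s - n2 s"
    "(norm (g1' (s + 1)))\<^sup>2 *\<^sub>R n2 (s + 1) = (norm (g1' s))\<^sup>2 *\<^sub>R n2 s" for s by (simp_all add: F G')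
  obtain C1 where C1: "eventually (\<lambda>p. \<forall>s k l. length l \<le> 3 \<longrightarrow> \<bar>wint g' n1 (\<lambda>s. (norm (g1' s))\<^sup>2 *\<^sub>R n2 s) (fst p) k l (g s + fst p *\<^sub>R snd p)\<bar> \<le> C1) small"
    using A[OF F(1,3) p(3) W(8)] by blast
  obtain C2 where C2: "eventually (\<lambda>p. \<forall>s k l. length l \<le> 3 \<longrightarrow> \<bar>wint g' (\<lambda>s. n1 s + n2 s) g1' (fst p) k l (g s + fst p *\<^sub>R snd p)\<bar> \<le> C2) small"
    using A[OF p(1) W(6) G'(2) G'(8)] by blast
  obtain C3 where C3: "eventually (\<lambda>p. \<forall>s k l. length l \<le> 3 \<longrightarrow> \<bar>wint g' (\<lambda>s. - n1 s - n2 s) g1' (fst p) k l (g s + fst p *\<^sub>R snd p)\<bar> \<le> C3) small"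
    using A[OF p(2) W(7) G'(2) G'(8)] by blast
  show ?thesis
  proof (rule exI[of _ "C1 + C2 + C3"], use C1 C2 C3 in eventually_elim, intro allI impI)
    fix p s k and l :: "3 list"
    assume a: "\<forall>s k l. length l \<le> 3 \<longrightarrow> \<bar>wint g' n1 (\<lambda>s. (norm (g1' s))\<^sup>2 *\<^sub>R n2 s) (fst p) k l (g s + fst p *\<^sub>R snd p)\<bar> \<le> C1"
      "\<forall>s k l. length l \<le> 3 \<longrightarrow> \<bar>wint g' (\<lambda>s. n1 s + n2 s) g1' (fst p) k l (g s + fst p *\<^sub>R snd p)\<bar> \<le> C2"
      "\<forall>s k l. length l \<le> 3 \<longrightarrow> \<bar>wint g' (\<lambda>s. - n1 s - n2 s) g1' (fst p) k l (g s + fst p *\<^sub>R snd p)\<bar> \<le> C3" and l: "length l \<le> 3"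
    show "\<bar>triple_wire g' g1' n1 n2 (fst p) k l (g s + fst p *\<^sub>R snd p)\<bar> \<le> C1 + C2 + C3"
      using a(1)[rule_format, OF l, of k s] a(2)[rule_format, OF l, of k s] a(3)[rule_format, OF l, of k s]
      unfolding triple_wire_def by linarith
  qed
qed

text \<open>The curl has two terms and the double curl at most four. The double curl differentiates
  twice and l once more; this is the origin of the order 3 in all approximations.\<close>

lemma curlj_diff_bound:
  assumes P: "\<And>k l. length l \<le> 3 \<Longrightarrow> \<bar>P k l x - W k l x\<bar> \<le> A" and Q: "\<And>k l. length l \<le> 3 \<Longrightarrow> \<bar>Q k l x\<bar> \<le> A"
    and l: "length l \<le> 1"
  shows "\<bar>curlj P k l x + curlcurlj Q k l x - curlj W k l x\<bar> \<le> 6 * A"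
    "\<bar>curlj P k l x - curlcurlj Q k l x - curlj W k l x\<bar> \<le> 6 * A"
proof -
  have P': "\<bar>P k (l @ [i]) x - W k (l @ [i]) x\<bar> \<le> A" for k i using P[of "l @ [i]" k] l by simp
  have 1: "\<bar>curlj P k l x - curlj W k l x\<bar> \<le> 2 * A"
    unfolding curlj_def using P'[of 1 2] P'[of 1 3] P'[of 2 1] P'[of 2 3] P'[of 3 1] P'[of 3 2] by (simp add: abs_le_iff)
  have Q': "\<bar>Q i (l @ [k, i]) x\<bar> \<le> A" for i using Q[of "l @ [k, i]" i] l by simp
  have 2: "\<bar>curlcurlj Q k l x\<bar> \<le> 4 * A"
    unfolding curlcurlj_def sum_3 using Q'[of 1] Q'[of 2] Q'[of 3] Q[of l k] l by (simp add: abs_le_iff)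
  show "\<bar>curlj P k l x + curlcurlj Q k l x - curlj W k l x\<bar> \<le> 6 * A"
    "\<bar>curlj P k l x - curlcurlj Q k l x - curlj W k l x\<bar> \<le> 6 * A" using 1 2 by (simp_all add: abs_le_iff)
qed

lemma finite_pos_lower_bound:
  fixes a :: "nat \<Rightarrow> real" assumes "\<And>i. i < n \<Longrightarrow> a i > 0"
  obtains e where "e > 0" "\<And>i. i < n \<Longrightarrow> e \<le> a i"
proof
  show "Min (insert 1 (a ` {..<n})) > 0" using assms by auto
qed auto

lemma finite_pos_choice:
  fixes R :: "nat \<Rightarrow> real \<Rightarrow> bool"
  assumes "\<And>i. i < n \<Longrightarrow> \<exists>e>0. \<forall>r. 0 < r \<longrightarrow> r \<le> e \<longrightarrow> R i r"
  shows "\<exists>e>0. \<forall>i<n. \<forall>r. 0 < r \<longrightarrow> r \<le> e \<longrightarrow> R i r"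
proof -
  obtain e where e: "\<And>i. i < n \<Longrightarrow> e i > 0" "\<And>i r. i < n \<Longrightarrow> 0 < r \<Longrightarrow> r \<le> e i \<Longrightarrow> R i r" using assms by metis
  obtain e0 where e0: "e0 > 0" "\<And>i. i < n \<Longrightarrow> e0 \<le> e i" using finite_pos_lower_bound[of n e, OF e(1)] by metis
  show ?thesis using e0 e(2) by (intro exI[of _ e0]) (meson order_trans)
qed

text \<open>The order of choices avoids circularity: first the bounds for interactions between
  components, which do not depend on r, then \<rho>, then r, then the compact union K of all tubes,
  and last the accuracy of the global solutions on K. All components share one r and one K.\<close>

lemma link_static_fields:
  fixes g g1 g2 n1 n2 m1 m2 :: "nat \<Rightarrow> real \<Rightarrow> real^3"
  assumes g: "\<And>i. i < n \<Longrightarrow> C2loop (g i) (g1 i) (g2 i)"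
    and disj: "\<And>i j. i < n \<Longrightarrow> j < n \<Longrightarrow> i \<noteq> j \<Longrightarrow> range (g i) \<inter> range (g j) = {}"
    and f: "\<And>i. i < n \<Longrightarrow> normal_frame (g1 i) (n1 i) (n2 i) (m1 i) (m2 i)"
    and \<kappa>: "\<kappa> > 0" and I: "I \<subseteq> {..<n}"
  shows "\<exists>P Q. (\<forall>k. helmholtz_jet (P k)) \<and> (\<forall>k. helmholtz_jet (Q k)) \<and> (\<forall>i<n. \<exists>c c1 \<mu>.
      (\<forall>s. c (s + 1) = c s \<and> (c has_vector_derivative c1 s) (at s) \<and> norm (c s - g i s) \<le> \<kappa> \<and> norm (c1 s - g1 i s) \<le> \<kappa> \<and>
        c1 s = \<mu> s *\<^sub>R fld (if i \<in> I then (\<lambda>k l x. curlj P k l x + curlcurlj Q k l x) else (\<lambda>k l x. curlj Q k l x - curlcurlj P k l x)) (c s) \<and>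
        \<mu> s > 0) \<and> continuous_on UNIV (\<mu> :: real \<Rightarrow> real))"
proof -
  define W where "W j = triple_wire (g j) (g1 j) (n1 j) (n2 j)" for j
  define X where "X i r s a b = g i s + (r * a) *\<^sub>R n1 i s + (r * b) *\<^sub>R n2 i s" for i r s a b
  have XW: "X i r s a b = g i s + r *\<^sub>R (a *\<^sub>R n1 i s + b *\<^sub>R n2 i s)" for i r s a b by (simp add: X_def algebra_simps)
  have nn: "norm (n1 i s) = 1" "norm (n2 i s) = 1" if "i < n" for i s
    using normal_frameD(5,6)[OF f[OF that], of s] by (simp_all add: norm_eq_sqrt_inner)
  have wle: "norm (a *\<^sub>R n1 i s + b *\<^sub>R n2 i s) \<le> 2 * \<rho>" if "i < n" "\<bar>a\<bar> \<le> \<rho>" "\<bar>b\<bar> \<le> \<rho>" for i s a b \<rho>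
    using norm_triangle_ineq[of "a *\<^sub>R n1 i s" "b *\<^sub>R n2 i s"] that by (simp add: nn)
  define fb where "fb i j C r w \<longleftrightarrow> (\<forall>s k l. length l \<le> 3 \<longrightarrow> \<bar>W j r k l (g i s + r *\<^sub>R w)\<bar> \<le> C)" for i j C r w
  have "\<exists>C. eventually (\<lambda>p. fb i j C (fst p) (snd p)) small" if ij: "i < n" "j < n" "i \<noteq> j" for i j
    unfolding fb_def W_def by (rule far_triple_wire_bounded[OF g[OF ij(1)] g[OF ij(2)] disj[OF ij] f[OF ij(2)]])
  then obtain C where C: "\<And>i j. i < n \<Longrightarrow> j < n \<Longrightarrow> i \<noteq> j \<Longrightarrow> eventually (\<lambda>p. fb i j (C i j) (fst p) (snd p)) small"
    by metis
  \<comment> \<open>The interactions of all pairs, plus one unit reserved for the total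
    approximation error.\<close>
  define A where "A = (\<Sum>i<n. \<Sum>j<n. \<bar>C i j\<bar>) + 1"
  have A: "A \<ge> 1" by (simp add: A_def sum_nonneg)
  have "eventually (\<lambda>p. \<forall>i\<in>{..<n}. \<forall>j\<in>{..<n} - {i}. fb i j (C i j) (fst p) (snd p)) small"
    using C by (intro eventually_ball_finite ballI) auto
  then obtain \<delta> where \<delta>: "\<delta> > 0" "\<forall>r w. 0 < r \<longrightarrow> r < \<delta> \<longrightarrow> norm w < \<delta> \<longrightarrow> (\<forall>i\<in>{..<n}. \<forall>j\<in>{..<n} - {i}. fb i j (C i j) r w)"
    unfolding eventually_small fst_conv snd_conv by (elim exE conjE) (rule that)
  define orbit where "orbit i U \<longleftrightarrow> (\<exists>c c1 \<mu>. (\<forall>s. c (s + 1) = c s \<and> (c has_vector_derivative c1 s) (at s) \<and> norm (c s - g i s) \<le> \<kappa> \<and>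
      norm (c1 s - g1 i s) \<le> \<kappa> \<and> c1 s = \<mu> s *\<^sub>R fld U (c s) \<and> \<mu> s > 0) \<and> continuous_on UNIV (\<mu> :: real \<Rightarrow> real))" for i U
  define good where "good i \<rho> r \<longleftrightarrow> (\<forall>U. (\<forall>k. helmholtz_jet (U k)) \<longrightarrow>
       (\<forall>k l s a b. length l \<le> 1 \<longrightarrow> \<bar>a\<bar> \<le> \<rho> \<longrightarrow> \<bar>b\<bar> \<le> \<rho> \<longrightarrow> \<bar>U k l (X i r s a b) - curlj (W i r) k l (X i r s a b)\<bar> \<le> 6 * A) \<longrightarrow> orbit i U)" for i \<rho> r
  have "\<exists>e>0. \<forall>\<rho>. 0 < \<rho> \<longrightarrow> \<rho> \<le> e \<longrightarrow> (\<exists>r1>0. \<forall>r. 0 < r \<longrightarrow> r \<le> r1 \<longrightarrow> good i \<rho> r)" if i: "i < n" for i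
  proof (rule triple_wire_orbit[OF g[OF i] f[OF i] \<kappa>, of "6 * A"])
    show "6 * A \<ge> 0" using A by simp
  next
    fix e :: real
    assume e: "e > 0" "\<And>\<rho>. 0 < \<rho> \<Longrightarrow> \<rho> \<le> e \<Longrightarrow> \<exists>r1>0. \<forall>r U. 0 < r \<longrightarrow> r \<le> r1 \<longrightarrow> (\<forall>k. helmholtz_jet (U k)) \<longrightarrow>
       (\<forall>k l s a b. length l \<le> 1 \<longrightarrow> \<bar>a\<bar> \<le> \<rho> \<longrightarrow> \<bar>b\<bar> \<le> \<rho> \<longrightarrow>
          \<bar>U k l (g i s + (r * a) *\<^sub>R n1 i s + (r * b) *\<^sub>R n2 i s) - curlj (triple_wire (g i) (g1 i) (n1 i) (n2 i) r) k l (g i s + (r * a) *\<^sub>R n1 i s + (r * b) *\<^sub>R n2 i s)\<bar> \<le> 6 * A) \<longrightarrow>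
       (\<exists>c c1 \<mu>. (\<forall>s. c (s + 1) = c s \<and> (c has_vector_derivative c1 s) (at s) \<and> norm (c s - g i s) \<le> \<kappa> \<and>
          norm (c1 s - g1 i s) \<le> \<kappa> \<and> c1 s = \<mu> s *\<^sub>R fld U (c s) \<and> \<mu> s > 0) \<and> continuous_on UNIV (\<mu> :: real \<Rightarrow> real))"
    have "\<exists>r1>0. \<forall>r. 0 < r \<longrightarrow> r \<le> r1 \<longrightarrow> good i \<rho> r" if r: "0 < \<rho>" "\<rho> \<le> e" for \<rho>
      using e(2)[OF r] unfolding W_def[symmetric] X_def[symmetric] orbit_def[symmetric] good_def by blast
    then show ?thesis using e(1) by blast
  qed
  from finite_pos_choice[of n "\<lambda>i \<rho>. \<exists>r1>0. \<forall>r. 0 < r \<longrightarrow> r \<le> r1 \<longrightarrow> good i \<rho> r", OF this]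
  obtain \<rho>1 where \<rho>1: "\<rho>1 > 0" "\<And>i \<rho>. i < n \<Longrightarrow> 0 < \<rho> \<Longrightarrow> \<rho> \<le> \<rho>1 \<Longrightarrow> \<exists>r1>0. \<forall>r. 0 < r \<longrightarrow> r \<le> r1 \<longrightarrow> good i \<rho> r" by blast
  define ap where "ap j c \<longleftrightarrow> (\<forall>r K \<epsilon>. 0 < r \<longrightarrow> r < c \<longrightarrow> compact K \<longrightarrow> (\<forall>x\<in>K. \<exists>j<n. \<exists>\<sigma>. norm (x - g j \<sigma>) < c * r) \<longrightarrow> \<epsilon> > 0 \<longrightarrow>
    (\<exists>P. (\<forall>k. helmholtz_jet (P k)) \<and> (\<forall>k l x. length l \<le> 3 \<longrightarrow> x \<in> K \<longrightarrow> \<bar>P k l x - W j r k l x\<bar> \<le> \<epsilon>)))" for j c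
  have "\<exists>c>0. ap j c" if "j < n" for j
    unfolding ap_def W_def by (rule triple_wire_approx[of n g g1 g2 j, OF g disj that f[OF that]])
  then obtain c where c: "\<And>j. j < n \<Longrightarrow> c j > 0" "\<And>j. j < n \<Longrightarrow> ap j (c j)" by metis
  obtain c0 where c0: "c0 > 0" "\<And>j. j < n \<Longrightarrow> c0 \<le> c j" using finite_pos_lower_bound[of n c, OF c(1)] by metis
  \<comment> \<open>Offsets in the tube have norm at most 2 \<rho>: below \<delta> for the bounds on
    distant wires, below c0 for the tubes to be missed by the rays.\<close>
  define \<rho> where "\<rho> = min \<rho>1 (min (\<delta> / 3) (c0 / 3))"
  have \<rho>: "0 < \<rho>" "\<rho> \<le> \<rho>1" "2 * \<rho> < \<delta>" "2 * \<rho> < c0" using \<rho>1(1) \<delta>(1) c0(1) by (auto simp: \<rho>_def)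
  from finite_pos_choice[of n "\<lambda>i r. good i \<rho> r", OF \<rho>1(2)[OF _ \<rho>(1,2)]]
  obtain r1 where r1: "r1 > 0" "\<And>i r. i < n \<Longrightarrow> 0 < r \<Longrightarrow> r \<le> r1 \<Longrightarrow> good i \<rho> r" by blast
  define r where "r = min r1 (min (\<delta> / 2) (c0 / 2))"
  have r: "0 < r" "r \<le> r1" "r < \<delta>" "r < c0" using r1(1) \<delta>(1) c0(1) by (auto simp: r_def)
  define K where "K = (\<Union>i<n. (\<lambda>p. X i r (fst p) (fst (snd p)) (snd (snd p))) ` ({0..1} \<times> ({-\<rho>..\<rho>} \<times> {-\<rho>..\<rho>})))"
  have K: "compact K" unfolding K_def
  proof (intro compact_UN finite_lessThan compact_continuous_image compact_Times compact_Icc)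
    fix i assume i: "i \<in> {..<n}"
    then have i: "i < n" by simp
    show "continuous_on ({0..1} \<times> ({-\<rho>..\<rho>} \<times> {-\<rho>..\<rho>})) (\<lambda>p. X i r (fst p) (fst (snd p)) (snd (snd p)))"
      unfolding X_def
      by (intro continuous_intros continuous_on_compose2[OF C2loopD(7)[OF g[OF i], of UNIV]]
          continuous_on_compose2[OF normal_frameD(3)[OF f[OF i], of UNIV]] continuous_on_compose2[OF normal_frameD(4)[OF f[OF i], of UNIV]]) auto
  qed
  have XK: "X i r s a b \<in> K" if i: "i < n" and ab: "\<bar>a\<bar> \<le> \<rho>" "\<bar>b\<bar> \<le> \<rho>" for i s a b
  proof -
    have per: "h (frac s) = h s" if "\<And>s. h (s + 1) = h s" for h :: "real \<Rightarrow> real^3"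
      using periodic_int[where g=h and k="-\<lfloor>s\<rfloor>" and s=s, OF that] by (simp add: frac_def)
    have "X i r s a b = X i r (frac s) a b"
      unfolding X_def per[of "g i", OF C2loopD(1)[OF g[OF i]]] per[of "n1 i", OF normal_frameD(1)[OF f[OF i]]]
        per[of "n2 i", OF normal_frameD(2)[OF f[OF i]]] ..
    moreover have "(frac s, a, b) \<in> {0..1} \<times> ({-\<rho>..\<rho>} \<times> {-\<rho>..\<rho>})"
      using ab frac_lt_1[of s] by (auto simp: less_imp_le)
    ultimately show ?thesis unfolding K_def using i by (intro UN_I[of i] image_eqI[of _ _ "(frac s, a, b)"]) auto
  qed
  have Kn: "\<exists>j<n. \<exists>\<sigma>. norm (x - g j \<sigma>) < c0 * r" if "x \<in> K" for x
  proof -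
    from \<open>x \<in> K\<close> obtain i p where ip: "i < n" "p \<in> {0..1} \<times> ({-\<rho>..\<rho>} \<times> {-\<rho>..\<rho>})"
        "x = X i r (fst p) (fst (snd p)) (snd (snd p))" unfolding K_def by blast
    obtain s a b where x: "i < n" "\<bar>a\<bar> \<le> \<rho>" "\<bar>b\<bar> \<le> \<rho>" "x = X i r s a b"
      by (rule that[of "fst (snd p)" "snd (snd p)" "fst p"]) (use ip in auto)
    have "norm (x - g i s) = r * norm (a *\<^sub>R n1 i s + b *\<^sub>R n2 i s)" unfolding x(4) XW using r(1) by simp
    also have "\<dots> \<le> r * (2 * \<rho>)" using wle[OF x(1-3)] r(1) by (intro mult_left_mono) auto
    also have "\<dots> < r * c0" using \<rho>(4) r(1) by (intro mult_strict_left_mono)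
    finally show ?thesis using x(1) by (auto simp: mult.commute)
  qed
  \<comment> \<open>At most n potentials with this error are added, so the total stays within the
    reserved unit.\<close>
  define \<epsilon> where "\<epsilon> = 1 / (real n + 1)"
  have \<epsilon>: "\<epsilon> > 0" "real n * \<epsilon> \<le> 1" by (simp_all add: \<epsilon>_def)
  have "\<exists>P. (\<forall>k. helmholtz_jet (P k)) \<and> (\<forall>k l x. length l \<le> 3 \<longrightarrow> x \<in> K \<longrightarrow> \<bar>P k l x - W j r k l x\<bar> \<le> \<epsilon>)" if j: "j < n" for j
  proof -
    have "c0 * r \<le> c j * r" using c0(2)[OF j] r(1) by (intro mult_right_mono) auto
    then have Kn': "\<forall>x\<in>K. \<exists>i<n. \<exists>\<sigma>. norm (x - g i \<sigma>) < c j * r" using Kn by (meson less_le_trans)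
    show ?thesis
      by (rule c(2)[OF j, unfolded ap_def, THEN spec[of _ r], THEN spec[of _ K], THEN spec[of _ \<epsilon>], THEN mp, OF r(1), THEN mp,
          OF less_le_trans[OF r(4) c0(2)[OF j]], THEN mp, OF K, THEN mp, OF Kn', THEN mp, OF \<epsilon>(1)])
  qed
  then obtain Ps where Ps: "\<And>j k. j < n \<Longrightarrow> helmholtz_jet (Ps j k)"
    "\<And>j k l x. j < n \<Longrightarrow> length l \<le> 3 \<Longrightarrow> x \<in> K \<Longrightarrow> \<bar>Ps j k l x - W j r k l x\<bar> \<le> \<epsilon>" by metis
  define S where "S J k l x = (\<Sum>j\<in>J. Ps j k l x)" for J k l x
  have SH: "helmholtz_jet (S J k)" if "J \<subseteq> {..<n}" for J k
    unfolding S_def using that by (intro helmholtz_jet_sum Ps) auto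
  \<comment> \<open>On the tube around component i a sum of potentials consists, up to the bounded
    error A, of the wire of i alone if i belongs to the sum, and of nothing otherwise. For P and Q
    exactly one of the two cases occurs at each i.\<close>
  have near: "\<bar>S J k l (X i r s a b) - (if i \<in> J then W i r k l (X i r s a b) else 0)\<bar> \<le> A"
    if i: "i < n" and J: "J \<subseteq> {..<n}" and ab: "\<bar>a\<bar> \<le> \<rho>" "\<bar>b\<bar> \<le> \<rho>" and l: "length l \<le> 3" for i J s a b k l
  proof -
    have fin: "finite J" using J finite_subset by blast
    define x where "x = X i r s a b"
    have "\<bar>\<Sum>j\<in>J. Ps j k l x - W j r k l x\<bar> \<le> (\<Sum>j\<in>J. \<epsilon>)"
      using J Ps(2)[OF _ l XK[OF i ab]] unfolding x_def by (intro order_trans[OF sum_abs] sum_mono) auto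
    also have "\<dots> \<le> real n * \<epsilon>" using card_mono[OF _ J] \<epsilon>(1) by (simp add: mult_right_mono)
    finally have 1: "\<bar>\<Sum>j\<in>J. Ps j k l x - W j r k l x\<bar> \<le> 1" using \<epsilon>(2) by linarith
    have "\<bar>W j r k l x\<bar> \<le> \<bar>C i j\<bar>" if "j \<in> J - {i}" for j
    proof -
      have "\<bar>W j r k l x\<bar> \<le> C i j" unfolding x_def XW
        using that J wle[OF i ab, of s] \<rho>(3) i l
        by (intro \<delta>(2)[THEN spec, THEN spec, THEN mp, OF r(1), THEN mp, OF r(3), THEN mp, THEN bspec, THEN bspec, unfolded fb_def, rule_format]) auto
      then show ?thesis by linarith
    qed
    then have "\<bar>\<Sum>j\<in>J - {i}. W j r k l x\<bar> \<le> (\<Sum>j\<in>J - {i}. \<bar>C i j\<bar>)" by (intro order_trans[OF sum_abs] sum_mono)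
    also have "\<dots> \<le> (\<Sum>j<n. \<bar>C i j\<bar>)" using J by (intro sum_mono2) auto
    also have "\<dots> \<le> (\<Sum>i<n. \<Sum>j<n. \<bar>C i j\<bar>)" using i by (intro member_le_sum[of i _ "\<lambda>i. \<Sum>j<n. \<bar>C i j\<bar>"] sum_nonneg) auto
    finally have 2: "\<bar>\<Sum>j\<in>J - {i}. W j r k l x\<bar> \<le> A - 1" by (simp add: A_def)
    have "(\<Sum>j\<in>J. W j r k l x) = (if i \<in> J then W i r k l x else 0) + (\<Sum>j\<in>J - {i}. W j r k l x)"
      using sum.remove[OF fin, of i "\<lambda>j. W j r k l x"] by auto
    then have "S J k l x - (if i \<in> J then W i r k l x else 0) = (\<Sum>j\<in>J. Ps j k l x - W j r k l x) + (\<Sum>j\<in>J - {i}. W j r k l x)"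
      by (simp add: S_def sum_subtractf)
    then show ?thesis using 1 2 unfolding x_def by linarith
  qed
  define P where "P = S I"
  define Q where "Q = S ({..<n} - I)"
  have PH: "helmholtz_jet (P k)" and QH: "helmholtz_jet (Q k)" for k unfolding P_def Q_def using I by (auto intro!: SH)
  have "orbit i (if i \<in> I then (\<lambda>k l x. curlj P k l x + curlcurlj Q k l x) else (\<lambda>k l x. curlj Q k l x - curlcurlj P k l x))" if i: "i < n" for i
  proof (cases "i \<in> I")
    case True
    have "orbit i (\<lambda>k l x. curlj P k l x + curlcurlj Q k l x)"
    proof (rule r1(2)[OF i r(1,2), unfolded good_def, THEN spec, THEN mp, THEN mp], safe)
      show "helmholtz_jet (\<lambda>l x. curlj P k l x + curlcurlj Q k l x)" for k
        by (intro helmholtz_jet_add helmholtz_jet_curlj helmholtz_jet_curlcurlj PH QH)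
      fix k s a b and l :: "3 list" assume h: "length l \<le> 1" "\<bar>a\<bar> \<le> \<rho>" "\<bar>b\<bar> \<le> \<rho>"
      show "\<bar>curlj P k l (X i r s a b) + curlcurlj Q k l (X i r s a b) - curlj (W i r) k l (X i r s a b)\<bar> \<le> 6 * A"
        using near[OF i I h(2,3), of _ _ s] near[OF i Diff_subset[of "{..<n}" I] h(2,3), of _ _ s] True
        by (intro curlj_diff_bound(1) h(1)) (simp_all add: P_def Q_def)
    qed
    then show ?thesis using True by simp
  next
    case False
    have "orbit i (\<lambda>k l x. curlj Q k l x - curlcurlj P k l x)"
    proof (rule r1(2)[OF i r(1,2), unfolded good_def, THEN spec, THEN mp, THEN mp], safe)
      show "helmholtz_jet (\<lambda>l x. curlj Q k l x - curlcurlj P k l x)" for k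
        by (intro helmholtz_jet_diff helmholtz_jet_curlj helmholtz_jet_curlcurlj PH QH)
      fix k s a b and l :: "3 list" assume h: "length l \<le> 1" "\<bar>a\<bar> \<le> \<rho>" "\<bar>b\<bar> \<le> \<rho>"
      show "\<bar>curlj Q k l (X i r s a b) - curlcurlj P k l (X i r s a b) - curlj (W i r) k l (X i r s a b)\<bar> \<le> 6 * A"
        using near[OF i I h(2,3), of _ _ s] near[OF i Diff_subset[of "{..<n}" I] h(2,3), of _ _ s] False i
        by (intro curlj_diff_bound(2) h(1)) (simp_all add: P_def Q_def)
    qed
    then show ?thesis using False by simp
  qed
  then show ?thesis unfolding orbit_def using PH QH by blast
qed

theorem theorem1:
  fixes n :: nat and L :: "nat \<Rightarrow> real \<Rightarrow> real^3" and I :: "nat set"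
  assumes "is_link n L" and "I \<subseteq> {..<n}"
  shows "\<exists>E B. maxwell E B \<and>
           (\<forall>t::real. \<exists>c :: nat \<Rightarrow> real \<Rightarrow> real^3.
              is_link n c \<and>
              (\<forall>i\<in>I. closed_field_line (E t) (c i)) \<and>
              (\<forall>i\<in>{..<n} - I. closed_field_line (B t) (c i)) \<and>
              ambient_isotopic n L c)"
proof -
  have "\<exists>g1 g2. C2loop (L i) g1 g2" if "i < n" for i
    using C2loop_of_closed_curve_param[of "L i"] assms(1) that unfolding is_link_def by metis
  then obtain L1 L2 where g: "\<And>i. i < n \<Longrightarrow> C2loop (L i) (L1 i) (L2 i)" by metis
  have cs: "curve_set (L i) = range (L i)" if "i < n" for i
  proof -
    have "L i s \<in> L i ` {0..1}" for s
      using periodic_int[where g="L i" and k="-\<lfloor>s\<rfloor>" and s=s, OF C2loopD(1)[OF g[OF that]]] frac_lt_1[of s]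
      by (intro image_eqI[of _ _ "frac s"]) (auto simp: frac_def less_imp_le)
    then show ?thesis unfolding curve_set_def by blast
  qed
  have disj: "curve_set (L i) \<inter> curve_set (L j) = {}" if "i < n" "j < n" "i \<noteq> j" for i j
    using assms(1) that unfolding is_link_def by blast
  have disj': "range (L i) \<inter> range (L j) = {}" if "i < n" "j < n" "i \<noteq> j" for i j
    using disj[OF that] that by (simp add: cs)
  have "\<exists>n1 n2 m1 m2. normal_frame (L1 i) n1 n2 m1 m2" if "i < n" for i
  proof (rule normal_frame_exists[OF g[OF that]])
    fix n1 n2 m1 m2
    assume "\<And>s. n1 (s + 1) = n1 s" "\<And>s. n2 (s + 1) = n2 s" "\<And>s. m1 (s + 1) = m1 s" "\<And>s. m2 (s + 1) = m2 s"
      "\<And>s. (n1 has_vector_derivative m1 s) (at s)" "\<And>s. (n2 has_vector_derivative m2 s) (at s)"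
      "\<And>s. n1 s \<bullet> n1 s = 1" "\<And>s. n2 s \<bullet> n2 s = 1" "\<And>s. n1 s \<bullet> n2 s = 0" "\<And>s. n1 s \<bullet> L1 i s = 0" "\<And>s. n2 s \<bullet> L1 i s = 0"
      "\<And>s. cross3 (n1 s) (n2 s) = (1 / norm (L1 i s)) *\<^sub>R L1 i s" "continuous_on UNIV m1" "continuous_on UNIV m2"
    then have "normal_frame (L1 i) n1 n2 m1 m2" unfolding normal_frame_def by simp
    then show ?thesis by blast
  qed
  then obtain n1 n2 m1 m2 where f: "\<And>i. i < n \<Longrightarrow> normal_frame (L1 i) (n1 i) (n2 i) (m1 i) (m2 i)" by metis
  show ?thesis
  proof (rule link_perturbation[of n L L1 L2, OF g disj])
  fix \<kappa>0 :: real
  assume \<kappa>0: "\<kappa>0 > 0"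
    "\<And>c c1. (\<And>i s. i < n \<Longrightarrow> c i (s + 1) = c i s \<and> (c i has_vector_derivative c1 i s) (at s) \<and>
        norm (c i s - L i s) \<le> \<kappa>0 \<and> norm (c1 i s - L1 i s) \<le> \<kappa>0) \<Longrightarrow>
      (\<forall>i<n. inj_on (c i) {0..<1}) \<and>
      (\<forall>i<n. \<forall>j<n. i \<noteq> j \<longrightarrow> curve_set (c i) \<inter> curve_set (c j) = {}) \<and> ambient_isotopic n L c"
  have "\<exists>v>0. \<forall>s. norm (L1 i s) \<ge> v" if "i < n" for i
    using periodic_bounded_below[of "L1 i", OF C2loopD(2)[OF g[OF that]] C2loopD(8)[OF g[OF that]] C2loopD(6)[OF g[OF that]]] by metis
  then obtain v where v: "\<And>i. i < n \<Longrightarrow> v i > 0" "\<And>i s. i < n \<Longrightarrow> norm (L1 i s) \<ge> v i" by metis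
  obtain v0 where v0: "v0 > 0" "\<And>i. i < n \<Longrightarrow> v0 \<le> v i" using finite_pos_lower_bound[of n v, OF v(1)] by metis
  \<comment> \<open>Closeness below the minimal speed v0 of the link keeps the velocity of each
    orbit nonzero, hence also the field along it.\<close>
  define \<kappa> where "\<kappa> = min \<kappa>0 (v0 / 2)"
  have \<kappa>: "\<kappa> > 0" "\<kappa> \<le> \<kappa>0" "\<kappa> < v0" using \<kappa>0(1) v0(1) by (auto simp: \<kappa>_def)
  have "\<exists>P Q. (\<forall>k. helmholtz_jet (P k)) \<and> (\<forall>k. helmholtz_jet (Q k)) \<and> (\<forall>i<n. \<exists>c c1 \<mu>.
      (\<forall>s. c (s + 1) = c s \<and> (c has_vector_derivative c1 s) (at s) \<and> norm (c s - L i s) \<le> \<kappa> \<and> norm (c1 s - L1 i s) \<le> \<kappa> \<and>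
        c1 s = \<mu> s *\<^sub>R fld (if i \<in> I then (\<lambda>k l x. curlj P k l x + curlcurlj Q k l x) else (\<lambda>k l x. curlj Q k l x - curlcurlj P k l x)) (c s) \<and>
        \<mu> s > 0) \<and> continuous_on UNIV (\<mu> :: real \<Rightarrow> real))"
    by (rule link_static_fields[of n L L1 L2 n1 n2 m1 m2 \<kappa> I, OF g disj' f \<kappa>(1) assms(2)])
  then obtain P Q where PH: "\<And>k. helmholtz_jet (P k)" and QH: "\<And>k. helmholtz_jet (Q k)" and orb: "(\<forall>i<n. \<exists>c c1 \<mu>.
      (\<forall>s. c (s + 1) = c s \<and> (c has_vector_derivative c1 s) (at s) \<and> norm (c s - L i s) \<le> \<kappa> \<and> norm (c1 s - L1 i s) \<le> \<kappa> \<and>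
        c1 s = \<mu> s *\<^sub>R fld (if i \<in> I then (\<lambda>k l x. curlj P k l x + curlcurlj Q k l x) else (\<lambda>k l x. curlj Q k l x - curlcurlj P k l x)) (c s) \<and>
        \<mu> s > 0) \<and> continuous_on UNIV (\<mu> :: real \<Rightarrow> real))"
    by (elim exE conjE) (rule that, erule spec, erule spec, assumption)
  define E where "E = (\<lambda>k l x. curlj P k l x + curlcurlj Q k l x)"
  define B where "B = (\<lambda>k l x. curlj Q k l x - curlcurlj P k l x)"
  define U where "U i = (if i \<in> I then E else B)" for i
  have "helmholtz_jet (E k)" "helmholtz_jet (B k)" for k unfolding E_def B_def
    by (intro helmholtz_jet_add helmholtz_jet_diff helmholtz_jet_curlj helmholtz_jet_curlcurlj PH QH)+
  then have UH: "helmholtz_jet (U i k)" for i k by (simp add: U_def)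
  define R where "R i c c1 \<mu> \<longleftrightarrow> (\<forall>s. c (s + 1) = c s \<and> (c has_vector_derivative c1 s) (at s) \<and> norm (c s - L i s) \<le> \<kappa> \<and>
      norm (c1 s - L1 i s) \<le> \<kappa> \<and> c1 s = \<mu> s *\<^sub>R fld (U i) (c s) \<and> \<mu> s > 0) \<and> continuous_on UNIV (\<mu> :: real \<Rightarrow> real)" for i c c1 \<mu>
  have "\<forall>i<n. \<exists>c c1 \<mu>. R i c c1 \<mu>" using orb unfolding R_def U_def E_def B_def .
  then obtain c c1 \<mu> where "\<And>i. i < n \<Longrightarrow> R i (c i) (c1 i) (\<mu> i)" by metis
  then have c: "\<And>i s. i < n \<Longrightarrow> c i (s + 1) = c i s" "\<And>i s. i < n \<Longrightarrow> (c i has_vector_derivative c1 i s) (at s)"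
    "\<And>i s. i < n \<Longrightarrow> norm (c i s - L i s) \<le> \<kappa>" "\<And>i s. i < n \<Longrightarrow> norm (c1 i s - L1 i s) \<le> \<kappa>"
    "\<And>i s. i < n \<Longrightarrow> c1 i s = \<mu> i s *\<^sub>R fld (U i) (c i s)" "\<And>i s. i < n \<Longrightarrow> \<mu> i s > 0" "\<And>i. i < n \<Longrightarrow> continuous_on UNIV (\<mu> i)"
    unfolding R_def by blast+
  have pert: "(\<forall>i<n. inj_on (c i) {0..<1}) \<and> (\<forall>i<n. \<forall>j<n. i \<noteq> j \<longrightarrow> curve_set (c i) \<inter> curve_set (c j) = {}) \<and> ambient_isotopic n L c"
  proof (rule \<kappa>0(2)[of c c1])
    fix i s assume i: "i < n"
    show "c i (s + 1) = c i s \<and> (c i has_vector_derivative c1 i s) (at s) \<and> norm (c i s - L i s) \<le> \<kappa>0 \<and> norm (c1 i s - L1 i s) \<le> \<kappa>0"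
      by (intro conjI c(1,2)[OF i] order_trans[OF c(3)[OF i] \<kappa>(2)] order_trans[OF c(4)[OF i] \<kappa>(2)])
  qed
  have nz: "fld (U i) (c i s) \<noteq> 0" if i: "i < n" for i s
  proof
    assume "fld (U i) (c i s) = 0"
    then have "norm (L1 i s) \<le> \<kappa>" using c(4)[OF i, of s] c(5)[OF i, of s] by simp
    then show False using v(2)[OF i, of s] v0(2)[OF i] \<kappa>(3) by linarith
  qed
  \<comment> \<open>The orbits are tangent to the field only with a continuous factor.
    Reparametrized to a constant factor they become smooth, with the same images; disjointness and
    \<open>ambient_isotopic\<close> depend on the images alone.\<close>
  define R' where "R' i b K \<longleftrightarrow> K > 0 \<and> (\<forall>s. b (s + 1) = b s) \<and> (\<forall>s. (b has_vector_derivative K *\<^sub>R fld (U i) (b s)) (at s)) \<and>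
      curve_set b = curve_set (c i) \<and> inj_on b {0..<1}" for i b K
  have "\<exists>b K. R' i b K" if i: "i < n" for i
  proof (rule reparametrize_field_line[of "c i" "\<mu> i" "fld (U i)"])
    show "c i (s + 1) = c i s" for s by (rule c(1)[OF i])
    show "(c i has_vector_derivative \<mu> i s *\<^sub>R fld (U i) (c i s)) (at s)" for s using c(2)[OF i, of s] c(5)[OF i, of s] by simp
    show "\<mu> i s > 0" for s by (rule c(6)[OF i])
    show "continuous_on UNIV (\<mu> i)" by (rule c(7)[OF i])
    show "fld (U i) (c i s) \<noteq> 0" for s by (rule nz[OF i])
    show "inj_on (c i) {0..<1}" using pert i by simp
    fix b K assume "K > 0" "\<And>s. b (s + 1) = b s" "\<And>s. (b has_vector_derivative K *\<^sub>R fld (U i) (b s)) (at s)"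
      "curve_set b = curve_set (c i)" "inj_on b {0..<1}"
    then have "R' i b K" by (simp add: R'_def)
    then show ?thesis by blast
  qed
  then obtain b K where "\<And>i. i < n \<Longrightarrow> R' i (b i) (K i)" by metis
  then have b: "\<And>i. i < n \<Longrightarrow> K i > 0" "\<And>i s. i < n \<Longrightarrow> b i (s + 1) = b i s"
    "\<And>i s. i < n \<Longrightarrow> (b i has_vector_derivative K i *\<^sub>R fld (U i) (b i s)) (at s)"
    "\<And>i. i < n \<Longrightarrow> curve_set (b i) = curve_set (c i)" "\<And>i. i < n \<Longrightarrow> inj_on (b i) {0..<1}"
    unfolding R'_def by blast+
  have nzb: "fld (U i) (b i s) \<noteq> 0" if i: "i < n" for i s
  proof -
    have "b i s = b i (frac s)" using periodic_int[where g="b i" and k="-\<lfloor>s\<rfloor>" and s=s, OF b(2)[OF i]] by (simp add: frac_def)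
    moreover have "frac s \<in> {0..1}" using frac_lt_1[of s] by (simp add: less_imp_le)
    ultimately have "b i s \<in> curve_set (b i)" unfolding curve_set_def by (rule image_eqI)
    then obtain u where "b i s = c i u" unfolding b(4)[OF i] unfolding curve_set_def by blast
    then show ?thesis using nz[OF i] by simp
  qed
  have vd: "vector_derivative (b i) (at s) = K i *\<^sub>R fld (U i) (b i s)" if i: "i < n" for i s
    by (rule vector_derivative_at[OF b(3)[OF i]])
  have ccp: "closed_curve_param (b i)" if i: "i < n" for i
    unfolding closed_curve_param_def using b(2,5)[OF i] field_line_smooth[OF UH b(3)[OF i]] nzb[OF i] b(1)[OF i]
    by (auto simp: vd[OF i])
  have line: "closed_field_line (\<lambda>x. exp t *\<^sub>R fld (U i) x) (b i)" if i: "i < n" for i t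
    unfolding closed_field_line_def
  proof (intro conjI ccp i allI exI)
    fix s
    show "exp t *\<^sub>R fld (U i) (b i s) \<noteq> 0" using nzb[OF i] by simp
    show "exp t *\<^sub>R fld (U i) (b i s) = (exp t / K i) *\<^sub>R vector_derivative (b i) (at s)"
      using b(1)[OF i] by (simp add: vd[OF i])
  qed
  have link: "is_link n b" unfolding is_link_def using ccp pert b(4) by simp
  have iso: "ambient_isotopic n L b" using pert b(4) unfolding ambient_isotopic_def by simp
  show ?thesis
  proof (intro exI conjI allI)
    show "maxwell (\<lambda>t x. exp t *\<^sub>R fld E x) (\<lambda>t x. exp t *\<^sub>R fld B x)" unfolding E_def B_def by (rule maxwell_exp(3)[OF PH QH])
    fix t :: real
    show "is_link n b" by (rule link)
    show "\<forall>i\<in>I. closed_field_line (\<lambda>x. exp t *\<^sub>R fld E x) (b i)"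
    proof
      fix i assume "i \<in> I"
      then show "closed_field_line (\<lambda>x. exp t *\<^sub>R fld E x) (b i)" using line[of i t] assms(2) by (auto simp: U_def)
    qed
    show "\<forall>i\<in>{..<n} - I. closed_field_line (\<lambda>x. exp t *\<^sub>R fld B x) (b i)"
    proof
      fix i assume "i \<in> {..<n} - I"
      then show "closed_field_line (\<lambda>x. exp t *\<^sub>R fld B x) (b i)" using line[of i t] by (auto simp: U_def)
    qed
    show "ambient_isotopic n L b" by (rule iso)
  qed
  qed
qed

end
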